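(* For a graph property $\mathcal P$, the following are equivalent: (a) $\mathcal P$ is testable; (b) for every $\varepsilon>0$ there is an $\varepsilon'>0$ and an $n'>0$ such that if $G\in\mathcal P$ and $G'$ is any other graph such that $\delta_\square(G,G')<\varepsilon'$ and $|V(G)|,|V(G')|\ge n'$, then $d_1(G',\mathcal P)<\varepsilon$; (c) for every $\varepsilon>0$ there is an $\varepsilon_0>0$ and an $n_0>0$ such that if $G\in\mathcal P$ and $G'$ is an induced subgraph of $G$ such that $\delta_\square(G,G')<\varepsilon_0$ and $|V(G')|\ge n_0$, then $d_1(G',\mathcal P)<\varepsilon$.
   Context: Graphs are finite and simple; a graph property is a class of graphs invariant under isomorphism. For graphs $G_1,G_2$ on the same node set $V$, $d_1(G_1,G_2)=|E(G_1)\triangle E(G_2)|/|V|^2$; $d_1(G,\mathcal P)$ is the minimum of $d_1(G,H)$ over $H\in\mathcal P$ with $V(H)=V(G)$, and is $\infty$ if no graph with $|V(G)|$ nodes has property $\mathcal P$. For a graph $G$ on $\{1,\dots,n\}$, $W_G:[0,1]^2\to\{0,1\}$ is defined by $W_G(x,y)=1$ if $x\in((i-1)/n,i/n]$, $y\in((j-1)/n,j/n]$ with $ij\in E(G)$, and $W_G(x,y)=0$ otherwise. For bounded symmetric measurable $W$ on $[0,1]^2$, $\|W\|_\square=\sup_{S,T\subseteq[0,1]}|\int_{S\times T}W|$ (sup over measurable $S,T$), and $\delta_\square(U,W)=\inf_\phi\|U-W^\phi\|_\square$, where $\phi$ ranges over invertible measure preserving maps $[0,1]\to[0,1]$ and $W^\phi(x,y)=W(\phi(x),\phi(y))$.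 For graphs (possibly with different numbers of nodes), $\delta_\square(G_1,G_2)=\delta_\square(W_{G_1},W_{G_2})$. A graph property $\mathcal P$ is testable if there is a graph property $\mathcal P'$ such that: (i) if $G\in\mathcal P$, then for all $1\le k\le|V(G)|$ at least a fraction of $2/3$ of the $k$-node induced subgraphs of $G$ have property $\mathcal P'$; (ii) for every $\varepsilon>0$ there is a $k_\varepsilon\ge1$ such that if $d_1(G,\mathcal P)\ge\varepsilon$, then for all $k_\varepsilon\le k\le|V(G)|$ at most a fraction of $1/3$ of the $k$-node induced subgraphs of $G$ have property $\mathcal P'$. *)

theory Defs
  imports "HOL-Analysis.Analysis"
begin

text \<open>
  Finite simple graphs. Node sets are finite subsets of \<^typ>\<open>nat\<close>, so every finite graph occurs
  up to isomorphism; edges are unordered pairs of distinct nodes.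
\<close>

datatype ugraph = UGraph (nodes: "nat set") (edges: "nat set set")

definition simple_graph :: "ugraph \<Rightarrow> bool" where
  "simple_graph G \<longleftrightarrow> finite (nodes G) \<and> (\<forall>e\<in>edges G. e \<subseteq> nodes G \<and> card e = 2)"

definition isomorphic_graphs :: "ugraph \<Rightarrow> ugraph \<Rightarrow> bool" where
  "isomorphic_graphs G H \<longleftrightarrow>
     (\<exists>f. bij_betw f (nodes G) (nodes H) \<and>
          (\<forall>u\<in>nodes G. \<forall>v\<in>nodes G. {u, v} \<in> edges G \<longleftrightarrow> {f u, f v} \<in> edges H))"

definition induced :: "ugraph \<Rightarrow> nat set \<Rightarrow> ugraph" where
  "induced G S = UGraph S {e \<in> edges G. e \<subseteq> S}"

definition induced_subgraph_of :: "ugraph \<Rightarrow> ugraph \<Rightarrow> bool" where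
  "induced_subgraph_of G' G \<longleftrightarrow> (\<exists>S\<subseteq>nodes G. G' = induced G S)"

definition graph_property :: "ugraph set \<Rightarrow> bool" where
  "graph_property P \<longleftrightarrow>
     (\<forall>G\<in>P. simple_graph G) \<and>
     (\<forall>G\<in>P. \<forall>H. simple_graph H \<and> isomorphic_graphs G H \<longrightarrow> H \<in> P)"

definition edit_dist :: "ugraph \<Rightarrow> ugraph \<Rightarrow> real" where
  "edit_dist G H =
     real (card ((edges G - edges H) \<union> (edges H - edges G))) / (real (card (nodes G)))\<^sup>2"

definition edit_dist_property :: "ugraph \<Rightarrow> ugraph set \<Rightarrow> ereal" where
  "edit_dist_property G P =
     (if \<exists>H\<in>P. card (nodes H) = card (nodes G)
      then ereal (Min {edit_dist G H | H. H \<in> P \<and> nodes H = nodes G})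
      else \<infinity>)"

text \<open>
  The step function \<open>W\<^sub>G\<close>. The nodes are numbered in increasing order, which is the identity
  numbering when the node set is \<open>{1..n}\<close>; another numbering would change \<open>W\<^sub>G\<close>
  only by permuting the intervals, which does not affect the cut distance.
\<close>

definition graph_fun :: "ugraph \<Rightarrow> real \<times> real \<Rightarrow> real" where
  "graph_fun G = (\<lambda>(x, y).
     let n = card (nodes G); vs = sorted_list_of_set (nodes G) in
     if \<exists>i\<in>{1..n}. \<exists>j\<in>{1..n}.
          x \<in> {(real i - 1) / real n<..real i / real n} \<and>
          y \<in> {(real j - 1) / real n<..real j / real n} \<and>
          {vs ! (i - 1), vs ! (j - 1)} \<in> edges G
     then 1 else 0)"

text \<open>
  In the next definitions only the values of the functions on \<open>[0,1]\<^sup>2\<close>, respectively \<open>[0,1]\<close>, matter.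
  The supremum and infimum are meant for bounded measurable functions; then the former is over a
  bounded set.
\<close>

definition cut_norm :: "(real \<times> real \<Rightarrow> real) \<Rightarrow> real" where
  "cut_norm W =
     (SUP (S, T) \<in> {(S, T). S \<in> sets lebesgue \<and> S \<subseteq> {0..1} \<and> T \<in> sets lebesgue \<and> T \<subseteq> {0..1}}.
        \<bar>LINT z:S \<times> T|lebesgue. W z\<bar>)"

definition invertible_measure_preserving :: "(real \<Rightarrow> real) set" where
  "invertible_measure_preserving =
     {\<phi>. bij_betw \<phi> {0..1} {0..1} \<and>
         \<phi> \<in> lebesgue_on {0..1} \<rightarrow>\<^sub>M lebesgue_on {0..1} \<and>
         the_inv_into {0..1} \<phi> \<in> lebesgue_on {0..1} \<rightarrow>\<^sub>M lebesgue_on {0..1} \<and>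
         distr (lebesgue_on {0..1}) (lebesgue_on {0..1}) \<phi> = lebesgue_on {0..1}}"

definition fun_cut_dist :: "(real \<times> real \<Rightarrow> real) \<Rightarrow> (real \<times> real \<Rightarrow> real) \<Rightarrow> real" where
  "fun_cut_dist U W =
     (INF \<phi>\<in>invertible_measure_preserving. cut_norm (\<lambda>(x, y). U (x, y) - W (\<phi> x, \<phi> y)))"

definition cut_dist :: "ugraph \<Rightarrow> ugraph \<Rightarrow> real" where
  "cut_dist G H = fun_cut_dist (graph_fun G) (graph_fun H)"

definition induced_fraction :: "nat \<Rightarrow> ugraph \<Rightarrow> ugraph set \<Rightarrow> real" where
  "induced_fraction k G Q =
     real (card {S. S \<subseteq> nodes G \<and> card S = k \<and> induced G S \<in> Q}) /
     real (card {S. S \<subseteq> nodes G \<and> card S = k})"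

definition testable :: "ugraph set \<Rightarrow> bool" where
  "testable P \<longleftrightarrow>
     (\<exists>P'. graph_property P' \<and>
        (\<forall>G\<in>P. \<forall>k. 1 \<le> k \<and> k \<le> card (nodes G) \<longrightarrow> induced_fraction k G P' \<ge> 2 / 3) \<and>
        (\<forall>\<epsilon>>0. \<exists>k\<^sub>\<epsilon>\<ge>1. \<forall>G. simple_graph G \<and> edit_dist_property G P \<ge> ereal \<epsilon> \<longrightarrow>
           (\<forall>k. k\<^sub>\<epsilon> \<le> k \<and> k \<le> card (nodes G) \<longrightarrow> induced_fraction k G P' \<le> 1 / 3)))"

end

theory Submission
  imports Defs "HOL-Probability.Probability" "HOL-Library.Diagonal_Subsequence"
begin

text \<open>
  Testability implies (b) by the counting lemma: pattern densities are Lipschitz in the cut distance,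
  and they determine the fraction of \<open>k\<close>-subsets inducing a graph with the test property up to
  \<open>k\<^sup>2 / n\<close>. Clearly (b) implies (c).

  For the way back, (c) is first upgraded to (b). If this fails, there are \<open>H\<^sub>m \<in> P\<close> and \<open>G\<^sub>m\<close>, ever larger
  and at cut distance tending to 0, with \<open>G\<^sub>m\<close> far from \<open>P\<close>. After passing to a subsequence \<open>G\<^sub>m\<close>
  tends to a kernel \<open>W\<close> (a martingale limit along weakly regular partitions). Put a random point of
  the unit interval into the cell of every node of \<open>G\<^sub>m\<close>, and change the pairs where \<open>W\<close> is 0 or 1
  accordingly. Few pairs change since \<open>G\<^sub>m\<close> tends to \<open>W\<close> weakly, and almost surely the resulting
  graph has positive density in \<open>W\<close>. Hence it is an induced subgraph of some much larger \<open>H\<^sub>j\<close>, it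
  is close to \<open>H\<^sub>j\<close> in cut distance, and (c) shows that it is close to \<open>P\<close>.

  Finally, random induced subgraphs are close to the whole graph in cut distance: outside a weakly
  regular partition the error has few 4-cycles, a property that sampling preserves in expectation.
  So (c) makes "the sample is close to \<open>P\<close>" hold for samples of members of \<open>P\<close>, and (b) makes it fail
  for samples of graphs far from \<open>P\<close>.
\<close>

section \<open>Weak regularity for finite matrices\<close>

text \<open>The obstacle: closeness in cut distance says nothing about single pairs, but the edit
  distance counts single pairs, and (c) speaks only of graphs that literally occur in members of P.
  The limit kernel W bridges the two. Where W lies strictly between 0 and 1, either state of a pair
  leaves the density of the pattern positive, so such pairs are copied from the given graph and only
  the pairs where W is 0 or 1 are forced. Positive density in W is a statement about all late
  members of the sequence, so the copy can be sought in a host that is large compared with the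
  pattern.

  Two devices recur. Nodes are ordered by their class in a regular partition, so that classes become
  intervals, and partitions of graphs of different size are compared through the endpoints of these
  intervals. The cut norm of a random submatrix, a maximum over exponentially many pairs of sets, is
  controlled by a sum over 4-tuples, whose mean can be computed.\<close>

definition mcut :: "'a set \<Rightarrow> ('a \<Rightarrow> 'a \<Rightarrow> real) \<Rightarrow> real" where
  "mcut V B =
     Max ((\<lambda>(X, Y). \<bar>\<Sum>u\<in>X. \<Sum>v\<in>Y. B u v\<bar>) ` (Pow V \<times> Pow V)) / (real (card V))\<^sup>2"

lemma mcut_ge:
  assumes "finite V" "X \<subseteq> V" "Y \<subseteq> V"
  shows "\<bar>\<Sum>u\<in>X. \<Sum>v\<in>Y. B u v\<bar> \<le> mcut V B * (real (card V))\<^sup>2"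
proof (cases "V = {}")
  case True
  then show ?thesis using assms by simp
next
  case False
  then have n: "real (card V) > 0" using assms by (simp add: card_gt_0_iff)
  have "\<bar>\<Sum>u\<in>X. \<Sum>v\<in>Y. B u v\<bar>
      \<le> Max ((\<lambda>(X, Y). \<bar>\<Sum>u\<in>X. \<Sum>v\<in>Y. B u v\<bar>) ` (Pow V \<times> Pow V))"
    using assms by (intro Max_ge) auto
  then show ?thesis using n by (simp add: mcut_def)
qed

lemma mcut_attained:
  assumes "finite V"
  shows "\<exists>X Y. X \<subseteq> V \<and> Y \<subseteq> V \<and> \<bar>\<Sum>u\<in>X. \<Sum>v\<in>Y. B u v\<bar> = mcut V B * (real (card V))\<^sup>2"
proof (cases "V = {}")
  case True
  then show ?thesis by (intro exI[of _ "{}"]) simp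
next
  case False
  then have n: "real (card V) > 0" using assms by (simp add: card_gt_0_iff)
  have "Max ((\<lambda>(X, Y). \<bar>\<Sum>u\<in>X. \<Sum>v\<in>Y. B u v\<bar>) ` (Pow V \<times> Pow V))
      \<in> (\<lambda>(X, Y). \<bar>\<Sum>u\<in>X. \<Sum>v\<in>Y. B u v\<bar>) ` (Pow V \<times> Pow V)"
    using assms by (intro Max_in) auto
  then obtain X Y where XY: "X \<subseteq> V" "Y \<subseteq> V"
    "Max ((\<lambda>(X, Y). \<bar>\<Sum>u\<in>X. \<Sum>v\<in>Y. B u v\<bar>) ` (Pow V \<times> Pow V)) = \<bar>\<Sum>u\<in>X. \<Sum>v\<in>Y. B u v\<bar>"
    by auto
  then have "mcut V B * (real (card V))\<^sup>2 = \<bar>\<Sum>u\<in>X. \<Sum>v\<in>Y. B u v\<bar>"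
    using n by (simp add: mcut_def)
  then show ?thesis using XY by (metis (no_types))
qed

lemma mcut_nonneg: "finite V \<Longrightarrow> 0 \<le> mcut V B"
  using mcut_ge[of V "{}" "{}" B]
  by (cases "V = {}") (auto simp: mcut_def zero_le_mult_iff)

lemma mcut_le_1:
  assumes "finite V" "\<And>u v. u \<in> V \<Longrightarrow> v \<in> V \<Longrightarrow> \<bar>B u v\<bar> \<le> 1"
  shows "mcut V B \<le> 1"
proof (cases "V = {}")
  case True
  then show ?thesis by (simp add: mcut_def)
next
  case False
  then have n: "real (card V) > 0" using assms by (simp add: card_gt_0_iff)
  obtain X Y where XY: "X \<subseteq> V" "Y \<subseteq> V"
      "\<bar>\<Sum>u\<in>X. \<Sum>v\<in>Y. B u v\<bar> = mcut V B * (real (card V))\<^sup>2"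
    using mcut_attained[OF assms(1)] by blast
  have "\<bar>\<Sum>u\<in>X. \<Sum>v\<in>Y. B u v\<bar> \<le> (\<Sum>u\<in>X. \<Sum>v\<in>Y. \<bar>B u v\<bar>)"
    by (intro order_trans[OF sum_abs] sum_mono sum_abs)
  also have "\<dots> \<le> (\<Sum>u\<in>X. \<Sum>v\<in>Y. 1)"
    using XY assms(2) by (intro sum_mono) blast
  also have "\<dots> \<le> real (card V) * real (card V)"
    using card_mono[OF assms(1) XY(1)] card_mono[OF assms(1) XY(2)]
    by (simp add: mult_mono)
  finally have "mcut V B * (real (card V))\<^sup>2 \<le> 1 * (real (card V))\<^sup>2"
    using XY(3) by (simp add: power2_eq_square)
  then show ?thesis using n by (simp only: mult_le_cancel_right) auto
qed

text \<open>A linear functional on the unit cube is extremal at vertices: keep, with full weight,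
  the \<open>u\<close> for which \<open>h u\<close> has the sign of the whole sum.\<close>

lemma abs_sum_weighted_le_subset:
  fixes f h :: "'a \<Rightarrow> real"
  assumes "finite V" "\<And>u. u \<in> V \<Longrightarrow> 0 \<le> f u \<and> f u \<le> 1"
  shows "\<exists>X\<subseteq>V. \<bar>\<Sum>u\<in>V. h u * f u\<bar> \<le> \<bar>\<Sum>u\<in>X. h u\<bar>"
proof (cases "(\<Sum>u\<in>V. h u * f u) \<ge> 0")
  case True
  have "(\<Sum>u\<in>V. h u * f u) \<le> (\<Sum>u\<in>V. if h u \<ge> 0 then h u else 0)"
  proof (rule sum_mono)
    fix u assume "u \<in> V"
    then show "h u * f u \<le> (if h u \<ge> 0 then h u else 0)"
      using assms(2)[of u] by (auto simp: mult_left_le mult_nonpos_nonneg)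
  qed
  also have "\<dots> = (\<Sum>u\<in>{u\<in>V. h u \<ge> 0}. h u)"
    using assms(1) by (simp add: sum.If_cases Int_def)
  finally show ?thesis using True by (intro exI[of _ "{u\<in>V. h u \<ge> 0}"]) auto
next
  case False
  have "(\<Sum>u\<in>V. h u * f u) \<ge> (\<Sum>u\<in>V. if h u \<le> 0 then h u else 0)"
  proof (rule sum_mono)
    fix u assume "u \<in> V"
    then show "h u * f u \<ge> (if h u \<le> 0 then h u else 0)"
      using assms(2)[of u] mult_left_mono_neg[of "f u" 1 "h u"] by auto
  qed
  moreover have "(\<Sum>u\<in>V. if h u \<le> 0 then h u else 0) = (\<Sum>u\<in>{u\<in>V. h u \<le> 0}. h u)"
    using assms(1) by (simp add: sum.If_cases Int_def)
  ultimately show ?thesis using False by (intro exI[of _ "{u\<in>V. h u \<le> 0}"]) auto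
qed

text \<open>The form is linear in each weight separately, so the weights can be rounded to
  indicators one after the other.\<close>

lemma mcut_weighted:
  fixes f g :: "'a \<Rightarrow> real"
  assumes "finite V" "\<And>u. u \<in> V \<Longrightarrow> 0 \<le> f u \<and> f u \<le> 1" "\<And>u. u \<in> V \<Longrightarrow> 0 \<le> g u \<and> g u \<le> 1"
  shows "\<bar>\<Sum>u\<in>V. \<Sum>v\<in>V. B u v * f u * g v\<bar> \<le> mcut V B * (real (card V))\<^sup>2"
proof -
  have "(\<Sum>u\<in>V. \<Sum>v\<in>V. B u v * f u * g v) = (\<Sum>u\<in>V. (\<Sum>v\<in>V. B u v * g v) * f u)"
    unfolding sum_distrib_right by (intro sum.cong refl) (simp only: mult_ac)
  moreover obtain X where X: "X \<subseteq> V"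
    "\<bar>\<Sum>u\<in>V. (\<Sum>v\<in>V. B u v * g v) * f u\<bar> \<le> \<bar>\<Sum>u\<in>X. \<Sum>v\<in>V. B u v * g v\<bar>"
    using abs_sum_weighted_le_subset[where f = f and h = "\<lambda>u. \<Sum>v\<in>V. B u v * g v", OF assms(1,2)] by blast
  moreover have "(\<Sum>u\<in>X. \<Sum>v\<in>V. B u v * g v) = (\<Sum>v\<in>V. (\<Sum>u\<in>X. B u v) * g v)"
    by (subst sum.swap) (simp add: sum_distrib_right)
  moreover obtain Y where Y: "Y \<subseteq> V"
    "\<bar>\<Sum>v\<in>V. (\<Sum>u\<in>X. B u v) * g v\<bar> \<le> \<bar>\<Sum>v\<in>Y. \<Sum>u\<in>X. B u v\<bar>"
    using abs_sum_weighted_le_subset[where f = g and h = "\<lambda>v. \<Sum>u\<in>X. B u v", OF assms(1,3)] by blast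
  moreover have "(\<Sum>v\<in>Y. \<Sum>u\<in>X. B u v) = (\<Sum>u\<in>X. \<Sum>v\<in>Y. B u v)"
    by (rule sum.swap)
  ultimately show ?thesis using mcut_ge[OF assms(1) X(1) Y(1), of B] by linarith
qed

text \<open>The factor 4 counts the combinations of positive and negative parts of \<open>f\<close>
  and \<open>g\<close>.\<close>

lemma mcut_weighted_signed:
  fixes f g :: "'a \<Rightarrow> real"
  assumes "finite V" "\<And>u. u \<in> V \<Longrightarrow> \<bar>f u\<bar> \<le> 1" "\<And>u. u \<in> V \<Longrightarrow> \<bar>g u\<bar> \<le> 1"
  shows "\<bar>\<Sum>u\<in>V. \<Sum>v\<in>V. B u v * f u * g v\<bar> \<le> 4 * mcut V B * (real (card V))\<^sup>2"
proof -
  define fp fm gp gm where "fp u = max 0 (f u)" and "fm u = max 0 (- f u)"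
    and "gp u = max 0 (g u)" and "gm u = max 0 (- g u)" for u
  let ?s = "\<lambda>f g. \<Sum>u\<in>V. \<Sum>v\<in>V. B u v * f u * g v"
  have fg: "f u = fp u - fm u" "g u = gp u - gm u" for u
    by (auto simp: fp_def fm_def gp_def gm_def max_def)
  have "B u v * f u * g v =
      B u v * fp u * gp v - B u v * fp u * gm v - B u v * fm u * gp v + B u v * fm u * gm v" for u v
    by (subst fg(1)[of u], subst fg(2)[of v]) (simp add: algebra_simps)
  then have "?s f g = ?s fp gp - ?s fp gm - ?s fm gp + ?s fm gm"
    by (simp only: sum.distrib sum_subtractf)
  moreover have "\<bar>?s fp gp\<bar> \<le> mcut V B * (real (card V))\<^sup>2"
    "\<bar>?s fp gm\<bar> \<le> mcut V B * (real (card V))\<^sup>2"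
    "\<bar>?s fm gp\<bar> \<le> mcut V B * (real (card V))\<^sup>2"
    "\<bar>?s fm gm\<bar> \<le> mcut V B * (real (card V))\<^sup>2"
    using assms
    by (intro mcut_weighted; force simp: fp_def fm_def gp_def gm_def abs_le_iff)+
  ultimately show ?thesis by linarith
qed

section \<open>Block averages of a matrix and their energy\<close>

definition dens :: "'a set \<Rightarrow> ('a \<Rightarrow> nat) \<Rightarrow> ('a \<Rightarrow> 'a \<Rightarrow> real) \<Rightarrow> nat \<Rightarrow> nat \<Rightarrow> real" where
  "dens V \<kappa> A a b =
     (\<Sum>u\<in>{u\<in>V. \<kappa> u = a}. \<Sum>v\<in>{v\<in>V. \<kappa> v = b}. A u v) /
     (real (card {u\<in>V. \<kappa> u = a}) * real (card {v\<in>V. \<kappa> v = b}))"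

lemma sum_classes2:
  fixes H :: "'a \<Rightarrow> 'a \<Rightarrow> real"
  assumes "finite V"
  shows "(\<Sum>u\<in>V. \<Sum>v\<in>V. H u v) =
    (\<Sum>a\<in>\<kappa> ` V. \<Sum>b\<in>\<kappa> ` V. \<Sum>u\<in>{u\<in>V. \<kappa> u = a}. \<Sum>v\<in>{v\<in>V. \<kappa> v = b}. H u v)"
proof -
  have "(\<Sum>u\<in>V. \<Sum>v\<in>V. H u v) =
    (\<Sum>a\<in>\<kappa> ` V. \<Sum>u\<in>{u\<in>V. \<kappa> u = a}. \<Sum>b\<in>\<kappa> ` V. \<Sum>v\<in>{v\<in>V. \<kappa> v = b}. H u v)"
    by (subst sum.image_gen[OF assms, of _ \<kappa>], subst sum.image_gen[OF assms, of _ \<kappa>]) simp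
  also have "\<dots> = (\<Sum>a\<in>\<kappa> ` V. \<Sum>b\<in>\<kappa> ` V. \<Sum>u\<in>{u\<in>V. \<kappa> u = a}. \<Sum>v\<in>{v\<in>V. \<kappa> v = b}. H u v)"
    by (intro sum.cong refl sum.swap)
  finally show ?thesis .
qed

text \<open>Block averaging preserves the sum over each block, and \<open>h\<close> is constant
  there. In other words, \<open>dens\<close> is the orthogonal projection to block matrices.\<close>

lemma sum_dens:
  fixes A :: "'a \<Rightarrow> 'a \<Rightarrow> real"
  assumes "finite V"
  shows "(\<Sum>u\<in>V. \<Sum>v\<in>V. dens V \<kappa> A (\<kappa> u) (\<kappa> v) * h (\<kappa> u) (\<kappa> v)) =
    (\<Sum>u\<in>V. \<Sum>v\<in>V. A u v * h (\<kappa> u) (\<kappa> v))"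
proof -
  have "(\<Sum>u\<in>{u\<in>V. \<kappa> u = a}. \<Sum>v\<in>{v\<in>V. \<kappa> v = b}. dens V \<kappa> A (\<kappa> u) (\<kappa> v) * h (\<kappa> u) (\<kappa> v)) =
    (\<Sum>u\<in>{u\<in>V. \<kappa> u = a}. \<Sum>v\<in>{v\<in>V. \<kappa> v = b}. A u v * h (\<kappa> u) (\<kappa> v))"
    if "a \<in> \<kappa> ` V" "b \<in> \<kappa> ` V" for a b
  proof -
    have ne: "card {u\<in>V. \<kappa> u = a} \<noteq> 0" "card {u\<in>V. \<kappa> u = b} \<noteq> 0"
      using that assms by auto
    have "(\<Sum>u\<in>{u\<in>V. \<kappa> u = a}. \<Sum>v\<in>{v\<in>V. \<kappa> v = b}. dens V \<kappa> A (\<kappa> u) (\<kappa> v) * h (\<kappa> u) (\<kappa> v))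
      = (\<Sum>u\<in>{u\<in>V. \<kappa> u = a}. \<Sum>v\<in>{v\<in>V. \<kappa> v = b}. dens V \<kappa> A a b * h a b)"
      by (intro sum.cong) auto
    also have "\<dots> = (\<Sum>u\<in>{u\<in>V. \<kappa> u = a}. \<Sum>v\<in>{v\<in>V. \<kappa> v = b}. A u v) * h a b"
      using ne by (simp add: dens_def)
    also have "\<dots> = (\<Sum>u\<in>{u\<in>V. \<kappa> u = a}. \<Sum>v\<in>{v\<in>V. \<kappa> v = b}. A u v * h (\<kappa> u) (\<kappa> v))"
      unfolding sum_distrib_right by (intro sum.cong) auto
    finally show ?thesis .
  qed
  note * = this
  show ?thesis
    unfolding sum_classes2[OF assms, of _ \<kappa>] by (rule sum.cong[OF refl], rule sum.cong[OF refl], rule *)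
qed

lemma dens_bounds:
  assumes "finite V" "\<And>u v. u \<in> V \<Longrightarrow> v \<in> V \<Longrightarrow> 0 \<le> A u v \<and> A u v \<le> 1"
  shows "0 \<le> dens V \<kappa> A a b" "dens V \<kappa> A a b \<le> 1"
proof -
  show "0 \<le> dens V \<kappa> A a b"
    unfolding dens_def using assms by (intro divide_nonneg_nonneg sum_nonneg mult_nonneg_nonneg) auto
  have "(\<Sum>u\<in>{u\<in>V. \<kappa> u = a}. \<Sum>v\<in>{v\<in>V. \<kappa> v = b}. A u v)
      \<le> (\<Sum>u\<in>{u\<in>V. \<kappa> u = a}. \<Sum>v\<in>{v\<in>V. \<kappa> v = b}. 1)"
    using assms by (intro sum_mono) auto
  then show "dens V \<kappa> A a b \<le> 1"
    unfolding dens_def by (intro divide_le_eq_1[THEN iffD2]) (auto simp: zero_less_mult_iff)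
qed

text \<open>The normalised squared norm of this projection, called index or mean square density in
  the theory of regular partitions.\<close>

definition energy :: "'a set \<Rightarrow> ('a \<Rightarrow> nat) \<Rightarrow> ('a \<Rightarrow> 'a \<Rightarrow> real) \<Rightarrow> real" where
  "energy V \<kappa> A = (\<Sum>u\<in>V. \<Sum>v\<in>V. (dens V \<kappa> A (\<kappa> u) (\<kappa> v))\<^sup>2) / (real (card V))\<^sup>2"

lemma energy_bounds:
  assumes "finite V" "\<And>u v. u \<in> V \<Longrightarrow> v \<in> V \<Longrightarrow> 0 \<le> A u v \<and> A u v \<le> 1"
  shows "0 \<le> energy V \<kappa> A" "energy V \<kappa> A \<le> 1"
proof -
  show "0 \<le> energy V \<kappa> A" unfolding energy_def by (intro divide_nonneg_nonneg sum_nonneg) auto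
  have "(\<Sum>u\<in>V. \<Sum>v\<in>V. (dens V \<kappa> A (\<kappa> u) (\<kappa> v))\<^sup>2) \<le> (\<Sum>u\<in>V. \<Sum>v\<in>V. 1)"
    using dens_bounds[OF assms] by (intro sum_mono power_le_one) auto
  then show "energy V \<kappa> A \<le> 1"
    unfolding energy_def by (intro divide_le_eq_1[THEN iffD2]) (auto simp: power2_eq_square zero_less_mult_iff)
qed

text \<open>Pythagoras: the coarse average is constant on the fine blocks, so the difference of the
  two projections is orthogonal to it. Refinement is expressed by a map \<open>r\<close> between the
  colours.\<close>

lemma energy_refine:
  fixes A :: "'a \<Rightarrow> 'a \<Rightarrow> real"
  assumes "finite V" "\<And>v. v \<in> V \<Longrightarrow> \<kappa> v = r (\<kappa>' v)"
  shows "(\<Sum>u\<in>V. \<Sum>v\<in>V. (dens V \<kappa>' A (\<kappa>' u) (\<kappa>' v) - dens V \<kappa> A (\<kappa> u) (\<kappa> v))\<^sup>2)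
      = (energy V \<kappa>' A - energy V \<kappa> A) * (real (card V))\<^sup>2"
proof (cases "V = {}")
  case True
  then show ?thesis by simp
next
  case False
  then have n: "real (card V) > 0" using assms by (simp add: card_gt_0_iff)
  let ?d' = "\<lambda>u v. dens V \<kappa>' A (\<kappa>' u) (\<kappa>' v)" and ?d = "\<lambda>u v. dens V \<kappa> A (\<kappa> u) (\<kappa> v)"
  \<comment> \<open>The cross term: \<open>sum_dens\<close> is used twice against the coarse
    average, first from the fine average to \<open>A\<close>, then from \<open>A\<close> to the
    coarse average.\<close>
  have "(\<Sum>u\<in>V. \<Sum>v\<in>V. ?d' u v * ?d u v) = (\<Sum>u\<in>V. \<Sum>v\<in>V. A u v * ?d u v)"
    using sum_dens[OF assms(1), of \<kappa>' A "\<lambda>a b. dens V \<kappa> A (r a) (r b)"] assms(2)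
    by simp
  also have "\<dots> = (\<Sum>u\<in>V. \<Sum>v\<in>V. ?d u v * ?d u v)"
    using sum_dens[OF assms(1), of \<kappa> A "dens V \<kappa> A"] by simp
  finally have *: "(\<Sum>u\<in>V. \<Sum>v\<in>V. ?d' u v * ?d u v) = (\<Sum>u\<in>V. \<Sum>v\<in>V. (?d u v)\<^sup>2)"
    by (simp add: power2_eq_square)
  have "(\<Sum>u\<in>V. \<Sum>v\<in>V. (?d' u v - ?d u v)\<^sup>2) =
     (\<Sum>u\<in>V. \<Sum>v\<in>V. (?d' u v)\<^sup>2) - 2 * (\<Sum>u\<in>V. \<Sum>v\<in>V. ?d' u v * ?d u v) + (\<Sum>u\<in>V. \<Sum>v\<in>V. (?d u v)\<^sup>2)"
    by (simp add: power2_diff sum.distrib sum_subtractf sum_distrib_left mult_ac)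
  moreover have "(energy V \<kappa>' A - energy V \<kappa> A) * (real (card V))\<^sup>2 =
      (\<Sum>u\<in>V. \<Sum>v\<in>V. (?d' u v)\<^sup>2) - (\<Sum>u\<in>V. \<Sum>v\<in>V. (?d u v)\<^sup>2)"
    using n by (simp add: energy_def left_diff_distrib)
  ultimately show ?thesis unfolding * by simp
qed

text \<open>\<open>X\<close> and \<open>Y\<close> are unions of classes of \<open>\<kappa>'\<close>,
  so over \<open>X \<times> Y\<close> the sum of \<open>A\<close> equals that of its fine average.
  What remains is a difference of two averages, bounded by Cauchy-Schwarz and
  \<open>energy_refine\<close>.\<close>

lemma energy_increment:
  fixes A :: "'a \<Rightarrow> 'a \<Rightarrow> real"
  assumes V: "finite V" and r: "\<And>v. v \<in> V \<Longrightarrow> \<kappa> v = r (\<kappa>' v)"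
    and XY: "X \<subseteq> V" "Y \<subseteq> V"
    and S: "\<And>v. v \<in> V \<Longrightarrow> v \<in> X \<longleftrightarrow> s (\<kappa>' v)" and T: "\<And>v. v \<in> V \<Longrightarrow> v \<in> Y \<longleftrightarrow> t (\<kappa>' v)"
  shows "(\<Sum>u\<in>X. \<Sum>v\<in>Y. A u v - dens V \<kappa> A (\<kappa> u) (\<kappa> v))\<^sup>2 \<le> (energy V \<kappa>' A - energy V \<kappa> A) * (real (card V))^4"
proof -
  let ?d' = "\<lambda>u v. dens V \<kappa>' A (\<kappa>' u) (\<kappa>' v)" and ?d = "\<lambda>u v. dens V \<kappa> A (\<kappa> u) (\<kappa> v)"
  have restr: "(\<Sum>u\<in>X. \<Sum>v\<in>Y. H u v) = (\<Sum>u\<in>V. \<Sum>v\<in>V. H u v * of_bool (s (\<kappa>' u) \<and> t (\<kappa>' v)))"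
    for H :: "'a \<Rightarrow> 'a \<Rightarrow> real"
  proof -
    have "(\<Sum>v\<in>V. H u v * of_bool (s (\<kappa>' u) \<and> t (\<kappa>' v))) = (if u \<in> X then \<Sum>v\<in>Y. H u v else 0)" if "u \<in> V" for u
    proof -
      have "(\<Sum>v\<in>V. H u v * of_bool (s (\<kappa>' u) \<and> t (\<kappa>' v))) = (\<Sum>v\<in>V. if v \<in> Y then (if u \<in> X then H u v else 0) else 0)"
        using S T that by (intro sum.cong) auto
      also have "\<dots> = (\<Sum>v\<in>V\<inter>Y. (if u \<in> X then H u v else 0))" using V by (simp add: sum.inter_restrict)
      also have "V \<inter> Y = Y" using XY by blast
      finally show ?thesis by auto
    qed
    then have "(\<Sum>u\<in>V. \<Sum>v\<in>V. H u v * of_bool (s (\<kappa>' u) \<and> t (\<kappa>' v))) = (\<Sum>u\<in>V. if u \<in> X then \<Sum>v\<in>Y. H u v else 0)"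
      by simp
    also have "\<dots> = (\<Sum>u\<in>V\<inter>X. \<Sum>v\<in>Y. H u v)" using V by (simp add: sum.inter_restrict)
    also have "V \<inter> X = X" using XY by blast
    finally show ?thesis by simp
  qed
  have "(\<Sum>u\<in>X. \<Sum>v\<in>Y. A u v) = (\<Sum>u\<in>X. \<Sum>v\<in>Y. ?d' u v)"
    unfolding restr by (rule sum_dens[OF V, symmetric])
  then have "(\<Sum>u\<in>X. \<Sum>v\<in>Y. A u v - ?d u v) = (\<Sum>u\<in>X. \<Sum>v\<in>Y. ?d' u v - ?d u v)"
    by (simp add: sum_subtractf)
  also have "\<dots> = (\<Sum>(u, v)\<in>X \<times> Y. ?d' u v - ?d u v)"
    by (simp add: sum.cartesian_product)
  finally have "(\<Sum>u\<in>X. \<Sum>v\<in>Y. A u v - ?d u v)\<^sup>2 \<le> (\<Sum>(u, v)\<in>X \<times> Y. (?d' u v - ?d u v)\<^sup>2) * card (X \<times> Y)"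
    using sum_squared_le_sum_of_squares[of "\<lambda>(u, v). ?d' u v - ?d u v" "X \<times> Y"]
    by (simp add: case_prod_beta)
  also have "\<dots> \<le> (\<Sum>(u, v)\<in>V \<times> V. (?d' u v - ?d u v)\<^sup>2) * card (V \<times> V)"
    using XY V by (intro mult_mono sum_mono2 of_nat_mono card_mono) (auto intro: sum_nonneg)
  also have "\<dots> = (energy V \<kappa>' A - energy V \<kappa> A) * (real (card V))\<^sup>2 * (real (card V))\<^sup>2"
    using energy_refine[where r = r and A = A, OF V r]
    by (simp only: sum.cartesian_product) (simp add: card_cartesian_product power2_eq_square mult_ac)
  finally show ?thesis by (simp add: power_def numeral_eq_Suc mult_ac)
qed

section \<open>Iterated refinement with square summable errors\<close>

definition max_cut_pair :: "'a set \<Rightarrow> ('a \<Rightarrow> 'a \<Rightarrow> real) \<Rightarrow> 'a set \<times> 'a set" where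
  "max_cut_pair V B = (SOME (X, Y). X \<subseteq> V \<and> Y \<subseteq> V \<and>
     \<bar>\<Sum>u\<in>X. \<Sum>v\<in>Y. B u v\<bar> = mcut V B * (real (card V))\<^sup>2)"

lemma max_cut_pair:
  assumes "finite V"
  shows "fst (max_cut_pair V B) \<subseteq> V" "snd (max_cut_pair V B) \<subseteq> V"
    "\<bar>\<Sum>u\<in>fst (max_cut_pair V B). \<Sum>v\<in>snd (max_cut_pair V B). B u v\<bar> = mcut V B * (real (card V))\<^sup>2"
proof -
  have "\<exists>p. case p of (X, Y) \<Rightarrow> X \<subseteq> V \<and> Y \<subseteq> V \<and>
     \<bar>\<Sum>u\<in>X. \<Sum>v\<in>Y. B u v\<bar> = mcut V B * (real (card V))\<^sup>2"
    using mcut_attained[OF assms, of B] by auto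
  from someI_ex[OF this, folded max_cut_pair_def]
  show "fst (max_cut_pair V B) \<subseteq> V" "snd (max_cut_pair V B) \<subseteq> V"
    "\<bar>\<Sum>u\<in>fst (max_cut_pair V B). \<Sum>v\<in>snd (max_cut_pair V B). B u v\<bar> = mcut V B * (real (card V))\<^sup>2"
    by (auto simp: case_prod_beta)
qed

text \<open>Each step splits the classes by a worst pair of sets for the current error. The two
  memberships are appended as a digit in base 4, so division by 4 restores the coarser class and
  level \<open>j\<close> has at most \<open>4 ^ j\<close> classes.\<close>

primrec parts :: "'a set \<Rightarrow> ('a \<Rightarrow> 'a \<Rightarrow> real) \<Rightarrow> nat \<Rightarrow> 'a \<Rightarrow> nat" where
  "parts V A 0 = (\<lambda>v. 0)"
| "parts V A (Suc j) =
     (let \<kappa> = parts V A j; (X, Y) = max_cut_pair V (\<lambda>u v. A u v - dens V \<kappa> A (\<kappa> u) (\<kappa> v))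
      in (\<lambda>v. 4 * \<kappa> v + 2 * of_bool (v \<in> X) + of_bool (v \<in> Y)))"

definition step_err :: "'a set \<Rightarrow> ('a \<Rightarrow> 'a \<Rightarrow> real) \<Rightarrow> nat \<Rightarrow> 'a \<Rightarrow> 'a \<Rightarrow> real" where
  "step_err V A j u v = A u v - dens V (parts V A j) A (parts V A j u) (parts V A j v)"

lemma parts_div: "i \<le> j \<Longrightarrow> parts V A i v = parts V A j v div 4 ^ (j - i)"
proof (induction rule: dec_induct)
  case (step k)
  then have e: "Suc k - i = Suc (k - i)" by simp
  have "parts V A (Suc k) v div 4 = parts V A k v"
    by (auto simp: Let_def case_prod_beta of_bool_def)
  then show ?case using step by (simp add: e div_mult2_eq del: parts.simps)
qed simp

lemma parts_less: "parts V A j v < 4 ^ j"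
  by (induction j) (auto simp: Let_def case_prod_beta of_bool_def)

text \<open>The next partition sees the two sets that attain the cut norm of the error, so this cut
  norm is paid for by energy.\<close>

lemma mcut_energy:
  assumes "finite V"
  shows "(mcut V (step_err V A j))\<^sup>2 \<le> energy V (parts V A (Suc j)) A - energy V (parts V A j) A"
proof (cases "V = {}")
  case True
  then show ?thesis by (simp add: mcut_def energy_def)
next
  case False
  then have n: "real (card V) > 0" using assms by (simp add: card_gt_0_iff)
  define X Y where "X = fst (max_cut_pair V (step_err V A j))" and "Y = snd (max_cut_pair V (step_err V A j))"
  have k': "parts V A (Suc j) v = 4 * parts V A j v + 2 * of_bool (v \<in> X) + of_bool (v \<in> Y)" for v
    by (simp add: X_def Y_def Let_def case_prod_beta step_err_def[abs_def])
  have XY: "X \<subseteq> V" "Y \<subseteq> V" "\<bar>\<Sum>u\<in>X. \<Sum>v\<in>Y. step_err V A j u v\<bar> = mcut V (step_err V A j) * (real (card V))\<^sup>2"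
    unfolding X_def Y_def by (rule max_cut_pair[OF assms])+
  \<comment> \<open>The last two bits of the new colour.\<close>
  have 2: "v \<in> X \<longleftrightarrow> parts V A (Suc j) v div 2 mod 2 = 1" "v \<in> Y \<longleftrightarrow> parts V A (Suc j) v mod 2 = 1" for v
    unfolding k' by (auto simp: of_bool_def) presburger+
  have "(mcut V (step_err V A j) * (real (card V))\<^sup>2)\<^sup>2 = (\<Sum>u\<in>X. \<Sum>v\<in>Y. step_err V A j u v)\<^sup>2"
    unfolding XY(3)[symmetric] by simp
  also have "\<dots> \<le> (energy V (parts V A (Suc j)) A - energy V (parts V A j) A) * (real (card V))^4"
    unfolding step_err_def
    by (rule energy_increment[OF assms _ XY(1,2), where r = "\<lambda>c. c div 4"
          and s = "\<lambda>c. c div 2 mod 2 = 1" and t = "\<lambda>c. c mod 2 = 1"])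
      (simp_all add: 2 parts_div[of j "Suc j"] del: parts.simps)
  finally have "(mcut V (step_err V A j))\<^sup>2 * (real (card V))^4
      \<le> (energy V (parts V A (Suc j)) A - energy V (parts V A j) A) * (real (card V))^4"
    by (simp add: power_mult_distrib del: parts.simps flip: power_mult)
  then show ?thesis using n by (simp add: mult_le_cancel_right del: parts.simps)
qed

text \<open>The energy telescopes and stays below 1. The bound on the sum serves the pigeonhole in
  \<open>weak_regularity\<close>, and in the limit of a graph sequence it shows that the errors of
  the levels tend to 0.\<close>

lemma sum_mcut_le_1:
  assumes "finite V" "\<And>u v. u \<in> V \<Longrightarrow> v \<in> V \<Longrightarrow> 0 \<le> A u v \<and> A u v \<le> 1"
  shows "(\<Sum>j<J. (mcut V (step_err V A j))\<^sup>2) \<le> 1"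
proof -
  have "(\<Sum>j<J. (mcut V (step_err V A j))\<^sup>2) \<le> (\<Sum>j<J. energy V (parts V A (Suc j)) A - energy V (parts V A j) A)"
    by (intro sum_mono mcut_energy assms)
  also have "\<dots> = energy V (parts V A J) A - energy V (parts V A 0) A"
    by (rule sum_lessThan_telescope)
  also have "\<dots> \<le> 1" using energy_bounds(2)[where \<kappa> = "parts V A J" and A = A, OF assms]
      energy_bounds(1)[where \<kappa> = "parts V A 0" and A = A, OF assms]
    by linarith
  finally show ?thesis .
qed

lemma weak_regularity:
  assumes "finite V" "\<And>u v. u \<in> V \<Longrightarrow> v \<in> V \<Longrightarrow> 0 \<le> A u v \<and> A u v \<le> 1" "0 < L"
  shows "\<exists>j<L. (mcut V (step_err V A j))\<^sup>2 \<le> 1 / real L"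
proof (rule ccontr)
  assume "\<not> ?thesis"
  then have "(\<Sum>j<L. 1 / real L) < (\<Sum>j<L. (mcut V (step_err V A j))\<^sup>2)"
    using assms(3) by (intro sum_strict_mono) (auto simp: not_le)
  then show False using sum_mcut_le_1[where J = L and A = A, OF assms(1,2)] assms(3) by simp
qed

section \<open>Pattern densities and the counting lemma\<close>

definition pairs :: "nat \<Rightarrow> (nat \<times> nat) set" where
  "pairs k = {(i, j). i < j \<and> j < k}"

definition pat :: "(nat \<times> nat) set \<Rightarrow> nat \<times> nat \<Rightarrow> real \<Rightarrow> real" where
  "pat D e z = (if e \<in> D then z else 1 - z)"

text \<open>The probability that the \<open>U\<close>-random graph on \<open>k\<close> independent
  points has exactly the edges in \<open>D\<close> among \<open>pairs k\<close>: a labelled induced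
  subgraph density.\<close>

definition tdens :: "'a measure \<Rightarrow> nat \<Rightarrow> (nat \<times> nat) set \<Rightarrow> ('a \<times> 'a \<Rightarrow> real) \<Rightarrow> real" where
  "tdens M k D U =
     (\<integral>x. (\<Prod>e\<in>pairs k. pat D e (U (x (fst e), x (snd e)))) \<partial>(\<Pi>\<^sub>M i\<in>{..<k}. M))"

text \<open>Closeness in cut norm for one fixed overlay of the two kernels; measure preserving maps
  enter only with the cut distance.\<close>

definition cut_close :: "'a measure \<Rightarrow> ('a \<times> 'a \<Rightarrow> real) \<Rightarrow> ('a \<times> 'a \<Rightarrow> real) \<Rightarrow> real \<Rightarrow> bool" where
  "cut_close M U W \<epsilon> \<longleftrightarrow>
     (\<forall>S\<in>sets M. \<forall>T\<in>sets M. \<bar>\<integral>z. indicator (S \<times> T) z * (U z - W z) \<partial>(M \<Otimes>\<^sub>M M)\<bar> \<le> \<epsilon>)"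

lemma finite_pairs [simp]: "finite (pairs k)"
  by (rule finite_subset[of _ "{..<k} \<times> {..<k}"]) (auto simp: pairs_def)

lemma card_pairs_le: "card (pairs k) \<le> k\<^sup>2"
proof -
  have "card (pairs k) \<le> card ({..<k} \<times> {..<k})"
    by (rule card_mono) (auto simp: pairs_def)
  then show ?thesis by (simp add: power2_eq_square card_cartesian_product)
qed

lemma pat_bounds: "0 \<le> z \<Longrightarrow> z \<le> 1 \<Longrightarrow> 0 \<le> pat D e z \<and> pat D e z \<le> 1"
  by (simp add: pat_def)

lemma pat_diff: "pat D e y - pat D e z = (if e \<in> D then 1 else - 1) * (y - z)"
  by (simp add: pat_def)

context prob_space
begin

text \<open>The integral of a non-integrable function is 0 by convention, so the bound survives
  without integrability.\<close>

lemma abs_integral_bound: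
  fixes h :: "'a \<Rightarrow> real"
  assumes "\<And>x. x \<in> space M \<Longrightarrow> \<bar>h x\<bar> \<le> \<epsilon>" "0 \<le> \<epsilon>"
  shows "\<bar>\<integral>x. h x \<partial>M\<bar> \<le> \<epsilon>"
proof (cases "integrable M h")
  case True
  have "\<bar>\<integral>x. h x \<partial>M\<bar> \<le> (\<integral>x. \<bar>h x\<bar> \<partial>M)" by (rule integral_abs_bound)
  also have "\<dots> \<le> (\<integral>x. \<epsilon> \<partial>M)" using True assms by (intro integral_mono) auto
  finally show ?thesis by (simp add: prob_space)
next
  case False
  then show ?thesis using assms by (simp add: not_integrable_integral_eq)
qed

lemma integrable_bounded:
  fixes h :: "'a \<Rightarrow> real"
  assumes "h \<in> borel_measurable M" "\<And>x. x \<in> space M \<Longrightarrow> \<bar>h x\<bar> \<le> c"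
  shows "integrable M h"
  by (rule integrable_const_bound[of _ c]) (use assms in auto)

lemma abs_integral_weighted_le_set:
  fixes f h :: "'a \<Rightarrow> real"
  assumes h: "integrable M h" and f: "f \<in> borel_measurable M"
    and f01: "\<And>x. x \<in> space M \<Longrightarrow> 0 \<le> f x \<and> f x \<le> 1"
  shows "\<exists>S\<in>sets M. \<bar>\<integral>x. f x * h x \<partial>M\<bar> \<le> \<bar>\<integral>x. indicator S x * h x \<partial>M\<bar>"
proof -
  have int: "integrable M (\<lambda>x. g x * h x)" if "g \<in> borel_measurable M" "\<And>x. x \<in> space M \<Longrightarrow> 0 \<le> g x \<and> g x \<le> 1"
    for g :: "'a \<Rightarrow> real"
    using that h f01
    by (intro Bochner_Integration.integrable_bound[OF h]) (auto simp: abs_mult intro!: mult_left_le_one_le)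
  have [measurable]: "h \<in> borel_measurable M" using h by simp
  show ?thesis
  proof (cases "(\<integral>x. f x * h x \<partial>M) \<ge> 0")
    case True
    define S where "S = {x \<in> space M. h x \<ge> 0}"
    have S: "S \<in> sets M" unfolding S_def by measurable
    have "(\<integral>x. f x * h x \<partial>M) \<le> (\<integral>x. indicator S x * h x \<partial>M)"
      using f01 f S
      by (intro integral_mono int)
        (auto simp: indicator_def S_def mult_left_le_one_le mult_nonneg_nonpos)
    then show ?thesis using True S by (intro bexI[of _ S]) auto
  next
    case False
    define S where "S = {x \<in> space M. h x \<le> 0}"
    have S: "S \<in> sets M" unfolding S_def by measurable
    have "indicator S x * h x \<le> f x * h x" if "x \<in> space M" for x
      using f01[OF that] that mult_right_mono_neg[of "f x" 1 "h x"] by (auto simp: indicator_def S_def)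
    then have "(\<integral>x. f x * h x \<partial>M) \<ge> (\<integral>x. indicator S x * h x \<partial>M)"
      using f01 f S by (intro integral_mono int) (auto simp: indicator_def)
    then show ?thesis using False S by (intro bexI[of _ S]) auto
  qed
qed

text \<open>Bilinearity again: integrating out the second variable leaves a linear functional of
  \<open>f\<close>, which can be rounded to a set \<open>S\<close>; integrating out the first one
  then does the same for \<open>g\<close>.\<close>

lemma cut_weighted:
  fixes B :: "'a \<times> 'a \<Rightarrow> real"
  assumes B[measurable]: "B \<in> borel_measurable (M \<Otimes>\<^sub>M M)"
    and B1: "\<And>z. z \<in> space (M \<Otimes>\<^sub>M M) \<Longrightarrow> \<bar>B z\<bar> \<le> 1"
    and f[measurable]: "f \<in> borel_measurable M" and f01: "\<And>x. x \<in> space M \<Longrightarrow> 0 \<le> f x \<and> f x \<le> 1"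
    and g[measurable]: "g \<in> borel_measurable M" and g01: "\<And>x. x \<in> space M \<Longrightarrow> 0 \<le> g x \<and> g x \<le> 1"
    and cut: "\<And>S T. S \<in> sets M \<Longrightarrow> T \<in> sets M \<Longrightarrow>
        \<bar>\<integral>z. indicator (S \<times> T) z * B z \<partial>(M \<Otimes>\<^sub>M M)\<bar> \<le> \<epsilon>"
  shows "\<bar>\<integral>z. B z * f (fst z) * g (snd z) \<partial>(M \<Otimes>\<^sub>M M)\<bar> \<le> \<epsilon>"
proof -
  interpret MM: pair_prob_space M M ..
  have int: "integrable (M \<Otimes>\<^sub>M M) (\<lambda>z. B z * u (fst z) * w (snd z))"
    if "u \<in> borel_measurable M" "\<And>x. x \<in> space M \<Longrightarrow> 0 \<le> u x \<and> u x \<le> 1"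
       "w \<in> borel_measurable M" "\<And>x. x \<in> space M \<Longrightarrow> 0 \<le> w x \<and> w x \<le> 1" for u w :: "'a \<Rightarrow> real"
  proof (rule MM.P.integrable_bounded[of _ 1])
    show "(\<lambda>z. B z * u (fst z) * w (snd z)) \<in> borel_measurable (M \<Otimes>\<^sub>M M)"
      using that by measurable
    fix z assume z: "z \<in> space (M \<Otimes>\<^sub>M M)"
    then show "\<bar>B z * u (fst z) * w (snd z)\<bar> \<le> 1"
      using B1[OF z] that(2)[of "fst z"] that(4)[of "snd z"]
      by (auto simp: abs_mult space_pair_measure intro!: mult_le_one)
  qed
  have sec: "integrable M (\<lambda>b. B (a, b) * g b)" if "a \<in> space M" for a
    using that B1 g01 by (intro integrable_bounded[of _ 1]) (auto simp: abs_mult space_pair_measure intro!: mult_le_one)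
  define h where "h a = (\<integral>b. B (a, b) * g b \<partial>M)" for a
  have hm: "h \<in> borel_measurable M" unfolding h_def by measurable
  have h1: "\<bar>h a\<bar> \<le> 1" if "a \<in> space M" for a
    unfolding h_def using that B1 g01
    by (intro abs_integral_bound) (auto simp: abs_mult space_pair_measure intro!: mult_le_one)
  have one: "(\<integral>z. B z * u (fst z) * g (snd z) \<partial>(M \<Otimes>\<^sub>M M)) = (\<integral>a. u a * h a \<partial>M)"
    if "u \<in> borel_measurable M" "\<And>x. x \<in> space M \<Longrightarrow> 0 \<le> u x \<and> u x \<le> 1" for u :: "'a \<Rightarrow> real"
  proof -
    have "(\<integral>z. B z * u (fst z) * g (snd z) \<partial>(M \<Otimes>\<^sub>M M)) = (\<integral>a. (\<integral>b. B (a, b) * u a * g b \<partial>M) \<partial>M)"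
      using MM.integral_fst'[OF int[OF that g g01]] by simp
    also have "\<dots> = (\<integral>a. (\<integral>b. u a * (B (a, b) * g b) \<partial>M) \<partial>M)"
      by (simp only: mult_ac)
    finally show ?thesis by (simp add: h_def)
  qed
  obtain S where S: "S \<in> sets M" "\<bar>\<integral>a. f a * h a \<partial>M\<bar> \<le> \<bar>\<integral>a. indicator S a * h a \<partial>M\<bar>"
    using abs_integral_weighted_le_set[OF integrable_bounded[OF hm h1] f f01] by blast
  define h' where "h' b = (\<integral>a. B (a, b) * indicator S a \<partial>M)" for b
  have hm': "h' \<in> borel_measurable M"
  proof -
    have [measurable]: "S \<in> sets M" by fact
    show ?thesis unfolding h'_def by measurable
  qed
  have h1': "\<bar>h' a\<bar> \<le> 1" if "a \<in> space M" for a
    unfolding h'_def using that B1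
    by (intro abs_integral_bound) (auto simp: abs_mult space_pair_measure indicator_def)
  have indS: "(indicator S :: 'a \<Rightarrow> real) \<in> borel_measurable M" using S by simp
  have two: "(\<integral>z. B z * indicator S (fst z) * w (snd z) \<partial>(M \<Otimes>\<^sub>M M)) = (\<integral>a. w a * h' a \<partial>M)"
    if "w \<in> borel_measurable M" "\<And>x. x \<in> space M \<Longrightarrow> 0 \<le> w x \<and> w x \<le> 1" for w :: "'a \<Rightarrow> real"
  proof -
    have "integrable (M \<Otimes>\<^sub>M M) (\<lambda>(x, y). B (x, y) * indicator S x * w y)"
      using int[OF indS _ that] by (simp add: case_prod_unfold)
    from MM.integral_snd[OF this]
    have "(\<integral>z. B z * indicator S (fst z) * w (snd z) \<partial>(M \<Otimes>\<^sub>M M)) =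
        (\<integral>b. (\<integral>a. B (a, b) * indicator S a * w b \<partial>M) \<partial>M)"
      by (simp only: case_prod_unfold prod.collapse)
    also have "\<dots> = (\<integral>b. (\<integral>a. w b * (B (a, b) * indicator S a) \<partial>M) \<partial>M)"
      by (simp only: mult_ac)
    finally show ?thesis by (simp add: h'_def)
  qed
  obtain T where T: "T \<in> sets M" "\<bar>\<integral>a. g a * h' a \<partial>M\<bar> \<le> \<bar>\<integral>a. indicator T a * h' a \<partial>M\<bar>"
    using abs_integral_weighted_le_set[OF integrable_bounded[OF hm' h1'] g g01] by blast
  have "\<bar>\<integral>z. B z * f (fst z) * g (snd z) \<partial>(M \<Otimes>\<^sub>M M)\<bar> \<le> \<bar>\<integral>a. indicator S a * h a \<partial>M\<bar>"
    using one[OF f f01] S by simp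
  also have "(\<integral>a. indicator S a * h a \<partial>M) = (\<integral>z. B z * indicator S (fst z) * g (snd z) \<partial>(M \<Otimes>\<^sub>M M))"
    by (subst one[OF indS]) auto
  also have "\<dots> = (\<integral>a. g a * h' a \<partial>M)" by (rule two[OF g g01])
  also have "\<bar>\<integral>a. g a * h' a \<partial>M\<bar> \<le> \<bar>\<integral>a. indicator T a * h' a \<partial>M\<bar>" by (rule T)
  also have "(\<integral>a. indicator T a * h' a \<partial>M) = (\<integral>z. B z * indicator S (fst z) * indicator T (snd z) \<partial>(M \<Otimes>\<^sub>M M))"
    using T by (subst two) auto
  also have "\<dots> = (\<integral>z. indicator (S \<times> T) z * B z \<partial>(M \<Otimes>\<^sub>M M))"
    by (intro Bochner_Integration.integral_cong) (auto simp: indicator_def)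
  also have "\<bar>\<dots>\<bar> \<le> \<epsilon>" by (rule cut[OF S(1) T(1)])
  finally show ?thesis .
qed

lemma measurable_eval_pair:
  fixes c :: "'a \<times> 'a \<Rightarrow> real"
  assumes "p \<in> I" "q \<in> I" and [measurable]: "c \<in> borel_measurable (M \<Otimes>\<^sub>M M)"
  shows "(\<lambda>x. c (x p, x q)) \<in> borel_measurable (\<Pi>\<^sub>M i\<in>I. M)"
  using assms(1,2) by measurable

lemma measurable_upd_pair:
  fixes c :: "'a \<times> 'a \<Rightarrow> real"
  assumes "i \<noteq> p \<Longrightarrow> x p \<in> space M" "i \<noteq> q \<Longrightarrow> x q \<in> space M" "c \<in> borel_measurable (M \<Otimes>\<^sub>M M)"
  shows "(\<lambda>a. c ((x(i := a)) p, (x(i := a)) q)) \<in> borel_measurable M"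
proof (rule measurable_compose[OF measurable_Pair assms(3)])
  show "(\<lambda>a. (x(i := a)) p) \<in> M \<rightarrow>\<^sub>M M" using assms(1) by (cases "i = p") auto
  show "(\<lambda>a. (x(i := a)) q) \<in> M \<rightarrow>\<^sub>M M" using assms(2) by (cases "i = q") auto
qed

text \<open>With all points except \<open>x i\<close> and \<open>x j\<close> fixed, no remaining
  factor contains both of them, because \<open>(i, j)\<close> is missing from \<open>E\<close> and
  \<open>pairs k\<close> lists every pair once. So the integrand is \<open>B (a, b)\<close> times a
  function of \<open>a\<close>, a function of \<open>b\<close> and a constant, as in
  \<open>cut_weighted\<close>.\<close>

lemma hybrid_bound:
  fixes B :: "'a \<times> 'a \<Rightarrow> real" and c :: "nat \<times> nat \<Rightarrow> 'a \<times> 'a \<Rightarrow> real"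
  assumes B[measurable]: "B \<in> borel_measurable (M \<Otimes>\<^sub>M M)"
    and B1: "\<And>z. z \<in> space (M \<Otimes>\<^sub>M M) \<Longrightarrow> \<bar>B z\<bar> \<le> 1"
    and c[measurable]: "\<And>e. c e \<in> borel_measurable (M \<Otimes>\<^sub>M M)"
    and c01: "\<And>e z. z \<in> space (M \<Otimes>\<^sub>M M) \<Longrightarrow> 0 \<le> c e z \<and> c e z \<le> 1"
    and cut: "\<And>S T. S \<in> sets M \<Longrightarrow> T \<in> sets M \<Longrightarrow>
        \<bar>\<integral>z. indicator (S \<times> T) z * B z \<partial>(M \<Otimes>\<^sub>M M)\<bar> \<le> \<epsilon>"
    and ij: "(i, j) \<in> pairs k" and E: "E \<subseteq> pairs k - {(i, j)}"
  shows "\<bar>\<integral>x. B (x i, x j) * (\<Prod>e\<in>E. c e (x (fst e), x (snd e))) \<partial>(\<Pi>\<^sub>M i\<in>{..<k}. M)\<bar> \<le> \<epsilon>"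
proof -
  interpret P: product_prob_space "\<lambda>_. M" "UNIV :: nat set" ..
  interpret MM: pair_prob_space M M ..
  define R where "R = {..<k} - {i, j}"
  have ne: "i \<noteq> j" and I: "{..<k} = insert i (insert j R)" and iR: "i \<notin> insert j R" and jR: "j \<notin> R" and fR: "finite R"
    using ij by (auto simp: pairs_def R_def)
  have finE: "finite E" using E finite_subset[OF E] by auto
  have eps: "0 \<le> \<epsilon>" using cut[of "{}" "{}"] by simp
  define \<Phi> where "\<Phi> x = B (x i, x j) * (\<Prod>e\<in>E. c e (x (fst e), x (snd e)))" for x :: "nat \<Rightarrow> 'a"
  have epq: "fst e \<in> insert i (insert j R)" "snd e \<in> insert i (insert j R)" if "e \<in> E" for e
    unfolding I[symmetric] using that E by (auto simp: pairs_def)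
  have \<Phi>m[measurable]: "\<Phi> \<in> borel_measurable (\<Pi>\<^sub>M i\<in>insert i (insert j R). M)"
    unfolding \<Phi>_def
    by (intro borel_measurable_times borel_measurable_prod measurable_eval_pair epq) (auto intro: B c)
  have \<Phi>1: "\<bar>\<Phi> x\<bar> \<le> 1" if "\<And>p. p \<in> insert i (insert j R) \<Longrightarrow> x p \<in> space M" for x
  proof -
    have "0 \<le> (\<Prod>e\<in>E. c e (x (fst e), x (snd e))) \<and> (\<Prod>e\<in>E. c e (x (fst e), x (snd e))) \<le> 1"
      using that epq c01 by (intro conjI prod_nonneg prod_le_1) (auto simp: space_pair_measure)
    moreover have "\<bar>B (x i, x j)\<bar> \<le> 1" using that by (intro B1) (auto simp: space_pair_measure)
    ultimately show ?thesis unfolding \<Phi>_def by (auto simp: abs_mult intro!: mult_le_one)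
  qed
  have PI: "prob_space (\<Pi>\<^sub>M i\<in>J. M)" for J :: "nat set" by (intro prob_space_PiM) (rule prob_space_axioms)
  interpret P1: prob_space "\<Pi>\<^sub>M i\<in>insert i (insert j R). M" by (rule PI)
  interpret P2: prob_space "\<Pi>\<^sub>M i\<in>insert j R. M" by (rule PI)
  interpret P3: prob_space "\<Pi>\<^sub>M i\<in>R. M" by (rule PI)
  have i1: "integrable (\<Pi>\<^sub>M i\<in>insert i (insert j R). M) \<Phi>"
    by (rule P1.integrable_bounded[of _ 1]) (auto simp: space_PiM PiE_def intro!: \<Phi>1)
  have "(\<integral>x. \<Phi> x \<partial>(\<Pi>\<^sub>M i\<in>{..<k}. M)) = (\<integral>x. (\<integral>a. \<Phi> (x(i := a)) \<partial>M) \<partial>(\<Pi>\<^sub>M i\<in>insert j R. M))"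
    unfolding I using fR iR by (intro P.product_integral_insert i1) auto
  also have "\<dots> = (\<integral>x. (\<integral>b. (\<integral>a. \<Phi> (x(j := b, i := a)) \<partial>M) \<partial>M) \<partial>(\<Pi>\<^sub>M i\<in>R. M))"
  proof (intro P.product_integral_insert fR jR P2.integrable_bounded[of _ 1])
    have "(\<lambda>(x, a). x(i := a)) \<in> (\<Pi>\<^sub>M i\<in>insert j R. M) \<Otimes>\<^sub>M M \<rightarrow>\<^sub>M (\<Pi>\<^sub>M i\<in>insert i (insert j R). M)"
      by (rule measurable_add_dim)
    from measurable_compose[OF this \<Phi>m]
    have "(\<lambda>(x, a). \<Phi> (x(i := a))) \<in> borel_measurable ((\<Pi>\<^sub>M i\<in>insert j R. M) \<Otimes>\<^sub>M M)"
      by (simp add: case_prod_beta)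
    then show "(\<lambda>x. \<integral>a. \<Phi> (x(i := a)) \<partial>M) \<in> borel_measurable (\<Pi>\<^sub>M i\<in>insert j R. M)"
      by (rule borel_measurable_lebesgue_integral)
    fix x assume "x \<in> space (\<Pi>\<^sub>M i\<in>insert j R. M)"
    then show "\<bar>\<integral>a. \<Phi> (x(i := a)) \<partial>M\<bar> \<le> 1"
      by (intro abs_integral_bound \<Phi>1) (auto simp: space_PiM PiE_def)
  qed
  also have "\<bar>\<dots>\<bar> \<le> \<epsilon>"
  proof (rule P3.abs_integral_bound[OF _ eps])
    fix x assume "x \<in> space (\<Pi>\<^sub>M i\<in>R. M)"
    then have xs: "x p \<in> space M" if "p \<in> R" for p using that by (auto simp: space_PiM)
    define Ei where "Ei = {e\<in>E. fst e = i \<or> snd e = i}"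
    define Ej where "Ej = {e\<in>E. fst e = j \<or> snd e = j}"
    define E0 where "E0 = E - Ei - Ej"
    have E_eq: "E = Ei \<union> Ej \<union> E0" "Ei \<inter> Ej = {}" "(Ei \<union> Ej) \<inter> E0 = {}"
      using E ij by (auto simp: Ei_def Ej_def E0_def pairs_def)
    have fins: "finite Ei" "finite Ej" "finite E0" using finE by (auto simp: Ei_def Ej_def E0_def)
    define f where "f a = (\<Prod>e\<in>Ei. c e ((x(i := a)) (fst e), (x(i := a)) (snd e)))" for a
    define g where "g b = (\<Prod>e\<in>Ej. c e ((x(j := b)) (fst e), (x(j := b)) (snd e)))" for b
    define c0 where "c0 = (\<Prod>e\<in>E0. c e (x (fst e), x (snd e)))"
    have Eie: "i \<noteq> fst e \<Longrightarrow> fst e \<in> R" "i \<noteq> snd e \<Longrightarrow> snd e \<in> R" if "e \<in> Ei" for e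
      using that epq[of e] E_eq ij E unfolding Ei_def Ej_def pairs_def by auto
    have Eje: "j \<noteq> fst e \<Longrightarrow> fst e \<in> R" "j \<noteq> snd e \<Longrightarrow> snd e \<in> R" if "e \<in> Ej" for e
      using that epq[of e] E_eq ij E unfolding Ei_def Ej_def pairs_def by auto
    have E0e: "fst e \<in> R" "snd e \<in> R" if "e \<in> E0" for e
      using that epq[of e] unfolding E0_def Ei_def Ej_def by auto
    have fm: "f \<in> borel_measurable M"
      unfolding f_def using Eie xs by (intro borel_measurable_prod measurable_upd_pair c) auto
    have gm: "g \<in> borel_measurable M"
      unfolding g_def using Eje xs by (intro borel_measurable_prod measurable_upd_pair c) auto
    have f01: "0 \<le> f a \<and> f a \<le> 1" if "a \<in> space M" for a
      unfolding f_def using Eie xs that c01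
      by (intro conjI prod_nonneg prod_le_1 ballI) (auto simp: space_pair_measure)
    have g01: "0 \<le> g a \<and> g a \<le> 1" if "a \<in> space M" for a
      unfolding g_def using Eje xs that c01
      by (intro conjI prod_nonneg prod_le_1 ballI) (auto simp: space_pair_measure)
    have c01': "0 \<le> c0 \<and> c0 \<le> 1"
      unfolding c0_def using E0e xs c01
      by (intro conjI prod_nonneg prod_le_1 ballI) (auto simp: space_pair_measure)
    have \<Phi>_eq: "\<Phi> (x(j := b, i := a)) = c0 * (B (a, b) * f a * g b)" for a b
    proof -
      let ?y = "x(j := b, i := a)"
      have "(\<Prod>e\<in>E. c e (?y (fst e), ?y (snd e))) =
         (\<Prod>e\<in>Ei. c e (?y (fst e), ?y (snd e))) * (\<Prod>e\<in>Ej. c e (?y (fst e), ?y (snd e)))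
          * (\<Prod>e\<in>E0. c e (?y (fst e), ?y (snd e)))"
        by (subst E_eq(1)) (simp add: prod.union_disjoint fins E_eq)
      also have "(\<Prod>e\<in>Ei. c e (?y (fst e), ?y (snd e))) = f a"
        unfolding f_def using E_eq(2) by (intro prod.cong) (auto simp: Ei_def Ej_def)
      also have "(\<Prod>e\<in>Ej. c e (?y (fst e), ?y (snd e))) = g b"
        unfolding g_def using E_eq(2) by (intro prod.cong) (auto simp: Ei_def Ej_def)
      also have "(\<Prod>e\<in>E0. c e (?y (fst e), ?y (snd e))) = c0"
        unfolding c0_def by (intro prod.cong) (auto simp: E0_def Ei_def Ej_def)
      finally have "(\<Prod>e\<in>E. c e (?y (fst e), ?y (snd e))) = f a * g b * c0" .
      moreover have "?y i = a" "?y j = b" using ne by auto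
      ultimately show ?thesis unfolding \<Phi>_def by (simp only: mult_ac)
    qed
    have int: "integrable (M \<Otimes>\<^sub>M M) (\<lambda>z. B z * f (fst z) * g (snd z))"
    proof (rule MM.P.integrable_bounded[of _ 1])
      show "(\<lambda>z. B z * f (fst z) * g (snd z)) \<in> borel_measurable (M \<Otimes>\<^sub>M M)"
        using fm gm by measurable
      fix z assume z: "z \<in> space (M \<Otimes>\<^sub>M M)"
      then show "\<bar>B z * f (fst z) * g (snd z)\<bar> \<le> 1"
        using B1[OF z] f01[of "fst z"] g01[of "snd z"]
        by (auto simp: abs_mult space_pair_measure intro!: mult_le_one)
    qed
    have "(\<integral>b. (\<integral>a. B (a, b) * f a * g b \<partial>M) \<partial>M) = (\<integral>z. B z * f (fst z) * g (snd z) \<partial>(M \<Otimes>\<^sub>M M))"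
      using MM.integral_snd[of "\<lambda>a b. B (a, b) * f a * g b"] int
      by (simp only: case_prod_unfold prod.collapse)
    then have "(\<integral>b. (\<integral>a. \<Phi> (x(j := b, i := a)) \<partial>M) \<partial>M) = c0 * (\<integral>z. B z * f (fst z) * g (snd z) \<partial>(M \<Otimes>\<^sub>M M))"
      by (simp only: \<Phi>_eq integral_mult_right_zero)
    moreover have "\<bar>\<integral>z. B z * f (fst z) * g (snd z) \<partial>(M \<Otimes>\<^sub>M M)\<bar> \<le> \<epsilon>"
      by (rule cut_weighted[OF B B1 fm f01 gm g01 cut])
    ultimately show "\<bar>\<integral>b. (\<integral>a. \<Phi> (x(j := b, i := a)) \<partial>M) \<partial>M\<bar> \<le> \<epsilon>"
      using c01' mult_mono[of "\<bar>c0\<bar>" 1 "\<bar>\<integral>z. B z * f (fst z) * g (snd z) \<partial>(M \<Otimes>\<^sub>M M)\<bar>" \<epsilon>]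
      by (simp only: abs_mult) auto
  qed
  finally show ?thesis unfolding \<Phi>_def .
qed

text \<open>Hybrid argument: \<open>W\<close> is replaced by \<open>U\<close> at one pair after
  another. The integrand is affine with slope 1 or -1 in the factor of that pair, so
  \<open>hybrid_bound\<close> limits the cost of each exchange to \<epsilon>.\<close>

lemma tdens_cut_close:
  fixes U W :: "'a \<times> 'a \<Rightarrow> real"
  assumes U[measurable]: "U \<in> borel_measurable (M \<Otimes>\<^sub>M M)" and U01: "\<And>z. z \<in> space (M \<Otimes>\<^sub>M M) \<Longrightarrow> 0 \<le> U z \<and> U z \<le> 1"
    and W[measurable]: "W \<in> borel_measurable (M \<Otimes>\<^sub>M M)" and W01: "\<And>z. z \<in> space (M \<Otimes>\<^sub>M M) \<Longrightarrow> 0 \<le> W z \<and> W z \<le> 1"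
    and cut: "cut_close M U W \<epsilon>"
  shows "\<bar>tdens M k D U - tdens M k D W\<bar> \<le> real (k\<^sup>2) * \<epsilon>"
proof -
  have eps: "0 \<le> \<epsilon>" using cut by (auto simp: cut_close_def dest!: bspec[of _ _ "{}"])
  define c where "c E e = (\<lambda>z. pat D e (if e \<in> E then U z else W z))" for E e
  define H where "H E = (\<integral>x. (\<Prod>e\<in>pairs k. c E e (x (fst e), x (snd e))) \<partial>(\<Pi>\<^sub>M i\<in>{..<k}. M))" for E
  have cm: "c E e \<in> borel_measurable (M \<Otimes>\<^sub>M M)" for E e
    unfolding c_def pat_def by measurable
  have c01: "0 \<le> c E e z \<and> c E e z \<le> 1" if "z \<in> space (M \<Otimes>\<^sub>M M)" for E e z
    unfolding c_def using U01[OF that] W01[OF that] by (auto intro!: pat_bounds)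
  interpret P: prob_space "\<Pi>\<^sub>M i\<in>{..<k}. M" by (intro prob_space_PiM) (rule prob_space_axioms)
  have int: "integrable (\<Pi>\<^sub>M i\<in>{..<k}. M) (\<lambda>x. \<Prod>e\<in>pairs k. c E e (x (fst e), x (snd e)))" for E
  proof (rule P.integrable_bounded[of _ 1])
    show "(\<lambda>x. \<Prod>e\<in>pairs k. c E e (x (fst e), x (snd e))) \<in> borel_measurable (\<Pi>\<^sub>M i\<in>{..<k}. M)"
      by (intro borel_measurable_prod measurable_eval_pair cm) (auto simp: pairs_def)
    fix x assume "x \<in> space (\<Pi>\<^sub>M i\<in>{..<k}. M)"
    then have "0 \<le> (\<Prod>e\<in>pairs k. c E e (x (fst e), x (snd e))) \<and> (\<Prod>e\<in>pairs k. c E e (x (fst e), x (snd e))) \<le> 1"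
      using c01 by (intro conjI prod_nonneg prod_le_1 ballI) (auto simp: space_pair_measure space_PiM pairs_def PiE_def Pi_def)
    then show "\<bar>\<Prod>e\<in>pairs k. c E e (x (fst e), x (snd e))\<bar> \<le> 1" by auto
  qed
  have "\<bar>H E - H {}\<bar> \<le> card E * \<epsilon>" if "finite E" "E \<subseteq> pairs k" for E
    using that
  proof (induction E rule: finite_induct)
    case empty
    then show ?case by simp
  next
    case (insert e0 E)
    obtain i j where e0: "e0 = (i, j)" by (cases e0)
    have ij: "(i, j) \<in> pairs k" using insert e0 by simp
    let ?s = "if e0 \<in> D then 1 else - 1 :: real"
    have "H (insert e0 E) - H E = (\<integral>x. (\<Prod>e\<in>pairs k. c (insert e0 E) e (x (fst e), x (snd e)))
        - (\<Prod>e\<in>pairs k. c E e (x (fst e), x (snd e))) \<partial>(\<Pi>\<^sub>M i\<in>{..<k}. M))"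
      unfolding H_def by (rule Bochner_Integration.integral_diff[symmetric]) (rule int)+
    also have "\<dots> = (\<integral>x. ?s * ((U (x i, x j) - W (x i, x j)) * (\<Prod>e\<in>pairs k - {(i, j)}. c E e (x (fst e), x (snd e))))
         \<partial>(\<Pi>\<^sub>M i\<in>{..<k}. M))"
    proof (rule Bochner_Integration.integral_cong[OF refl])
      fix x :: "nat \<Rightarrow> 'a"
      have split: "(\<Prod>e\<in>pairs k. c E' e (x (fst e), x (snd e))) =
          c E' e0 (x i, x j) * (\<Prod>e\<in>pairs k - {(i, j)}. c E' e (x (fst e), x (snd e)))" for E'
        using prod.remove[OF finite_pairs ij, of "\<lambda>e. c E' e (x (fst e), x (snd e))"] e0 by simp
      have same: "(\<Prod>e\<in>pairs k - {(i, j)}. c (insert e0 E) e (x (fst e), x (snd e))) =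
          (\<Prod>e\<in>pairs k - {(i, j)}. c E e (x (fst e), x (snd e)))"
        using e0 by (intro prod.cong) (auto simp: c_def)
      have diff: "c (insert e0 E) e0 z - c E e0 z = ?s * (U z - W z)" for z
        using insert(2) pat_diff[of D e0 "U z" "W z"] by (simp add: c_def)
      show "(\<Prod>e\<in>pairs k. c (insert e0 E) e (x (fst e), x (snd e)))
        - (\<Prod>e\<in>pairs k. c E e (x (fst e), x (snd e))) =
        ?s * ((U (x i, x j) - W (x i, x j)) * (\<Prod>e\<in>pairs k - {(i, j)}. c E e (x (fst e), x (snd e))))"
        unfolding split same left_diff_distrib[symmetric] diff by (simp only: mult.assoc)
    qed
    also have "\<bar>\<dots>\<bar> = \<bar>\<integral>x. (U (x i, x j) - W (x i, x j)) * (\<Prod>e\<in>pairs k - {(i, j)}. c E e (x (fst e), x (snd e)))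
         \<partial>(\<Pi>\<^sub>M i\<in>{..<k}. M)\<bar>"
      by (simp only: integral_mult_right_zero abs_mult) simp
    also have "\<dots> \<le> \<epsilon>"
    proof (rule hybrid_bound[where B = "\<lambda>z. U z - W z" and c = "c E" and E = "pairs k - {(i, j)}", OF _ _ cm c01 _ ij order.refl])
      fix z assume "z \<in> space (M \<Otimes>\<^sub>M M)"
      then show "\<bar>U z - W z\<bar> \<le> 1" using U01[of z] W01[of z] by auto
    qed (use cut in \<open>auto simp: cut_close_def\<close>)
    finally have "\<bar>H (insert e0 E) - H E\<bar> \<le> \<epsilon>" .
    moreover have "\<bar>H E - H {}\<bar> \<le> card E * \<epsilon>" using insert by auto
    ultimately show ?case using insert(1,2) by (simp add: algebra_simps)
  qed
  from this[of "pairs k"] have "\<bar>H (pairs k) - H {}\<bar> \<le> card (pairs k) * \<epsilon>" by simp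
  also have "\<dots> \<le> real (k\<^sup>2) * \<epsilon>"
    using card_pairs_le[of k] eps by (intro mult_right_mono of_nat_mono)
  finally show ?thesis by (simp add: H_def tdens_def c_def)
qed

end

section \<open>Limits of kernels\<close>

context prob_space
begin

text \<open>A Cauchy sequence in L2 has a subsequence that converges almost everywhere. The
  hypothesis \<open>sq\<close> expresses orthogonal increments, as for a martingale, so convergence
  of \<open>e\<close> is the Cauchy property.\<close>

lemma L1_limit:
  fixes w :: "nat \<Rightarrow> 'a \<Rightarrow> real"
  assumes w[measurable]: "\<And>j. w j \<in> borel_measurable M"
    and w01: "\<And>j x. x \<in> space M \<Longrightarrow> 0 \<le> w j x \<and> w j x \<le> 1"
    and sq: "\<And>i j. i \<le> j \<Longrightarrow> (\<integral>x. (w j x - w i x)\<^sup>2 \<partial>M) = e j - e i"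
    and e: "convergent e"
  shows "\<exists>W s. W \<in> borel_measurable M \<and> (\<forall>x\<in>space M. 0 \<le> W x \<and> W x \<le> 1) \<and> strict_mono (s :: nat \<Rightarrow> nat) \<and>
           (\<lambda>i. \<integral>x. \<bar>w (s i) x - W x\<bar> \<partial>M) \<longlonglongrightarrow> 0"
proof -
  \<comment> \<open>\<open>1/16\<close> is the square of \<open>1/4\<close>: squared L2 distances
    below \<open>(1/16)^i\<close> give L1 distances of at most \<open>(1/4)^i\<close>, which are
    summable.\<close>
  have "\<exists>N. \<forall>j\<ge>N. \<forall>k\<ge>N. \<bar>e j - e k\<bar> < (1/16)^i" for i :: nat
    using CauchyD[OF convergent_Cauchy[OF e], of "(1/16)^i"] unfolding real_norm_def by auto
  then have "\<forall>i. \<exists>N. \<forall>j\<ge>N. \<forall>k\<ge>N. \<bar>e j - e k\<bar> < (1/16)^i" by blast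
  from choice[OF this]
  obtain N where N: "\<And>i j k. j \<ge> N i \<Longrightarrow> k \<ge> N i \<Longrightarrow> \<bar>e j - e k\<bar> < (1/16)^i"
    by blast
  \<comment> \<open>The sum makes \<open>s\<close> dominate \<open>N\<close>, the summand
    \<open>i\<close> makes it strictly increasing.\<close>
  define s where "s i = (\<Sum>l\<le>i. N l) + i" for i :: nat
  have s: "strict_mono s" by (rule strict_monoI_Suc) (simp add: s_def)
  have sN: "N i \<le> s i" for i using member_le_sum[of i "{..i}" N] by (simp add: s_def)
  define f where "f i x = \<bar>w (s (Suc i)) x - w (s i) x\<bar>" for i x
  have fm[measurable]: "f i \<in> borel_measurable M" for i unfolding f_def by measurable
  have f1: "0 \<le> f i x \<and> f i x \<le> 1" if "x \<in> space M" for i x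
    unfolding f_def using w01[OF that, of "s i"] w01[OF that, of "s (Suc i)"] by auto
  have fint: "integrable M (f i)" for i by (rule integrable_bounded[of _ 1]) (use f1 in auto)
  have f2int: "integrable M (\<lambda>x. (f i x)\<^sup>2)" for i
    by (rule integrable_bounded[of _ 1]) (use f1 in \<open>auto intro: power_le_one\<close>)
  have "(\<integral>x. f i x \<partial>M) \<le> (1/4)^i" for i
  proof -
    define d where "d = (1/4 :: real)^i"
    have d: "d > 0" by (simp add: d_def)
    have dd: "(1/16)^i = d * d" unfolding d_def power_mult_distrib[symmetric] by simp
    \<comment> \<open>The inequality of arithmetic and geometric means in place of
      Cauchy-Schwarz.\<close>
    have "f i x \<le> (f i x)\<^sup>2 / (2 * d) + d / 2" for x
    proof -
      have "0 \<le> (f i x - d)\<^sup>2 / (2 * d)" using d by simp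
      also have "\<dots> = (f i x)\<^sup>2 / (2 * d) + d / 2 - f i x"
        using d by (simp add: power2_diff add_divide_distrib diff_divide_distrib power2_eq_square[of d])
      finally show ?thesis by simp
    qed
    then have "(\<integral>x. f i x \<partial>M) \<le> (\<integral>x. (f i x)\<^sup>2 / (2 * d) + d / 2 \<partial>M)"
      using fint f2int by (intro integral_mono) auto
    also have "\<dots> = (\<integral>x. (f i x)\<^sup>2 \<partial>M) / (2 * d) + d / 2"
      using f2int by (simp add: prob_space)
    also have "(\<integral>x. (f i x)\<^sup>2 \<partial>M) = e (s (Suc i)) - e (s i)"
      using sq[of "s i" "s (Suc i)"] strict_mono_less_eq[OF s] by (simp add: f_def)
    finally have *: "(\<integral>x. f i x \<partial>M) \<le> (e (s (Suc i)) - e (s i)) / (2 * d) + d / 2" .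
    have "s i \<le> s (Suc i)" using strict_mono_less_eq[OF s, of i "Suc i"] by simp
    then have "e (s (Suc i)) - e (s i) \<le> d * d"
      using N[of i "s (Suc i)" "s i"] sN[of i] unfolding dd[symmetric] by linarith
    then have "(e (s (Suc i)) - e (s i)) / (2 * d) \<le> d * d / (2 * d)"
      using d by (intro divide_right_mono) auto
    also have "\<dots> = d / 2" using d by simp
    finally show ?thesis using * unfolding d_def by linarith
  qed
  then have nn: "(\<integral>\<^sup>+x. f i x \<partial>M) \<le> ennreal ((1/4)^i)" for i
    using f1 by (subst nn_integral_eq_integral[OF fint]) (auto intro: ennreal_leI)
  have "(\<integral>\<^sup>+x. (\<Sum>i. ennreal (f i x)) \<partial>M) = (\<Sum>i. \<integral>\<^sup>+x. f i x \<partial>M)"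
    by (rule nn_integral_suminf) auto
  also have "\<dots> \<le> (\<Sum>i. ennreal ((1/4)^i))" by (intro suminf_le nn) auto
  also have "\<dots> < \<infinity>"
    unfolding infinity_ennreal_def top.not_eq_extremum[symmetric]
    by (rule ennreal_suminf_neq_top[OF summable_geometric]) auto
  finally have "AE x in M. (\<Sum>i. ennreal (f i x)) \<noteq> \<infinity>"
    by (intro nn_integral_noteq_infinite) auto
  then have conv: "AE x in M. convergent (\<lambda>i. w (s i) x)"
  proof eventually_elim
    case (elim x)
    then have "summable (\<lambda>i. f i x)" by (intro summable_suminf_not_top) (auto simp: f_def)
    then have "summable (\<lambda>i. w (s (Suc i)) x - w (s i) x)"
      unfolding f_def by (rule summable_rabs_cancel)
    then have "convergent (\<lambda>n. \<Sum>i<n. w (s (Suc i)) x - w (s i) x)" by (simp add: summable_iff_convergent)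
    then have "convergent (\<lambda>n. w (s n) x - w (s 0) x)" using sum_lessThan_telescope[of "\<lambda>n. w (s n) x"] by simp
    then have "convergent (\<lambda>n. (w (s n) x - w (s 0) x) + w (s 0) x)"
      by (rule convergent_add) (rule convergent_const)
    then show ?case by simp
  qed
  \<comment> \<open>\<open>lim\<close> is unspecified where the sequence diverges; clipping keeps
    \<open>W\<close> in the unit interval there too.\<close>
  define W where "W x = max 0 (min 1 (lim (\<lambda>i. w (s i) x)))" for x
  have Wm[measurable]: "W \<in> borel_measurable M" unfolding W_def by measurable
  have W01: "0 \<le> W x \<and> W x \<le> 1" for x by (auto simp: W_def)
  have "(\<lambda>i. \<integral>x. \<bar>w (s i) x - W x\<bar> \<partial>M) \<longlonglongrightarrow> (\<integral>x. 0 \<partial>M)"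
  proof (rule integral_dominated_convergence[where w = "\<lambda>_. 1"])
    show "AE x in M. (\<lambda>i. \<bar>w (s i) x - W x\<bar>) \<longlonglongrightarrow> 0"
      using conv AE_space
    proof eventually_elim
      case (elim x)
      then obtain l where l: "(\<lambda>i. w (s i) x) \<longlonglongrightarrow> l" by (auto simp: convergent_def)
      have "0 \<le> l" "l \<le> 1"
        using LIMSEQ_le_const[OF l, of 0] LIMSEQ_le_const2[OF l, of 1] w01[OF elim(2)] by blast+
      then have "W x = l" using limI[OF l] by (simp add: W_def)
      then show ?case using l by (simp add: LIM_zero_iff tendsto_rabs_zero)
    qed
    show "AE x in M. norm \<bar>w (s i) x - W x\<bar> \<le> 1" for i
    proof (rule AE_I2)
      fix x assume "x \<in> space M"
      then show "norm \<bar>w (s i) x - W x\<bar> \<le> 1" using w01[of x "s i"] W01[of x] by auto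
    qed
  qed auto
  then show ?thesis using s W01 Wm by (intro exI[of _ W] exI[of _ s]) auto
qed

text \<open>\<open>V j m\<close> is a step approximation of \<open>U m\<close> at level
  \<open>j\<close> with cut error \<open>\<gamma> j m\<close>. For fixed \<open>j\<close> these
  converge to \<open>w j\<close>, and by the energies the \<open>w j\<close> converge in L1 along a
  subsequence. Given \<delta>, the level is chosen first and then \<open>m\<close> large for this
  level.\<close>

lemma cut_limit:
  fixes U :: "nat \<Rightarrow> 'a \<times> 'a \<Rightarrow> real" and V :: "nat \<Rightarrow> nat \<Rightarrow> 'a \<times> 'a \<Rightarrow> real" and w :: "nat \<Rightarrow> 'a \<times> 'a \<Rightarrow> real"
  assumes U[measurable]: "\<And>m. U m \<in> borel_measurable (M \<Otimes>\<^sub>M M)"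
    and U01: "\<And>m z. z \<in> space (M \<Otimes>\<^sub>M M) \<Longrightarrow> 0 \<le> U m z \<and> U m z \<le> 1"
    and V[measurable]: "\<And>j m. V j m \<in> borel_measurable (M \<Otimes>\<^sub>M M)"
    and V01: "\<And>j m z. z \<in> space (M \<Otimes>\<^sub>M M) \<Longrightarrow> 0 \<le> V j m z \<and> V j m z \<le> 1"
    and w[measurable]: "\<And>j. w j \<in> borel_measurable (M \<Otimes>\<^sub>M M)"
    and w01: "\<And>j z. z \<in> space (M \<Otimes>\<^sub>M M) \<Longrightarrow> 0 \<le> w j z \<and> w j z \<le> 1"
    and lim: "\<And>j. AE z in M \<Otimes>\<^sub>M M. (\<lambda>m. V j m z) \<longlonglongrightarrow> w j z"
    and cut: "\<And>j m. cut_close M (U m) (V j m) (\<gamma> j m)"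
    and \<gamma>: "\<And>j. (\<lambda>m. \<gamma> j m) \<longlonglongrightarrow> g j" and g: "g \<longlonglongrightarrow> 0"
    and en: "\<And>i j m. i \<le> j \<Longrightarrow> (\<integral>z. (V j m z - V i m z)\<^sup>2 \<partial>(M \<Otimes>\<^sub>M M)) = E j m - E i m"
    and E: "\<And>j. (\<lambda>m. E j m) \<longlonglongrightarrow> e j" and E01: "\<And>j m. 0 \<le> E j m \<and> E j m \<le> 1"
  shows "\<exists>W. W \<in> borel_measurable (M \<Otimes>\<^sub>M M) \<and> (\<forall>z\<in>space (M \<Otimes>\<^sub>M M). 0 \<le> W z \<and> W z \<le> 1) \<and>
           (\<forall>\<delta>>0. \<exists>N. \<forall>m\<ge>N. cut_close M (U m) W \<delta>)"
proof -
  interpret MM: pair_prob_space M M ..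
  have sq: "(\<integral>z. (w j z - w i z)\<^sup>2 \<partial>(M \<Otimes>\<^sub>M M)) = e j - e i" if "i \<le> j" for i j
  proof (rule LIMSEQ_unique)
    show "(\<lambda>m. \<integral>z. (V j m z - V i m z)\<^sup>2 \<partial>(M \<Otimes>\<^sub>M M)) \<longlonglongrightarrow> (\<integral>z. (w j z - w i z)\<^sup>2 \<partial>(M \<Otimes>\<^sub>M M))"
    proof (rule integral_dominated_convergence[where w = "\<lambda>_. 1"])
      show "AE z in M \<Otimes>\<^sub>M M. (\<lambda>m. (V j m z - V i m z)\<^sup>2) \<longlonglongrightarrow> (w j z - w i z)\<^sup>2"
        using lim[of i] lim[of j] by eventually_elim (intro tendsto_intros)
      show "AE z in M \<Otimes>\<^sub>M M. norm ((V j m z - V i m z)\<^sup>2) \<le> 1" for m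
      proof (rule AE_I2)
        fix z assume "z \<in> space (M \<Otimes>\<^sub>M M)"
        then show "norm ((V j m z - V i m z)\<^sup>2) \<le> 1" using V01[of z i m] V01[of z j m]
          by (auto simp: abs_square_le_1)
      qed
    qed auto
    show "(\<lambda>m. \<integral>z. (V j m z - V i m z)\<^sup>2 \<partial>(M \<Otimes>\<^sub>M M)) \<longlonglongrightarrow> e j - e i"
      unfolding en[OF that] by (intro tendsto_diff E)
  qed
  have "convergent e"
  proof (rule Bseq_mono_convergent)
    have "\<bar>e j\<bar> \<le> 1" for j
      using LIMSEQ_le_const[OF E[of j], of 0] LIMSEQ_le_const2[OF E[of j], of 1] E01 by auto
    then show "Bseq e" by (intro BseqI'[of _ 1]) auto
    show "\<forall>m n. m \<le> n \<longrightarrow> e m \<le> e n"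
    proof (intro allI impI)
      fix i j :: nat assume "i \<le> j"
      have "0 \<le> (\<integral>z. (w j z - w i z)\<^sup>2 \<partial>(M \<Otimes>\<^sub>M M))" by (rule Bochner_Integration.integral_nonneg) auto
      then show "e i \<le> e j" using sq[OF \<open>i \<le> j\<close>] by simp
    qed
  qed
  from MM.P.L1_limit[OF w w01 sq this]
  obtain W s where Wm[measurable]: "W \<in> borel_measurable (M \<Otimes>\<^sub>M M)"
    and W01: "\<And>z. z\<in>space (M \<Otimes>\<^sub>M M) \<Longrightarrow> 0 \<le> W z \<and> W z \<le> 1"
    and s: "strict_mono (s :: nat \<Rightarrow> nat)"
    and Ws: "(\<lambda>i. \<integral>x. \<bar>w (s i) x - W x\<bar> \<partial>(M \<Otimes>\<^sub>M M)) \<longlonglongrightarrow> 0" by auto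
  have VL1: "(\<lambda>m. \<integral>z. \<bar>V j m z - w j z\<bar> \<partial>(M \<Otimes>\<^sub>M M)) \<longlonglongrightarrow> (\<integral>z. 0 \<partial>(M \<Otimes>\<^sub>M M))" for j
  proof (rule integral_dominated_convergence[where w = "\<lambda>_. 1"])
    show "AE z in M \<Otimes>\<^sub>M M. (\<lambda>m. \<bar>V j m z - w j z\<bar>) \<longlonglongrightarrow> 0"
      using lim[of j] by eventually_elim (simp add: LIM_zero_iff tendsto_rabs_zero)
    show "AE z in M \<Otimes>\<^sub>M M. norm \<bar>V j m z - w j z\<bar> \<le> 1" for m
    proof (rule AE_I2)
      fix z assume "z \<in> space (M \<Otimes>\<^sub>M M)"
      then show "norm \<bar>V j m z - w j z\<bar> \<le> 1" using V01[of z j m] w01[of z j] by auto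
    qed
  qed auto
  have "\<exists>N. \<forall>m\<ge>N. cut_close M (U m) W \<delta>" if "\<delta> > 0" for \<delta>
  proof -
    have "(\<lambda>i. g (s i)) \<longlonglongrightarrow> 0" using LIMSEQ_subseq_LIMSEQ[OF g s] by (simp add: o_def)
    then have "\<forall>\<^sub>F i in sequentially. g (s i) < \<delta> / 4"
      using that by (intro order_tendstoD) auto
    moreover have "\<forall>\<^sub>F i in sequentially. (\<integral>x. \<bar>w (s i) x - W x\<bar> \<partial>(M \<Otimes>\<^sub>M M)) < \<delta> / 4"
      using that by (intro order_tendstoD(2)[OF Ws]) auto
    ultimately have "\<forall>\<^sub>F i in sequentially. g (s i) < \<delta> / 4 \<and> (\<integral>x. \<bar>w (s i) x - W x\<bar> \<partial>(M \<Otimes>\<^sub>M M)) < \<delta> / 4"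
      by (rule eventually_conj)
    then obtain i where i: "g (s i) < \<delta> / 4" "(\<integral>x. \<bar>w (s i) x - W x\<bar> \<partial>(M \<Otimes>\<^sub>M M)) < \<delta> / 4"
      by (auto simp: eventually_sequentially)
    define j where "j = s i"
    have "\<forall>\<^sub>F m in sequentially. \<gamma> j m < \<delta> / 4"
      using i by (intro order_tendstoD(2)[OF \<gamma>]) (simp add: j_def)
    moreover have "\<forall>\<^sub>F m in sequentially. (\<integral>z. \<bar>V j m z - w j z\<bar> \<partial>(M \<Otimes>\<^sub>M M)) < \<delta> / 4"
      using that by (intro order_tendstoD(2)[OF VL1]) simp
    ultimately have "\<forall>\<^sub>F m in sequentially. cut_close M (U m) W \<delta>"
    proof eventually_elim
      case (elim m)
      show ?case unfolding cut_close_def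
      proof (intro ballI)
        fix S T assume ST[measurable]: "S \<in> sets M" "T \<in> sets M"
        let ?I = "\<lambda>f. \<integral>z. indicator (S \<times> T) z * f z \<partial>(M \<Otimes>\<^sub>M M)"
        have int: "integrable (M \<Otimes>\<^sub>M M) (\<lambda>z. indicator (S \<times> T) z * (f z - h z))"
          if "f \<in> borel_measurable (M \<Otimes>\<^sub>M M)" "h \<in> borel_measurable (M \<Otimes>\<^sub>M M)"
             "\<And>z. z\<in>space (M \<Otimes>\<^sub>M M) \<Longrightarrow> 0 \<le> f z \<and> f z \<le> 1" "\<And>z. z\<in>space (M \<Otimes>\<^sub>M M) \<Longrightarrow> 0 \<le> h z \<and> h z \<le> 1"
           for f h :: "'a \<times> 'a \<Rightarrow> real"
        proof (rule MM.P.integrable_bounded[of _ 1])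
          show "(\<lambda>z. indicator (S \<times> T) z * (f z - h z)) \<in> borel_measurable (M \<Otimes>\<^sub>M M)"
            using that by measurable
          fix z assume "z \<in> space (M \<Otimes>\<^sub>M M)"
          then show "\<bar>indicator (S \<times> T) z * (f z - h z)\<bar> \<le> 1"
            using that(3,4)[of z] by (auto simp: indicator_def)
        qed
        have L1: "\<bar>?I (\<lambda>z. f z - h z)\<bar> \<le> (\<integral>z. \<bar>f z - h z\<bar> \<partial>(M \<Otimes>\<^sub>M M))"
          if "f \<in> borel_measurable (M \<Otimes>\<^sub>M M)" "h \<in> borel_measurable (M \<Otimes>\<^sub>M M)"
             "\<And>z. z\<in>space (M \<Otimes>\<^sub>M M) \<Longrightarrow> 0 \<le> f z \<and> f z \<le> 1" "\<And>z. z\<in>space (M \<Otimes>\<^sub>M M) \<Longrightarrow> 0 \<le> h z \<and> h z \<le> 1"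
           for f h :: "'a \<times> 'a \<Rightarrow> real"
        proof -
          have "\<bar>?I (\<lambda>z. f z - h z)\<bar> \<le> (\<integral>z. \<bar>indicator (S \<times> T) z * (f z - h z)\<bar> \<partial>(M \<Otimes>\<^sub>M M))"
            by (rule integral_abs_bound)
          also have "\<dots> \<le> (\<integral>z. \<bar>f z - h z\<bar> \<partial>(M \<Otimes>\<^sub>M M))"
          proof (rule integral_mono)
            show "integrable (M \<Otimes>\<^sub>M M) (\<lambda>z. \<bar>f z - h z\<bar>)"
            proof (rule MM.P.integrable_bounded[of _ 1])
              show "(\<lambda>z. \<bar>f z - h z\<bar>) \<in> borel_measurable (M \<Otimes>\<^sub>M M)" using that by measurable
              fix z assume "z \<in> space (M \<Otimes>\<^sub>M M)"
              then show "\<bar>\<bar>f z - h z\<bar>\<bar> \<le> 1" using that(3,4)[of z] by auto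
            qed
          qed (use int[OF that] in \<open>auto simp: indicator_def\<close>)
          finally show ?thesis .
        qed
        have i1: "integrable (M \<Otimes>\<^sub>M M) (\<lambda>z. indicator (S \<times> T) z * (U m z - V j m z))"
          by (rule int) (simp_all add: U01 V01)
        have i2: "integrable (M \<Otimes>\<^sub>M M) (\<lambda>z. indicator (S \<times> T) z * (V j m z - w j z))"
          by (rule int) (simp_all add: w01 V01)
        have i3: "integrable (M \<Otimes>\<^sub>M M) (\<lambda>z. indicator (S \<times> T) z * (w j z - W z))"
          by (rule int) (simp_all add: w01 W01)
        have "?I (\<lambda>z. U m z - W z) = (\<integral>z. indicator (S \<times> T) z * (U m z - V j m z) +
            indicator (S \<times> T) z * (V j m z - w j z) + indicator (S \<times> T) z * (w j z - W z) \<partial>(M \<Otimes>\<^sub>M M))"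
          by (intro Bochner_Integration.integral_cong refl) (simp add: indicator_def)
        also have "\<dots> = ?I (\<lambda>z. U m z - V j m z) + ?I (\<lambda>z. V j m z - w j z) + ?I (\<lambda>z. w j z - W z)"
          unfolding Bochner_Integration.integral_add[OF Bochner_Integration.integrable_add[OF i1 i2] i3]
            Bochner_Integration.integral_add[OF i1 i2] ..
        finally have "?I (\<lambda>z. U m z - W z) = ?I (\<lambda>z. U m z - V j m z) + ?I (\<lambda>z. V j m z - w j z) + ?I (\<lambda>z. w j z - W z)" .
        moreover have "\<bar>?I (\<lambda>z. U m z - V j m z)\<bar> \<le> \<gamma> j m"
          using cut[of m j] ST by (auto simp: cut_close_def)
        moreover have "\<bar>?I (\<lambda>z. V j m z - w j z)\<bar> \<le> (\<integral>z. \<bar>V j m z - w j z\<bar> \<partial>(M \<Otimes>\<^sub>M M))"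
          by (rule L1) (simp_all add: V01 w01)
        moreover have "\<bar>?I (\<lambda>z. w j z - W z)\<bar> \<le> (\<integral>z. \<bar>w j z - W z\<bar> \<partial>(M \<Otimes>\<^sub>M M))"
          by (rule L1) (simp_all add: W01 w01)
        ultimately show "\<bar>?I (\<lambda>z. U m z - W z)\<bar> \<le> \<delta>" using elim i unfolding j_def by linarith
      qed
    qed
    then show ?thesis by (simp add: eventually_sequentially)
  qed
  then show ?thesis using Wm W01 by blast
qed

text \<open>Cut closeness gives the claim for rectangles, which generate the product sets and are
  closed under intersection; complements and disjoint unions follow. There is no rate uniform in
  \<open>Z\<close>.\<close>

lemma cut_close_weak_star:
  fixes U :: "nat \<Rightarrow> 'a \<times> 'a \<Rightarrow> real"
  assumes U[measurable]: "\<And>m. U m \<in> borel_measurable (M \<Otimes>\<^sub>M M)"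
    and U01: "\<And>m z. z \<in> space (M \<Otimes>\<^sub>M M) \<Longrightarrow> 0 \<le> U m z \<and> U m z \<le> 1"
    and W[measurable]: "W \<in> borel_measurable (M \<Otimes>\<^sub>M M)"
    and W01: "\<And>z. z \<in> space (M \<Otimes>\<^sub>M M) \<Longrightarrow> 0 \<le> W z \<and> W z \<le> 1"
    and cut: "\<And>\<delta>. \<delta> > 0 \<Longrightarrow> \<exists>N. \<forall>m\<ge>N. cut_close M (U m) W \<delta>"
    and Z: "Z \<in> sets (M \<Otimes>\<^sub>M M)"
  shows "(\<lambda>m. \<integral>z. indicator Z z * (U m z - W z) \<partial>(M \<Otimes>\<^sub>M M)) \<longlonglongrightarrow> 0"
proof -
  interpret MM: pair_prob_space M M ..
  let ?I = "\<lambda>Z m. \<integral>z. indicator Z z * (U m z - W z) \<partial>(M \<Otimes>\<^sub>M M)"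
  have bd: "\<bar>indicator Z z * (U m z - W z)\<bar> \<le> indicator Z z" if "z \<in> space (M \<Otimes>\<^sub>M M)" for Z m z
    using U01[OF that, of m] W01[OF that] by (auto simp: indicator_def)
  have int: "integrable (M \<Otimes>\<^sub>M M) (\<lambda>z. indicator Z z * (U m z - W z))" if "Z \<in> sets (M \<Otimes>\<^sub>M M)" for Z m
  proof (rule MM.P.integrable_bounded[of _ 1])
    show "(\<lambda>z. indicator Z z * (U m z - W z)) \<in> borel_measurable (M \<Otimes>\<^sub>M M)" using that by measurable
    fix z assume z: "z \<in> space (M \<Otimes>\<^sub>M M)"
    show "\<bar>indicator Z z * (U m z - W z)\<bar> \<le> 1"
      using bd[OF z, of Z m] by (rule order_trans) (simp add: indicator_def)
  qed
  have bdI: "\<bar>?I Z m\<bar> \<le> measure (M \<Otimes>\<^sub>M M) Z" if "Z \<in> sets (M \<Otimes>\<^sub>M M)" for Z m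
  proof -
    have "\<bar>?I Z m\<bar> \<le> (\<integral>z. \<bar>indicator Z z * (U m z - W z)\<bar> \<partial>(M \<Otimes>\<^sub>M M))" by (rule integral_abs_bound)
    also have "\<dots> \<le> (\<integral>z. indicator Z z \<partial>(M \<Otimes>\<^sub>M M))"
      using int[OF that] that bd by (intro integral_mono integrable_abs MM.P.integrable_bounded[of "indicator Z" 1]) auto
    finally show ?thesis using that by simp
  qed
  have rect: "?I (S \<times> T) \<longlonglongrightarrow> 0" if "S \<in> sets M" "T \<in> sets M" for S T
  proof (rule LIMSEQ_I)
    fix r :: real assume "0 < r"
    then obtain N where "\<forall>m\<ge>N. cut_close M (U m) W (r/2)" using cut[of "r/2"] by auto
    then show "\<exists>N. \<forall>m\<ge>N. norm (?I (S \<times> T) m - 0) < r"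
      using that \<open>0 < r\<close> by (intro exI[of _ N]) (force simp: cut_close_def)
  qed
  have "Z \<in> sigma_sets (space M \<times> space M) {a \<times> b | a b. a \<in> sets M \<and> b \<in> sets M}"
    using Z by (simp add: sets_pair_measure)
  then show ?thesis
  proof (induct rule: sigma_sets_induct_disjoint[OF Int_stable_pair_measure_generator pair_measure_closed, consumes 1, case_names basic empty compl union])
    case (basic A)
    then show ?case using rect by auto
  next
    case empty
    then show ?case by simp
  next
    case (compl A)
    then have A: "A \<in> sets (M \<Otimes>\<^sub>M M)" by (simp add: sets_pair_measure)
    have "?I (space M \<times> space M - A) m = ?I (space M \<times> space M) m - ?I A m" for m
    proof -
      have "?I (space M \<times> space M) m - ?I A m =
          (\<integral>z. indicator (space M \<times> space M) z * (U m z - W z) - indicator A z * (U m z - W z) \<partial>(M \<Otimes>\<^sub>M M))"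
        using int[of "space M \<times> space M" m] int[OF A, of m]
        by (intro Bochner_Integration.integral_diff[symmetric]) auto
      also have "\<dots> = ?I (space M \<times> space M - A) m"
        using sets.sets_into_space[OF A]
        by (intro Bochner_Integration.integral_cong) (auto simp: indicator_def space_pair_measure)
      finally show ?thesis by simp
    qed
    then show ?case using tendsto_diff[OF rect[of "space M" "space M"] compl(2)] by simp
  next
    case (union A)
    have A: "A i \<in> sets (M \<Otimes>\<^sub>M M)" for i using union(2) by (auto simp: sets_pair_measure)
    have sm: "(\<lambda>i. measure (M \<Otimes>\<^sub>M M) (A i)) sums measure (M \<Otimes>\<^sub>M M) (\<Union>i. A i)"
      using A union(1) by (intro MM.P.finite_measure_UNION) auto
    have UA: "(\<Union>i. A i) \<in> sets (M \<Otimes>\<^sub>M M)" using A by auto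
    have eq: "?I (\<Union>i. A i) m = (\<Sum>i. ?I (A i) m)" for m
      using lebesgue_integral_countable_add[of A "M \<Otimes>\<^sub>M M" "\<lambda>z. U m z - W z"] A union(1) int[OF UA, of m]
      by (simp add: set_lebesgue_integral_def set_integrable_def disjoint_family_on_def)
    \<comment> \<open>Tannery's theorem: the term of \<open>A k\<close> is bounded by the measure of
      \<open>A k\<close> for all \<open>m\<close>, and these measures are summable.\<close>
    have "(\<lambda>m. \<Sum>i. ?I (A i) m) \<longlonglongrightarrow> (\<Sum>i. 0)"
    proof (rule tannerys_theorem[THEN conjunct2, THEN conjunct2])
      show "\<forall>\<^sub>F (k, n) in sequentially \<times>\<^sub>F sequentially. norm (?I (A k) n) \<le> measure (M \<Otimes>\<^sub>M M) (A k)"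
        using bdI[OF A] by (intro always_eventually) auto
    qed (use sums_summable[OF sm] union(3) in auto)
    then show ?case unfolding eq by simp
  qed
qed

end

section \<open>Removing patterns of limit density zero\<close>

text \<open>Domination of the factors passes to the product, one coordinate at a time. This
  transports null sets from independent points in the whole space to points placed in prescribed
  cells.\<close>

lemma nn_integral_PiM_dominated:
  assumes N: "\<And>i :: nat. prob_space (N i)" and M: "\<And>i. prob_space (M i)" and s: "\<And>i. sets (N i) = sets (M i)"
    and dom: "\<And>i f. f \<in> borel_measurable (M i) \<Longrightarrow> (\<integral>\<^sup>+x. f x \<partial>N i) \<le> c * (\<integral>\<^sup>+x. f x \<partial>M i)"
    and J: "finite J" and g: "g \<in> borel_measurable (PiM J M)"
  shows "(\<integral>\<^sup>+x. g x \<partial>PiM J N) \<le> c ^ card J * (\<integral>\<^sup>+x. g x \<partial>PiM J M)"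
proof -
  interpret N: product_prob_space N UNIV
    using N by (simp add: product_prob_space_def product_prob_space_axioms_def product_sigma_finite_def prob_space_imp_sigma_finite)
  interpret M: product_prob_space M UNIV
    using M by (simp add: product_prob_space_def product_prob_space_axioms_def product_sigma_finite_def prob_space_imp_sigma_finite)
  have sP: "sets (PiM J N) = sets (PiM J M)" for J by (intro sets_PiM_cong s refl)
  have sE: "space (N i) = space (M i)" for i using s by (rule sets_eq_imp_space_eq)
  show ?thesis using J g
  proof (induction J arbitrary: g rule: finite_induct)
    case empty
    have "PiM {} N = PiM {} M" by (simp add: PiM_empty)
    then show ?case by simp
  next
    case (insert i J)
    have gN: "g \<in> borel_measurable (PiM (insert i J) N)"
      using insert.prems by (simp cong: measurable_cong_sets add: sP)
    have "(\<lambda>z. g (case z of (x, a) \<Rightarrow> x(i := a))) \<in> borel_measurable (PiM J M \<Otimes>\<^sub>M M i)"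
      by (rule measurable_compose[OF measurable_add_dim insert.prems])
    moreover have "(\<lambda>(x, a). g (x(i := a))) = (\<lambda>z. g (case z of (x, a) \<Rightarrow> x(i := a)))" by auto
    ultimately have gm: "(\<lambda>(x, a). g (x(i := a))) \<in> borel_measurable (PiM J M \<Otimes>\<^sub>M M i)"
      by (simp only:)
    have "(\<integral>\<^sup>+x. g x \<partial>PiM (insert i J) N) = (\<integral>\<^sup>+x. \<integral>\<^sup>+y. g (x(i := y)) \<partial>N i \<partial>PiM J N)"
      using insert.hyps gN by (intro N.product_nn_integral_insert)
    also have "\<dots> \<le> (\<integral>\<^sup>+x. c * (\<integral>\<^sup>+y. g (x(i := y)) \<partial>M i) \<partial>PiM J N)"
    proof (intro nn_integral_mono dom)
      fix x assume "x \<in> space (PiM J N)"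
      then have x: "x \<in> space (PiM J M)" using sets_eq_imp_space_eq[OF sP] by simp
      show "(\<lambda>y. g (x(i := y))) \<in> borel_measurable (M i)"
        using measurable_compose[OF measurable_Pair1'[OF x] gm] by simp
    qed
    also have "\<dots> \<le> c ^ card J * (\<integral>\<^sup>+x. c * (\<integral>\<^sup>+y. g (x(i := y)) \<partial>M i) \<partial>PiM J M)"
      by (intro insert.IH borel_measurable_times_ennreal M.M.borel_measurable_nn_integral gm) simp
    also have "\<dots> = c ^ card J * (c * (\<integral>\<^sup>+x. (\<integral>\<^sup>+y. g (x(i := y)) \<partial>M i) \<partial>PiM J M))"
      by (subst nn_integral_cmult) (intro M.M.borel_measurable_nn_integral gm, rule refl)
    also have "(\<integral>\<^sup>+x. (\<integral>\<^sup>+y. g (x(i := y)) \<partial>M i) \<partial>PiM J M) = (\<integral>\<^sup>+x. g x \<partial>PiM (insert i J) M)"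
      using insert by (intro M.product_nn_integral_insert[symmetric])
    finally show ?case using insert.hyps by (simp add: mult_ac)
  qed
qed

lemma nn_integral_PiM_pair:
  assumes N: "\<And>i :: nat. prob_space (N i)" and fin: "finite I" and ij: "i \<in> I" "j \<in> I" "i \<noteq> j"
    and f: "f \<in> borel_measurable (N i \<Otimes>\<^sub>M N j)"
  shows "(\<integral>\<^sup>+x. f (x i, x j) \<partial>PiM I N) = (\<integral>\<^sup>+b. \<integral>\<^sup>+a. f (a, b) \<partial>N i \<partial>N j)"
proof -
  interpret N: product_prob_space N UNIV
    using N by (simp add: product_prob_space_def product_prob_space_axioms_def product_sigma_finite_def prob_space_imp_sigma_finite)
  define R where "R = I - {i, j}"
  have I: "I = insert i (insert j R)" and R: "finite R" "i \<notin> insert j R" "j \<notin> R" using ij fin by (auto simp: R_def)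
  interpret R: prob_space "PiM R N" by (intro prob_space_PiM N)
  interpret S: pair_sigma_finite "N i" "N j" ..
  have m: "(\<lambda>x. f (x i, x j)) \<in> borel_measurable (PiM (insert i (insert j R)) N)"
    by (rule measurable_compose[OF _ f]) simp
  have m2: "(\<lambda>b. \<integral>\<^sup>+a. f (a, b) \<partial>N i) \<in> borel_measurable (N j)"
  proof -
    have [measurable]: "f \<in> borel_measurable (N i \<Otimes>\<^sub>M N j)" by fact
    show ?thesis by measurable
  qed
  have "(\<integral>\<^sup>+x. f (x i, x j) \<partial>PiM I N) = (\<integral>\<^sup>+x. \<integral>\<^sup>+a. f (a, x j) \<partial>N i \<partial>PiM (insert j R) N)"
    unfolding I using R ij(3) by (subst N.product_nn_integral_insert[OF _ _ m]) auto
  also have "\<dots> = (\<integral>\<^sup>+x. \<integral>\<^sup>+b. \<integral>\<^sup>+a. f (a, b) \<partial>N i \<partial>N j \<partial>PiM R N)"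
  proof (subst N.product_nn_integral_insert)
    show "(\<lambda>x. \<integral>\<^sup>+a. f (a, x j) \<partial>N i) \<in> borel_measurable (PiM (insert j R) N)"
      by (rule measurable_compose[OF _ m2]) simp
  qed (use R in auto)
  also have "\<dots> = (\<integral>\<^sup>+b. \<integral>\<^sup>+a. f (a, b) \<partial>N i \<partial>N j)" by (simp add: R.emeasure_space_1)
  finally show ?thesis .
qed

context prob_space
begin

text \<open>Draw \<open>x i\<close> uniformly from the cell of \<open>i\<close> for each
  \<open>i < n\<close>. Let the pattern follow \<open>W\<close> where \<open>W\<close> is 0 or 1 and
  \<open>A\<close> elsewhere; then every factor of the density integrand is positive at
  \<open>x\<close>, and the expected number of changed pairs is at most
  \<open>2 * \<delta> * (real n)\<^sup>2\<close>. If all patterns near \<open>A\<close> had density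
  0, almost every \<open>x\<close> would produce none of them, so the number of changed pairs would
  almost surely exceed \<open>\<epsilon> * (real n)\<^sup>2\<close>.\<close>

lemma removal:
  fixes A :: "nat \<Rightarrow> nat \<Rightarrow> real" and v :: "'a \<Rightarrow> nat" and W :: "'a \<times> 'a \<Rightarrow> real"
  assumes n: "n > 0" and v[measurable]: "v \<in> M \<rightarrow>\<^sub>M count_space UNIV"
    and pv: "\<And>i. i < n \<Longrightarrow> prob {x \<in> space M. v x = i} = 1 / real n"
    and W[measurable]: "W \<in> borel_measurable (M \<Otimes>\<^sub>M M)" and W01: "\<And>z. z \<in> space (M \<Otimes>\<^sub>M M) \<Longrightarrow> 0 \<le> W z \<and> W z \<le> 1"
    and A: "\<And>i j. A i j = 0 \<or> A i j = 1"
    and Z0: "(\<integral>z. indicator {z \<in> space (M \<Otimes>\<^sub>M M). W z = 0} z * A (v (fst z)) (v (snd z)) \<partial>(M \<Otimes>\<^sub>M M)) \<le> \<delta>"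
    and Z1: "(\<integral>z. indicator {z \<in> space (M \<Otimes>\<^sub>M M). W z = 1} z * (1 - A (v (fst z)) (v (snd z))) \<partial>(M \<Otimes>\<^sub>M M)) \<le> \<delta>"
    and \<epsilon>: "2 * \<delta> < \<epsilon>"
  shows "\<exists>D\<subseteq>pairs n. 0 < tdens M n D W \<and>
           real (card {e\<in>pairs n. (e \<in> D) \<noteq> (A (fst e) (snd e) = 1)}) \<le> \<epsilon> * (real n)\<^sup>2"
proof (rule ccontr)
  assume contra: "\<not> ?thesis"
  interpret MM: pair_prob_space M M ..
  define I where "I i = {x \<in> space M. v x = i}" for i
  have Im[measurable]: "I i \<in> sets M" for i unfolding I_def by measurable
  have eI: "emeasure M (I i) = ennreal (1 / real n)" if "i < n" for i
    using pv[OF that] by (simp add: I_def emeasure_eq_measure)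
  \<comment> \<open>The law of \<open>x i\<close>; the default \<open>M\<close> makes it a
    probability measure for every index.\<close>
  define N where "N i = (if i < n then uniform_measure M (I i) else M)" for i
  have sN: "sets (N i) = sets M" for i by (simp add: N_def)
  have Np: "prob_space (N i)" for i
    unfolding N_def using eI[of i] n prob_space_axioms by (auto intro!: prob_space_uniform_measure)
  have nnN: "(\<integral>\<^sup>+x. f x \<partial>N i) = of_nat n * (\<integral>\<^sup>+x. f x * indicator (I i) x \<partial>M)"
    if "i < n" "f \<in> borel_measurable M" for i f
  proof -
    have "(\<integral>\<^sup>+x. f x \<partial>N i) = (\<integral>\<^sup>+x. f x * indicator (I i) x \<partial>M) / ennreal (1 / real n)"
      using that by (simp add: N_def nn_integral_uniform_measure eI)
    also have "\<dots> = of_nat n * (\<integral>\<^sup>+x. f x * indicator (I i) x \<partial>M)"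
      using n by (simp add: divide_ennreal_def inverse_ennreal ennreal_of_nat_eq_real_of_nat mult.commute)
    finally show ?thesis .
  qed
  have dom: "(\<integral>\<^sup>+x. f x \<partial>N i) \<le> of_nat n * (\<integral>\<^sup>+x. f x \<partial>M)" if "f \<in> borel_measurable M" for i f
  proof (cases "i < n")
    case True
    have "(\<integral>\<^sup>+x. f x * indicator (I i) x \<partial>M) \<le> (\<integral>\<^sup>+x. f x \<partial>M)"
      by (intro nn_integral_mono) (auto simp: indicator_def)
    then show ?thesis using nnN[OF True that] by (auto intro: mult_left_mono)
  next
    case False
    have "1 * (\<integral>\<^sup>+x. f x \<partial>M) \<le> of_nat n * (\<integral>\<^sup>+x. f x \<partial>M)"
      using n by (intro mult_right_mono) auto
    then show ?thesis using False by (simp add: N_def)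
  qed
  define PN where "PN = PiM {..<n} N"
  define PM where "PM = (\<Pi>\<^sub>M i\<in>{..<n}. M)"
  have sP[measurable_cong]: "sets PN = sets PM" unfolding PN_def PM_def by (intro sets_PiM_cong sN refl)
  have spP: "space PN = space PM" using sP by (rule sets_eq_imp_space_eq)
  interpret PN: prob_space PN unfolding PN_def by (intro prob_space_PiM Np)
  interpret PM: prob_space PM unfolding PM_def by (intro prob_space_PiM) (rule prob_space_axioms)
  \<comment> \<open>Null sets of independent points stay null for points in prescribed cells,
    because the second law is at most \<open>n ^ n\<close> times the first.\<close>
  have AE_PN: "AE x in PN. Q x" if Q: "AE x in PM. Q x" for Q
  proof -
    obtain X where X: "X \<in> sets PM" "emeasure PM X = 0" "{x\<in>space PM. \<not> Q x} \<subseteq> X"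
      by (rule AE_E[OF Q])
    have "(\<integral>\<^sup>+x. indicator X x \<partial>PN) \<le> of_nat n ^ card {..<n} * (\<integral>\<^sup>+x. indicator X x \<partial>PM)"
      unfolding PN_def PM_def
    proof (rule nn_integral_PiM_dominated)
      show "indicator X \<in> borel_measurable (\<Pi>\<^sub>M i\<in>{..<n}. M)" using X(1) by (simp add: PM_def)
    qed (auto simp: Np sN prob_space_axioms intro: dom)
    then have "emeasure PN X = 0" using X sP by simp
    then show ?thesis using X sP spP by (intro AE_I'[of X]) (auto simp: null_sets_def)
  qed
  define prd where "prd D x = (\<Prod>e\<in>pairs n. pat D e (W (x (fst e), x (snd e))))" for D and x :: "nat \<Rightarrow> 'a"
  have xs: "(x (fst e), x (snd e)) \<in> space (M \<Otimes>\<^sub>M M)" if "x \<in> space PM" "e \<in> pairs n" for x e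
    using that by (auto simp: PM_def space_PiM space_pair_measure pairs_def PiE_def Pi_def)
  have prd_m: "prd D \<in> borel_measurable PM" for D
    unfolding prd_def PM_def pat_def
    by (intro borel_measurable_prod borel_measurable_if borel_measurable_diff borel_measurable_const
        measurable_eval_pair W) (auto simp: pairs_def)
  have prd01: "0 \<le> prd D x \<and> prd D x \<le> 1" if x: "x \<in> space PM" for D x
  proof -
    have p: "0 \<le> pat D e (W (x (fst e), x (snd e))) \<and> pat D e (W (x (fst e), x (snd e))) \<le> 1"
      if "e \<in> pairs n" for e
      using W01[OF xs[OF x that]] by (intro pat_bounds) auto
    have "0 \<le> prd D x" unfolding prd_def using p by (intro prod_nonneg) blast
    moreover have "prd D x \<le> 1" unfolding prd_def using p by (rule prod_le_1)
    ultimately show ?thesis by blast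
  qed
  have "AE x in PM. prd D x = 0" if "D \<subseteq> pairs n"
    "real (card {e\<in>pairs n. (e \<in> D) \<noteq> (A (fst e) (snd e) = 1)}) \<le> \<epsilon> * (real n)\<^sup>2" for D
  proof -
    have "\<not> 0 < tdens M n D W" using contra that by blast
    then have "tdens M n D W \<le> 0" by simp
    then have "(\<integral>x. prd D x \<partial>PM) \<le> 0" by (simp add: tdens_def prd_def PM_def)
    moreover have "(\<integral>x. prd D x \<partial>PM) \<ge> 0" using prd01 by (intro Bochner_Integration.integral_nonneg) auto
    ultimately have "(\<integral>x. prd D x \<partial>PM) = 0" by simp
    moreover have "integrable PM (prd D)" using prd01 prd_m by (intro PM.integrable_bounded[of _ 1]) auto
    ultimately show ?thesis using prd01 by (subst (asm) integral_nonneg_eq_0_iff_AE) (auto intro: AE_I2)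
  qed
  then have "AE x in PN. prd D x = 0" if "D \<subseteq> pairs n"
    "real (card {e\<in>pairs n. (e \<in> D) \<noteq> (A (fst e) (snd e) = 1)}) \<le> \<epsilon> * (real n)\<^sup>2" for D
    using that AE_PN by blast
  \<comment> \<open>There are finitely many patterns, so one null set serves all of them.\<close>
  then have all: "AE x in PN. \<forall>D\<in>{D\<in>Pow (pairs n). real (card {e\<in>pairs n. (e \<in> D) \<noteq> (A (fst e) (snd e) = 1)}) \<le> \<epsilon> * (real n)\<^sup>2}. prd D x = 0"
    by (intro AE_finite_allI) auto
  define bad where "bad e z \<longleftrightarrow> (W z = 0 \<and> A (fst e) (snd e) = 1) \<or> (W z = 1 \<and> A (fst e) (snd e) = 0)" for e :: "nat \<times> nat" and z
  have "AE x in PN. ennreal (\<epsilon> * (real n)\<^sup>2) \<le> (\<Sum>e\<in>pairs n. indicator {z. bad e z} (x (fst e), x (snd e)))"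
    using all AE_space
  proof eventually_elim
    case (elim x)
    define D where "D = {e\<in>pairs n. W (x (fst e), x (snd e)) = 1 \<or> (W (x (fst e), x (snd e)) \<noteq> 0 \<and> A (fst e) (snd e) = 1)}"
    have "pat D e (W (x (fst e), x (snd e))) > 0" if "e \<in> pairs n" for e
      using W01[of "(x (fst e), x (snd e))"] xs[of x e] that elim(2) by (auto simp: pat_def D_def spP)
    then have "prd D x > 0" unfolding prd_def by (intro prod_pos) auto
    then have "\<not> real (card {e\<in>pairs n. (e \<in> D) \<noteq> (A (fst e) (snd e) = 1)}) \<le> \<epsilon> * (real n)\<^sup>2"
      using elim(1) by (auto simp: D_def)
    moreover have "{e\<in>pairs n. (e \<in> D) \<noteq> (A (fst e) (snd e) = 1)} = {e\<in>pairs n. bad e (x (fst e), x (snd e))}"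
      unfolding D_def bad_def using A by fastforce
    moreover have "(\<Sum>e\<in>pairs n. indicator {z. bad e z} (x (fst e), x (snd e))) =
        (of_nat (card {e\<in>pairs n. bad e (x (fst e), x (snd e))}) :: ennreal)"
      by (simp add: indicator_def sum.If_cases Int_def)
    ultimately show ?case
      by (simp add: ennreal_of_nat_eq_real_of_nat ennreal_leI)
  qed
  then have "(\<integral>\<^sup>+x. ennreal (\<epsilon> * (real n)\<^sup>2) \<partial>PN) \<le>
      (\<integral>\<^sup>+x. (\<Sum>e\<in>pairs n. indicator {z. bad e z} (x (fst e), x (snd e))) \<partial>PN)"
    by (rule nn_integral_mono_AE)
  then have lower: "ennreal (\<epsilon> * (real n)\<^sup>2) \<le> (\<integral>\<^sup>+x. (\<Sum>e\<in>pairs n. indicator {z. bad e z} (x (fst e), x (snd e))) \<partial>PN)"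
    by (simp add: PN.emeasure_space_1)
  define bi where "bi e z = (indicator {z \<in> space (M \<Otimes>\<^sub>M M). bad e z} z :: ennreal)" for e z
  have bim[measurable]: "bi e \<in> borel_measurable (M \<Otimes>\<^sub>M M)" for e
    unfolding bi_def bad_def by measurable
  have "(\<integral>\<^sup>+x. (\<Sum>e\<in>pairs n. indicator {z. bad e z} (x (fst e), x (snd e))) \<partial>PN)
      = (\<integral>\<^sup>+x. (\<Sum>e\<in>pairs n. bi e (x (fst e), x (snd e))) \<partial>PN)"
    using xs by (intro nn_integral_cong sum.cong refl) (auto simp: bi_def spP indicator_def)
  also have "\<dots> = (\<Sum>e\<in>pairs n. \<integral>\<^sup>+x. bi e (x (fst e), x (snd e)) \<partial>PN)"
  proof (rule nn_integral_sum)
    fix e assume "e \<in> pairs n"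
    then have "(\<lambda>x. (x (fst e), x (snd e))) \<in> PM \<rightarrow>\<^sub>M M \<Otimes>\<^sub>M M"
      unfolding PM_def by (auto simp: pairs_def)
    from measurable_compose[OF this bim] show "(\<lambda>x. bi e (x (fst e), x (snd e))) \<in> borel_measurable PN"
      by (simp cong: measurable_cong_sets add: sP)
  qed
  \<comment> \<open>Conditioning on a cell of measure \<open>1 / n\<close> multiplies by
    \<open>n\<close>, once for each end of the pair.\<close>
  also have "\<dots> = (\<Sum>e\<in>pairs n. of_nat n * (of_nat n * (\<integral>\<^sup>+z. bi e z * indicator (I (fst e) \<times> I (snd e)) z \<partial>(M \<Otimes>\<^sub>M M))))"
  proof (rule sum.cong[OF refl])
    fix e assume e: "e \<in> pairs n"
    have cong: "sets (N (fst e) \<Otimes>\<^sub>M N (snd e)) = sets (M \<Otimes>\<^sub>M M)" by (intro sets_pair_measure_cong sN)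
    have "(\<integral>\<^sup>+x. bi e (x (fst e), x (snd e)) \<partial>PN) = (\<integral>\<^sup>+b. \<integral>\<^sup>+a. bi e (a, b) \<partial>N (fst e) \<partial>N (snd e))"
      unfolding PN_def using e bim[of e]
      by (intro nn_integral_PiM_pair Np) (auto simp: pairs_def cong: measurable_cong_sets[OF cong refl])
    also have "\<dots> = (\<integral>\<^sup>+b. of_nat n * (\<integral>\<^sup>+a. bi e (a, b) * indicator (I (fst e)) a \<partial>M) \<partial>N (snd e))"
    proof (rule nn_integral_cong)
      fix b assume "b \<in> space (N (snd e))"
      then have "b \<in> space M" using sN sets_eq_imp_space_eq by blast
      then have "(\<lambda>a. bi e (a, b)) \<in> borel_measurable M" by measurable
      then show "(\<integral>\<^sup>+a. bi e (a, b) \<partial>N (fst e)) = of_nat n * (\<integral>\<^sup>+a. bi e (a, b) * indicator (I (fst e)) a \<partial>M)"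
        using e by (intro nnN) (auto simp: pairs_def)
    qed
    also have "\<dots> = of_nat n * (\<integral>\<^sup>+b. (of_nat n * (\<integral>\<^sup>+a. bi e (a, b) * indicator (I (fst e)) a \<partial>M)) * indicator (I (snd e)) b \<partial>M)"
      using e by (intro nnN) (auto simp: pairs_def)
    also have "(\<integral>\<^sup>+b. (of_nat n * (\<integral>\<^sup>+a. bi e (a, b) * indicator (I (fst e)) a \<partial>M)) * indicator (I (snd e)) b \<partial>M)
      = (\<integral>\<^sup>+b. of_nat n * (\<integral>\<^sup>+a. bi e (a, b) * indicator (I (fst e) \<times> I (snd e)) (a, b) \<partial>M) \<partial>M)"
    proof (rule nn_integral_cong)
      fix b assume "b \<in> space M"
      show "(of_nat n * (\<integral>\<^sup>+a. bi e (a, b) * indicator (I (fst e)) a \<partial>M)) * indicator (I (snd e)) b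
        = of_nat n * (\<integral>\<^sup>+a. bi e (a, b) * indicator (I (fst e) \<times> I (snd e)) (a, b) \<partial>M)"
        by (cases "b \<in> I (snd e)") (auto simp: indicator_def intro!: nn_integral_cong arg_cong2[of _ _ _ _ "(*)"])
    qed
    also have "\<dots> = of_nat n * (\<integral>\<^sup>+b. (\<integral>\<^sup>+a. bi e (a, b) * indicator (I (fst e) \<times> I (snd e)) (a, b) \<partial>M) \<partial>M)"
      by (rule nn_integral_cmult) measurable
    also have "(\<integral>\<^sup>+b. (\<integral>\<^sup>+a. bi e (a, b) * indicator (I (fst e) \<times> I (snd e)) (a, b) \<partial>M) \<partial>M)
        = (\<integral>\<^sup>+z. bi e z * indicator (I (fst e) \<times> I (snd e)) z \<partial>(M \<Otimes>\<^sub>M M))"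
      by (rule MM.nn_integral_snd) measurable
    finally show "(\<integral>\<^sup>+x. bi e (x (fst e), x (snd e)) \<partial>PN) = of_nat n * (of_nat n * (\<integral>\<^sup>+z. bi e z * indicator (I (fst e) \<times> I (snd e)) z \<partial>(M \<Otimes>\<^sub>M M)))" .
  qed
  also have "\<dots> = of_nat n * (of_nat n * (\<integral>\<^sup>+z. (\<Sum>e\<in>pairs n. bi e z * indicator (I (fst e) \<times> I (snd e)) z) \<partial>(M \<Otimes>\<^sub>M M)))"
    by (subst nn_integral_sum) (auto simp: sum_distrib_left)
  finally have eq: "(\<integral>\<^sup>+x. (\<Sum>e\<in>pairs n. indicator {z. bad e z} (x (fst e), x (snd e))) \<partial>PN) =
      of_nat n * (of_nat n * (\<integral>\<^sup>+z. (\<Sum>e\<in>pairs n. bi e z * indicator (I (fst e) \<times> I (snd e)) z) \<partial>(M \<Otimes>\<^sub>M M)))" .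
  have "(\<integral>\<^sup>+z. (\<Sum>e\<in>pairs n. bi e z * indicator (I (fst e) \<times> I (snd e)) z) \<partial>(M \<Otimes>\<^sub>M M)) \<le>
     (\<integral>\<^sup>+z. ennreal (indicator {z \<in> space (M \<Otimes>\<^sub>M M). W z = 0} z * A (v (fst z)) (v (snd z)) +
         indicator {z \<in> space (M \<Otimes>\<^sub>M M). W z = 1} z * (1 - A (v (fst z)) (v (snd z)))) \<partial>(M \<Otimes>\<^sub>M M))"
  proof (rule nn_integral_mono)
    fix z assume z: "z \<in> space (M \<Otimes>\<^sub>M M)"
    define e0 where "e0 = (v (fst z), v (snd z))"
    \<comment> \<open>Each point lies in one product of cells only, that of the index pair
      \<open>e0\<close>.\<close>
    have "(\<Sum>e\<in>pairs n. bi e z * indicator (I (fst e) \<times> I (snd e)) z) = (\<Sum>e\<in>pairs n. if e = e0 then bi e0 z else 0)"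
      using z by (intro sum.cong) (auto simp: I_def e0_def indicator_def space_pair_measure)
    also have "\<dots> \<le> bi e0 z" by simp
    also have "\<dots> \<le> ennreal (indicator {z \<in> space (M \<Otimes>\<^sub>M M). W z = 0} z * A (v (fst z)) (v (snd z)) +
         indicator {z \<in> space (M \<Otimes>\<^sub>M M). W z = 1} z * (1 - A (v (fst z)) (v (snd z))))"
      using A[of "v (fst z)" "v (snd z)"] by (auto simp: bi_def bad_def e0_def indicator_def)
    finally show "(\<Sum>e\<in>pairs n. bi e z * indicator (I (fst e) \<times> I (snd e)) z) \<le> ennreal (indicator {z \<in> space (M \<Otimes>\<^sub>M M). W z = 0} z * A (v (fst z)) (v (snd z)) +
         indicator {z \<in> space (M \<Otimes>\<^sub>M M). W z = 1} z * (1 - A (v (fst z)) (v (snd z))))" .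
  qed
  also have "\<dots> = ennreal (\<integral>z. indicator {z \<in> space (M \<Otimes>\<^sub>M M). W z = 0} z * A (v (fst z)) (v (snd z)) +
         indicator {z \<in> space (M \<Otimes>\<^sub>M M). W z = 1} z * (1 - A (v (fst z)) (v (snd z))) \<partial>(M \<Otimes>\<^sub>M M))"
  proof (rule nn_integral_eq_integral)
    show "integrable (M \<Otimes>\<^sub>M M) (\<lambda>z. indicator {z \<in> space (M \<Otimes>\<^sub>M M). W z = 0} z * A (v (fst z)) (v (snd z)) +
         indicator {z \<in> space (M \<Otimes>\<^sub>M M). W z = 1} z * (1 - A (v (fst z)) (v (snd z))))"
    proof (rule MM.P.integrable_bounded[of _ 1])
      fix z
      show "\<bar>indicator {z \<in> space (M \<Otimes>\<^sub>M M). W z = 0} z * A (v (fst z)) (v (snd z)) +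
         indicator {z \<in> space (M \<Otimes>\<^sub>M M). W z = 1} z * (1 - A (v (fst z)) (v (snd z)))\<bar> \<le> 1"
        using A[of "v (fst z)" "v (snd z)"] by (auto simp: indicator_def)
    qed measurable
    show "AE z in M \<Otimes>\<^sub>M M. 0 \<le> indicator {z \<in> space (M \<Otimes>\<^sub>M M). W z = 0} z * A (v (fst z)) (v (snd z)) +
         indicator {z \<in> space (M \<Otimes>\<^sub>M M). W z = 1} z * (1 - A (v (fst z)) (v (snd z)))"
    proof (rule AE_I2)
      fix z
      show "0 \<le> indicator {z \<in> space (M \<Otimes>\<^sub>M M). W z = 0} z * A (v (fst z)) (v (snd z)) +
         indicator {z \<in> space (M \<Otimes>\<^sub>M M). W z = 1} z * (1 - A (v (fst z)) (v (snd z)))"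
        using A[of "v (fst z)" "v (snd z)"] by (auto simp: indicator_def)
    qed
  qed
  also have "\<dots> \<le> ennreal (2 * \<delta>)"
  proof (rule ennreal_leI)
    have i0: "integrable (M \<Otimes>\<^sub>M M) (\<lambda>z. indicator {z \<in> space (M \<Otimes>\<^sub>M M). W z = 0} z * A (v (fst z)) (v (snd z)))"
    proof (rule MM.P.integrable_bounded[of _ 1])
      fix z show "\<bar>indicator {z \<in> space (M \<Otimes>\<^sub>M M). W z = 0} z * A (v (fst z)) (v (snd z))\<bar> \<le> 1"
        using A[of "v (fst z)" "v (snd z)"] by (auto simp: indicator_def)
    qed measurable
    have i1: "integrable (M \<Otimes>\<^sub>M M) (\<lambda>z. indicator {z \<in> space (M \<Otimes>\<^sub>M M). W z = 1} z * (1 - A (v (fst z)) (v (snd z))))"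
    proof (rule MM.P.integrable_bounded[of _ 1])
      fix z show "\<bar>indicator {z \<in> space (M \<Otimes>\<^sub>M M). W z = 1} z * (1 - A (v (fst z)) (v (snd z)))\<bar> \<le> 1"
        using A[of "v (fst z)" "v (snd z)"] by (auto simp: indicator_def)
    qed measurable
    show "(\<integral>z. indicator {z \<in> space (M \<Otimes>\<^sub>M M). W z = 0} z * A (v (fst z)) (v (snd z)) +
         indicator {z \<in> space (M \<Otimes>\<^sub>M M). W z = 1} z * (1 - A (v (fst z)) (v (snd z))) \<partial>(M \<Otimes>\<^sub>M M)) \<le> 2 * \<delta>"
      unfolding Bochner_Integration.integral_add[OF i0 i1] using Z0 Z1 by linarith
  qed
  finally have "(\<integral>\<^sup>+x. (\<Sum>e\<in>pairs n. indicator {z. bad e z} (x (fst e), x (snd e))) \<partial>PN)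
      \<le> of_nat n * (of_nat n * ennreal (2 * \<delta>))"
    unfolding eq by (intro mult_left_mono) auto
  with lower have le: "ennreal (\<epsilon> * (real n)\<^sup>2) \<le> of_nat n * (of_nat n * ennreal (2 * \<delta>))" by (rule order_trans)
  have "\<delta> \<ge> 0"
  proof -
    have "0 \<le> (\<integral>z. indicator {z \<in> space (M \<Otimes>\<^sub>M M). W z = 0} z * A (v (fst z)) (v (snd z)) \<partial>(M \<Otimes>\<^sub>M M))"
    proof (rule Bochner_Integration.integral_nonneg)
      fix z show "0 \<le> indicator {z \<in> space (M \<Otimes>\<^sub>M M). W z = 0} z * A (v (fst z)) (v (snd z))"
        using A[of "v (fst z)" "v (snd z)"] by auto
    qed
    then show ?thesis using Z0 by linarith
  qed
  then have "of_nat n * (of_nat n * ennreal (2 * \<delta>)) = ennreal (2 * \<delta> * (real n)\<^sup>2)"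
    by (simp add: ennreal_of_nat_eq_real_of_nat power2_eq_square mult_ac flip: ennreal_mult)
  with le have "\<epsilon> * (real n)\<^sup>2 \<le> 2 * \<delta> * (real n)\<^sup>2" using \<open>\<delta> \<ge> 0\<close> by simp
  then show False using \<epsilon> n by simp
qed

end

section \<open>Cut norm and cut distance on the unit square\<close>

abbreviation unit_measure :: "real measure" where
  "unit_measure \<equiv> lebesgue_on {0..1}"

section \<open>Lebesgue measure on the square and the product measure\<close>

lemma null_sets_lborel_Times:
  fixes N :: "real set"
  assumes "N \<in> null_sets lborel"
  shows "N \<times> (UNIV :: real set) \<in> null_sets lborel" "(UNIV :: real set) \<times> N \<in> null_sets lborel"
proof -
  have "N \<times> UNIV \<in> null_sets (lborel \<Otimes>\<^sub>M (lborel :: real measure))"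
    "UNIV \<times> N \<in> null_sets ((lborel :: real measure) \<Otimes>\<^sub>M lborel)"
    using assms by (auto simp: null_sets_def lborel.emeasure_pair_measure_Times intro!: pair_measureI)
  then show "N \<times> (UNIV :: real set) \<in> null_sets lborel" "(UNIV :: real set) \<times> N \<in> null_sets lborel"
    unfolding lborel_prod by auto
qed

text \<open>Lebesgue measure on the plane is the completion of the Borel product and not the product
  of the completed factors, so rectangles need an argument. Write each side as a Borel set with a
  null set added; what this adds to the rectangle lies in two null strips.\<close>

lemma lebesgue_Times:
  fixes S T :: "real set"
  assumes "S \<in> sets lebesgue" "T \<in> sets lebesgue"
  shows "S \<times> T \<in> sets lebesgue" "emeasure lebesgue (S \<times> T) = emeasure lebesgue S * emeasure lebesgue T"
proof -
  obtain S' N N' where S: "S = S' \<union> N" "N \<subseteq> N'" "N' \<in> null_sets lborel" "S' \<in> sets lborel"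
    by (rule sets_completionE[OF assms(1)])
  obtain T' O1 O' where T: "T = T' \<union> O1" "O1 \<subseteq> O'" "O' \<in> null_sets lborel" "T' \<in> sets lborel"
    by (rule sets_completionE[OF assms(2)])
  define Y where "Y = (N' \<times> UNIV) \<union> (UNIV \<times> O')"
  define X where "X = (S \<times> T) - (S' \<times> T')"
  have "Y \<in> null_sets lborel" unfolding Y_def using S(3) T(3) by (intro null_sets.Un null_sets_lborel_Times)
  moreover have "X \<subseteq> Y" using S(1,2) T(1,2) by (auto simp: X_def Y_def)
  ultimately have X: "X \<in> null_sets lebesgue" by (auto simp: null_sets_completion_iff2)
  have b: "S' \<times> T' \<in> sets lborel" "emeasure lborel (S' \<times> T') = emeasure lborel S' * emeasure lborel T'"
    using S(4) T(4) lborel.emeasure_pair_measure_Times[of S' lborel T'] pair_measureI[of S' lborel T' lborel]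
    unfolding lborel_prod by auto
  have e: "S \<times> T = S' \<times> T' \<union> X" using S(1) T(1) by (auto simp: X_def)
  show "S \<times> T \<in> sets lebesgue" unfolding e using b X by auto
  have "N \<in> null_sets lebesgue" "O1 \<in> null_sets lebesgue" using S T by (auto simp: null_sets_completion_iff2)
  then have "emeasure lebesgue S = emeasure lborel S'" "emeasure lebesgue T = emeasure lborel T'"
    unfolding S(1) T(1) using S(4) T(4) by (simp_all add: emeasure_Un_null_set)
  moreover have "emeasure lebesgue (S \<times> T) = emeasure lborel (S' \<times> T')"
    unfolding e using X b(1) by (simp add: emeasure_Un_null_set)
  ultimately show "emeasure lebesgue (S \<times> T) = emeasure lebesgue S * emeasure lebesgue T" using b(2) by simp
qed

interpretation unit: prob_space unit_measure
  by (rule prob_spaceI) (simp add: emeasure_restrict_space)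

interpretation unit2: pair_prob_space unit_measure unit_measure ..

lemma sets_unit_iff: "S \<in> sets unit_measure \<longleftrightarrow> S \<in> sets lebesgue \<and> S \<subseteq> {0..1}"
  by (subst sets_restrict_space_iff) auto

lemma space_unit2: "space (unit_measure \<Otimes>\<^sub>M unit_measure) = {0..1} \<times> {0..1}"
  by (simp add: space_pair_measure)

text \<open>\<open>cut_norm\<close> integrates over the completed plane while Fubini needs the
  product measure. The identity carries one to the other, since both agree on rectangles.\<close>

lemma distr_unit2: "distr (lebesgue_on ({0..1} \<times> {0..1})) (unit_measure \<Otimes>\<^sub>M unit_measure) (\<lambda>z. z) = unit_measure \<Otimes>\<^sub>M unit_measure"
  and measurable_unit2: "(\<lambda>z. z) \<in> lebesgue_on ({0..1} \<times> {0..1}) \<rightarrow>\<^sub>M unit_measure \<Otimes>\<^sub>M unit_measure"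
proof -
  let ?Q = "{0..1} \<times> {0..1} :: (real \<times> real) set"
  have Q: "?Q \<in> sets lebesgue" by (intro lebesgue_Times) auto
  have "fst \<in> lebesgue_on ?Q \<rightarrow>\<^sub>M unit_measure" "snd \<in> lebesgue_on ?Q \<rightarrow>\<^sub>M unit_measure"
  proof (rule_tac [!] measurableI)
    fix A :: "real set" assume A: "A \<in> sets unit_measure"
    then have "A \<times> {0..1::real} \<in> sets lebesgue" "{0..1::real} \<times> A \<in> sets lebesgue"
      using lebesgue_Times(1)[of A "{0..1}"] lebesgue_Times(1)[of "{0..1}" A] by (simp_all add: sets_unit_iff)
    moreover have "fst -` A \<inter> space (lebesgue_on ?Q) = A \<times> {0..1}" "snd -` A \<inter> space (lebesgue_on ?Q) = {0..1} \<times> A"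
      using A by (auto simp: sets_unit_iff)
    ultimately show "fst -` A \<inter> space (lebesgue_on ?Q) \<in> sets (lebesgue_on ?Q)"
      "snd -` A \<inter> space (lebesgue_on ?Q) \<in> sets (lebesgue_on ?Q)"
      using Q A by (auto simp: sets_restrict_space_iff sets_unit_iff)
  qed auto
  from measurable_Pair[OF this]
  show m: "(\<lambda>z. z) \<in> lebesgue_on ?Q \<rightarrow>\<^sub>M unit_measure \<Otimes>\<^sub>M unit_measure" by simp
  show "distr (lebesgue_on ?Q) (unit_measure \<Otimes>\<^sub>M unit_measure) (\<lambda>z. z) = unit_measure \<Otimes>\<^sub>M unit_measure"
  proof (rule pair_measure_eqI[symmetric])
    fix A B :: "real set" assume AB: "A \<in> sets unit_measure" "B \<in> sets unit_measure"
    have "emeasure (distr (lebesgue_on ?Q) (unit_measure \<Otimes>\<^sub>M unit_measure) (\<lambda>z. z)) (A \<times> B)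
        = emeasure (lebesgue_on ?Q) (A \<times> B)"
      using AB by (subst emeasure_distr[OF m]) (auto simp: sets_unit_iff intro!: arg_cong2[of _ _ _ _ emeasure])
    also have "\<dots> = emeasure lebesgue (A \<times> B)"
      using AB Q by (subst emeasure_restrict_space) (auto simp: sets_unit_iff)
    also have "\<dots> = emeasure unit_measure A * emeasure unit_measure B"
      using AB by (subst lebesgue_Times) (auto simp: sets_unit_iff emeasure_restrict_space)
    finally show "emeasure unit_measure A * emeasure unit_measure B =
       emeasure (distr (lebesgue_on ?Q) (unit_measure \<Otimes>\<^sub>M unit_measure) (\<lambda>z. z)) (A \<times> B)" by simp
  qed (auto intro: unit.sigma_finite_measure_axioms)
qed

lemma lebesgue_integral_Times:
  fixes U :: "real \<times> real \<Rightarrow> real"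
  assumes U: "U \<in> borel_measurable (unit_measure \<Otimes>\<^sub>M unit_measure)"
    and ST: "S \<in> sets unit_measure" "T \<in> sets unit_measure"
  shows "(LINT z:S \<times> T|lebesgue. U z) = (\<integral>z. indicator (S \<times> T) z * U z \<partial>(unit_measure \<Otimes>\<^sub>M unit_measure))"
proof -
  let ?Q = "{0..1} \<times> {0..1} :: (real \<times> real) set"
  have Q: "?Q \<in> sets lebesgue" by (intro lebesgue_Times) auto
  have "(\<integral>z. indicator (S \<times> T) z * U z \<partial>(unit_measure \<Otimes>\<^sub>M unit_measure)) =
      (\<integral>z. indicator (S \<times> T) z * U z \<partial>distr (lebesgue_on ?Q) (unit_measure \<Otimes>\<^sub>M unit_measure) (\<lambda>z. z))"
    by (simp only: distr_unit2)
  also have "\<dots> = (\<integral>z. indicator (S \<times> T) z * U z \<partial>lebesgue_on ?Q)"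
    using U ST by (intro integral_distr measurable_unit2) auto
  also have "\<dots> = (\<integral>z. indicator ?Q z *\<^sub>R (indicator (S \<times> T) z * U z) \<partial>lebesgue)"
    using Q by (intro integral_restrict_space) auto
  also have "\<dots> = (LINT z:S \<times> T|lebesgue. U z)"
    unfolding set_lebesgue_integral_def using ST
    by (intro Bochner_Integration.integral_cong refl) (auto simp: indicator_def sets_unit_iff)
  finally show ?thesis by simp
qed

section \<open>Kernels on the unit square and closeness in cut norm\<close>

definition unit_kernel :: "(real \<times> real \<Rightarrow> real) \<Rightarrow> bool" where
  "unit_kernel U \<longleftrightarrow> U \<in> borel_measurable (unit_measure \<Otimes>\<^sub>M unit_measure) \<and>
     (\<forall>z\<in>{0..1} \<times> {0..1}. 0 \<le> U z \<and> U z \<le> 1)"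

lemma kernelD:
  assumes "unit_kernel U"
  shows "U \<in> borel_measurable (unit_measure \<Otimes>\<^sub>M unit_measure)"
    "z \<in> space (unit_measure \<Otimes>\<^sub>M unit_measure) \<Longrightarrow> 0 \<le> U z \<and> U z \<le> 1"
  using assms unfolding unit_kernel_def space_unit2 by blast+

lemma kernel_diff_integrable:
  assumes "unit_kernel U" "unit_kernel V" "S \<in> sets unit_measure" "T \<in> sets unit_measure"
  shows "integrable (unit_measure \<Otimes>\<^sub>M unit_measure) (\<lambda>z. indicator (S \<times> T) z * (U z - V z))"
proof (rule unit2.P.integrable_bounded[of _ 1])
  show "(\<lambda>z. indicator (S \<times> T) z * (U z - V z)) \<in> borel_measurable (unit_measure \<Otimes>\<^sub>M unit_measure)"
    using assms kernelD(1)[OF assms(1)] kernelD(1)[OF assms(2)] by measurable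
  fix z assume "z \<in> space (unit_measure \<Otimes>\<^sub>M unit_measure)"
  then show "\<bar>indicator (S \<times> T) z * (U z - V z)\<bar> \<le> 1"
    using kernelD(2)[OF assms(1), of z] kernelD(2)[OF assms(2), of z] by (auto simp: indicator_def)
qed

abbreviation ucut_close :: "(real \<times> real \<Rightarrow> real) \<Rightarrow> (real \<times> real \<Rightarrow> real) \<Rightarrow> real \<Rightarrow> bool" where
  "ucut_close \<equiv> cut_close unit_measure"

lemma ucut_close_sym: "ucut_close U V b \<Longrightarrow> ucut_close V U b"
proof -
  assume a: "ucut_close U V b"
  have "(\<integral>z. indicator (S \<times> T) z * (V z - U z) \<partial>(unit_measure \<Otimes>\<^sub>M unit_measure)) =
    - (\<integral>z. indicator (S \<times> T) z * (U z - V z) \<partial>(unit_measure \<Otimes>\<^sub>M unit_measure))" for S T :: "real set"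
    by (subst Bochner_Integration.integral_minus[symmetric]) (simp add: algebra_simps)
  then show ?thesis using a by (simp add: cut_close_def)
qed

lemma ucut_close_trans:
  assumes K: "unit_kernel U" "unit_kernel V" "unit_kernel W" and "ucut_close U V a" "ucut_close V W b"
  shows "ucut_close U W (a + b)"
  unfolding cut_close_def
proof (intro ballI)
  fix S T :: "real set" assume ST: "S \<in> sets unit_measure" "T \<in> sets unit_measure"
  let ?I = "\<lambda>f. \<integral>z. indicator (S \<times> T) z * f z \<partial>(unit_measure \<Otimes>\<^sub>M unit_measure)"
  have "?I (\<lambda>z. U z - W z) = (\<integral>z. indicator (S \<times> T) z * (U z - V z) + indicator (S \<times> T) z * (V z - W z) \<partial>(unit_measure \<Otimes>\<^sub>M unit_measure))"
    by (intro Bochner_Integration.integral_cong refl) (simp add: indicator_def)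
  also have "\<dots> = ?I (\<lambda>z. U z - V z) + ?I (\<lambda>z. V z - W z)"
    using K ST by (intro Bochner_Integration.integral_add kernel_diff_integrable)
  finally have "?I (\<lambda>z. U z - W z) = ?I (\<lambda>z. U z - V z) + ?I (\<lambda>z. V z - W z)" .
  moreover have "\<bar>?I (\<lambda>z. U z - V z)\<bar> \<le> a" "\<bar>?I (\<lambda>z. V z - W z)\<bar> \<le> b"
    using assms ST by (auto simp: cut_close_def)
  ultimately show "\<bar>?I (\<lambda>z. U z - W z)\<bar> \<le> a + b" by linarith
qed

lemma AE_unit_pair:
  assumes "AE x in unit_measure. P x"
  shows "AE z in unit_measure \<Otimes>\<^sub>M unit_measure. P (fst z) \<and> P (snd z)"
proof -
  obtain N where N: "{x \<in> space unit_measure. \<not> P x} \<subseteq> N" "emeasure unit_measure N = 0" "N \<in> sets unit_measure"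
    by (rule AE_E[OF assms])
  have "N \<times> {0..1} \<union> {0..1} \<times> N \<in> null_sets (unit_measure \<Otimes>\<^sub>M unit_measure)"
    using N by (intro null_sets.Un) (auto simp: null_sets_def unit.emeasure_pair_measure_Times intro!: pair_measureI)
  then show ?thesis by (rule AE_I') (use N in \<open>auto simp: space_unit2\<close>)
qed

text \<open>Applied with \<open>Q x\<close> being \<open>0 < x\<close>: the cells of a step kernel
  are open on the left and miss 0, so different descriptions of it may disagree on the axes.\<close>

lemma ucut_close_AE_eq:
  assumes K: "unit_kernel U" "unit_kernel V" and "AE x in unit_measure. Q x"
    and eq: "\<And>x y. Q x \<Longrightarrow> Q y \<Longrightarrow> x \<in> {0..1} \<Longrightarrow> y \<in> {0..1} \<Longrightarrow> U (x, y) = V (x, y)"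
  shows "ucut_close U V 0"
  unfolding cut_close_def
proof (intro ballI)
  fix S T :: "real set" assume ST: "S \<in> sets unit_measure" "T \<in> sets unit_measure"
  have "(\<integral>z. indicator (S \<times> T) z * (U z - V z) \<partial>(unit_measure \<Otimes>\<^sub>M unit_measure)) = 0"
  proof (rule integral_eq_zero_AE)
    show "AE z in unit_measure \<Otimes>\<^sub>M unit_measure. indicator (S \<times> T) z * (U z - V z) = 0"
      using AE_unit_pair[OF assms(3)] AE_space
    proof eventually_elim
      case (elim z)
      then have "U (fst z, snd z) = V (fst z, snd z)" by (intro eq) (auto simp: space_unit2)
      then show ?case by simp
    qed
  qed
  then show "\<bar>\<integral>z. indicator (S \<times> T) z * (U z - V z) \<partial>(unit_measure \<Otimes>\<^sub>M unit_measure)\<bar> \<le> 0" by simp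
qed

lemma cut_norm_le_iff:
  assumes K: "unit_kernel U" "unit_kernel V" and W: "\<And>z. z \<in> {0..1} \<times> {0..1} \<Longrightarrow> W z = U z - V z"
  shows "cut_norm W \<le> b \<longleftrightarrow> ucut_close U V b"
proof -
  let ?D = "{(S, T). S \<in> sets lebesgue \<and> S \<subseteq> {0..1} \<and> T \<in> sets lebesgue \<and> T \<subseteq> {0..1}} :: (real set \<times> real set) set"
  have eq: "(LINT z:S \<times> T|lebesgue. W z) = (\<integral>z. indicator (S \<times> T) z * (U z - V z) \<partial>(unit_measure \<Otimes>\<^sub>M unit_measure))"
    if "S \<in> sets unit_measure" "T \<in> sets unit_measure" for S T
  proof -
    have "(LINT z:S \<times> T|lebesgue. W z) = (LINT z:S \<times> T|lebesgue. U z - V z)"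
      unfolding set_lebesgue_integral_def using that W
      by (intro Bochner_Integration.integral_cong refl) (auto simp: indicator_def sets_unit_iff)
    also have "\<dots> = (\<integral>z. indicator (S \<times> T) z * (U z - V z) \<partial>(unit_measure \<Otimes>\<^sub>M unit_measure))"
      using kernelD(1)[OF K(1)] kernelD(1)[OF K(2)] that by (intro lebesgue_integral_Times) auto
    finally show ?thesis .
  qed
  \<comment> \<open>This bounds the set whose supremum is \<open>cut_norm W\<close>; without a bound
    the supremum would be unspecified.\<close>
  have "ucut_close U V 1"
    unfolding cut_close_def
  proof (intro ballI)
    fix S T :: "real set" assume ST: "S \<in> sets unit_measure" "T \<in> sets unit_measure"
    show "\<bar>\<integral>z. indicator (S \<times> T) z * (U z - V z) \<partial>(unit_measure \<Otimes>\<^sub>M unit_measure)\<bar> \<le> 1"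
    proof (rule unit2.P.abs_integral_bound)
      fix z assume "z \<in> space (unit_measure \<Otimes>\<^sub>M unit_measure)"
      then show "\<bar>indicator (S \<times> T) z * (U z - V z)\<bar> \<le> 1"
        using kernelD(2)[OF K(1), of z] kernelD(2)[OF K(2), of z] by (auto simp: indicator_def)
    qed simp
  qed
  then have bdd: "bdd_above ((\<lambda>(S, T). \<bar>LINT z:S \<times> T|lebesgue. W z\<bar>) ` ?D)"
    by (intro bdd_aboveI[of _ 1]) (auto simp: eq sets_unit_iff cut_close_def)
  have "cut_norm W \<le> b \<longleftrightarrow> (\<forall>p\<in>?D. (case p of (S, T) \<Rightarrow> \<bar>LINT z:S \<times> T|lebesgue. W z\<bar>) \<le> b)"
    unfolding cut_norm_def by (rule cSUP_le_iff[OF _ bdd]) (auto intro: exI[of _ "{}"])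
  also have "\<dots> \<longleftrightarrow> ucut_close U V b"
    unfolding cut_close_def by (auto simp: eq sets_unit_iff)
  finally show ?thesis .
qed

section \<open>Invertible measure preserving maps\<close>

lemma imp_measurable:
  assumes "\<phi> \<in> invertible_measure_preserving"
  shows "\<phi> \<in> unit_measure \<rightarrow>\<^sub>M unit_measure" "distr unit_measure unit_measure \<phi> = unit_measure"
    "x \<in> {0..1} \<Longrightarrow> \<phi> x \<in> {0..1}"
  using assms by (auto simp: invertible_measure_preserving_def dest: bij_betwE)

lemma imp_id: "(\<lambda>x. x) \<in> invertible_measure_preserving"
proof -
  have b: "bij_betw (\<lambda>x. x) {0..1::real} {0..1}" by (simp add: bij_betw_def)
  have "the_inv_into {0..1::real} (\<lambda>x. x) x = x" if "x \<in> {0..1}" for x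
    using that by (simp add: the_inv_into_f_eq)
  then have "the_inv_into {0..1} (\<lambda>x. x) \<in> unit_measure \<rightarrow>\<^sub>M unit_measure"
    by (subst measurable_cong[of _ _ "\<lambda>x. x"]) auto
  then show ?thesis using b by (simp add: invertible_measure_preserving_def distr_id2)
qed

lemma imp_comp:
  assumes "\<phi> \<in> invertible_measure_preserving" "\<psi> \<in> invertible_measure_preserving"
  shows "(\<lambda>x. \<phi> (\<psi> x)) \<in> invertible_measure_preserving"
proof -
  have b: "bij_betw \<phi> {0..1} {0..1}" "bij_betw \<psi> {0..1} {0..1}"
    and m: "\<phi> \<in> unit_measure \<rightarrow>\<^sub>M unit_measure" "\<psi> \<in> unit_measure \<rightarrow>\<^sub>M unit_measure"
    and i: "the_inv_into {0..1} \<phi> \<in> unit_measure \<rightarrow>\<^sub>M unit_measure" "the_inv_into {0..1} \<psi> \<in> unit_measure \<rightarrow>\<^sub>M unit_measure"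
    and d: "distr unit_measure unit_measure \<phi> = unit_measure" "distr unit_measure unit_measure \<psi> = unit_measure"
    using assms by (auto simp: invertible_measure_preserving_def)
  have bc: "bij_betw (\<lambda>x. \<phi> (\<psi> x)) {0..1} {0..1}" using bij_betw_trans[OF b(2,1)] by (simp add: o_def)
  have "the_inv_into {0..1} (\<lambda>x. \<phi> (\<psi> x)) x = the_inv_into {0..1} \<psi> (the_inv_into {0..1} \<phi> x)" if "x \<in> {0..1}" for x
  proof (rule the_inv_into_f_eq)
    show "inj_on (\<lambda>x. \<phi> (\<psi> x)) {0..1}" using bc by (rule bij_betw_imp_inj_on)
    have 1: "the_inv_into {0..1} \<phi> x \<in> {0..1}"
      using bij_betw_the_inv_into[OF b(1)] that by (rule bij_betwE[rule_format])
    then show "the_inv_into {0..1} \<psi> (the_inv_into {0..1} \<phi> x) \<in> {0..1}"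
      using bij_betw_the_inv_into[OF b(2)] by (metis bij_betwE)
    show "\<phi> (\<psi> (the_inv_into {0..1} \<psi> (the_inv_into {0..1} \<phi> x))) = x"
      using 1 that b by (simp add: f_the_inv_into_f_bij_betw)
  qed
  then have "the_inv_into {0..1} (\<lambda>x. \<phi> (\<psi> x)) \<in> unit_measure \<rightarrow>\<^sub>M unit_measure"
    using i by (subst measurable_cong[of _ _ "\<lambda>x. the_inv_into {0..1} \<psi> (the_inv_into {0..1} \<phi> x)"]) auto
  moreover have "distr unit_measure unit_measure (\<lambda>x. \<phi> (\<psi> x)) = unit_measure"
    using distr_distr[OF m] d by (simp add: o_def)
  ultimately show ?thesis using bc m by (simp add: invertible_measure_preserving_def)
qed

lemma imp_inverse:
  assumes "\<phi> \<in> invertible_measure_preserving"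
  shows "\<exists>\<psi>\<in>invertible_measure_preserving. \<forall>x\<in>{0..1}. \<phi> (\<psi> x) = x \<and> \<psi> (\<phi> x) = x"
proof -
  have b: "bij_betw \<phi> {0..1} {0..1}"
    and m: "\<phi> \<in> unit_measure \<rightarrow>\<^sub>M unit_measure"
    and i: "the_inv_into {0..1} \<phi> \<in> unit_measure \<rightarrow>\<^sub>M unit_measure"
    and d: "distr unit_measure unit_measure \<phi> = unit_measure"
    using assms by (auto simp: invertible_measure_preserving_def)
  define \<psi> where "\<psi> = the_inv_into {0..1} \<phi>"
  have inv: "\<phi> (\<psi> x) = x" "\<psi> (\<phi> x) = x" if "x \<in> {0..1}" for x
    unfolding \<psi>_def using that b by (auto simp: f_the_inv_into_f_bij_betw the_inv_into_f_f bij_betw_imp_inj_on)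
  have b': "bij_betw \<psi> {0..1} {0..1}" unfolding \<psi>_def by (rule bij_betw_the_inv_into[OF b])
  have "the_inv_into {0..1} \<psi> x = \<phi> x" if "x \<in> {0..1}" for x
    using that b b' inv by (intro the_inv_into_f_eq) (auto simp: bij_betw_imp_inj_on dest: bij_betwE)
  then have "the_inv_into {0..1} \<psi> \<in> unit_measure \<rightarrow>\<^sub>M unit_measure"
    using m by (subst measurable_cong[of _ _ \<phi>]) auto
  moreover have "distr unit_measure unit_measure \<psi> = unit_measure"
  proof -
    have "distr unit_measure unit_measure \<psi> = distr (distr unit_measure unit_measure \<phi>) unit_measure \<psi>" by (simp add: d)
    also have "\<dots> = distr unit_measure unit_measure (\<psi> \<circ> \<phi>)" using m i by (intro distr_distr) (simp_all add: \<psi>_def)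
    also have "\<dots> = distr unit_measure unit_measure (\<lambda>x. x)" using inv by (intro distr_cong) auto
    finally show ?thesis by (simp add: distr_id2)
  qed
  ultimately have "\<psi> \<in> invertible_measure_preserving"
    using b' i by (simp add: invertible_measure_preserving_def \<psi>_def)
  then show ?thesis using inv by blast
qed

abbreviation pull :: "(real \<Rightarrow> real) \<Rightarrow> (real \<times> real \<Rightarrow> real) \<Rightarrow> real \<times> real \<Rightarrow> real" where
  "pull \<phi> U \<equiv> (\<lambda>z. U (\<phi> (fst z), \<phi> (snd z)))"

lemma kernel_pull:
  assumes "\<phi> \<in> invertible_measure_preserving" "unit_kernel U"
  shows "unit_kernel (pull \<phi> U)"
proof -
  have [measurable]: "\<phi> \<in> unit_measure \<rightarrow>\<^sub>M unit_measure" "U \<in> borel_measurable (unit_measure \<Otimes>\<^sub>M unit_measure)"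
    using imp_measurable[OF assms(1)] kernelD[OF assms(2)] by auto
  have "pull \<phi> U \<in> borel_measurable (unit_measure \<Otimes>\<^sub>M unit_measure)" by measurable
  then show ?thesis using assms(2) imp_measurable(3)[OF assms(1)] by (auto simp: unit_kernel_def simp del: atLeastAtMost_iff)
qed

text \<open>Change of variables: \<open>\<phi>\<close> in both coordinates preserves the product
  measure, and the test sets are replaced by their preimages under the inverse
  \<open>\<psi>\<close>.\<close>

lemma ucut_close_pull:
  assumes \<phi>: "\<phi> \<in> invertible_measure_preserving" and K: "unit_kernel U" "unit_kernel V" and UV: "ucut_close U V b"
  shows "ucut_close (pull \<phi> U) (pull \<phi> V) b"
proof -
  let ?M = "unit_measure \<Otimes>\<^sub>M unit_measure"
  note [measurable] = kernelD(1)[OF K(1)] kernelD(1)[OF K(2)]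
  obtain \<psi> where \<psi>: "\<psi> \<in> invertible_measure_preserving" and inv: "\<And>x. x \<in> {0..1} \<Longrightarrow> \<phi> (\<psi> x) = x \<and> \<psi> (\<phi> x) = x"
    using imp_inverse[OF \<phi>] by blast
  have m[measurable]: "\<phi> \<in> unit_measure \<rightarrow>\<^sub>M unit_measure" by (rule imp_measurable[OF \<phi>])
  have "distr unit_measure unit_measure \<phi> \<Otimes>\<^sub>M distr unit_measure unit_measure \<phi> =
      distr ?M ?M (\<lambda>(x, y). (\<phi> x, \<phi> y))"
    using imp_measurable(2)[OF \<phi>] unit.sigma_finite_measure_axioms by (intro pair_measure_distr m) simp
  then have D: "distr ?M ?M (\<lambda>(x, y). (\<phi> x, \<phi> y)) = ?M" by (simp add: imp_measurable(2)[OF \<phi>])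
  show ?thesis unfolding cut_close_def
  proof (intro ballI)
    fix S T assume ST: "S \<in> sets unit_measure" "T \<in> sets unit_measure"
    define S' T' where "S' = \<psi> -` S \<inter> space unit_measure" and "T' = \<psi> -` T \<inter> space unit_measure"
    have ST': "S' \<in> sets unit_measure" "T' \<in> sets unit_measure"
      unfolding S'_def T'_def using ST measurable_sets[OF imp_measurable(1)[OF \<psi>]] by blast+
    have "(\<integral>z. indicator (S' \<times> T') z * (U z - V z) \<partial>?M) =
       (\<integral>z. indicator (S' \<times> T') z * (U z - V z) \<partial>distr ?M ?M (\<lambda>(x, y). (\<phi> x, \<phi> y)))" by (simp only: D)
    also have "\<dots> = (\<integral>z. indicator (S' \<times> T') (\<phi> (fst z), \<phi> (snd z)) * (pull \<phi> U z - pull \<phi> V z) \<partial>?M)"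
      using ST' by (subst integral_distr) (auto simp: case_prod_beta)
    also have "\<dots> = (\<integral>z. indicator (S \<times> T) z * (pull \<phi> U z - pull \<phi> V z) \<partial>?M)"
    proof (rule Bochner_Integration.integral_cong[OF refl])
      fix z assume "z \<in> space ?M"
      then have z: "fst z \<in> {0..1}" "snd z \<in> {0..1}" unfolding space_unit2 by auto
      have "(\<phi> (fst z), \<phi> (snd z)) \<in> S' \<times> T' \<longleftrightarrow> z \<in> S \<times> T"
        using inv[OF z(1)] inv[OF z(2)] imp_measurable(3)[OF \<phi> z(1)] imp_measurable(3)[OF \<phi> z(2)]
        unfolding S'_def T'_def mem_Sigma_iff mem_Times_iff by simp
      then have "indicator (S' \<times> T') (\<phi> (fst z), \<phi> (snd z)) = (indicator (S \<times> T) z :: real)"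
        unfolding indicator_def by (simp only:)
      then show "indicator (S' \<times> T') (\<phi> (fst z), \<phi> (snd z)) * (pull \<phi> U z - pull \<phi> V z) =
          indicator (S \<times> T) z * (pull \<phi> U z - pull \<phi> V z)" by (simp only:)
    qed
    finally have eq: "(\<integral>z. indicator (S' \<times> T') z * (U z - V z) \<partial>?M) =
        (\<integral>z. indicator (S \<times> T) z * (pull \<phi> U z - pull \<phi> V z) \<partial>?M)" .
    have "\<bar>\<integral>z. indicator (S' \<times> T') z * (U z - V z) \<partial>?M\<bar> \<le> b"
      using UV ST' unfolding cut_close_def by blast
    then show "\<bar>\<integral>z. indicator (S \<times> T) z * (pull \<phi> U z - pull \<phi> V z) \<partial>?M\<bar> \<le> b"
      unfolding eq .
  qed
qed

text \<open>The infimum in \<open>fun_cut_dist\<close> moves only the second kernel; a motion of the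
  first one is undone by pulling both back along its inverse.\<close>

lemma fun_cut_dist_le:
  assumes K: "unit_kernel U" "unit_kernel V" and \<phi>: "\<phi> \<in> invertible_measure_preserving" "\<psi> \<in> invertible_measure_preserving"
    and c: "ucut_close (pull \<phi> U) (pull \<psi> V) b"
  shows "fun_cut_dist U V \<le> b"
proof -
  obtain \<eta> where \<eta>: "\<eta> \<in> invertible_measure_preserving" and inv: "\<And>x. x \<in> {0..1} \<Longrightarrow> \<phi> (\<eta> x) = x \<and> \<eta> (\<phi> x) = x"
    using imp_inverse[OF \<phi>(1)] by blast
  define \<theta> where "\<theta> x = \<psi> (\<eta> x)" for x
  have \<theta>: "\<theta> \<in> invertible_measure_preserving" unfolding \<theta>_def by (rule imp_comp[OF \<phi>(2) \<eta>])
  have "ucut_close (pull \<eta> (pull \<phi> U)) (pull \<eta> (pull \<psi> V)) b"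
    by (intro ucut_close_pull \<eta> kernel_pull \<phi> K c)
  moreover have "cut_norm (\<lambda>(x, y). U (x, y) - V (\<theta> x, \<theta> y)) \<le> b \<longleftrightarrow> ucut_close (pull \<eta> (pull \<phi> U)) (pull \<eta> (pull \<psi> V)) b"
    by (intro cut_norm_le_iff kernel_pull \<eta> \<phi> K) (auto simp: \<theta>_def inv simp del: atLeastAtMost_iff)
  ultimately have le: "cut_norm (\<lambda>(x, y). U (x, y) - V (\<theta> x, \<theta> y)) \<le> b" by simp
  have "bdd_below ((\<lambda>\<phi>. cut_norm (\<lambda>(x, y). U (x, y) - V (\<phi> x, \<phi> y))) ` invertible_measure_preserving)"
  proof (rule bdd_belowI2[of _ 0])
    fix \<phi> :: "real \<Rightarrow> real" assume \<phi>: "\<phi> \<in> invertible_measure_preserving"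
    have "ucut_close U (pull \<phi> V) (cut_norm (\<lambda>(x, y). U (x, y) - V (\<phi> x, \<phi> y)))"
      by (subst cut_norm_le_iff[symmetric, OF K(1) kernel_pull[OF \<phi> K(2)], where W = "\<lambda>(x, y). U (x, y) - V (\<phi> x, \<phi> y)"]) auto
    then show "0 \<le> cut_norm (\<lambda>(x, y). U (x, y) - V (\<phi> x, \<phi> y))"
      by (auto simp: cut_close_def dest!: bspec[of _ _ "{}"])
  qed
  then have "fun_cut_dist U V \<le> cut_norm (\<lambda>(x, y). U (x, y) - V (\<theta> x, \<theta> y))"
    unfolding fun_cut_dist_def by (rule cINF_lower[OF _ \<theta>])
  then show ?thesis using le by simp
qed

lemma fun_cut_dist_less:
  assumes K: "unit_kernel U" "unit_kernel V" and "fun_cut_dist U V < b"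
  shows "\<exists>\<phi>\<in>invertible_measure_preserving. ucut_close U (pull \<phi> V) b"
proof -
  have "\<exists>\<phi>\<in>invertible_measure_preserving. cut_norm (\<lambda>(x, y). U (x, y) - V (\<phi> x, \<phi> y)) < b"
  proof (rule ccontr)
    assume "\<not> ?thesis"
    then have "b \<le> fun_cut_dist U V"
      unfolding fun_cut_dist_def using imp_id by (intro cINF_greatest) (auto simp: not_less)
    then show False using assms by simp
  qed
  then obtain \<phi> where \<phi>: "\<phi> \<in> invertible_measure_preserving" and "cut_norm (\<lambda>(x, y). U (x, y) - V (\<phi> x, \<phi> y)) < b" by blast
  then have "cut_norm (\<lambda>(x, y). U (x, y) - V (\<phi> x, \<phi> y)) \<le> b" by simp
  then have "ucut_close U (pull \<phi> V) b"
    by (subst cut_norm_le_iff[symmetric, OF K(1) kernel_pull[OF \<phi> K(2)], where W = "\<lambda>(x, y). U (x, y) - V (\<phi> x, \<phi> y)"]) auto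
  then show ?thesis using \<phi> by blast
qed

text \<open>Almost optimal overlays are composed, after the second closeness has been pulled back
  along the first map.\<close>

lemma fun_cut_dist_triangle:
  assumes K: "unit_kernel U" "unit_kernel V" "unit_kernel W"
  shows "fun_cut_dist U W \<le> fun_cut_dist U V + fun_cut_dist V W"
proof (rule field_le_epsilon)
  fix e :: real assume e: "e > 0"
  obtain \<phi> where \<phi>: "\<phi> \<in> invertible_measure_preserving" and 1: "ucut_close U (pull \<phi> V) (fun_cut_dist U V + e / 2)"
    using fun_cut_dist_less[OF K(1,2), of "fun_cut_dist U V + e / 2"] e by auto
  obtain \<psi> where \<psi>: "\<psi> \<in> invertible_measure_preserving" and 2: "ucut_close V (pull \<psi> W) (fun_cut_dist V W + e / 2)"
    using fun_cut_dist_less[OF K(2,3), of "fun_cut_dist V W + e / 2"] e by auto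
  have "ucut_close (pull \<phi> V) (pull \<phi> (pull \<psi> W)) (fun_cut_dist V W + e / 2)"
    by (intro ucut_close_pull \<phi> \<psi> K kernel_pull 2)
  from ucut_close_trans[OF K(1) kernel_pull[OF \<phi> K(2)] kernel_pull[OF \<phi> kernel_pull[OF \<psi> K(3)]] 1 this]
  have "ucut_close U (pull \<phi> (pull \<psi> W)) (fun_cut_dist U V + e / 2 + (fun_cut_dist V W + e / 2))" .
  then have "fun_cut_dist U W \<le> fun_cut_dist U V + e / 2 + (fun_cut_dist V W + e / 2)"
    by (intro fun_cut_dist_le[OF K(1,3) imp_id imp_comp[OF \<psi> \<phi>]]) simp
  then show "fun_cut_dist U W \<le> fun_cut_dist U V + fun_cut_dist V W + e" by simp
qed

lemma fun_cut_dist_sym: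
  assumes K: "unit_kernel U" "unit_kernel V"
  shows "fun_cut_dist V U \<le> fun_cut_dist U V"
proof (rule field_le_epsilon)
  fix e :: real assume e: "e > 0"
  obtain \<phi> where \<phi>: "\<phi> \<in> invertible_measure_preserving" and 1: "ucut_close U (pull \<phi> V) (fun_cut_dist U V + e)"
    using fun_cut_dist_less[OF K, of "fun_cut_dist U V + e"] e by auto
  show "fun_cut_dist V U \<le> fun_cut_dist U V + e"
    using ucut_close_sym[OF 1] by (intro fun_cut_dist_le[OF K(2,1) \<phi> imp_id]) simp
qed

section \<open>Graphs as kernels\<close>

text \<open>Index, counted from 0, of the cell that contains \<open>x\<close>; the ceiling fits
  cells that are open on the left. At \<open>x = 0\<close>, which lies in no cell, truncation by
  \<open>nat\<close> gives 0.\<close>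

definition idx :: "nat \<Rightarrow> real \<Rightarrow> nat" where
  "idx n x = nat (\<lceil>real n * x\<rceil> - 1)"

definition cell :: "nat \<Rightarrow> nat \<Rightarrow> real set" where
  "cell n i = {real i / real n<..real (Suc i) / real n}"

lemma idx_eq_iff: "0 < n \<Longrightarrow> 0 < x \<Longrightarrow> idx n x = i \<longleftrightarrow> x \<in> cell n i"
proof -
  assume n: "0 < n" and x: "0 < x"
  have "\<lceil>real n * x\<rceil> \<ge> 1" using n x by (simp add: one_le_ceiling)
  then have "idx n x = i \<longleftrightarrow> \<lceil>real n * x\<rceil> = int i + 1" by (auto simp: idx_def)
  also have "\<dots> \<longleftrightarrow> real i < real n * x \<and> real n * x \<le> real i + 1" by (simp add: ceiling_eq_iff)
  also have "\<dots> \<longleftrightarrow> x \<in> cell n i" using n by (simp add: cell_def field_simps)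
  finally show ?thesis .
qed

lemma idx_less: "0 < n \<Longrightarrow> x \<le> 1 \<Longrightarrow> idx n x < n"
proof -
  assume n: "0 < n" and x: "x \<le> 1"
  have "\<lceil>real n * x\<rceil> \<le> int n" using n x by (simp add: ceiling_le_iff mult_left_le)
  then show ?thesis using n by (simp add: idx_def)
qed

lemma cell_subset: "0 < n \<Longrightarrow> i < n \<Longrightarrow> cell n i \<subseteq> {0<..1}"
proof
  fix x assume n: "0 < n" "i < n" "x \<in> cell n i"
  have "0 \<le> real i / real n" by simp
  moreover have "real (Suc i) / real n \<le> 1" using n by simp
  moreover have "real i / real n < x" "x \<le> real (Suc i) / real n"
    using n(3) by (simp_all add: cell_def del: of_nat_Suc)
  ultimately have "0 < x" "x \<le> 1" by linarith+
  then show "x \<in> {0<..1}" by simp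
qed

lemma cell_cover: "0 < n \<Longrightarrow> 0 < x \<Longrightarrow> x \<le> 1 \<Longrightarrow> x \<in> cell n (idx n x)"
  using idx_eq_iff by blast

lemma cell_sets: "0 < n \<Longrightarrow> i < n \<Longrightarrow> cell n i \<in> sets unit_measure"
  using cell_subset[of n i] by (force simp: sets_unit_iff cell_def)

lemma measurable_idx [measurable]: "idx n \<in> unit_measure \<rightarrow>\<^sub>M count_space UNIV"
proof -
  have "idx n \<in> lborel \<rightarrow>\<^sub>M count_space UNIV" unfolding idx_def by measurable
  then show ?thesis by (intro measurable_restrict_space1 measurable_completion)
qed

lemma AE_unit_pos: "AE x in unit_measure. 0 < x"
proof (rule AE_I')
  show "{0} \<in> null_sets unit_measure"
    by (auto simp: null_sets_def sets_unit_iff emeasure_restrict_space)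
qed auto

lemma unit_measure_eq: "A \<in> sets unit_measure \<Longrightarrow> unit.prob A = measure lebesgue A"
  by (subst measure_restrict_space) (auto simp: sets_unit_iff)

lemma prob_idx:
  assumes "i < n"
  shows "unit.prob {x \<in> space unit_measure. idx n x = i} = 1 / real n"
proof -
  have n: "0 < n" using assms by simp
  have [measurable]: "cell n i \<in> sets unit_measure" by (rule cell_sets[OF n assms])
  have "unit.prob {x \<in> space unit_measure. idx n x = i} = unit.prob (cell n i)"
  proof (rule measure_eq_AE)
    show "AE x in unit_measure. x \<in> {x \<in> space unit_measure. idx n x = i} \<longleftrightarrow> x \<in> cell n i"
      using AE_unit_pos AE_space by eventually_elim (use idx_eq_iff[OF n] in auto)
  qed measurable
  also have "\<dots> = measure lebesgue (cell n i)" by (rule unit_measure_eq) (rule cell_sets[OF n assms])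
  also have "\<dots> = 1 / real n" using n by (simp add: cell_def divide_right_mono diff_divide_distrib[symmetric])
  finally show ?thesis .
qed

section \<open>Interval exchanges that permute the cells\<close>

lemma prob_split_cells:
  assumes n: "0 < n" and A: "A \<in> sets unit_measure"
  shows "unit.prob A = (\<Sum>i<n. unit.prob (A \<inter> cell n i))"
proof -
  have "unit.prob A = unit.prob (\<Union>i<n. A \<inter> cell n i)"
  proof (rule measure_eq_AE)
    show "AE x in unit_measure. x \<in> A \<longleftrightarrow> x \<in> (\<Union>i<n. A \<inter> cell n i)"
      using AE_unit_pos AE_space
      by eventually_elim (use cell_cover[OF n] idx_less[OF n] in auto)
  qed (use A cell_sets[OF n] in auto)
  also have "\<dots> = (\<Sum>i<n. unit.prob (A \<inter> cell n i))"
  proof (rule unit.finite_measure_finite_Union)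
    show "disjoint_family_on (\<lambda>i. A \<inter> cell n i) {..<n}"
      unfolding disjoint_family_on_def
    proof (intro ballI impI)
      fix i j assume ij: "i \<in> {..<n}" "j \<in> {..<n}" "i \<noteq> j"
      have "x \<notin> cell n j" if "x \<in> cell n i" for x
      proof -
        have "0 < x" using that cell_subset[OF n, of i] ij by auto
        then show ?thesis using that idx_eq_iff[OF n, of x i] idx_eq_iff[OF n, of x j] ij(3) by simp
      qed
      then show "(A \<inter> cell n i) \<inter> (A \<inter> cell n j) = {}" by blast
    qed
  qed (use A cell_sets[OF n] in auto)
  finally show ?thesis .
qed

definition perm_map :: "nat \<Rightarrow> (nat \<Rightarrow> nat) \<Rightarrow> real \<Rightarrow> real" where
  "perm_map n \<sigma> x = (if 0 < x \<and> x \<le> 1 then x + (real (\<sigma> (idx n x)) - real (idx n x)) / real n else x)"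

lemma perm_map_cell:
  assumes n: "0 < n" and i: "i < n" and x: "x \<in> cell n i"
  shows "perm_map n \<sigma> x = x + (real (\<sigma> i) - real i) / real n" "perm_map n \<sigma> x \<in> cell n (\<sigma> i)"
proof -
  have "0 < x" "x \<le> 1" using cell_subset[OF n i] x by auto
  moreover from this have "idx n x = i" using idx_eq_iff[OF n] x by simp
  ultimately show e: "perm_map n \<sigma> x = x + (real (\<sigma> i) - real i) / real n" by (simp add: perm_map_def)
  show "perm_map n \<sigma> x \<in> cell n (\<sigma> i)" using x unfolding e cell_def by (simp add: diff_divide_distrib add_divide_distrib)
qed

lemma perm_map_inverse:
  assumes n: "0 < n" and \<sigma>: "bij_betw \<sigma> {..<n} {..<n}" and \<tau>: "\<And>i. i < n \<Longrightarrow> \<tau> (\<sigma> i) = i"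
    and x: "x \<in> {0..1}"
  shows "perm_map n \<tau> (perm_map n \<sigma> x) = x" "perm_map n \<sigma> x \<in> {0..1}"
proof -
  show "perm_map n \<tau> (perm_map n \<sigma> x) = x"
  proof (cases "x = 0")
    case False
    define i where "i = idx n x"
    have i: "i < n" "x \<in> cell n i" using x False idx_less[OF n] cell_cover[OF n] by (auto simp: i_def)
    have si: "\<sigma> i < n" using i \<sigma> by (auto dest: bij_betwE)
    show ?thesis
      using perm_map_cell[OF n i, of \<sigma>] perm_map_cell(1)[OF n si, of "perm_map n \<sigma> x" \<tau>] \<tau>[OF i(1)]
      by (simp add: field_simps diff_divide_distrib)
  qed (simp add: perm_map_def)
  show "perm_map n \<sigma> x \<in> {0..1}"
  proof (cases "x = 0")
    case False
    define i where "i = idx n x"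
    have i: "i < n" "x \<in> cell n i" using x False idx_less[OF n] cell_cover[OF n] by (auto simp: i_def)
    have si: "\<sigma> i < n" using i \<sigma> by (auto dest: bij_betwE)
    show ?thesis using perm_map_cell(2)[OF n i, of \<sigma>] cell_subset[OF n si] by auto
  qed (simp add: perm_map_def)
qed

text \<open>Within each cell the preimage is a translate, and the cells cover the unit interval up
  to the point 0, which is fixed.\<close>

lemma perm_map_measure:
  assumes n: "0 < n" and \<sigma>: "bij_betw \<sigma> {..<n} {..<n}" and A: "A \<in> sets unit_measure"
  shows "perm_map n \<sigma> -` A \<inter> {0..1} \<in> sets unit_measure"
    "unit.prob (perm_map n \<sigma> -` A \<inter> {0..1}) = unit.prob A"
proof -
  let ?P = "perm_map n \<sigma> -` A \<inter> {0..1}"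
  have s: "\<sigma> i < n" if "i < n" for i using that \<sigma> by (auto dest: bij_betwE)
  have piece: "?P \<inter> cell n i = (+) (- ((real (\<sigma> i) - real i) / real n)) ` (A \<inter> cell n (\<sigma> i))" if i: "i < n" for i
  proof (intro equalityI subsetI)
    fix x assume "x \<in> ?P \<inter> cell n i"
    then show "x \<in> (+) (- ((real (\<sigma> i) - real i) / real n)) ` (A \<inter> cell n (\<sigma> i))"
      using perm_map_cell[OF n i, of x \<sigma>] by (intro image_eqI[of _ _ "perm_map n \<sigma> x"]) auto
  next
    fix x assume "x \<in> (+) (- ((real (\<sigma> i) - real i) / real n)) ` (A \<inter> cell n (\<sigma> i))"
    then obtain y where y: "y \<in> A" "y \<in> cell n (\<sigma> i)" "x = y - (real (\<sigma> i) - real i) / real n" by auto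
    have x: "x \<in> cell n i" using y n unfolding cell_def by (simp add: field_simps)
    have "perm_map n \<sigma> x = y" using perm_map_cell(1)[OF n i x, of \<sigma>] y by simp
    then show "x \<in> ?P \<inter> cell n i" using x y cell_subset[OF n i] by auto
  qed
  have Ac: "A \<inter> cell n i \<in> sets unit_measure" if "i < n" for i
    using A cell_sets[OF n that] by auto
  have pm: "?P \<inter> cell n i \<in> sets unit_measure" if i: "i < n" for i
  proof -
    have "?P \<inter> cell n i \<in> sets lebesgue"
      unfolding piece[OF i] using Ac[OF s[OF i]] by (intro lebesgue_sets_translation) (simp add: sets_unit_iff)
    then show ?thesis by (auto simp: sets_unit_iff)
  qed
  have "?P = (A \<inter> {0}) \<union> (\<Union>i<n. ?P \<inter> cell n i)"
  proof (intro equalityI subsetI)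
    fix x assume x: "x \<in> ?P"
    show "x \<in> (A \<inter> {0}) \<union> (\<Union>i<n. ?P \<inter> cell n i)"
    proof (cases "x = 0")
      case True
      then show ?thesis using x by (simp add: perm_map_def)
    next
      case False
      then show ?thesis using x idx_less[OF n, of x] cell_cover[OF n, of x] by auto
    qed
  next
    fix x assume "x \<in> (A \<inter> {0}) \<union> (\<Union>i<n. ?P \<inter> cell n i)"
    then show "x \<in> ?P" by (auto simp: perm_map_def)
  qed
  also have "\<dots> \<in> sets unit_measure"
  proof (intro sets.Un sets.finite_UN)
    show "A \<inter> {0} \<in> sets unit_measure" using A by (auto simp: sets_unit_iff)
  qed (use pm in auto)
  finally show P: "?P \<in> sets unit_measure" .
  have "unit.prob ?P = (\<Sum>i<n. unit.prob (?P \<inter> cell n i))" by (rule prob_split_cells[OF n P])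
  also have "\<dots> = (\<Sum>i<n. unit.prob (A \<inter> cell n (\<sigma> i)))"
  proof (rule sum.cong[OF refl])
    fix i assume "i \<in> {..<n}"
    then have i: "i < n" by simp
    have "unit.prob (?P \<inter> cell n i) = measure lebesgue (?P \<inter> cell n i)" by (rule unit_measure_eq[OF pm[OF i]])
    also have "\<dots> = measure lebesgue (A \<inter> cell n (\<sigma> i))" unfolding piece[OF i] by (rule measure_translation)
    also have "\<dots> = unit.prob (A \<inter> cell n (\<sigma> i))" by (rule unit_measure_eq[OF Ac[OF s[OF i]], symmetric])
    finally show "unit.prob (?P \<inter> cell n i) = unit.prob (A \<inter> cell n (\<sigma> i))" .
  qed
  also have "\<dots> = (\<Sum>i<n. unit.prob (A \<inter> cell n i))"
    using sum.reindex_bij_betw[OF \<sigma>, of "\<lambda>i. unit.prob (A \<inter> cell n i)"] by simp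
  also have "\<dots> = unit.prob A" by (rule prob_split_cells[OF n A, symmetric])
  finally show "unit.prob ?P = unit.prob A" .
qed

lemma perm_map_imp:
  assumes n: "0 < n" and \<sigma>: "bij_betw \<sigma> {..<n} {..<n}"
  shows "perm_map n \<sigma> \<in> invertible_measure_preserving"
proof -
  define \<tau> where "\<tau> = the_inv_into {..<n} \<sigma>"
  have \<tau>: "bij_betw \<tau> {..<n} {..<n}" unfolding \<tau>_def by (rule bij_betw_the_inv_into[OF \<sigma>])
  have 1: "\<tau> (\<sigma> i) = i" if "i < n" for i
    using that \<sigma> by (simp add: \<tau>_def the_inv_into_f_f bij_betw_imp_inj_on)
  have 2: "\<sigma> (\<tau> i) = i" if "i < n" for i
    using that f_the_inv_into_f_bij_betw[OF \<sigma>] by (simp add: \<tau>_def)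
  have b: "bij_betw (perm_map n \<sigma>) {0..1} {0..1}"
    by (rule bij_betwI[of _ _ _ "perm_map n \<tau>"])
      (use perm_map_inverse[OF n \<sigma> 1] perm_map_inverse[OF n \<tau> 2] in auto)
  have m: "perm_map n \<rho> \<in> unit_measure \<rightarrow>\<^sub>M unit_measure" if "bij_betw \<rho> {..<n} {..<n}"
    "\<And>x. x \<in> {0..1} \<Longrightarrow> perm_map n \<rho> x \<in> {0..1}" for \<rho>
  proof (rule measurableI)
    fix A assume "A \<in> sets unit_measure"
    from perm_map_measure(1)[OF n that(1) this]
    show "perm_map n \<rho> -` A \<inter> space unit_measure \<in> sets unit_measure" by simp
  qed (use that(2) in simp)
  have m1: "perm_map n \<sigma> \<in> unit_measure \<rightarrow>\<^sub>M unit_measure" by (rule m[OF \<sigma> perm_map_inverse(2)[OF n \<sigma> 1]])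
  have m2: "perm_map n \<tau> \<in> unit_measure \<rightarrow>\<^sub>M unit_measure" by (rule m[OF \<tau> perm_map_inverse(2)[OF n \<tau> 2]])
  have "the_inv_into {0..1} (perm_map n \<sigma>) x = perm_map n \<tau> x" if x: "x \<in> {0..1}" for x
    using perm_map_inverse[OF n \<tau> 2 x] by (intro the_inv_into_f_eq bij_betw_imp_inj_on[OF b])
  then have "the_inv_into {0..1} (perm_map n \<sigma>) \<in> unit_measure \<rightarrow>\<^sub>M unit_measure"
    using m2 by (subst measurable_cong[of _ _ "perm_map n \<tau>"]) auto
  moreover have "distr unit_measure unit_measure (perm_map n \<sigma>) = unit_measure"
  proof (rule measure_eqI)
    fix A assume "A \<in> sets (distr unit_measure unit_measure (perm_map n \<sigma>))"
    then have A: "A \<in> sets unit_measure" by simp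
    have "emeasure (distr unit_measure unit_measure (perm_map n \<sigma>)) A = emeasure unit_measure (perm_map n \<sigma> -` A \<inter> {0..1})"
      by (subst emeasure_distr[OF m1 A]) simp
    also have "\<dots> = emeasure unit_measure A"
      unfolding unit.emeasure_eq_measure using perm_map_measure(2)[OF n \<sigma> A] by simp
    finally show "emeasure (distr unit_measure unit_measure (perm_map n \<sigma>)) A = emeasure unit_measure A" .
  qed simp
  ultimately show ?thesis using b m1 by (simp add: invertible_measure_preserving_def)
qed

section \<open>Step kernels of graphs\<close>

definition adj :: "ugraph \<Rightarrow> nat \<Rightarrow> nat \<Rightarrow> real" where
  "adj G u v = (if {u, v} \<in> edges G then 1 else 0)"

text \<open>The step kernel for an arbitrary enumeration \<open>e\<close> of the nodes.
  \<open>graph_fun\<close> is tied to the increasing one, whereas the arguments about partitions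
  need the nodes sorted by class.\<close>

definition gker :: "ugraph \<Rightarrow> (nat \<Rightarrow> nat) \<Rightarrow> real \<times> real \<Rightarrow> real" where
  "gker G e z = adj G (e (idx (card (nodes G)) (fst z))) (e (idx (card (nodes G)) (snd z)))"

lemma kernel_step:
  fixes F :: "nat \<Rightarrow> nat \<Rightarrow> real"
  assumes "c \<in> unit_measure \<rightarrow>\<^sub>M count_space UNIV" "\<And>i j. 0 \<le> F i j \<and> F i j \<le> 1"
  shows "unit_kernel (\<lambda>z. F (c (fst z)) (c (snd z)))"
proof -
  have [measurable]: "c \<in> unit_measure \<rightarrow>\<^sub>M count_space UNIV" by fact
  have "(\<lambda>z. F (c (fst z)) (c (snd z))) \<in> borel_measurable (unit_measure \<Otimes>\<^sub>M unit_measure)" by measurable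
  then show ?thesis using assms(2) by (simp add: unit_kernel_def)
qed

lemma kernel_gker: "unit_kernel (gker G e)"
  unfolding gker_def using kernel_step[of "\<lambda>x. e (idx (card (nodes G)) x)" "adj G"]
  by (simp add: adj_def)

lemma graph_fun_cell:
  assumes "i < card (nodes G)" "j < card (nodes G)" "x \<in> cell (card (nodes G)) i" "y \<in> cell (card (nodes G)) j"
  shows "graph_fun G (x, y) = adj G (sorted_list_of_set (nodes G) ! i) (sorted_list_of_set (nodes G) ! j)"
proof -
  let ?n = "card (nodes G)"
  have n: "0 < ?n" using assms(1) by simp
  have x: "0 < x" "idx ?n x = i" and y: "0 < y" "idx ?n y = j"
    using assms cell_subset[OF n assms(1)] cell_subset[OF n assms(2)] idx_eq_iff[OF n, of x i] idx_eq_iff[OF n, of y j]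
    by auto
  \<comment> \<open>\<open>graph_fun\<close> counts the intervals from 1, \<open>idx\<close> counts
    them from 0.\<close>
  have cl: "z \<in> {(real l - 1) / real ?n<..real l / real ?n} \<longleftrightarrow> l = Suc (idx ?n z)" if "0 < z" "l \<in> {1..?n}" for z l
  proof -
    have "{(real l - 1) / real ?n<..real l / real ?n} = cell ?n (l - 1)"
      using that by (auto simp: cell_def of_nat_diff)
    moreover have "idx ?n z = l - 1 \<longleftrightarrow> l = Suc (idx ?n z)" using that(2) by simp arith
    ultimately show ?thesis unfolding idx_eq_iff[OF n that(1)] by (simp only:)
  qed
  have "(\<exists>i\<in>{1..?n}. \<exists>j\<in>{1..?n}.
          x \<in> {(real i - 1) / real ?n<..real i / real ?n} \<and>
          y \<in> {(real j - 1) / real ?n<..real j / real ?n} \<and>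
          {sorted_list_of_set (nodes G) ! (i - 1), sorted_list_of_set (nodes G) ! (j - 1)} \<in> edges G) \<longleftrightarrow>
     (\<exists>i'\<in>{1..?n}. \<exists>j'\<in>{1..?n}. i' = Suc i \<and> j' = Suc j \<and>
          {sorted_list_of_set (nodes G) ! (i' - 1), sorted_list_of_set (nodes G) ! (j' - 1)} \<in> edges G)"
    by (intro bex_cong refl) (simp only: cl[OF x(1)] cl[OF y(1)] x(2) y(2))
  also have "\<dots> \<longleftrightarrow> {sorted_list_of_set (nodes G) ! i, sorted_list_of_set (nodes G) ! j} \<in> edges G"
    using assms(1,2) by auto
  finally show ?thesis by (simp add: graph_fun_def Let_def adj_def)
qed

lemma kernel_graph_fun: "unit_kernel (graph_fun G)"
proof -
  let ?n = "card (nodes G)" and ?vs = "sorted_list_of_set (nodes G)"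
  define V where "V = (\<lambda>z :: real \<times> real. if 0 < fst z \<and> 0 < snd z \<and> 0 < ?n then adj G (?vs ! idx ?n (fst z)) (?vs ! idx ?n (snd z)) else 0)"
  have eq: "graph_fun G z = V z" if z: "z \<in> {0..1} \<times> {0..1}" for z
  proof -
    obtain x y where xy: "z = (x, y)" by (cases z)
    show ?thesis
    proof (cases "0 < x \<and> 0 < y \<and> 0 < ?n")
      case True
      then show ?thesis using z xy graph_fun_cell[OF idx_less[of ?n x] idx_less[of ?n y] cell_cover[of ?n x] cell_cover[of ?n y]]
        by (simp add: V_def)
    next
      case False
      have "\<not> (\<exists>i\<in>{1..?n}. \<exists>j\<in>{1..?n}. x \<in> {(real i - 1) / real ?n<..real i / real ?n} \<and>
          y \<in> {(real j - 1) / real ?n<..real j / real ?n} \<and> {?vs ! (i - 1), ?vs ! (j - 1)} \<in> edges G)"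
      proof safe
        fix i j assume ij: "i \<in> {1..?n}" "j \<in> {1..?n}" "x \<in> {(real i - 1) / real ?n<..real i / real ?n}"
          "y \<in> {(real j - 1) / real ?n<..real j / real ?n}"
        then have "0 \<le> (real i - 1) / real ?n" "0 \<le> (real j - 1) / real ?n" by simp_all
        moreover have "(real i - 1) / real ?n < x" "(real j - 1) / real ?n < y" "0 < ?n" using ij by auto
        ultimately have "0 < x" "0 < y" "0 < ?n" by linarith+
        then show False using False by simp
      qed
      then show ?thesis using False xy by (auto simp: graph_fun_def Let_def V_def)
    qed
  qed
  have "V \<in> borel_measurable (unit_measure \<Otimes>\<^sub>M unit_measure)"
  proof -
    have [measurable]: "(\<lambda>x. x) \<in> borel_measurable unit_measure"
      by (intro measurable_restrict_space1 measurable_completion) simp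
    have [measurable]: "fst \<in> borel_measurable (unit_measure \<Otimes>\<^sub>M unit_measure)"
      "snd \<in> borel_measurable (unit_measure \<Otimes>\<^sub>M unit_measure)"
      using measurable_compose[OF measurable_fst \<open>(\<lambda>x. x) \<in> borel_measurable unit_measure\<close>]
        measurable_compose[OF measurable_snd \<open>(\<lambda>x. x) \<in> borel_measurable unit_measure\<close>] by simp_all
    have 1: "(\<lambda>z. adj G (?vs ! idx ?n (fst z)) (?vs ! idx ?n (snd z))) \<in> borel_measurable (unit_measure \<Otimes>\<^sub>M unit_measure)"
      by (rule kernelD(1)[OF kernel_step[OF measurable_idx, of "\<lambda>i j. adj G (?vs ! i) (?vs ! j)"]]) (simp add: adj_def)
    show ?thesis unfolding V_def by (intro measurable_If 1 borel_measurable_const) measurable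
  qed
  then have "graph_fun G \<in> borel_measurable (unit_measure \<Otimes>\<^sub>M unit_measure)"
    by (subst measurable_cong[of _ _ V]) (simp_all only: space_unit2 eq)
  moreover have "0 \<le> graph_fun G z \<and> graph_fun G z \<le> 1" for z
    by (cases z) (simp add: graph_fun_def Let_def)
  ultimately show ?thesis by (simp add: unit_kernel_def)
qed

text \<open>The two enumerations differ by a permutation \<open>\<sigma>\<close> of the positions,
  and the corresponding interval exchange turns one kernel into the other off the axes.\<close>

lemma graph_fun_pull:
  assumes n: "0 < card (nodes G)" and e: "bij_betw e {..<card (nodes G)} (nodes G)"
  shows "\<exists>\<phi>\<in>invertible_measure_preserving. ucut_close (pull \<phi> (graph_fun G)) (gker G e) 0"
proof -
  let ?n = "card (nodes G)" and ?vs = "sorted_list_of_set (nodes G)"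
  have fin: "finite (nodes G)" using n card_gt_0_iff by blast
  have vs: "bij_betw ((!) ?vs) {..<?n} (nodes G)"
    using fin by (intro bij_betw_nth) auto
  define \<sigma> where "\<sigma> = the_inv_into {..<?n} ((!) ?vs) \<circ> e"
  have \<sigma>: "bij_betw \<sigma> {..<?n} {..<?n}"
    unfolding \<sigma>_def by (rule bij_betw_trans[OF e bij_betw_the_inv_into[OF vs]])
  have s: "?vs ! \<sigma> i = e i" if "i < ?n" for i
    unfolding \<sigma>_def o_def using that e by (intro f_the_inv_into_f_bij_betw[OF vs]) (auto dest: bij_betwE)
  have \<phi>: "perm_map ?n \<sigma> \<in> invertible_measure_preserving" by (rule perm_map_imp[OF n \<sigma>])
  have "ucut_close (pull (perm_map ?n \<sigma>) (graph_fun G)) (gker G e) 0"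
  proof (rule ucut_close_AE_eq[OF kernel_pull[OF \<phi> kernel_graph_fun] kernel_gker AE_unit_pos])
    fix x y :: real assume "0 < x" "0 < y" "x \<in> {0..1}" "y \<in> {0..1}"
    then have i: "idx ?n x < ?n" "idx ?n y < ?n" and c: "x \<in> cell ?n (idx ?n x)" "y \<in> cell ?n (idx ?n y)"
      using idx_less[OF n] cell_cover[OF n] by auto
    have si: "\<sigma> (idx ?n x) < ?n" "\<sigma> (idx ?n y) < ?n" using i \<sigma> by (auto dest: bij_betwE)
    show "pull (perm_map ?n \<sigma>) (graph_fun G) (x, y) = gker G e (x, y)"
      using graph_fun_cell[OF si perm_map_cell(2)[OF n i(1) c(1), of \<sigma>] perm_map_cell(2)[OF n i(2) c(2), of \<sigma>]] s i
      by (simp add: gker_def)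
  qed
  then show ?thesis using \<phi> by blast
qed

text \<open>By \<open>graph_fun_pull\<close> every enumeration is as good as the increasing one, so
  both can be chosen to suit the comparison.\<close>

lemma cut_dist_le:
  assumes n: "0 < card (nodes G)" "0 < card (nodes H)"
    and e: "bij_betw e {..<card (nodes G)} (nodes G)" "bij_betw e' {..<card (nodes H)} (nodes H)"
    and c: "ucut_close (gker G e) (gker H e') b"
  shows "cut_dist G H \<le> b"
proof -
  obtain \<phi> where \<phi>: "\<phi> \<in> invertible_measure_preserving" "ucut_close (pull \<phi> (graph_fun G)) (gker G e) 0"
    using graph_fun_pull[OF n(1) e(1)] by blast
  obtain \<psi> where \<psi>: "\<psi> \<in> invertible_measure_preserving" "ucut_close (pull \<psi> (graph_fun H)) (gker H e') 0"
    using graph_fun_pull[OF n(2) e(2)] by blast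
  note K = kernel_pull[OF \<phi>(1) kernel_graph_fun] kernel_pull[OF \<psi>(1) kernel_graph_fun]
  have "ucut_close (pull \<phi> (graph_fun G)) (pull \<psi> (graph_fun H)) (0 + b + 0)"
    by (rule ucut_close_trans[OF K(1) kernel_gker K(2) ucut_close_trans[OF K(1) kernel_gker kernel_gker \<phi>(2) c] ucut_close_sym[OF \<psi>(2)]])
  then show ?thesis unfolding cut_dist_def
    by (intro fun_cut_dist_le[OF kernel_graph_fun kernel_graph_fun \<phi>(1) \<psi>(1)]) simp
qed

text \<open>In this direction a measure preserving map remains: it may cut through the cells, so it
  cannot be absorbed into the enumerations.\<close>

lemma cut_dist_less:
  assumes n: "0 < card (nodes G)" "0 < card (nodes H)"
    and e: "bij_betw e {..<card (nodes G)} (nodes G)" "bij_betw e' {..<card (nodes H)} (nodes H)"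
    and c: "cut_dist G H < b"
  shows "\<exists>\<phi>\<in>invertible_measure_preserving. ucut_close (gker G e) (pull \<phi> (gker H e')) b"
proof -
  obtain \<phi> where \<phi>: "\<phi> \<in> invertible_measure_preserving" "ucut_close (pull \<phi> (graph_fun G)) (gker G e) 0"
    using graph_fun_pull[OF n(1) e(1)] by blast
  obtain \<psi> where \<psi>: "\<psi> \<in> invertible_measure_preserving" "ucut_close (pull \<psi> (graph_fun H)) (gker H e') 0"
    using graph_fun_pull[OF n(2) e(2)] by blast
  have "fun_cut_dist (gker G e) (graph_fun G) \<le> 0"
    by (rule fun_cut_dist_le[OF kernel_gker kernel_graph_fun imp_id \<phi>(1)]) (use ucut_close_sym[OF \<phi>(2)] in simp)
  moreover have "fun_cut_dist (graph_fun H) (gker H e') \<le> 0"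
    by (rule fun_cut_dist_le[OF kernel_graph_fun kernel_gker \<psi>(1) imp_id]) (use \<psi>(2) in simp)
  moreover have "fun_cut_dist (gker G e) (gker H e') \<le> fun_cut_dist (gker G e) (graph_fun G) + (fun_cut_dist (graph_fun G) (graph_fun H) + fun_cut_dist (graph_fun H) (gker H e'))"
    using fun_cut_dist_triangle[OF kernel_gker[of G e] kernel_graph_fun[of G] kernel_gker[of H e']]
      fun_cut_dist_triangle[OF kernel_graph_fun[of G] kernel_graph_fun[of H] kernel_gker[of H e']] by linarith
  ultimately have "fun_cut_dist (gker G e) (gker H e') < b" using c by (simp add: cut_dist_def)
  then show ?thesis by (rule fun_cut_dist_less[OF kernel_gker kernel_gker])
qed

lemma cut_dist_triangle: "cut_dist G H \<le> cut_dist G F + cut_dist F H"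
  unfolding cut_dist_def by (intro fun_cut_dist_triangle kernel_graph_fun)

lemma cut_dist_sym: "cut_dist G H = cut_dist H G"
  unfolding cut_dist_def by (intro antisym fun_cut_dist_sym kernel_graph_fun)

section \<open>Pattern densities of graphs\<close>

text \<open>The point \<open>x\<close> enters only through the map \<open>f i = v (x i)\<close>, and
  the product is 1 if \<open>f\<close> induces exactly the pattern and 0 otherwise. Taking any
  \<open>v\<close> with uniform law instead of \<open>idx\<close> also covers kernels pulled back
  along a measure preserving map.\<close>

lemma (in prob_space) tdens_finite:
  fixes A :: "nat \<Rightarrow> nat \<Rightarrow> real" and v :: "'a \<Rightarrow> nat"
  assumes v[measurable]: "v \<in> M \<rightarrow>\<^sub>M count_space UNIV" and vn: "\<And>x. x \<in> space M \<Longrightarrow> v x < n"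
    and pv: "\<And>i. i < n \<Longrightarrow> prob {x \<in> space M. v x = i} = 1 / real n"
    and A: "\<And>i j. A i j = 0 \<or> A i j = 1"
  shows "tdens M k D (\<lambda>z. A (v (fst z)) (v (snd z))) =
     real (card {f \<in> {..<k} \<rightarrow>\<^sub>E {..<n}. \<forall>p\<in>pairs k. p \<in> D \<longleftrightarrow> A (f (fst p)) (f (snd p)) = 1}) / real n ^ k"
proof -
  define Fs where "Fs = {f \<in> {..<k} \<rightarrow>\<^sub>E {..<n}. \<forall>p\<in>pairs k. p \<in> D \<longleftrightarrow> A (f (fst p)) (f (snd p)) = 1}"
  define PM where "PM = (\<Pi>\<^sub>M i\<in>{..<k}. M)"
  interpret P: finite_product_prob_space "\<lambda>_. M" "{..<k}" by standard auto
  have finF: "finite Fs" unfolding Fs_def by (rule finite_subset[of _ "{..<k} \<rightarrow>\<^sub>E {..<n}"]) (auto intro: finite_PiE)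
  define I where "I i = {x \<in> space M. v x = i}" for i
  have Im: "I i \<in> sets M" for i unfolding I_def by measurable
  define X where "X f = (\<Pi>\<^sub>E i\<in>{..<k}. I (f i))" for f
  have Xm: "X f \<in> sets PM" for f unfolding X_def PM_def using Im by (intro sets_PiM_I_finite) auto
  have Xp: "measure PM (X f) = 1 / real n ^ k" if "f \<in> Fs" for f
  proof -
    have "measure PM (X f) = (\<Prod>i<k. prob (I (f i)))"
      unfolding X_def PM_def by (rule P.prob_times) (rule Im)
    also have "\<dots> = (\<Prod>i<k. 1 / real n)"
      using that pv by (intro prod.cong refl) (auto simp: I_def Fs_def)
    finally show ?thesis by (simp add: power_divide)
  qed
  have int: "(\<Prod>p\<in>pairs k. pat D p (A (v (x (fst p))) (v (x (snd p))))) = indicator (\<Union>f\<in>Fs. X f) x"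
    if x: "x \<in> space PM" for x
  proof -
    have xs: "x i \<in> space M" if "i < k" for i using x that by (auto simp: PM_def space_PiM)
    define f where "f = restrict (\<lambda>i. v (x i)) {..<k}"
    have f: "f \<in> {..<k} \<rightarrow>\<^sub>E {..<n}" unfolding f_def using xs vn by auto
    have pf: "pat D p (A (v (x (fst p))) (v (x (snd p)))) = (if p \<in> D \<longleftrightarrow> A (f (fst p)) (f (snd p)) = 1 then 1 else 0)"
      if "p \<in> pairs k" for p
      using that A[of "v (x (fst p))" "v (x (snd p))"] by (auto simp: pat_def f_def pairs_def)
    have xX: "x \<in> X g \<longleftrightarrow> g = f" if "g \<in> {..<k} \<rightarrow>\<^sub>E {..<n}" for g
    proof
      assume xg: "x \<in> X g"
      show "g = f"
      proof (rule PiE_ext[OF that f])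
        fix i assume "i \<in> {..<k}"
        then show "g i = f i" using PiE_mem[OF xg[unfolded X_def], of i] by (simp add: I_def f_def)
      qed
    next
      assume "g = f"
      then show "x \<in> X g" using x xs by (auto simp: X_def I_def f_def PM_def space_PiM PiE_def)
    qed
    have "x \<in> (\<Union>f\<in>Fs. X f) \<longleftrightarrow> f \<in> Fs" using xX f by (auto simp: Fs_def)
    moreover have "(\<Prod>p\<in>pairs k. pat D p (A (v (x (fst p))) (v (x (snd p))))) = (if f \<in> Fs then 1 else 0)"
    proof (cases "f \<in> Fs")
      case True
      then show ?thesis using pf by (simp add: Fs_def)
    next
      case False
      then obtain p where p: "p \<in> pairs k" "\<not> (p \<in> D \<longleftrightarrow> A (f (fst p)) (f (snd p)) = 1)" using f by (auto simp: Fs_def)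
      then have "pat D p (A (v (x (fst p))) (v (x (snd p)))) = 0" using pf by simp
      then have "(\<Prod>p\<in>pairs k. pat D p (A (v (x (fst p))) (v (x (snd p))))) = 0"
        using p(1) by (intro prod_zero) auto
      then show ?thesis using False by simp
    qed
    ultimately show ?thesis by (simp add: indicator_def)
  qed
  have "tdens M k D (\<lambda>z. A (v (fst z)) (v (snd z))) = (\<integral>x. indicator (\<Union>f\<in>Fs. X f) x \<partial>PM)"
    unfolding tdens_def PM_def[symmetric] by (intro Bochner_Integration.integral_cong refl) (simp add: int)
  also have "\<dots> = measure PM (\<Union>f\<in>Fs. X f)"
  proof -
    have U: "(\<Union>f\<in>Fs. X f) \<in> sets PM" using Xm finF by auto
    show ?thesis using sets.sets_into_space[OF U] U by (simp add: Int_absorb2)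
  qed
  also have "\<dots> = (\<Sum>f\<in>Fs. measure PM (X f))"
    unfolding PM_def
  proof (rule P.finite_measure_finite_Union[OF finF])
    show "disjoint_family_on X Fs"
      unfolding disjoint_family_on_def
    proof (intro ballI impI)
      fix f g assume fg: "f \<in> Fs" "g \<in> Fs" "f \<noteq> g"
      show "X f \<inter> X g = {}"
      proof (rule ccontr)
        assume "X f \<inter> X g \<noteq> {}"
        then obtain x where x: "x \<in> X f" "x \<in> X g" by auto
        have "f = g"
        proof (rule PiE_ext)
          show "f \<in> {..<k} \<rightarrow>\<^sub>E {..<n}" "g \<in> {..<k} \<rightarrow>\<^sub>E {..<n}" using fg by (auto simp: Fs_def)
          fix i assume "i \<in> {..<k}"
          then show "f i = g i" using PiE_mem[OF x(1)[unfolded X_def], of i] PiE_mem[OF x(2)[unfolded X_def], of i]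
            by (simp add: I_def)
        qed
        then show False using fg by simp
      qed
    qed
  qed (use Xm in \<open>auto simp: PM_def\<close>)
  also have "\<dots> = real (card Fs) / real n ^ k" using Xp by simp
  finally show ?thesis unfolding Fs_def .
qed

text \<open>The maps may fail to be injective; a pair with coinciding values counts as a non-edge in
  a simple graph, because a singleton is not an edge.\<close>

definition hom_maps :: "nat \<Rightarrow> (nat \<times> nat) set \<Rightarrow> ugraph \<Rightarrow> (nat \<Rightarrow> nat) set" where
  "hom_maps k D G = {f \<in> {..<k} \<rightarrow>\<^sub>E nodes G. \<forall>p\<in>pairs k. p \<in> D \<longleftrightarrow> {f (fst p), f (snd p)} \<in> edges G}"

definition tden :: "nat \<Rightarrow> (nat \<times> nat) set \<Rightarrow> ugraph \<Rightarrow> real" where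
  "tden k D G = real (card (hom_maps k D G)) / real (card (nodes G)) ^ k"

lemma tdens_vertex_map:
  assumes e: "bij_betw e {..<card (nodes G)} (nodes G)"
    and v: "v \<in> unit_measure \<rightarrow>\<^sub>M count_space UNIV" "\<And>x. x \<in> {0..1} \<Longrightarrow> v x < card (nodes G)"
    and pv: "\<And>i. i < card (nodes G) \<Longrightarrow> unit.prob {x \<in> space unit_measure. v x = i} = 1 / real (card (nodes G))"
  shows "tdens unit_measure k D (\<lambda>z. adj G (e (v (fst z))) (e (v (snd z)))) = tden k D G"
proof -
  let ?n = "card (nodes G)"
  define Fs where "Fs = {f \<in> {..<k} \<rightarrow>\<^sub>E {..<?n}. \<forall>p\<in>pairs k. p \<in> D \<longleftrightarrow> adj G (e (f (fst p))) (e (f (snd p))) = 1}"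
  define e' where "e' = the_inv_into {..<?n} e"
  have e': "bij_betw e' (nodes G) {..<?n}" unfolding e'_def by (rule bij_betw_the_inv_into[OF e])
  have ee: "e (e' x) = x" if "x \<in> nodes G" for x unfolding e'_def using that by (rule f_the_inv_into_f_bij_betw[OF e])
  have ee': "e' (e i) = i" if "i < ?n" for i
    unfolding e'_def using that e by (simp add: the_inv_into_f_f bij_betw_imp_inj_on)
  have pk: "fst p < k" "snd p < k" if "p \<in> pairs k" for p using that by (auto simp: pairs_def)
  have "bij_betw (\<lambda>f. restrict (\<lambda>i. e (f i)) {..<k}) Fs (hom_maps k D G)"
  proof (rule bij_betw_byWitness[where f' = "\<lambda>f. restrict (\<lambda>i. e' (f i)) {..<k}"])
    show "\<forall>f\<in>Fs. restrict (\<lambda>i. e' (restrict (\<lambda>i. e (f i)) {..<k} i)) {..<k} = f"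
    proof
      fix f assume "f \<in> Fs"
      then have f: "f \<in> {..<k} \<rightarrow>\<^sub>E {..<?n}" by (simp add: Fs_def)
      show "restrict (\<lambda>i. e' (restrict (\<lambda>i. e (f i)) {..<k} i)) {..<k} = f"
      proof (rule extensionalityI[of _ "{..<k}"])
        fix i assume "i \<in> {..<k}"
        then show "restrict (\<lambda>i. e' (restrict (\<lambda>i. e (f i)) {..<k} i)) {..<k} i = f i"
          using PiE_mem[OF f, of i] ee' by simp
      qed (use f in \<open>auto simp: PiE_def\<close>)
    qed
    show "\<forall>f\<in>hom_maps k D G. restrict (\<lambda>i. e (restrict (\<lambda>i. e' (f i)) {..<k} i)) {..<k} = f"
    proof
      fix f assume "f \<in> hom_maps k D G"
      then have f: "f \<in> {..<k} \<rightarrow>\<^sub>E nodes G" by (simp add: hom_maps_def)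
      show "restrict (\<lambda>i. e (restrict (\<lambda>i. e' (f i)) {..<k} i)) {..<k} = f"
      proof (rule extensionalityI[of _ "{..<k}"])
        fix i assume "i \<in> {..<k}"
        then show "restrict (\<lambda>i. e (restrict (\<lambda>i. e' (f i)) {..<k} i)) {..<k} i = f i"
          using PiE_mem[OF f, of i] ee by simp
      qed (use f in \<open>auto simp: PiE_def\<close>)
    qed
    show "(\<lambda>f. restrict (\<lambda>i. e (f i)) {..<k}) ` Fs \<subseteq> hom_maps k D G"
    proof (rule image_subsetI)
      fix f assume f: "f \<in> Fs"
      then have "f i < ?n" if "i < k" for i using that by (auto simp: Fs_def)
      then have "e (f i) \<in> nodes G" if "i < k" for i using that bij_betwE[OF e] by auto
      moreover have "p \<in> D \<longleftrightarrow> {e (f (fst p)), e (f (snd p))} \<in> edges G" if "p \<in> pairs k" for p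
        using f that by (auto simp: Fs_def adj_def split: if_splits)
      ultimately show "restrict (\<lambda>i. e (f i)) {..<k} \<in> hom_maps k D G"
        using pk by (auto simp: hom_maps_def)
    qed
    show "(\<lambda>f. restrict (\<lambda>i. e' (f i)) {..<k}) ` hom_maps k D G \<subseteq> Fs"
    proof (rule image_subsetI)
      fix f assume f: "f \<in> hom_maps k D G"
      then have fi: "f i \<in> nodes G" if "i < k" for i using that by (auto simp: hom_maps_def)
      then have "e' (f i) < ?n" if "i < k" for i using that bij_betwE[OF e'] by auto
      moreover have "p \<in> D \<longleftrightarrow> adj G (e (e' (f (fst p)))) (e (e' (f (snd p)))) = 1" if p: "p \<in> pairs k" for p
        unfolding ee[OF fi[OF pk(1)[OF p]]] ee[OF fi[OF pk(2)[OF p]]]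
        using f p by (auto simp: hom_maps_def adj_def)
      ultimately show "restrict (\<lambda>i. e' (f i)) {..<k} \<in> Fs"
        using pk by (auto simp: Fs_def)
    qed
  qed
  then have "card Fs = card (hom_maps k D G)" by (rule bij_betw_same_card)
  moreover have "tdens unit_measure k D (\<lambda>z. adj G (e (v (fst z))) (e (v (snd z)))) = real (card Fs) / real ?n ^ k"
    unfolding Fs_def using v pv
    by (intro unit.tdens_finite[where A = "\<lambda>i j. adj G (e i) (e j)"]) (auto simp: adj_def)
  ultimately show ?thesis by (simp add: tden_def)
qed

lemma tdens_gker:
  assumes "0 < card (nodes G)" "bij_betw e {..<card (nodes G)} (nodes G)"
  shows "tdens unit_measure k D (gker G e) = tden k D G"
  unfolding gker_def[abs_def] using assms idx_less
  by (intro tdens_vertex_map[OF assms(2)] measurable_idx prob_idx) auto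

text \<open>A measure preserving map does not change the law of the node on which a random point
  falls, so \<open>tdens_vertex_map\<close> applies to the composed vertex map.\<close>

lemma tdens_pull_gker:
  assumes n: "0 < card (nodes G)" and e: "bij_betw e {..<card (nodes G)} (nodes G)"
    and \<phi>: "\<phi> \<in> invertible_measure_preserving"
  shows "tdens unit_measure k D (pull \<phi> (gker G e)) = tden k D G"
proof -
  let ?n = "card (nodes G)"
  have m[measurable]: "\<phi> \<in> unit_measure \<rightarrow>\<^sub>M unit_measure" by (rule imp_measurable(1)[OF \<phi>])
  have "unit.prob {x \<in> space unit_measure. idx ?n (\<phi> x) = i} = 1 / real ?n" if "i < ?n" for i
  proof -
    have "unit.prob {x \<in> space unit_measure. idx ?n x = i} =
        measure (distr unit_measure unit_measure \<phi>) {x \<in> space unit_measure. idx ?n x = i}"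
      by (simp only: imp_measurable(2)[OF \<phi>])
    also have "\<dots> = unit.prob (\<phi> -` {x \<in> space unit_measure. idx ?n x = i} \<inter> space unit_measure)"
      by (rule measure_distr[OF m]) measurable
    also have "\<phi> -` {x \<in> space unit_measure. idx ?n x = i} \<inter> space unit_measure = {x \<in> space unit_measure. idx ?n (\<phi> x) = i}"
      using measurable_space[OF m] by blast
    finally show ?thesis using prob_idx[OF that] by simp
  qed
  moreover have "idx ?n (\<phi> x) < ?n" if "x \<in> {0..1}" for x
    using imp_measurable(3)[OF \<phi> that] by (intro idx_less n) simp
  moreover have "(\<lambda>x. idx ?n (\<phi> x)) \<in> unit_measure \<rightarrow>\<^sub>M count_space UNIV" by measurable
  ultimately show ?thesis
    unfolding gker_def by simp (intro tdens_vertex_map[OF e, where v = "\<lambda>x. idx ?n (\<phi> x)"]; simp)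
qed

lemma ex_ordering: "finite V \<Longrightarrow> \<exists>e. bij_betw e {..<card V} V"
  using ex_bij_betw_nat_finite[of V] by (simp add: atLeast0LessThan)

text \<open>Pattern densities do not see the overlay, so \<open>tdens_cut_close\<close> can be used
  for an almost optimal one.\<close>

lemma tden_cut_dist:
  assumes n: "0 < card (nodes G)" "0 < card (nodes H)" and c: "cut_dist G H < b"
  shows "\<bar>tden k D G - tden k D H\<bar> \<le> real (k\<^sup>2) * b"
proof -
  have "finite (nodes G)" "finite (nodes H)" using n card_gt_0_iff by blast+
  then obtain e e' where e: "bij_betw e {..<card (nodes G)} (nodes G)" and e': "bij_betw e' {..<card (nodes H)} (nodes H)"
    using ex_ordering by meson
  obtain \<phi> where \<phi>: "\<phi> \<in> invertible_measure_preserving" and cc: "ucut_close (gker G e) (pull \<phi> (gker H e')) b"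
    using cut_dist_less[OF n e e' c] by blast
  have "\<bar>tdens unit_measure k D (gker G e) - tdens unit_measure k D (pull \<phi> (gker H e'))\<bar> \<le> real (k\<^sup>2) * b"
    by (rule unit.tdens_cut_close[OF kernelD(1)[OF kernel_gker] kernelD(2)[OF kernel_gker]
          kernelD(1)[OF kernel_pull[OF \<phi> kernel_gker]] kernelD(2)[OF kernel_pull[OF \<phi> kernel_gker]] cc])
  then show ?thesis unfolding tdens_gker[OF n(1) e] tdens_pull_gker[OF n(2) e' \<phi>] .
qed

section \<open>Patterns as graphs, and injective maps\<close>

definition dgraph :: "nat \<Rightarrow> (nat \<times> nat) set \<Rightarrow> ugraph" where
  "dgraph k D = UGraph {..<k} ((\<lambda>p. {fst p, snd p}) ` (D \<inter> pairs k))"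

lemma simple_dgraph: "simple_graph (dgraph k D)"
  by (auto simp: simple_graph_def dgraph_def pairs_def card_insert_if)

lemma dgraph_edge: "i < j \<Longrightarrow> j < k \<Longrightarrow> {i, j} \<in> edges (dgraph k D) \<longleftrightarrow> (i, j) \<in> D"
  by (force simp: dgraph_def pairs_def doubleton_eq_iff image_iff)

lemma simple_graph_loop: "simple_graph G \<Longrightarrow> {u} \<notin> edges G"
  by (force simp: simple_graph_def)

lemma simple_induced: "simple_graph G \<Longrightarrow> S \<subseteq> nodes G \<Longrightarrow> simple_graph (induced G S)"
  by (auto simp: simple_graph_def induced_def intro: finite_subset)

lemma isomorphic_sym: "isomorphic_graphs G H \<Longrightarrow> isomorphic_graphs H G"
proof -
  assume "isomorphic_graphs G H"
  then obtain f where f: "bij_betw f (nodes G) (nodes H)"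
    and fe: "\<And>u v. u \<in> nodes G \<Longrightarrow> v \<in> nodes G \<Longrightarrow> {u, v} \<in> edges G \<longleftrightarrow> {f u, f v} \<in> edges H"
    by (auto simp: isomorphic_graphs_def)
  let ?g = "the_inv_into (nodes G) f"
  have g: "bij_betw ?g (nodes H) (nodes G)" by (rule bij_betw_the_inv_into[OF f])
  have fg: "f (?g u) = u" if "u \<in> nodes H" for u using that by (rule f_the_inv_into_f_bij_betw[OF f])
  have "{u, v} \<in> edges H \<longleftrightarrow> {?g u, ?g v} \<in> edges G" if "u \<in> nodes H" "v \<in> nodes H" for u v
    using fe[of "?g u" "?g v"] that fg bij_betwE[OF g] by simp
  then show ?thesis using g by (auto simp: isomorphic_graphs_def)
qed

lemma hom_map_iso:
  assumes G: "simple_graph G" and f: "f \<in> hom_maps k D G" and inj: "inj_on f {..<k}"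
  shows "isomorphic_graphs (dgraph k D) (induced G (f ` {..<k}))"
  unfolding isomorphic_graphs_def
proof (intro exI conjI ballI)
  show "bij_betw f (nodes (dgraph k D)) (nodes (induced G (f ` {..<k})))"
    using inj by (simp add: dgraph_def induced_def bij_betw_def)
  fix u v assume "u \<in> nodes (dgraph k D)" "v \<in> nodes (dgraph k D)"
  then have uv: "u < k" "v < k" by (auto simp: dgraph_def)
  have ind: "{f u, f v} \<in> edges (induced G (f ` {..<k})) \<longleftrightarrow> {f u, f v} \<in> edges G"
    using uv by (auto simp: induced_def)
  have lt: "{i, j} \<in> edges (dgraph k D) \<longleftrightarrow> {f i, f j} \<in> edges G" if "i < j" "j < k" for i j
    using f that dgraph_edge[OF that] by (auto simp: hom_maps_def pairs_def)
  consider "u < v" | "u = v" | "v < u" by linarith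
  then show "{u, v} \<in> edges (dgraph k D) \<longleftrightarrow> {f u, f v} \<in> edges (induced G (f ` {..<k}))"
  proof cases
    case 2
    then show ?thesis using ind simple_graph_loop[OF G, of "f v"] simple_graph_loop[OF simple_dgraph, of v k D] by simp
  next
    case 3
    then show ?thesis using ind lt[of v u] uv by (simp add: insert_commute)
  qed (use ind lt[of u v] uv in simp)
qed

text \<open>If \<open>f i = f j\<close> for a given pair \<open>i < j\<close>, then \<open>f\<close>
  is determined by its values off \<open>j\<close>, which leaves a share of
  \<open>1 / card V\<close>. There are at most \<open>k\<^sup>2\<close> such pairs.\<close>

lemma noninj_count:
  assumes V: "finite V" "V \<noteq> {}"
  shows "real (card {f \<in> {..<k} \<rightarrow>\<^sub>E V. \<not> inj_on f {..<k}}) \<le> real (k\<^sup>2) / real (card V) * real (card V) ^ k"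
proof -
  let ?n = "card V"
  have n: "0 < ?n" using V by (simp add: card_gt_0_iff)
  have finE: "finite ({..<k} \<rightarrow>\<^sub>E V)" using V by (intro finite_PiE) auto
  have one: "real (card {f \<in> {..<k} \<rightarrow>\<^sub>E V. f (fst p) = f (snd p)}) \<le> real ?n ^ k / real ?n" if p: "p \<in> pairs k" for p
  proof -
    obtain i j where ij: "p = (i, j)" "i < j" "j < k" using p by (auto simp: pairs_def)
    have "inj_on (\<lambda>f. restrict f ({..<k} - {j})) {f \<in> {..<k} \<rightarrow>\<^sub>E V. f i = f j}"
    proof (rule inj_onI)
      fix f g assume fg: "f \<in> {f \<in> {..<k} \<rightarrow>\<^sub>E V. f i = f j}" "g \<in> {f \<in> {..<k} \<rightarrow>\<^sub>E V. f i = f j}"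
        "restrict f ({..<k} - {j}) = restrict g ({..<k} - {j})"
      have e: "f l = g l" if "l < k" "l \<noteq> j" for l using fun_cong[OF fg(3), of l] that by simp
      show "f = g"
      proof (rule PiE_ext)
        show "f \<in> {..<k} \<rightarrow>\<^sub>E V" "g \<in> {..<k} \<rightarrow>\<^sub>E V" using fg by auto
        fix l assume "l \<in> {..<k}"
        then show "f l = g l" using e[of l] e[of i] fg ij by (cases "l = j") auto
      qed
    qed
    moreover have "(\<lambda>f. restrict f ({..<k} - {j})) ` {f \<in> {..<k} \<rightarrow>\<^sub>E V. f i = f j} \<subseteq> ({..<k} - {j}) \<rightarrow>\<^sub>E V"
      unfolding image_subset_iff restrict_PiE_iff by (blast dest: PiE_mem)
    moreover have "finite (({..<k} - {j}) \<rightarrow>\<^sub>E V)" using V by (intro finite_PiE) auto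
    ultimately have "card {f \<in> {..<k} \<rightarrow>\<^sub>E V. f i = f j} \<le> card (({..<k} - {j}) \<rightarrow>\<^sub>E V)" by (rule card_inj_on_le)
    also have "\<dots> = ?n ^ (k - 1)" using ij by (subst card_PiE) auto
    finally have "real (card {f \<in> {..<k} \<rightarrow>\<^sub>E V. f i = f j}) \<le> real ?n ^ (k - 1)"
      unfolding of_nat_power[symmetric] by (rule of_nat_mono)
    also have "\<dots> = real ?n ^ k / real ?n" using n ij by (simp add: power_diff)
    finally show ?thesis by (simp add: ij)
  qed
  have "{f \<in> {..<k} \<rightarrow>\<^sub>E V. \<not> inj_on f {..<k}} \<subseteq> (\<Union>p\<in>pairs k. {f \<in> {..<k} \<rightarrow>\<^sub>E V. f (fst p) = f (snd p)})"
  proof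
    fix f assume f: "f \<in> {f \<in> {..<k} \<rightarrow>\<^sub>E V. \<not> inj_on f {..<k}}"
    then obtain a b where ab: "a < k" "b < k" "f a = f b" "a \<noteq> b" by (auto simp: inj_on_def)
    show "f \<in> (\<Union>p\<in>pairs k. {f \<in> {..<k} \<rightarrow>\<^sub>E V. f (fst p) = f (snd p)})"
    proof (cases "a < b")
      case True
      then show ?thesis using f ab by (intro UN_I[of "(a, b)"]) (auto simp: pairs_def)
    next
      case False
      then show ?thesis using f ab by (intro UN_I[of "(b, a)"]) (auto simp: pairs_def)
    qed
  qed
  then have "card {f \<in> {..<k} \<rightarrow>\<^sub>E V. \<not> inj_on f {..<k}} \<le> card (\<Union>p\<in>pairs k. {f \<in> {..<k} \<rightarrow>\<^sub>E V. f (fst p) = f (snd p)})"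
    by (rule card_mono[rotated]) (use finE in auto)
  also have "\<dots> \<le> (\<Sum>p\<in>pairs k. card {f \<in> {..<k} \<rightarrow>\<^sub>E V. f (fst p) = f (snd p)})" by (rule card_UN_le) simp
  finally have "real (card {f \<in> {..<k} \<rightarrow>\<^sub>E V. \<not> inj_on f {..<k}}) \<le> (\<Sum>p\<in>pairs k. real (card {f \<in> {..<k} \<rightarrow>\<^sub>E V. f (fst p) = f (snd p)}))"
    unfolding of_nat_sum[symmetric] by (rule of_nat_mono)
  also have "\<dots> \<le> (\<Sum>p\<in>pairs k. real ?n ^ k / real ?n)" by (intro sum_mono one)
  also have "\<dots> \<le> real (k\<^sup>2) * (real ?n ^ k / real ?n)"
    unfolding sum_constant by (intro mult_right_mono of_nat_mono card_pairs_le) simp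
  finally show ?thesis by simp
qed

text \<open>More maps induce the pattern than there are non-injective maps, so one of them is
  injective.\<close>

lemma tden_pos_induced:
  assumes G: "simple_graph G" and n: "0 < card (nodes G)" and t: "real (k\<^sup>2) / real (card (nodes G)) < tden k D G"
  shows "\<exists>S\<subseteq>nodes G. isomorphic_graphs (dgraph k D) (induced G S)"
proof -
  have V: "finite (nodes G)" "nodes G \<noteq> {}" using n card_gt_0_iff by blast+
  have "\<exists>f\<in>hom_maps k D G. inj_on f {..<k}"
  proof (rule ccontr)
    assume "\<not> ?thesis"
    then have "hom_maps k D G \<subseteq> {f \<in> {..<k} \<rightarrow>\<^sub>E nodes G. \<not> inj_on f {..<k}}" by (auto simp: hom_maps_def)
    moreover have "finite {f \<in> {..<k} \<rightarrow>\<^sub>E nodes G. \<not> inj_on f {..<k}}"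
      by (rule finite_subset[of _ "{..<k} \<rightarrow>\<^sub>E nodes G"]) (use V in \<open>auto intro!: finite_PiE\<close>)
    ultimately have "real (card (hom_maps k D G)) \<le> real (k\<^sup>2) / real (card (nodes G)) * real (card (nodes G)) ^ k"
      using order_trans[OF of_nat_mono[OF card_mono] noninj_count[OF V, of k]] by blast
    then have "tden k D G \<le> real (k\<^sup>2) / real (card (nodes G))"
      unfolding tden_def using n by (subst pos_divide_le_eq) auto
    then show False using t by simp
  qed
  then obtain f where f: "f \<in> hom_maps k D G" "inj_on f {..<k}" by blast
  then show ?thesis using hom_map_iso[OF G f] by (intro exI[of _ "f ` {..<k}"]) (auto simp: hom_maps_def)
qed

text \<open>Every \<open>k\<close>-subset is the image of equally many injective maps, so the
  fraction of subsets is a fraction of injective maps; passing to all maps costs the share of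
  non-injective ones.\<close>

lemma induced_fraction_tden:
  assumes G: "simple_graph G" and n: "0 < card (nodes G)" and k: "k \<le> card (nodes G)" and Q: "graph_property Q"
  shows "\<bar>induced_fraction k G Q - (\<Sum>D | D \<subseteq> pairs k \<and> dgraph k D \<in> Q. tden k D G)\<bar> \<le> real (k\<^sup>2) / real (card (nodes G))"
proof -
  let ?n = "card (nodes G)" and ?V = "nodes G"
  have V: "finite ?V" "?V \<noteq> {}" using n card_gt_0_iff by blast+
  define All where "All = {..<k} \<rightarrow>\<^sub>E ?V"
  define patt where "patt f = {p\<in>pairs k. {f (fst p), f (snd p)} \<in> edges G}" for f :: "nat \<Rightarrow> nat"
  define AllQ where "AllQ = {f\<in>All. dgraph k (patt f) \<in> Q}"
  define Inj where "Inj = {f\<in>All. inj_on f {..<k}}"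
  have finA: "finite All" unfolding All_def using V by (intro finite_PiE) auto
  have hm: "hom_maps k D G = {f\<in>All. patt f = D}" if "D \<subseteq> pairs k" for D
    using that by (auto simp: hom_maps_def All_def patt_def)
  have "(\<Sum>D | D \<subseteq> pairs k \<and> dgraph k D \<in> Q. tden k D G)
      = (\<Sum>D | D \<subseteq> pairs k \<and> dgraph k D \<in> Q. real (card {f\<in>All. patt f = D})) / real ?n ^ k"
    unfolding tden_def sum_divide_distrib by (intro sum.cong refl) (simp add: hm)
  also have "(\<Sum>D | D \<subseteq> pairs k \<and> dgraph k D \<in> Q. real (card {f\<in>All. patt f = D})) = real (card AllQ)"
  proof -
    have fD: "finite {D. D \<subseteq> pairs k \<and> dgraph k D \<in> Q}" by (rule finite_subset[of _ "Pow (pairs k)"]) auto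
    have "card AllQ = card (\<Union>D\<in>{D. D \<subseteq> pairs k \<and> dgraph k D \<in> Q}. {f\<in>All. patt f = D})"
      by (rule arg_cong[of _ _ card]) (auto simp: AllQ_def patt_def)
    also have "\<dots> = (\<Sum>D | D \<subseteq> pairs k \<and> dgraph k D \<in> Q. card {f\<in>All. patt f = D})"
      using finA by (intro card_UN_disjoint fD) auto
    finally show ?thesis by simp
  qed
  finally have sumD: "(\<Sum>D | D \<subseteq> pairs k \<and> dgraph k D \<in> Q. tden k D G) = real (card AllQ) / real ?n ^ k" .
  have iso: "dgraph k (patt f) \<in> Q \<longleftrightarrow> induced G (f ` {..<k}) \<in> Q" if "f \<in> Inj" for f
  proof -
    have f: "f \<in> hom_maps k (patt f) G" "inj_on f {..<k}" "f ` {..<k} \<subseteq> ?V"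
      using that by (auto simp: hom_maps_def Inj_def All_def patt_def)
    have i: "isomorphic_graphs (dgraph k (patt f)) (induced G (f ` {..<k}))" by (rule hom_map_iso[OF G f(1,2)])
    have s: "simple_graph (induced G (f ` {..<k}))" by (rule simple_induced[OF G f(3)])
    show ?thesis
    proof
      assume "dgraph k (patt f) \<in> Q"
      then show "induced G (f ` {..<k}) \<in> Q" using Q i s unfolding graph_property_def by blast
    next
      assume "induced G (f ` {..<k}) \<in> Q"
      then show "dgraph k (patt f) \<in> Q" using Q isomorphic_sym[OF i] simple_dgraph unfolding graph_property_def by blast
    qed
  qed
  define fib where "fib S = {f\<in>All. bij_betw f {..<k} S}" for S
  \<comment> \<open>This is the factorial of \<open>k\<close>, written as the fibre over
    \<open>{..<k}\<close> so that relabelling yields \<open>fibc\<close>.\<close>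
  define c where "c = card {f\<in>{..<k} \<rightarrow>\<^sub>E {..<k}. bij_betw f {..<k} {..<k}}"
  have fibc: "card (fib S) = c" if S: "S \<subseteq> ?V" "card S = k" for S
  proof -
    have "finite S" using S V finite_subset by blast
    then obtain h where h: "bij_betw h {..<k} S" using ex_ordering[of S] S by auto
    define h' where "h' = the_inv_into {..<k} h"
    have h': "bij_betw h' S {..<k}" unfolding h'_def by (rule bij_betw_the_inv_into[OF h])
    have hh: "h (h' x) = x" if "x \<in> S" for x unfolding h'_def using that by (rule f_the_inv_into_f_bij_betw[OF h])
    have hh': "h' (h i) = i" if "i < k" for i
      unfolding h'_def using that h by (simp add: the_inv_into_f_f bij_betw_imp_inj_on)
    have "bij_betw (\<lambda>f. restrict (\<lambda>i. h (f i)) {..<k}) {f\<in>{..<k} \<rightarrow>\<^sub>E {..<k}. bij_betw f {..<k} {..<k}} (fib S)"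
    proof (rule bij_betw_byWitness[where f' = "\<lambda>f. restrict (\<lambda>i. h' (f i)) {..<k}"])
      show "\<forall>f\<in>{f\<in>{..<k} \<rightarrow>\<^sub>E {..<k}. bij_betw f {..<k} {..<k}}. restrict (\<lambda>i. h' (restrict (\<lambda>i. h (f i)) {..<k} i)) {..<k} = f"
      proof
        fix f assume f: "f\<in>{f\<in>{..<k} \<rightarrow>\<^sub>E {..<k}. bij_betw f {..<k} {..<k}}"
        then have fi: "f i < k" if "i < k" for i using that by auto
        show "restrict (\<lambda>i. h' (restrict (\<lambda>i. h (f i)) {..<k} i)) {..<k} = f"
          by (rule extensionalityI[of _ "{..<k}"]) (use f fi hh' in \<open>auto simp: PiE_def\<close>)
      qed
      show "\<forall>f\<in>fib S. restrict (\<lambda>i. h (restrict (\<lambda>i. h' (f i)) {..<k} i)) {..<k} = f"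
      proof
        fix f assume f: "f \<in> fib S"
        then have fi: "f i \<in> S" if "i < k" for i using that by (auto simp: fib_def dest: bij_betwE)
        show "restrict (\<lambda>i. h (restrict (\<lambda>i. h' (f i)) {..<k} i)) {..<k} = f"
          by (rule extensionalityI[of _ "{..<k}"]) (use f fi hh in \<open>auto simp: fib_def All_def PiE_def\<close>)
      qed
      show "(\<lambda>f. restrict (\<lambda>i. h (f i)) {..<k}) ` {f\<in>{..<k} \<rightarrow>\<^sub>E {..<k}. bij_betw f {..<k} {..<k}} \<subseteq> fib S"
      proof (rule image_subsetI)
        fix f assume "f\<in>{f\<in>{..<k} \<rightarrow>\<^sub>E {..<k}. bij_betw f {..<k} {..<k}}"
        then have "bij_betw (h \<circ> f) {..<k} S" using h by (auto intro: bij_betw_trans)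
        then have "bij_betw (restrict (\<lambda>i. h (f i)) {..<k}) {..<k} S" by (subst bij_betw_cong[of _ _ "h \<circ> f"]) auto
        then show "restrict (\<lambda>i. h (f i)) {..<k} \<in> fib S" using S by (auto simp: fib_def All_def dest: bij_betwE)
      qed
      show "(\<lambda>f. restrict (\<lambda>i. h' (f i)) {..<k}) ` fib S \<subseteq> {f\<in>{..<k} \<rightarrow>\<^sub>E {..<k}. bij_betw f {..<k} {..<k}}"
      proof (rule image_subsetI)
        fix f assume "f \<in> fib S"
        then have "bij_betw (h' \<circ> f) {..<k} {..<k}" using h' by (auto simp: fib_def intro: bij_betw_trans)
        then have "bij_betw (restrict (\<lambda>i. h' (f i)) {..<k}) {..<k} {..<k}" by (subst bij_betw_cong[of _ _ "h' \<circ> f"]) auto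
        then show "restrict (\<lambda>i. h' (f i)) {..<k} \<in> {f\<in>{..<k} \<rightarrow>\<^sub>E {..<k}. bij_betw f {..<k} {..<k}}"
          by (auto dest: bij_betwE)
      qed
    qed
    from bij_betw_same_card[OF this] show ?thesis unfolding c_def by (rule sym)
  qed
  have cnt: "card (\<Union>S\<in>\<S>. fib S) = card \<S> * c" if "\<S> \<subseteq> {S. S \<subseteq> ?V \<and> card S = k}" for \<S>
  proof -
    have "\<S> \<subseteq> Pow ?V" using that by blast
    then have fS: "finite \<S>" using V(1) by (meson finite_Pow_iff finite_subset)
    have "card (\<Union>S\<in>\<S>. fib S) = (\<Sum>S\<in>\<S>. card (fib S))"
    proof (rule card_UN_disjoint[OF fS])
      show "\<forall>S\<in>\<S>. finite (fib S)" unfolding fib_def using finA by simp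
      show "\<forall>S\<in>\<S>. \<forall>T\<in>\<S>. S \<noteq> T \<longrightarrow> fib S \<inter> fib T = {}"
        unfolding fib_def using bij_betw_imp_surj_on by blast
    qed
    also have "\<dots> = (\<Sum>S\<in>\<S>. c)" by (rule sum.cong[OF refl]) (use that fibc in blast)
    also have "\<dots> = card \<S> * c" by simp
    finally show ?thesis .
  qed
  let ?SQ = "{S. S \<subseteq> ?V \<and> card S = k \<and> induced G S \<in> Q}" and ?S = "{S. S \<subseteq> ?V \<and> card S = k}"
  have Inj_eq: "Inj = (\<Union>S\<in>?S. fib S)"
  proof (intro equalityI subsetI)
    fix f assume f: "f \<in> Inj"
    then show "f \<in> (\<Union>S\<in>?S. fib S)"
      by (intro UN_I[of "f ` {..<k}"]) (auto simp: Inj_def All_def fib_def bij_betw_def card_image)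
  qed (auto simp: fib_def Inj_def bij_betw_def)
  have InjQ_eq: "AllQ \<inter> Inj = (\<Union>S\<in>?SQ. fib S)"
  proof (intro equalityI subsetI)
    fix f assume f: "f \<in> AllQ \<inter> Inj"
    then show "f \<in> (\<Union>S\<in>?SQ. fib S)"
      using iso[of f] by (intro UN_I[of "f ` {..<k}"]) (auto simp: AllQ_def Inj_def All_def fib_def bij_betw_def card_image)
  next
    fix f assume "f \<in> (\<Union>S\<in>?SQ. fib S)"
    then obtain S where S: "S \<subseteq> ?V" "induced G S \<in> Q" "f \<in> All" "inj_on f {..<k}" "f ` {..<k} = S"
      by (auto simp: fib_def bij_betw_def)
    then have "f \<in> Inj" by (simp add: Inj_def)
    then show "f \<in> AllQ \<inter> Inj" using iso[of f] S by (simp add: AllQ_def)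
  qed
  have cI: "card Inj = card ?S * c" unfolding Inj_eq by (rule cnt) simp
  have cIQ: "card (AllQ \<inter> Inj) = card ?SQ * c" unfolding InjQ_eq by (rule cnt) auto
  have "\<exists>S. S \<subseteq> ?V \<and> card S = k" using k V by (meson obtain_subset_with_card_n)
  then obtain S0 where S0: "S0 \<subseteq> ?V" "card S0 = k" by blast
  have "?S \<subseteq> Pow ?V" by blast
  then have "finite ?S" using V(1) by (meson finite_Pow_iff finite_subset)
  moreover have "?S \<noteq> {}" using S0 by blast
  ultimately have Spos: "0 < card ?S" unfolding card_gt_0_iff by blast
  have "finite S0" using S0 V finite_subset by blast
  then obtain h where h: "bij_betw h {..<k} S0" using ex_ordering[of S0] S0 by auto
  have b0: "bij_betw (restrict h {..<k}) {..<k} S0" using h by (subst bij_betw_cong[of _ _ h]) auto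
  have "h i \<in> ?V" if "i < k" for i using bij_betwE[OF h] S0(1) that by auto
  then have "restrict h {..<k} \<in> All" by (simp add: All_def restrict_PiE_iff)
  with b0 have "restrict h {..<k} \<in> fib S0" by (simp add: fib_def)
  then have "fib S0 \<noteq> {}" by blast
  moreover have "finite (fib S0)" unfolding fib_def using finA by simp
  ultimately have "c \<noteq> 0" unfolding fibc[OF S0, symmetric] by (meson card_0_eq)
  then have frac: "induced_fraction k G Q = real (card (AllQ \<inter> Inj)) / real (card Inj)"
    unfolding induced_fraction_def cI cIQ by simp
  have Injpos: "0 < card Inj" using cI Spos \<open>c \<noteq> 0\<close> by simp
  \<comment> \<open>Numbers of all maps, injective maps, injective maps with pattern in
    \<open>Q\<close> and non-injective ones with pattern in \<open>Q\<close>. Both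
    \<open>a / I - a / T\<close> and \<open>b / T\<close> lie between 0 and
    \<open>(T - I) / T\<close>, hence so does the absolute value of their difference.\<close>
  define T I a b where "T = real ?n ^ k" and "I = real (card Inj)" and "a = real (card (AllQ \<inter> Inj))" and "b = real (card (AllQ - Inj))"
  have T0: "T > 0" and I0: "I > 0" using n Injpos by (auto simp: T_def I_def)
  have finQ: "finite AllQ" using finA by (simp add: AllQ_def)
  have ab: "real (card AllQ) = a + b" unfolding a_def b_def
    using card_Int_Diff[OF finQ, of Inj] by simp
  have "real (card (All - Inj)) \<le> real (k\<^sup>2) / real ?n * T"
  proof -
    have "All - Inj = {f \<in> {..<k} \<rightarrow>\<^sub>E ?V. \<not> inj_on f {..<k}}" by (auto simp: All_def Inj_def)
    then show ?thesis using noninj_count[OF V, of k] by (simp only: T_def)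
  qed
  moreover have "real (card All) = I + real (card (All - Inj))"
    using card_Int_Diff[OF finA, of Inj] by (simp add: I_def Inj_def Int_def)
  moreover have "real (card All) = T" unfolding All_def T_def using V by (simp add: card_PiE)
  ultimately have TI: "T - I \<le> real (k\<^sup>2) / real ?n * T" and TIeq: "T - I = real (card (All - Inj))" by linarith+
  have b: "0 \<le> b" "b \<le> T - I" unfolding TIeq b_def using finA by (auto intro!: card_mono simp: AllQ_def)
  have a: "0 \<le> a" "a \<le> I" unfolding a_def I_def using finA by (auto intro!: card_mono simp: Inj_def)
  have q: "(T - I) / T \<le> real (k\<^sup>2) / real ?n" using TI T0 by (simp add: pos_divide_le_eq)
  have "a / I - a / T = (a / I) * ((T - I) / T)" using T0 I0 by (simp add: field_simps)
  moreover have "(a / I) * ((T - I) / T) \<le> 1 * ((T - I) / T)"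
    using a b I0 T0 by (intro mult_right_mono) auto
  moreover have "0 \<le> (a / I) * ((T - I) / T)" using a b I0 T0 by auto
  moreover have "0 \<le> b / T" "b / T \<le> (T - I) / T" using b T0 by (auto intro: divide_right_mono)
  ultimately have "\<bar>a / I - (a + b) / T\<bar> \<le> (T - I) / T" unfolding add_divide_distrib by linarith
  then show ?thesis using q unfolding frac sumD ab by (simp add: a_def I_def T_def)
qed

section \<open>Random subsets\<close>

text \<open>The sum of products of entries along 4-cycles \<open>v\<close>, \<open>u\<close>,
  \<open>w\<close>, \<open>u'\<close>. Up to normalisation and a power it controls the cut norm from
  both sides, but as a sum over tuples it has a mean over random subsets that can be
  computed.\<close>

definition q4 :: "'a set \<Rightarrow> ('a \<Rightarrow> 'a \<Rightarrow> real) \<Rightarrow> real" where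
  "q4 V B = (\<Sum>v\<in>V. \<Sum>w\<in>V. (\<Sum>u\<in>V. B u v * B u w)\<^sup>2)"

lemma q4_nonneg: "0 \<le> q4 V B"
  unfolding q4_def by (intro sum_nonneg) auto

text \<open>Cauchy-Schwarz twice: over \<open>u\<close>, which squares the sum over
  \<open>v\<close>, and then over the pairs \<open>(v, w)\<close>.\<close>

lemma mcut_le_q4:
  assumes V: "finite V"
  shows "(mcut V B) ^ 4 * real (card V) ^ 4 \<le> q4 V B"
proof (cases "V = {}")
  case True
  then show ?thesis by (simp add: q4_def)
next
  case False
  define n where "n = real (card V)"
  have n: "n > 0" using False V by (simp add: card_gt_0_iff n_def)
  obtain X Y where XY: "X \<subseteq> V" "Y \<subseteq> V" and s: "\<bar>\<Sum>u\<in>X. \<Sum>v\<in>Y. B u v\<bar> = mcut V B * n\<^sup>2"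
    using mcut_attained[OF V, of B] unfolding n_def by blast
  define s where "s = (\<Sum>u\<in>X. \<Sum>v\<in>Y. B u v)"
  define c where "c v w = (\<Sum>u\<in>V. B u v * B u w)" for v w
  have cX: "real (card X) \<le> n" and cY: "real (card Y) \<le> n" unfolding n_def
    using XY V by (auto intro!: card_mono)
  have "s\<^sup>2 \<le> (\<Sum>u\<in>X. (\<Sum>v\<in>Y. B u v)\<^sup>2) * real (card X)"
    unfolding s_def by (rule sum_squared_le_sum_of_squares)
  also have "\<dots> \<le> (\<Sum>u\<in>V. (\<Sum>v\<in>Y. B u v)\<^sup>2) * n"
    using XY V cX by (intro mult_mono sum_mono2 sum_nonneg) auto
  also have "(\<Sum>u\<in>V. (\<Sum>v\<in>Y. B u v)\<^sup>2) = (\<Sum>u\<in>V. \<Sum>v\<in>Y. \<Sum>w\<in>Y. B u v * B u w)"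
    by (simp add: power2_eq_square sum_product)
  also have "\<dots> = (\<Sum>v\<in>Y. \<Sum>w\<in>Y. c v w)"
    unfolding c_def by (subst sum.swap, rule sum.cong[OF refl], rule sum.swap)
  also have "\<dots> = (\<Sum>(v, w)\<in>Y \<times> Y. c v w)" by (simp add: sum.cartesian_product)
  finally have s2: "s\<^sup>2 \<le> (\<Sum>(v, w)\<in>Y \<times> Y. c v w) * n" .
  have "(s\<^sup>2)\<^sup>2 \<le> ((\<Sum>(v, w)\<in>Y \<times> Y. c v w) * n)\<^sup>2" using s2 by (intro power_mono) auto
  also have "\<dots> = (\<Sum>p\<in>Y \<times> Y. c (fst p) (snd p))\<^sup>2 * n\<^sup>2" by (simp add: power_mult_distrib case_prod_beta)
  also have "\<dots> \<le> ((\<Sum>p\<in>Y \<times> Y. (c (fst p) (snd p))\<^sup>2) * real (card (Y \<times> Y))) * n\<^sup>2"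
    by (intro mult_right_mono sum_squared_le_sum_of_squares) simp
  also have "\<dots> \<le> ((\<Sum>p\<in>V \<times> V. (c (fst p) (snd p))\<^sup>2) * n\<^sup>2) * n\<^sup>2"
  proof (intro mult_right_mono mult_mono)
    show "(\<Sum>p\<in>Y \<times> Y. (c (fst p) (snd p))\<^sup>2) \<le> (\<Sum>p\<in>V \<times> V. (c (fst p) (snd p))\<^sup>2)"
      using XY V by (intro sum_mono2) auto
    show "real (card (Y \<times> Y)) \<le> n\<^sup>2" using cY by (simp add: card_cartesian_product power2_eq_square mult_mono)
  qed (auto intro: sum_nonneg)
  also have "(\<Sum>p\<in>V \<times> V. (c (fst p) (snd p))\<^sup>2) = q4 V B"
    by (simp add: q4_def c_def sum.cartesian_product case_prod_beta)
  finally have "(s\<^sup>2)\<^sup>2 \<le> q4 V B * n ^ 4" by (simp add: mult_ac flip: power_add)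
  moreover have "(s\<^sup>2)\<^sup>2 = mcut V B ^ 4 * n ^ 4 * n ^ 4"
  proof -
    have "(s\<^sup>2)\<^sup>2 = \<bar>s\<bar> ^ 4" by (simp add: power_even_abs flip: power_mult)
    also have "\<bar>s\<bar> = mcut V B * n\<^sup>2" using s by (simp add: s_def)
    finally show ?thesis by (simp add: power_mult_distrib flip: power_mult power_add)
  qed
  ultimately show ?thesis using n by (simp add: n_def[symmetric])
qed

definition F4 :: "('a \<Rightarrow> 'a \<Rightarrow> real) \<Rightarrow> 'a \<times> 'a \<times> 'a \<times> 'a \<Rightarrow> real" where
  "F4 B = (\<lambda>(v, w, u, u'). B u v * B u w * (B u' v * B u' w))"

lemma q4_F4: "q4 V B = (\<Sum>t\<in>V \<times> V \<times> V \<times> V. F4 B t)"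
proof -
  have "q4 V B = (\<Sum>v\<in>V. \<Sum>w\<in>V. \<Sum>u\<in>V. \<Sum>u'\<in>V. F4 B (v, w, u, u'))"
    unfolding q4_def F4_def by (simp add: power2_eq_square sum_product)
  then show ?thesis by (simp add: sum.cartesian_product)
qed

text \<open>For fixed \<open>w\<close> and \<open>u'\<close> the rest is a bilinear form of
  \<open>B\<close> with weights \<open>B u w\<close> and \<open>B u' v\<close>, which lie between -1
  and 1.\<close>

lemma q4_le_mcut:
  assumes V: "finite V" and B: "\<And>u v. u \<in> V \<Longrightarrow> v \<in> V \<Longrightarrow> \<bar>B u v\<bar> \<le> 1"
  shows "q4 V B \<le> 4 * mcut V B * real (card V) ^ 4"
proof -
  define n where "n = real (card V)"
  have "q4 V B = (\<Sum>v\<in>V. \<Sum>w\<in>V. \<Sum>u\<in>V. \<Sum>u'\<in>V. B u v * B u w * (B u' v * B u' w))"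
    unfolding q4_def by (simp add: power2_eq_square sum_product)
  \<comment> \<open>The exchanges bring the fixed variables \<open>w\<close> and \<open>u'\<close>
    to the outside.\<close>
  also have "\<dots> = (\<Sum>w\<in>V. \<Sum>v\<in>V. \<Sum>u\<in>V. \<Sum>u'\<in>V. B u v * B u w * (B u' v * B u' w))"
    by (rule sum.swap)
  also have "\<dots> = (\<Sum>w\<in>V. \<Sum>v\<in>V. \<Sum>u'\<in>V. \<Sum>u\<in>V. B u v * B u w * (B u' v * B u' w))"
    by (rule sum.cong[OF refl], rule sum.cong[OF refl], rule sum.swap)
  also have "\<dots> = (\<Sum>w\<in>V. \<Sum>u'\<in>V. \<Sum>v\<in>V. \<Sum>u\<in>V. B u v * B u w * (B u' v * B u' w))"
    by (rule sum.cong[OF refl], rule sum.swap)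
  also have "\<dots> = (\<Sum>w\<in>V. \<Sum>u'\<in>V. \<Sum>u\<in>V. \<Sum>v\<in>V. B u v * B u w * (B u' v * B u' w))"
    by (rule sum.cong[OF refl], rule sum.cong[OF refl], rule sum.swap)
  also have "\<dots> \<le> (\<Sum>w\<in>V. \<Sum>u'\<in>V. 4 * mcut V B * n\<^sup>2)"
  proof (intro sum_mono)
    fix w u' assume wu: "w \<in> V" "u' \<in> V"
    have "(\<Sum>u\<in>V. \<Sum>v\<in>V. B u v * B u w * (B u' v * B u' w)) = B u' w * (\<Sum>u\<in>V. \<Sum>v\<in>V. B u v * B u w * B u' v)"
      by (simp only: sum_distrib_left mult_ac)
    also have "\<dots> \<le> \<bar>B u' w\<bar> * \<bar>\<Sum>u\<in>V. \<Sum>v\<in>V. B u v * B u w * B u' v\<bar>"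
      unfolding abs_mult[symmetric] by (rule abs_ge_self)
    also have "\<dots> \<le> 1 * (4 * mcut V B * n\<^sup>2)"
      unfolding n_def using B wu by (intro mult_mono mcut_weighted_signed V) auto
    finally show "(\<Sum>u\<in>V. \<Sum>v\<in>V. B u v * B u w * (B u' v * B u' w)) \<le> 4 * mcut V B * n\<^sup>2" by simp
  qed
  also have "\<dots> = 4 * mcut V B * n ^ 4"
    by (simp add: n_def power2_eq_square power4_eq_xxxx)
  finally show ?thesis by (simp add: n_def)
qed

section \<open>Counting subsets of size k and averaging over them\<close>

abbreviation ksubsets :: "'a set \<Rightarrow> nat \<Rightarrow> 'a set set" where
  "ksubsets V k \<equiv> {S. S \<subseteq> V \<and> card S = k}"

lemma finite_ksubsets: "finite V \<Longrightarrow> finite (ksubsets V k)"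
  by (rule finite_subset[of _ "Pow V"]) auto

lemma card_ksubsets_superset:
  assumes V: "finite V" and T: "T \<subseteq> V" "card T \<le> k"
  shows "card {S \<in> ksubsets V k. T \<subseteq> S} = (card V - card T) choose (k - card T)"
proof -
  have fT: "finite T" using T V finite_subset by blast
  have "bij_betw (\<lambda>S. S - T) {S \<in> ksubsets V k. T \<subseteq> S} (ksubsets (V - T) (k - card T))"
  proof (rule bij_betw_byWitness[where f' = "\<lambda>S. S \<union> T"])
    show "(\<lambda>S. S - T) ` {S \<in> ksubsets V k. T \<subseteq> S} \<subseteq> ksubsets (V - T) (k - card T)"
      using fT by (auto simp: card_Diff_subset)
    show "(\<lambda>S. S \<union> T) ` ksubsets (V - T) (k - card T) \<subseteq> {S \<in> ksubsets V k. T \<subseteq> S}"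
    proof (rule image_subsetI)
      fix S assume S: "S \<in> ksubsets (V - T) (k - card T)"
      then have "finite S" "S \<inter> T = {}" using V finite_subset by blast+
      then have "card (S \<union> T) = k" using S T fT by (simp add: card_Un_disjoint)
      then show "S \<union> T \<in> {S \<in> ksubsets V k. T \<subseteq> S}" using S T by auto
    qed
  qed auto
  then have "card {S \<in> ksubsets V k. T \<subseteq> S} = card (ksubsets (V - T) (k - card T))" by (rule bij_betw_same_card)
  also have "\<dots> = card (V - T) choose (k - card T)" using V by (simp add: n_subsets)
  finally show ?thesis using fT T by (simp add: card_Diff_subset)
qed

text \<open>The quotient of the binomials is the product of \<open>(k - i) / (n - i)\<close> over
  \<open>i < r\<close>, and each factor is at most \<open>k / n\<close>.\<close>

lemma binomial_ratio:
  assumes "r \<le> k" "k \<le> n" "0 < n"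
  shows "real ((n - r) choose (k - r)) \<le> (real k / real n) ^ r * real (n choose k)"
  using assms(1)
proof (induction r)
  case (Suc r)
  then have r: "r < k" "r < n" using assms by auto
  have "(k - r) * ((n - r) choose (k - r)) = (n - r) * ((n - r - 1) choose (k - r - 1))"
    using r times_binomial_minus1_eq[of "k - r" "n - r"] by simp
  then have "real (k - r) * real ((n - r) choose (k - r)) = real (n - r) * real ((n - Suc r) choose (k - Suc r))"
    by (metis diff_Suc_eq_diff_pred diff_commute of_nat_mult One_nat_def)
  then have eq: "real ((n - Suc r) choose (k - Suc r)) = real (k - r) / real (n - r) * real ((n - r) choose (k - r))"
    using r by (simp add: field_simps)
  have "real (k - r) / real (n - r) \<le> real k / real n"
  proof -
    have "real (k - r) * real n \<le> real k * real (n - r)"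
      using r assms by (simp add: of_nat_diff algebra_simps mult_right_mono)
    then show ?thesis using r by (simp add: divide_simps)
  qed
  then have "real ((n - Suc r) choose (k - Suc r)) \<le> real k / real n * ((real k / real n) ^ r * real (n choose k))"
    unfolding eq using Suc by (intro mult_mono) auto
  then show ?case by (simp add: mult_ac)
qed simp

lemma card_superset_le:
  assumes V: "finite V" "V \<noteq> {}" and T: "T \<subseteq> V" "card T \<le> k" and k: "k \<le> card V"
  shows "real (card {S \<in> ksubsets V k. T \<subseteq> S}) \<le> (real k / real (card V)) ^ card T * real (card (ksubsets V k))"
proof -
  have "0 < card V" using V by (simp add: card_gt_0_iff)
  then show ?thesis unfolding card_ksubsets_superset[OF V(1) T] n_subsets[OF V(1)]
    by (rule binomial_ratio[OF T(2) k])
qed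

lemma card_point_superset:
  assumes V: "finite V" and x: "x \<in> V" and k: "0 < k" "k \<le> card V"
  shows "real (card {S \<in> ksubsets V k. x \<in> S}) = real k / real (card V) * real (card (ksubsets V k))"
proof -
  have n: "0 < card V" using V x card_gt_0_iff by blast
  have "card {S \<in> ksubsets V k. {x} \<subseteq> S} = (card V - 1) choose (k - 1)"
    using card_ksubsets_superset[OF V, of "{x}" k] x k by simp
  moreover have "k * (card V choose k) = card V * ((card V - 1) choose (k - 1))"
    using times_binomial_minus1_eq[of k "card V"] k by simp
  then have "real k * real (card V choose k) = real (card V) * real ((card V - 1) choose (k - 1))"
    by (metis of_nat_mult)
  ultimately show ?thesis using n by (simp add: n_subsets[OF V] field_simps)
qed

text \<open>Two of the four entries coincide, in one of 6 pairs of positions, and each case is an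
  image of the set of triples.\<close>

lemma degenerate_tuples:
  assumes V: "finite V"
  shows "card {(v, w, u, u') \<in> V \<times> V \<times> V \<times> V. card {v, w, u, u'} \<noteq> 4} \<le> 6 * card V ^ 3"
proof -
  let ?V3 = "V \<times> V \<times> V"
  define im where "im f = f ` ?V3" for f :: "'a \<times> 'a \<times> 'a \<Rightarrow> 'a \<times> 'a \<times> 'a \<times> 'a"
  have c: "card (im f) \<le> card V ^ 3" for f
    using card_image_le[of ?V3 f] V by (simp add: im_def card_cartesian_product power3_eq_cube)
  have "{(v, w, u, u') \<in> V \<times> V \<times> V \<times> V. card {v, w, u, u'} \<noteq> 4} \<subseteq>
    im (\<lambda>(a, b, c). (a, a, b, c)) \<union> (im (\<lambda>(a, b, c). (a, b, a, c)) \<union> (im (\<lambda>(a, b, c). (a, b, c, a)) \<union>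
    (im (\<lambda>(a, b, c). (b, a, a, c)) \<union> (im (\<lambda>(a, b, c). (b, a, c, a)) \<union> im (\<lambda>(a, b, c). (b, c, a, a))))))"
  proof (rule subsetI)
    fix t assume "t \<in> {(v, w, u, u') \<in> V \<times> V \<times> V \<times> V. card {v, w, u, u'} \<noteq> 4}"
    then obtain v w u u' where t: "t = (v, w, u, u')" and m: "v \<in> V" "w \<in> V" "u \<in> V" "u' \<in> V"
      and c4: "card {v, w, u, u'} \<noteq> 4" by blast
    have "v = w \<or> v = u \<or> v = u' \<or> w = u \<or> w = u' \<or> u = u'"
    proof (rule ccontr)
      assume "\<not> ?thesis"
      then have "card {v, w, u, u'} = 4" by simp
      then show False using c4 by simp
    qed
    then consider "v = w" | "v = u" | "v = u'" | "w = u" | "w = u'" | "u = u'" by blast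
    then show "t \<in> im (\<lambda>(a, b, c). (a, a, b, c)) \<union> (im (\<lambda>(a, b, c). (a, b, a, c)) \<union> (im (\<lambda>(a, b, c). (a, b, c, a)) \<union>
    (im (\<lambda>(a, b, c). (b, a, a, c)) \<union> (im (\<lambda>(a, b, c). (b, a, c, a)) \<union> im (\<lambda>(a, b, c). (b, c, a, a))))))"
    proof cases
      case 1
      then have "t \<in> im (\<lambda>(a, b, c). (a, a, b, c))"
        unfolding im_def by (intro image_eqI[of _ _ "(v, u, u')"]) (use t m in auto)
      then show ?thesis by blast
    next
      case 2
      then have "t \<in> im (\<lambda>(a, b, c). (a, b, a, c))"
        unfolding im_def by (intro image_eqI[of _ _ "(v, w, u')"]) (use t m in auto)
      then show ?thesis by blast
    next
      case 3
      then have "t \<in> im (\<lambda>(a, b, c). (a, b, c, a))"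
        unfolding im_def by (intro image_eqI[of _ _ "(v, w, u)"]) (use t m in auto)
      then show ?thesis by blast
    next
      case 4
      then have "t \<in> im (\<lambda>(a, b, c). (b, a, a, c))"
        unfolding im_def by (intro image_eqI[of _ _ "(w, v, u')"]) (use t m in auto)
      then show ?thesis by blast
    next
      case 5
      then have "t \<in> im (\<lambda>(a, b, c). (b, a, c, a))"
        unfolding im_def by (intro image_eqI[of _ _ "(w, v, u)"]) (use t m in auto)
      then show ?thesis by blast
    next
      case 6
      then have "t \<in> im (\<lambda>(a, b, c). (b, c, a, a))"
        unfolding im_def by (intro image_eqI[of _ _ "(u, v, w)"]) (use t m in auto)
      then show ?thesis by blast
    qed
  qed
  moreover have "finite (im f)" for f unfolding im_def using V by simp
  ultimately have "card {(v, w, u, u') \<in> V \<times> V \<times> V \<times> V. card {v, w, u, u'} \<noteq> 4} \<le>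
     card (im (\<lambda>(a, b, c). (a, a, b, c)) \<union> (im (\<lambda>(a, b, c). (a, b, a, c)) \<union> (im (\<lambda>(a, b, c). (a, b, c, a)) \<union>
    (im (\<lambda>(a, b, c). (b, a, a, c)) \<union> (im (\<lambda>(a, b, c). (b, a, c, a)) \<union> im (\<lambda>(a, b, c). (b, c, a, a)))))))"
    by (intro card_mono) auto
  also have "\<dots> \<le> card V ^ 3 + (card V ^ 3 + (card V ^ 3 + (card V ^ 3 + (card V ^ 3 + card V ^ 3))))"
    by (intro order_trans[OF card_Un_le] add_mono c)
  finally show ?thesis by simp
qed

text \<open>All tuples of four distinct entries lie in the same number \<open>N4\<close> of subsets.
  The equality matters because the terms have both signs: the estimate of \<open>N4\<close> may be
  applied only to the whole sum. Tuples with repetitions are bounded trivially, in \<open>V\<close>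
  and in each subset.\<close>

lemma sum_q4_ksubsets:
  assumes V: "finite V" and B: "\<And>u v. u \<in> V \<Longrightarrow> v \<in> V \<Longrightarrow> \<bar>B u v\<bar> \<le> 1" and k: "4 \<le> k" "k \<le> card V"
  shows "(\<Sum>S\<in>ksubsets V k. q4 S B) \<le>
    real (card (ksubsets V k)) * ((real k / real (card V)) ^ 4 * (q4 V B + 6 * real (card V) ^ 3) + 6 * real k ^ 3)"
proof -
  let ?V4 = "V \<times> V \<times> V \<times> V" and ?n = "real (card V)"
  have ne: "V \<noteq> {}" using k by auto
  define st where "st = (\<lambda>(v, w, u, u'). {v, w, u, u'} :: 'a set)"
  define Dg where "Dg = {t. card (st t) = 4}"
  have F1: "\<bar>F4 B t\<bar> \<le> 1" if "t \<in> ?V4" for t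
  proof -
    obtain v w u u' where t: "t = (v, w, u, u')" by (metis prod_cases4)
    show ?thesis using that B unfolding t F4_def by (auto simp: abs_mult intro!: mult_le_one)
  qed
  have deg: "real (card {t \<in> W \<times> W \<times> W \<times> W. t \<notin> Dg}) \<le> 6 * real (card W) ^ 3" if "finite W" for W :: "'a set"
  proof -
    have "{t \<in> W \<times> W \<times> W \<times> W. t \<notin> Dg} = {(v, w, u, u') \<in> W \<times> W \<times> W \<times> W. card {v, w, u, u'} \<noteq> 4}"
      by (auto simp: Dg_def st_def)
    then have "card {t \<in> W \<times> W \<times> W \<times> W. t \<notin> Dg} \<le> 6 * card W ^ 3" using degenerate_tuples[OF that] by simp
    then have "real (card {t \<in> W \<times> W \<times> W \<times> W. t \<notin> Dg}) \<le> real (6 * card W ^ 3)" by (rule of_nat_mono)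
    then show ?thesis by simp
  qed
  have split: "q4 W B = (\<Sum>t\<in>{t \<in> W \<times> W \<times> W \<times> W. t \<in> Dg}. F4 B t) + (\<Sum>t\<in>{t \<in> W \<times> W \<times> W \<times> W. t \<notin> Dg}. F4 B t)"
    if "finite W" for W :: "'a set"
    unfolding q4_F4 using that by (subst sum.union_disjoint[symmetric]) (auto intro!: sum.cong)
  have nd: "\<bar>\<Sum>t\<in>{t \<in> W \<times> W \<times> W \<times> W. t \<notin> Dg}. F4 B t\<bar> \<le> 6 * real (card W) ^ 3" if W: "W \<subseteq> V" for W
  proof -
    have "\<bar>\<Sum>t\<in>{t \<in> W \<times> W \<times> W \<times> W. t \<notin> Dg}. F4 B t\<bar> \<le> (\<Sum>t\<in>{t \<in> W \<times> W \<times> W \<times> W. t \<notin> Dg}. 1)"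
      using W by (intro order_trans[OF sum_abs] sum_mono F1) auto
    also have "\<dots> \<le> 6 * real (card W) ^ 3" using deg[OF finite_subset[OF W V]] by simp
    finally show ?thesis .
  qed
  define N4 where "N4 = real ((card V - 4) choose (k - 4))"
  have N4: "real (card {S \<in> ksubsets V k. st t \<subseteq> S}) = N4" if "t \<in> ?V4" "t \<in> Dg" for t
  proof -
    have "st t \<subseteq> V" using that by (auto simp: st_def)
    then show ?thesis using card_ksubsets_superset[OF V, of "st t" k] that k by (simp add: N4_def Dg_def)
  qed
  have N4le: "N4 \<le> (real k / ?n) ^ 4 * real (card (ksubsets V k))"
    unfolding N4_def n_subsets[OF V] using k by (intro binomial_ratio) auto
  have "(\<Sum>S\<in>ksubsets V k. q4 S B) \<le> (\<Sum>S\<in>ksubsets V k. (\<Sum>t\<in>{t \<in> ?V4. t \<in> Dg}. F4 B t * of_bool (st t \<subseteq> S)) + 6 * real k ^ 3)"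
  proof (rule sum_mono)
    fix S assume S: "S \<in> ksubsets V k"
    then have fS: "finite S" using V finite_subset by blast
    have "(\<Sum>t\<in>{t \<in> ?V4. t \<in> Dg}. F4 B t * of_bool (st t \<subseteq> S)) = (\<Sum>t\<in>{t \<in> ?V4. t \<in> Dg}. if st t \<subseteq> S then F4 B t else 0)"
      by (intro sum.cong refl) auto
    also have "\<dots> = (\<Sum>t\<in>{t \<in> ?V4. t \<in> Dg} \<inter> {t. st t \<subseteq> S}. F4 B t)"
      using V by (intro sum.inter_filter[symmetric, THEN trans] sum.cong) (auto simp: Int_def)
    also have "{t \<in> ?V4. t \<in> Dg} \<inter> {t. st t \<subseteq> S} = {t \<in> S \<times> S \<times> S \<times> S. t \<in> Dg}"
      using S by (auto simp: st_def)
    finally show "q4 S B \<le> (\<Sum>t\<in>{t \<in> ?V4. t \<in> Dg}. F4 B t * of_bool (st t \<subseteq> S)) + 6 * real k ^ 3"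
      using split[OF fS] nd[of S] S by simp
  qed
  also have "\<dots> = (\<Sum>S\<in>ksubsets V k. \<Sum>t\<in>{t \<in> ?V4. t \<in> Dg}. F4 B t * of_bool (st t \<subseteq> S)) + real (card (ksubsets V k)) * (6 * real k ^ 3)"
    by (simp add: sum.distrib)
  also have "(\<Sum>S\<in>ksubsets V k. \<Sum>t\<in>{t \<in> ?V4. t \<in> Dg}. F4 B t * of_bool (st t \<subseteq> S))
      = (\<Sum>t\<in>{t \<in> ?V4. t \<in> Dg}. F4 B t * N4)"
  proof (subst sum.swap, rule sum.cong[OF refl])
    fix t assume t: "t \<in> {t \<in> ?V4. t \<in> Dg}"
    have "(\<Sum>S\<in>ksubsets V k. F4 B t * of_bool (st t \<subseteq> S)) = F4 B t * (\<Sum>S\<in>ksubsets V k. of_bool (st t \<subseteq> S))"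
      by (rule sum_distrib_left[symmetric])
    also have "(\<Sum>S\<in>ksubsets V k. of_bool (st t \<subseteq> S)) = real (card {S \<in> ksubsets V k. st t \<subseteq> S})"
      using finite_ksubsets[OF V] by (subst sum_of_bool_eq) (auto simp: Int_def conj_commute)
    finally show "(\<Sum>S\<in>ksubsets V k. F4 B t * of_bool (st t \<subseteq> S)) = F4 B t * N4" using N4[of t] t by simp
  qed
  also have "\<dots> = N4 * (\<Sum>t\<in>{t \<in> ?V4. t \<in> Dg}. F4 B t)" by (simp add: sum_distrib_left mult.commute)
  also have "\<dots> \<le> N4 * (q4 V B + 6 * ?n ^ 3)"
    using split[OF V] nd[of V] by (intro mult_left_mono) (auto simp: N4_def)
  also have "\<dots> \<le> ((real k / ?n) ^ 4 * real (card (ksubsets V k))) * (q4 V B + 6 * ?n ^ 3)"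
    using q4_nonneg[of V B] by (intro mult_right_mono N4le) auto
  finally show ?thesis by (simp add: algebra_simps)
qed

text \<open>The variance of a hypergeometric variable from its first two moments. Two distinct
  points are selected together with probability at most the square of \<open>k / card V\<close>, so
  the quadratic terms in \<open>card X\<close> cancel.\<close>

lemma sum_deviation_ksubsets:
  assumes V: "finite V" and X: "X \<subseteq> V" and k: "2 \<le> k" "k \<le> card V"
  shows "(\<Sum>S\<in>ksubsets V k. (real (card (S \<inter> X)) / real k - real (card X) / real (card V))\<^sup>2) \<le> real (card (ksubsets V k)) / real k"
proof -
  have ne: "V \<noteq> {}" using k by auto
  have fX: "finite X" using X V finite_subset by blast
  define n N K x where "n = real (card V)" and "N = real (card (ksubsets V k))" and "K = real k" and "x = real (card X)"
  have n: "n > 0" and K: "K > 0" and N: "N \<ge> 0" using ne V k by (auto simp: n_def K_def N_def card_gt_0_iff)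
  have x: "0 \<le> x" "x \<le> n" unfolding x_def n_def using X V by (auto intro: card_mono)
  have ind: "real (card (S \<inter> X)) = (\<Sum>v\<in>X. of_bool (v \<in> S))" for S
    using fX by (subst sum_of_bool_eq) (auto simp: Int_commute Int_def conj_commute)
  have s1: "(\<Sum>S\<in>ksubsets V k. real (card (S \<inter> X))) = x * (K / n * N)"
  proof -
    have "(\<Sum>S\<in>ksubsets V k. real (card (S \<inter> X))) = (\<Sum>v\<in>X. \<Sum>S\<in>ksubsets V k. of_bool (v \<in> S))"
      unfolding ind by (rule sum.swap)
    also have "\<dots> = (\<Sum>v\<in>X. K / n * N)"
    proof (rule sum.cong[OF refl])
      fix v assume "v \<in> X"
      then have v: "v \<in> V" using X by auto
      have "(\<Sum>S\<in>ksubsets V k. of_bool (v \<in> S)) = real (card {S \<in> ksubsets V k. v \<in> S})"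
        using finite_ksubsets[OF V] by (subst sum_of_bool_eq) (auto simp: Int_def conj_commute)
      also have "\<dots> = K / n * N" unfolding K_def n_def N_def using k by (intro card_point_superset V v) auto
      finally show "(\<Sum>S\<in>ksubsets V k. of_bool (v \<in> S)) = K / n * N" .
    qed
    finally show ?thesis by (simp add: x_def)
  qed
  have s2: "(\<Sum>S\<in>ksubsets V k. (real (card (S \<inter> X)))\<^sup>2) \<le> x * (K / n * N) + x\<^sup>2 * ((K / n)\<^sup>2 * N)"
  proof -
    have "(\<Sum>S\<in>ksubsets V k. (real (card (S \<inter> X)))\<^sup>2) = (\<Sum>S\<in>ksubsets V k. \<Sum>v\<in>X. \<Sum>w\<in>X. of_bool (v \<in> S) * of_bool (w \<in> S))"
      unfolding ind by (simp only: power2_eq_square sum_product)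
    also have "\<dots> = (\<Sum>v\<in>X. \<Sum>w\<in>X. \<Sum>S\<in>ksubsets V k. of_bool (v \<in> S) * of_bool (w \<in> S))"
      by (subst sum.swap, rule sum.cong[OF refl], rule sum.swap)
    also have "\<dots> \<le> (\<Sum>v\<in>X. \<Sum>w\<in>X. of_bool (v = w) * (K / n * N) + (K / n)\<^sup>2 * N)"
    proof (intro sum_mono)
      fix v w assume vw: "v \<in> X" "w \<in> X"
      have eq: "(\<Sum>S\<in>ksubsets V k. of_bool (v \<in> S) * of_bool (w \<in> S)) = real (card {S \<in> ksubsets V k. {v, w} \<subseteq> S})"
      proof -
        have "(\<Sum>S\<in>ksubsets V k. of_bool (v \<in> S) * of_bool (w \<in> S)) = (\<Sum>S\<in>ksubsets V k. of_bool ({v, w} \<subseteq> S) :: real)"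
          by (intro sum.cong) auto
        also have "\<dots> = real (card {S \<in> ksubsets V k. {v, w} \<subseteq> S})"
          using finite_ksubsets[OF V] by (subst sum_of_bool_eq) (auto simp: Int_def conj_commute)
        finally show ?thesis .
      qed
      show "(\<Sum>S\<in>ksubsets V k. of_bool (v \<in> S) * of_bool (w \<in> S)) \<le> of_bool (v = w) * (K / n * N) + (K / n)\<^sup>2 * N"
      proof (cases "v = w")
        case True
        then have "real (card {S \<in> ksubsets V k. {v, w} \<subseteq> S}) = K / n * N"
          unfolding K_def n_def N_def using card_point_superset[OF V, of v k] vw X k by auto
        then show ?thesis unfolding eq using True N by simp
      next
        case False
        then have c2: "card {v, w} = 2" by simp
        have "real (card {S \<in> ksubsets V k. {v, w} \<subseteq> S}) \<le> (K / n) ^ card {v, w} * N"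
          unfolding K_def n_def N_def by (rule card_superset_le[OF V ne]) (use vw X k c2 in auto)
        then have "real (card {S \<in> ksubsets V k. {v, w} \<subseteq> S}) \<le> (K / n)\<^sup>2 * N" unfolding c2 .
        then show ?thesis unfolding eq using False by simp
      qed
    qed
    also have "\<dots> = x * (K / n * N) + x\<^sup>2 * ((K / n)\<^sup>2 * N)"
    proof -
      have "(\<Sum>w\<in>X. of_bool (v = w) * (K / n * N) + (K / n)\<^sup>2 * N) = K / n * N + x * ((K / n)\<^sup>2 * N)" if "v \<in> X" for v
      proof -
        have "(\<Sum>w\<in>X. of_bool (v = w) * (K / n * N)) = (\<Sum>w\<in>X. if v = w then K / n * N else 0)"
          by (intro sum.cong) auto
        then show ?thesis using that fX by (simp add: sum.distrib x_def)
      qed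
      then have "(\<Sum>v\<in>X. \<Sum>w\<in>X. of_bool (v = w) * (K / n * N) + (K / n)\<^sup>2 * N) = (\<Sum>v\<in>X. K / n * N + x * ((K / n)\<^sup>2 * N))"
        by (intro sum.cong) auto
      also have "\<dots> = x * (K / n * N + x * ((K / n)\<^sup>2 * N))" by (simp add: x_def)
      finally show ?thesis by (simp add: distrib_left power2_eq_square mult_ac)
    qed
    finally show ?thesis .
  qed
  have "(\<Sum>S\<in>ksubsets V k. (real (card (S \<inter> X)) / K - x / n)\<^sup>2) =
      (\<Sum>S\<in>ksubsets V k. (real (card (S \<inter> X)))\<^sup>2 / K\<^sup>2 - 2 * x / (n * K) * real (card (S \<inter> X)) + (x / n)\<^sup>2)"
    by (intro sum.cong refl) (simp add: power2_diff power_divide mult_ac)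
  also have "\<dots> = (\<Sum>S\<in>ksubsets V k. (real (card (S \<inter> X)))\<^sup>2) / K\<^sup>2 - 2 * x / (n * K) * (\<Sum>S\<in>ksubsets V k. real (card (S \<inter> X))) + N * (x / n)\<^sup>2"
    by (simp add: sum.distrib sum_subtractf sum_divide_distrib sum_distrib_left N_def)
  also have "\<dots> \<le> (x * (K / n * N) + x\<^sup>2 * ((K / n)\<^sup>2 * N)) / K\<^sup>2 - 2 * x / (n * K) * (x * (K / n * N)) + N * (x / n)\<^sup>2"
    unfolding s1 using s2 by (intro add_right_mono diff_right_mono divide_right_mono) auto
  also have "\<dots> = x / n * (N / K)"
    using n K by (simp add: field_simps power2_eq_square)
  also have "\<dots> \<le> 1 * (N / K)" using x n K N by (intro mult_right_mono) auto
  finally show ?thesis by (simp add: n_def N_def K_def x_def)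
qed

lemma markov_sum:
  fixes f :: "'b \<Rightarrow> real"
  assumes "finite A" "\<And>x. x \<in> A \<Longrightarrow> 0 \<le> f x" "(\<Sum>x\<in>A. f x) \<le> real (card A) * c" "0 < a"
  shows "real (card {x\<in>A. a < f x}) \<le> real (card A) * (c / a)"
proof -
  have "real (card {x\<in>A. a < f x}) * a = (\<Sum>x\<in>{x\<in>A. a < f x}. a)" by simp
  also have "\<dots> \<le> (\<Sum>x\<in>{x\<in>A. a < f x}. f x)" by (intro sum_mono) auto
  also have "\<dots> \<le> (\<Sum>x\<in>A. f x)" using assms by (intro sum_mono2) auto
  also have "\<dots> \<le> real (card A) * c" by fact
  finally show ?thesis using assms(4) by (simp add: field_simps)
qed

section \<open>The sampling lemma\<close>

text \<open>With the nodes sorted by class, the nodes of class below \<open>c\<close> fill the unit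
  interval up to this point.\<close>

definition thr :: "'a set \<Rightarrow> ('a \<Rightarrow> nat) \<Rightarrow> nat \<Rightarrow> real" where
  "thr V \<kappa> c = real (card {v\<in>V. \<kappa> v < c}) / real (card V)"

lemma thr_bounds: "finite V \<Longrightarrow> 0 \<le> thr V \<kappa> c \<and> thr V \<kappa> c \<le> 1"
  using card_mono[of V "{v\<in>V. \<kappa> v < c}"] by (cases "V = {}") (auto simp: thr_def divide_le_eq_1 card_gt_0_iff)

definition class_ordering :: "'a set \<Rightarrow> ('a \<Rightarrow> nat) \<Rightarrow> (nat \<Rightarrow> 'a) \<Rightarrow> bool" where
  "class_ordering V \<kappa> e \<longleftrightarrow> bij_betw e {..<card V} V \<and> (\<forall>j<card V. \<forall>i\<le>j. \<kappa> (e i) \<le> \<kappa> (e j))"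

lemma ex_ordering_key:
  fixes V :: "'a :: linorder set"
  assumes "finite V"
  shows "\<exists>e. class_ordering V \<kappa> e"
proof -
  define xs where "xs = sort_key \<kappa> (sorted_list_of_set V)"
  have xs: "distinct xs" "set xs = V" "length xs = card V" "sorted (map \<kappa> xs)"
    using assms by (simp_all add: xs_def)
  have "bij_betw ((!) xs) {..<card V} V" using xs by (intro bij_betw_nth) auto
  moreover have "\<kappa> (xs ! i) \<le> \<kappa> (xs ! j)" if "j < card V" "i \<le> j" for i j
    using sorted_nth_mono[OF xs(4), of i j] that xs(3) by simp
  ultimately show ?thesis unfolding class_ordering_def by blast
qed

text \<open>Nodes of class below \<open>c\<close> come first in the ordering. So the class of a
  point is encoded by its position relative to the thresholds, which can be compared between graphs
  with different numbers of nodes.\<close>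

lemma class_thresholds:
  assumes V: "finite V" "V \<noteq> {}" and e: "class_ordering V \<kappa> e" and x: "0 < x" "x \<le> 1"
  shows "c \<le> \<kappa> (e (idx (card V) x)) \<longleftrightarrow> thr V \<kappa> c < x"
proof -
  define n i where "n = card V" and "i = idx (card V) x"
  have n: "0 < n" using V by (simp add: card_gt_0_iff n_def)
  have i: "i < n" using idx_less[OF n x(2)] by (simp add: i_def n_def)
  have xi: "real i / real n < x" "x \<le> real (Suc i) / real n"
    using cell_cover[OF n x] unfolding i_def n_def cell_def by auto
  have b: "bij_betw e {..<n} V" and mono: "\<And>i j. j < n \<Longrightarrow> i \<le> j \<Longrightarrow> \<kappa> (e i) \<le> \<kappa> (e j)"
    using e by (auto simp: class_ordering_def n_def)
  define a where "a = card {v\<in>V. \<kappa> v < c}"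
  have "bij_betw e {l\<in>{..<n}. \<kappa> (e l) < c} {v\<in>V. \<kappa> v < c}"
    using b unfolding bij_betw_def by (auto intro: inj_on_subset)
  then have a: "a = card {l\<in>{..<n}. \<kappa> (e l) < c}" unfolding a_def by (rule bij_betw_same_card[symmetric])
  have t: "thr V \<kappa> c = real a / real n" by (simp add: thr_def a_def n_def)
  show ?thesis
  proof (cases "\<kappa> (e i) < c")
    case True
    have "{..i} \<subseteq> {l\<in>{..<n}. \<kappa> (e l) < c}" using True mono[OF i] i by fastforce
    then have "Suc i \<le> a" unfolding a using card_mono[of "{l\<in>{..<n}. \<kappa> (e l) < c}" "{..i}"] by simp
    then have "real (Suc i) / real n \<le> real a / real n" by (intro divide_right_mono) auto
    then show ?thesis using True xi t unfolding i_def by linarith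
  next
    case False
    have "{l\<in>{..<n}. \<kappa> (e l) < c} \<subseteq> {..<i}"
    proof
      fix l assume l: "l \<in> {l\<in>{..<n}. \<kappa> (e l) < c}"
      show "l \<in> {..<i}"
      proof (rule ccontr)
        assume "l \<notin> {..<i}"
        then have "\<kappa> (e i) \<le> \<kappa> (e l)" using l by (intro mono) auto
        then show False using l False by simp
      qed
    qed
    then have "a \<le> i" unfolding a using card_mono[of "{..<i}" "{l\<in>{..<n}. \<kappa> (e l) < c}"] by simp
    then have "real a / real n \<le> real i / real n" by (intro divide_right_mono) auto
    then show ?thesis using False xi t unfolding i_def by linarith
  qed
qed

section \<open>Integrals of step kernels\<close>

lemma measure_unit2_Times:
  assumes "S \<in> sets unit_measure" "T \<in> sets unit_measure"
  shows "measure (unit_measure \<Otimes>\<^sub>M unit_measure) (S \<times> T) = unit.prob S * unit.prob T"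
  using unit.emeasure_pair_measure_Times[OF assms] by (simp add: measure_def enn2real_mult)

lemma step_integral:
  assumes V: "finite V" "V \<noteq> {}" and e: "bij_betw e {..<card V} V"
    and ST: "S \<in> sets unit_measure" "T \<in> sets unit_measure"
  shows "(\<integral>z. indicator (S \<times> T) z * B (e (idx (card V) (fst z))) (e (idx (card V) (snd z))) \<partial>(unit_measure \<Otimes>\<^sub>M unit_measure))
     = (\<Sum>u\<in>V. \<Sum>w\<in>V. B u w * unit.prob (S \<inter> {x \<in> space unit_measure. e (idx (card V) x) = u})
          * unit.prob (T \<inter> {x \<in> space unit_measure. e (idx (card V) x) = w}))"
proof -
  let ?M = "unit_measure \<Otimes>\<^sub>M unit_measure"
  define n where "n = card V"
  have n: "0 < n" using V by (simp add: card_gt_0_iff n_def)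
  define v where "v x = e (idx n x)" for x
  define I where "I u = {x \<in> space unit_measure. v x = u}" for u
  have [measurable]: "v \<in> unit_measure \<rightarrow>\<^sub>M count_space UNIV" unfolding v_def by measurable
  have Im[measurable]: "I u \<in> sets unit_measure" for u unfolding I_def by measurable
  have "(\<integral>z. indicator (S \<times> T) z * B (v (fst z)) (v (snd z)) \<partial>?M) =
      (\<integral>z. (\<Sum>u\<in>V. \<Sum>w\<in>V. B u w * indicator ((S \<inter> I u) \<times> (T \<inter> I w)) z) \<partial>?M)"
  proof (rule Bochner_Integration.integral_cong[OF refl])
    fix z assume z: "z \<in> space ?M"
    define p q where "p = v (fst z)" and "q = v (snd z)"
    have "idx n (fst z) < n" "idx n (snd z) < n" using z by (auto intro!: idx_less n simp: space_unit2)
    then have pq: "p \<in> V" "q \<in> V" unfolding p_def q_def v_def using bij_betwE[OF e] by (auto simp: n_def)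
    have zI: "fst z \<in> I i \<longleftrightarrow> i = p" "snd z \<in> I i \<longleftrightarrow> i = q" for i
      using z by (auto simp: I_def p_def q_def space_pair_measure)
    have "(\<Sum>u\<in>V. \<Sum>w\<in>V. B u w * indicator ((S \<inter> I u) \<times> (T \<inter> I w)) z) =
       (\<Sum>u\<in>V. if u = p then (\<Sum>w\<in>V. if w = q then B p q * indicator (S \<times> T) z else 0) else 0)"
      by (intro sum.cong refl) (auto simp: indicator_def mem_Times_iff zI intro!: sum.cong)
    also have "\<dots> = B p q * indicator (S \<times> T) z" using pq V by simp
    finally show "indicator (S \<times> T) z * B (v (fst z)) (v (snd z)) =
       (\<Sum>u\<in>V. \<Sum>w\<in>V. B u w * indicator ((S \<inter> I u) \<times> (T \<inter> I w)) z)"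
      by (simp add: p_def q_def)
  qed
  also have "\<dots> = (\<Sum>u\<in>V. \<Sum>w\<in>V. \<integral>z. B u w * indicator ((S \<inter> I u) \<times> (T \<inter> I w)) z \<partial>?M)"
  proof -
    have int: "integrable ?M (\<lambda>z. B u w * indicator ((S \<inter> I u) \<times> (T \<inter> I w)) z)" for u w
      using ST by (intro integrable_mult_right integrable_real_indicator) (auto simp: unit2.P.emeasure_finite top.not_eq_extremum[symmetric])
    show ?thesis
      by (subst Bochner_Integration.integral_sum, intro Bochner_Integration.integrable_sum int,
          rule sum.cong[OF refl], rule Bochner_Integration.integral_sum, rule int)
  qed
  also have "\<dots> = (\<Sum>u\<in>V. \<Sum>w\<in>V. B u w * unit.prob (S \<inter> I u) * unit.prob (T \<inter> I w))"
  proof (intro sum.cong refl)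
    fix i j
    have m: "S \<inter> I i \<in> sets unit_measure" "T \<inter> I j \<in> sets unit_measure" using ST by auto
    have sub: "(S \<inter> I i) \<times> (T \<inter> I j) \<inter> space ?M = (S \<inter> I i) \<times> (T \<inter> I j)"
      using sets.sets_into_space[OF pair_measureI[OF m]] by blast
    have "(\<integral>z. B i j * indicator ((S \<inter> I i) \<times> (T \<inter> I j)) z \<partial>?M) = B i j * measure ?M ((S \<inter> I i) \<times> (T \<inter> I j))"
      by (simp only: integral_mult_right_zero Bochner_Integration.integral_indicator sub)
    then show "(\<integral>z. B i j * indicator ((S \<inter> I i) \<times> (T \<inter> I j)) z \<partial>?M) = B i j * unit.prob (S \<inter> I i) * unit.prob (T \<inter> I j)"
      using measure_unit2_Times[OF m] by simp
  qed
  finally show ?thesis unfolding I_def v_def n_def .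
qed

lemma prob_vertex:
  assumes V: "finite V" and e: "bij_betw e {..<card V} V" and u: "u \<in> V"
  shows "unit.prob {x \<in> space unit_measure. e (idx (card V) x) = u} = 1 / real (card V)"
proof -
  have n: "0 < card V" using V u card_gt_0_iff by blast
  have "u \<in> e ` {..<card V}" using bij_betw_imp_surj_on[OF e] u by (simp only:)
  then obtain i where i: "i < card V" "e i = u" by auto
  have "e (idx (card V) x) = u \<longleftrightarrow> idx (card V) x = i" if "x \<in> space unit_measure" for x
  proof -
    have "idx (card V) x < card V" using that by (intro idx_less n) auto
    then show ?thesis
      using i inj_on_eq_iff[OF bij_betw_imp_inj_on[OF e], of "idx (card V) x" i] by simp
  qed
  then have "{x \<in> space unit_measure. e (idx (card V) x) = u} = {x \<in> space unit_measure. idx (card V) x = i}" by blast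
  then show ?thesis using prob_idx[OF i(1)] by simp
qed

lemma step_integral_space:
  assumes V: "finite V" "V \<noteq> {}" and e: "bij_betw e {..<card V} V"
  shows "(\<integral>z. B (e (idx (card V) (fst z))) (e (idx (card V) (snd z))) \<partial>(unit_measure \<Otimes>\<^sub>M unit_measure))
     = (\<Sum>u\<in>V. \<Sum>w\<in>V. B u w) / (real (card V))\<^sup>2"
proof -
  let ?M = "unit_measure \<Otimes>\<^sub>M unit_measure" and ?s = "space unit_measure"
  have "(\<integral>z. B (e (idx (card V) (fst z))) (e (idx (card V) (snd z))) \<partial>?M) =
      (\<integral>z. indicator (?s \<times> ?s) z * B (e (idx (card V) (fst z))) (e (idx (card V) (snd z))) \<partial>?M)"
    by (intro Bochner_Integration.integral_cong refl) (auto simp: space_pair_measure)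
  also have "\<dots> = (\<Sum>u\<in>V. \<Sum>w\<in>V. B u w * unit.prob (?s \<inter> {x \<in> ?s. e (idx (card V) x) = u})
          * unit.prob (?s \<inter> {x \<in> ?s. e (idx (card V) x) = w}))"
    by (rule step_integral[OF V e]) auto
  also have "\<dots> = (\<Sum>u\<in>V. \<Sum>w\<in>V. B u w / (real (card V))\<^sup>2)"
  proof (intro sum.cong refl)
    fix u w assume uw: "u \<in> V" "w \<in> V"
    have a: "?s \<inter> {x \<in> ?s. e (idx (card V) x) = u} = {x \<in> ?s. e (idx (card V) x) = u}" for u by blast
    show "B u w * unit.prob (?s \<inter> {x \<in> ?s. e (idx (card V) x) = u}) * unit.prob (?s \<inter> {x \<in> ?s. e (idx (card V) x) = w}) = B u w / (real (card V))\<^sup>2"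
      unfolding a prob_vertex[OF V(1) e uw(1)] prob_vertex[OF V(1) e uw(2)] by (simp add: power2_eq_square)
  qed
  finally show ?thesis by (simp add: sum_divide_distrib)
qed

text \<open>The measure of the part of \<open>S\<close> in the cell of a node, multiplied by the
  number of nodes, is a weight between 0 and 1, so the integral is a weighted sum as in
  \<open>mcut_weighted\<close>.\<close>

lemma mcut_step_integral:
  assumes V: "finite V" "V \<noteq> {}" and e: "bij_betw e {..<card V} V"
    and ST: "S \<in> sets unit_measure" "T \<in> sets unit_measure"
  shows "\<bar>\<integral>z. indicator (S \<times> T) z * B (e (idx (card V) (fst z))) (e (idx (card V) (snd z))) \<partial>(unit_measure \<Otimes>\<^sub>M unit_measure)\<bar>
     \<le> mcut V B"
proof -
  define n where "n = card V"
  have n: "0 < n" using V by (simp add: card_gt_0_iff n_def)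
  define s where "s S u = unit.prob (S \<inter> {x \<in> space unit_measure. e (idx (card V) x) = u})" for S u
  have st: "0 \<le> real n * s S u \<and> real n * s S u \<le> 1" if u: "u \<in> V" for u S
  proof -
    have "s S u \<le> unit.prob {x \<in> space unit_measure. e (idx (card V) x) = u}"
      unfolding s_def by (rule unit.finite_measure_mono[OF Int_lower2]) measurable
    also have "\<dots> = 1 / real n" unfolding n_def by (rule prob_vertex[OF V(1) e u])
    finally show ?thesis using n by (simp add: s_def field_simps)
  qed
  have "(\<Sum>u\<in>V. \<Sum>w\<in>V. B u w * s S u * s T w) = (\<Sum>u\<in>V. \<Sum>w\<in>V. B u w * (real n * s S u) * (real n * s T w)) / (real n)\<^sup>2"
    using n by (simp add: sum_divide_distrib power2_eq_square mult.assoc)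
  moreover have "\<bar>\<Sum>u\<in>V. \<Sum>w\<in>V. B u w * (real n * s S u) * (real n * s T w)\<bar> \<le> mcut V B * (real n)\<^sup>2"
    unfolding n_def using st by (intro mcut_weighted V) (auto simp: n_def)
  ultimately have "\<bar>\<Sum>u\<in>V. \<Sum>w\<in>V. B u w * s S u * s T w\<bar> \<le> mcut V B"
    using n by (simp add: pos_divide_le_eq)
  then show ?thesis unfolding step_integral[OF V e ST] s_def .
qed

lemma ucut_close_mcut:
  assumes V: "finite V" "V \<noteq> {}" and e: "bij_betw e {..<card V} V"
  shows "ucut_close (\<lambda>z. A (e (idx (card V) (fst z))) (e (idx (card V) (snd z))))
      (\<lambda>z. P (e (idx (card V) (fst z))) (e (idx (card V) (snd z)))) (mcut V (\<lambda>u w. A u w - P u w))"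
  unfolding cut_close_def using mcut_step_integral[OF V e, where B = "\<lambda>u w. A u w - P u w"] by blast

text \<open>The two classes of \<open>x\<close> differ only if \<open>x\<close> lies between the two
  thresholds of some \<open>c\<close>.\<close>

lemma prob_class_mismatch:
  fixes \<kappa> :: "'a \<Rightarrow> nat" and \<kappa>' :: "'b \<Rightarrow> nat"
  assumes V: "finite V" "V \<noteq> {}" "class_ordering V \<kappa> e" and V': "finite V'" "V' \<noteq> {}" "class_ordering V' \<kappa>' e'"
    and M: "\<And>v. v \<in> V \<Longrightarrow> \<kappa> v < M" "\<And>v. v \<in> V' \<Longrightarrow> \<kappa>' v < M"
  shows "unit.prob {x \<in> space unit_measure. \<kappa> (e (idx (card V) x)) \<noteq> \<kappa>' (e' (idx (card V') x))}
    \<le> (\<Sum>c<M. \<bar>thr V \<kappa> c - thr V' \<kappa>' c\<bar>)"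
proof -
  let ?k = "\<lambda>x. \<kappa> (e (idx (card V) x))" and ?k' = "\<lambda>x. \<kappa>' (e' (idx (card V') x))"
  let ?J = "\<lambda>c. {min (thr V \<kappa> c) (thr V' \<kappa>' c)<..max (thr V \<kappa> c) (thr V' \<kappa>' c)}"
  have [measurable]: "?k \<in> unit_measure \<rightarrow>\<^sub>M count_space UNIV" "?k' \<in> unit_measure \<rightarrow>\<^sub>M count_space UNIV" by measurable
  have n: "0 < card V" "0 < card V'" using V(1,2) V'(1,2) by (simp_all add: card_gt_0_iff)
  have t01: "0 \<le> thr V \<kappa> c \<and> thr V \<kappa> c \<le> 1" "0 \<le> thr V' \<kappa>' c \<and> thr V' \<kappa>' c \<le> 1" for c
    by (intro thr_bounds V V')+
  have Jsub: "?J c \<subseteq> {0..1}" for c using t01[of c] by auto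
  have Jm: "?J c \<in> sets unit_measure" for c unfolding sets_unit_iff using Jsub by auto
  have Jp: "unit.prob (?J c) = \<bar>thr V \<kappa> c - thr V' \<kappa>' c\<bar>" for c
    unfolding unit_measure_eq[OF Jm] by (simp add: max_def min_def)
  have sub: "x \<in> (\<Union>c\<in>{..<M}. ?J c)" if x: "0 < x" "x \<le> 1" and ne: "?k x \<noteq> ?k' x" for x
  proof -
    have m: "?k x < M" "?k' x < M"
      using V(3) V'(3) idx_less[OF n(1) x(2)] idx_less[OF n(2) x(2)]
      by (auto simp: class_ordering_def intro!: M dest: bij_betwE)
    \<comment> \<open>The larger class is a level that \<open>x\<close> reaches in one graph and not
      in the other.\<close>
    define c where "c = max (?k x) (?k' x)"
    have c: "c < M" using m by (simp add: c_def)
    have "(c \<le> ?k x) \<noteq> (c \<le> ?k' x)" using ne unfolding c_def by linarith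
    then have "x \<in> ?J c"
      unfolding class_thresholds[OF V x] class_thresholds[OF V' x] by auto
    then show ?thesis using c by blast
  qed
  have "unit.prob {x \<in> space unit_measure. ?k x \<noteq> ?k' x} \<le> unit.prob (\<Union>c\<in>{..<M}. ?J c)"
  proof (rule unit.finite_measure_mono_AE)
    show "AE x in unit_measure. x \<in> {x \<in> space unit_measure. ?k x \<noteq> ?k' x} \<longrightarrow> x \<in> (\<Union>c\<in>{..<M}. ?J c)"
      using AE_unit_pos AE_space
    proof eventually_elim
      case (elim x)
      then show ?case using sub[of x] by (metis (mono_tags) atLeastAtMost_iff mem_Collect_eq space_lebesgue_on)
    qed
    show "(\<Union>c\<in>{..<M}. ?J c) \<in> sets unit_measure" using Jm by blast
  qed
  also have "\<dots> \<le> (\<Sum>c<M. unit.prob (?J c))"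
    by (rule unit.finite_measure_subadditive_finite) (use Jm in auto)
  finally show ?thesis unfolding Jp .
qed

text \<open>The kernels differ only on two strips, one for each coordinate, over the set where
  \<open>\<kappa>\<close> and \<open>\<kappa>'\<close> differ.\<close>

lemma ucut_close_mismatch:
  fixes d :: "nat \<Rightarrow> nat \<Rightarrow> real"
  assumes d: "\<And>a b. 0 \<le> d a b \<and> d a b \<le> 1"
    and m[measurable]: "\<kappa> \<in> unit_measure \<rightarrow>\<^sub>M count_space UNIV" "\<kappa>' \<in> unit_measure \<rightarrow>\<^sub>M count_space UNIV"
    and p: "unit.prob {x \<in> space unit_measure. \<kappa> x \<noteq> \<kappa>' x} \<le> b"
  shows "ucut_close (\<lambda>z. d (\<kappa> (fst z)) (\<kappa> (snd z))) (\<lambda>z. d (\<kappa>' (fst z)) (\<kappa>' (snd z))) (2 * b)"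
  unfolding cut_close_def
proof (intro ballI)
  fix S T assume ST[measurable]: "S \<in> sets unit_measure" "T \<in> sets unit_measure"
  let ?M = "unit_measure \<Otimes>\<^sub>M unit_measure"
  define X where "X = {x \<in> space unit_measure. \<kappa> x \<noteq> \<kappa>' x}"
  have "X = space unit_measure -
      (\<Union>i. {x \<in> space unit_measure. \<kappa> x = i} \<inter> {x \<in> space unit_measure. \<kappa>' x = i})"
    unfolding X_def by auto
  also have "\<dots> \<in> sets unit_measure" by measurable
  finally have X[measurable]: "X \<in> sets unit_measure" .
  let ?f = "\<lambda>z. d (\<kappa> (fst z)) (\<kappa> (snd z)) - d (\<kappa>' (fst z)) (\<kappa>' (snd z))"
  have K: "unit_kernel (\<lambda>z. d (\<kappa> (fst z)) (\<kappa> (snd z)))" "unit_kernel (\<lambda>z. d (\<kappa>' (fst z)) (\<kappa>' (snd z)))"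
    by (rule kernel_step[OF m(1), of d, OF d], rule kernel_step[OF m(2), of d, OF d])
  have i1: "integrable ?M (indicator (X \<times> space unit_measure) :: _ \<Rightarrow> real)"
    "integrable ?M (indicator (space unit_measure \<times> X) :: _ \<Rightarrow> real)"
    by (auto intro!: integrable_real_indicator simp: unit2.P.emeasure_finite top.not_eq_extremum[symmetric])
  have "\<bar>\<integral>z. indicator (S \<times> T) z * ?f z \<partial>?M\<bar> \<le> (\<integral>z. \<bar>indicator (S \<times> T) z * ?f z\<bar> \<partial>?M)"
    by (rule integral_abs_bound)
  also have "\<dots> \<le> (\<integral>z. indicator (X \<times> space unit_measure) z + indicator (space unit_measure \<times> X) z \<partial>?M)"
  proof (rule integral_mono)
    show "integrable ?M (\<lambda>z. \<bar>indicator (S \<times> T) z * ?f z\<bar>)"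
      by (intro integrable_abs kernel_diff_integrable K ST)
    show "integrable ?M (\<lambda>z. indicator (X \<times> space unit_measure) z + indicator (space unit_measure \<times> X) z :: real)"
      by (intro Bochner_Integration.integrable_add i1)
    fix z assume z: "z \<in> space ?M"
    then have zs: "fst z \<in> space unit_measure" "snd z \<in> space unit_measure" by (auto simp: space_pair_measure)
    show "\<bar>indicator (S \<times> T) z * ?f z\<bar> \<le> indicator (X \<times> space unit_measure) z + indicator (space unit_measure \<times> X) z"
    proof (cases "fst z \<in> X \<or> snd z \<in> X")
      case True
      have "\<bar>indicator (S \<times> T) z * ?f z\<bar> \<le> 1"
        using d[of "\<kappa> (fst z)" "\<kappa> (snd z)"] d[of "\<kappa>' (fst z)" "\<kappa>' (snd z)"] by (auto simp: indicator_def)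
      also have "1 \<le> indicator (X \<times> space unit_measure) z + (indicator (space unit_measure \<times> X) z :: real)"
        using True zs by (auto simp: indicator_def mem_Times_iff)
      finally show ?thesis .
    next
      case False
      then have "?f z = 0" using zs by (auto simp: X_def)
      then show ?thesis by simp
    qed
  qed
  also have "\<dots> = measure ?M (X \<times> space unit_measure) + measure ?M (space unit_measure \<times> X)"
  proof -
    have "X \<times> space unit_measure \<inter> space ?M = X \<times> space unit_measure" "space unit_measure \<times> X \<inter> space ?M = space unit_measure \<times> X"
      using sets.sets_into_space[OF X] unfolding space_pair_measure by blast+
    then show ?thesis unfolding Bochner_Integration.integral_add[OF i1] Bochner_Integration.integral_indicator by (simp only:)
  qed
  also have "\<dots> = 2 * unit.prob X"
    unfolding measure_unit2_Times[OF X sets.top] measure_unit2_Times[OF sets.top X] unit.prob_space by simp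
  also have "\<dots> \<le> 2 * b" using p by (simp add: X_def)
  finally show "\<bar>\<integral>z. indicator (S \<times> T) z * ?f z \<partial>?M\<bar> \<le> 2 * b" .
qed

text \<open>\<open>G\<close> is compared with its block averages, these with the same averages
  placed on \<open>S\<close>, and those with the sample. Since the averages of \<open>G\<close> are
  used on both sides, the error on \<open>S\<close> is a restriction of one fixed matrix, to which
  \<open>sum_q4_ksubsets\<close> applies; the middle step only moves the borders of the
  classes.\<close>

lemma cut_dist_induced_le:
  fixes G :: ugraph
  defines "A \<equiv> adj G"
  assumes G: "simple_graph G" and S: "S \<subseteq> nodes G" "S \<noteq> {}"
  shows "cut_dist G (induced G S) \<le> mcut (nodes G) (step_err (nodes G) A j) + mcut S (step_err (nodes G) A j)
      + 2 * (\<Sum>c<4^j. \<bar>thr (nodes G) (parts (nodes G) A j) c - thr S (parts (nodes G) A j) c\<bar>)"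
proof -
  let ?V = "nodes G"
  define \<kappa> where "\<kappa> = parts ?V A j"
  define d where "d = dens ?V \<kappa> A"
  have V: "finite ?V" "?V \<noteq> {}" using G S by (auto simp: simple_graph_def)
  have fS: "finite S" using S V finite_subset by blast
  have A01: "0 \<le> A u w \<and> A u w \<le> 1" for u w by (simp add: A_def adj_def)
  have d01: "0 \<le> d a b \<and> d a b \<le> 1" for a b unfolding d_def using dens_bounds[OF V(1), of A \<kappa> a b] A01 by blast
  have \<kappa>M: "\<kappa> v < 4 ^ j" for v unfolding \<kappa>_def by (rule parts_less)
  obtain e where e: "class_ordering ?V \<kappa> e" using ex_ordering_key[OF V(1)] by blast
  obtain f where f: "class_ordering S \<kappa> f" using ex_ordering_key[OF fS] by blast
  have be: "bij_betw e {..<card ?V} ?V" and bf: "bij_betw f {..<card S} S" using e f by (auto simp: class_ordering_def)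
  define v w where "v x = e (idx (card ?V) x)" and "w x = f (idx (card S) x)" for x
  have vm: "(\<lambda>x. v x) \<in> unit_measure \<rightarrow>\<^sub>M count_space UNIV" unfolding v_def by measurable
  have wm: "(\<lambda>x. w x) \<in> unit_measure \<rightarrow>\<^sub>M count_space UNIV" unfolding w_def by measurable
  have \<kappa>v: "(\<lambda>x. \<kappa> (v x)) \<in> unit_measure \<rightarrow>\<^sub>M count_space UNIV" using vm by measurable
  have \<kappa>w: "(\<lambda>x. \<kappa> (w x)) \<in> unit_measure \<rightarrow>\<^sub>M count_space UNIV" using wm by measurable
  define U P P' U' where "U z = A (v (fst z)) (v (snd z))" and "P z = d (\<kappa> (v (fst z))) (\<kappa> (v (snd z)))"
    and "P' z = d (\<kappa> (w (fst z))) (\<kappa> (w (snd z)))" and "U' z = A (w (fst z)) (w (snd z))" for z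
  have K: "unit_kernel U" "unit_kernel U'" unfolding U_def U'_def by (intro kernel_step vm wm A01)+
  have KP: "unit_kernel P" "unit_kernel P'" unfolding P_def P'_def by (intro kernel_step[OF \<kappa>v] kernel_step[OF \<kappa>w] d01)+
  have err: "step_err ?V A j = (\<lambda>u w. A u w - d (\<kappa> u) (\<kappa> w))"
    by (intro ext) (simp add: step_err_def \<kappa>_def d_def)
  have 1: "ucut_close U P (mcut ?V (step_err ?V A j))"
    unfolding U_def P_def v_def err by (rule ucut_close_mcut[OF V be])
  have 2: "ucut_close P P' (2 * (\<Sum>c<4^j. \<bar>thr ?V \<kappa> c - thr S \<kappa> c\<bar>))"
    unfolding P_def P'_def
    by (intro ucut_close_mismatch d01 \<kappa>v \<kappa>w) (unfold v_def w_def, rule prob_class_mismatch[OF V e fS S(2) f \<kappa>M \<kappa>M])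
  have 3: "ucut_close U' P' (mcut S (step_err ?V A j))"
    unfolding U'_def P'_def w_def err by (rule ucut_close_mcut[OF fS S(2) bf])
  have "ucut_close U U' (mcut ?V (step_err ?V A j) + 2 * (\<Sum>c<4^j. \<bar>thr ?V \<kappa> c - thr S \<kappa> c\<bar>) + mcut S (step_err ?V A j))"
    by (rule ucut_close_trans[OF K(1) KP(2) K(2) ucut_close_trans[OF K(1) KP 1 2] ucut_close_sym[OF 3]])
  moreover have "gker G e = U" by (rule ext) (simp add: gker_def U_def v_def A_def)
  moreover have cS: "card (nodes (induced G S)) = card S" by (simp add: induced_def)
  have nS: "0 < card S" using fS S by (simp add: card_gt_0_iff)
  have U'eq: "gker (induced G S) f z = U' z" if z: "z \<in> {0..1} \<times> {0..1}" for z
  proof -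
    have "f (idx (card S) (fst z)) \<in> S" "f (idx (card S) (snd z)) \<in> S"
      using z bij_betwE[OF bf] idx_less[OF nS, of "fst z"] idx_less[OF nS, of "snd z"] by auto
    then show ?thesis unfolding gker_def cS U'_def w_def A_def adj_def by (simp add: induced_def)
  qed
  have "ucut_close U' (gker (induced G S) f) 0"
    by (rule ucut_close_AE_eq[OF K(2) kernel_gker AE_unit_pos]) (use U'eq in auto)
  ultimately have "ucut_close (gker G e) (gker (induced G S) f)
      (mcut ?V (step_err ?V A j) + 2 * (\<Sum>c<4^j. \<bar>thr ?V \<kappa> c - thr S \<kappa> c\<bar>) + mcut S (step_err ?V A j) + 0)"
    using ucut_close_trans[OF K(1) K(2) kernel_gker] by metis
  then have "cut_dist G (induced G S) \<le> mcut ?V (step_err ?V A j) + 2 * (\<Sum>c<4^j. \<bar>thr ?V \<kappa> c - thr S \<kappa> c\<bar>) + mcut S (step_err ?V A j) + 0"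
    using V S nS bf be cS by (intro cut_dist_le) (auto simp: card_gt_0_iff induced_def)
  then show ?thesis by (simp add: \<kappa>_def)
qed

text \<open>The regular partition of \<open>G\<close> has at most \<open>4 ^ L\<close> classes with
  \<open>L\<close> independent of \<open>G\<close>, so \<open>K\<close> depends on \<epsilon> only.
  A sample is bad if the error has a large sum over 4-cycles on it or if its class sizes deviate;
  each kind makes up at most one sixth.\<close>

lemma sampling:
  fixes \<epsilon> :: real
  assumes \<epsilon>: "0 < \<epsilon>"
  shows "\<exists>K\<ge>1. \<forall>G k. simple_graph G \<and> K \<le> k \<and> k \<le> card (nodes G) \<longrightarrow>
    real (card {S \<in> ksubsets (nodes G) k. \<epsilon> \<le> cut_dist G (induced G S)}) \<le> 1/3 * real (card (ksubsets (nodes G) k))"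
proof -
  \<comment> \<open>By \<open>mcut_le_q4\<close> this bound on the normalised \<open>q4\<close> of
    the sample makes the cut norm of the error there at most \<open>\<epsilon> / 4\<close>.\<close>
  define \<eta> where "\<eta> = (\<epsilon> / 4) ^ 4"
  have \<eta>: "0 < \<eta>" using \<epsilon> by (simp add: \<eta>_def)
  \<comment> \<open>Markov's inequality needs the mean \<open>\<eta> / 6\<close>. By
    \<open>q4_le_mcut\<close> the bound \<open>\<eta> / 48\<close> yields one half of it; the
    condition \<open>144 / \<eta> < k\<close> yields the other half, for tuples with repetitions.
    The bound \<open>\<epsilon> / 4\<close> is the error on \<open>G\<close> itself.\<close>
  define a where "a = min (\<epsilon> / 4) (\<eta> / 48)"
  have a: "0 < a" using \<epsilon> \<eta> by (simp add: a_def)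
  obtain L :: nat where L: "0 < L" "1 / real L < a\<^sup>2"
    using ex_inverse_of_nat_less[of "a\<^sup>2"] a by (auto simp: inverse_eq_divide)
  define M where "M = real (4 ^ L)"
  have M: "M \<ge> 1" by (simp add: M_def)
  \<comment> \<open>Then the at most \<open>M\<close> thresholds deviate by at most
    \<open>\<epsilon> / 16\<close> in total.\<close>
  define \<eta>' where "\<eta>' = (\<epsilon> / (16 * M))\<^sup>2"
  have \<eta>': "0 < \<eta>'" using \<epsilon> M by (simp add: \<eta>'_def)
  obtain K0 :: nat where K0: "max (144 / \<eta>) (6 * M / \<eta>') < real K0" using reals_Archimedean2 by blast
  define K where "K = max K0 4"
  show ?thesis
  proof (intro exI[of _ K] conjI allI impI)
    show "1 \<le> K" by (simp add: K_def)
    fix G :: ugraph and k :: nat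
    assume asm: "simple_graph G \<and> K \<le> k \<and> k \<le> card (nodes G)"
    let ?V = "nodes G"
    define A where "A = adj G"
    have k: "4 \<le> k" "k \<le> card ?V" and kK: "144 / \<eta> < real k" "6 * M / \<eta>' < real k"
      using asm K0 by (auto simp: K_def)
    have V: "finite ?V" using asm by (simp add: simple_graph_def)
    have A01: "0 \<le> A u w \<and> A u w \<le> 1" for u w by (simp add: A_def adj_def)
    obtain j where j: "j < L" "(mcut ?V (step_err ?V A j))\<^sup>2 \<le> 1 / real L"
      using weak_regularity[of ?V A L] V A01 L by auto
    define B \<kappa> where "B = step_err ?V A j" and "\<kappa> = parts ?V A j"
    have B1: "\<bar>B u w\<bar> \<le> 1" if "u \<in> ?V" "w \<in> ?V" for u w
      using dens_bounds[OF V, of A \<kappa> "\<kappa> u" "\<kappa> w"] A01[of u w] A01 unfolding B_def step_err_def \<kappa>_def[symmetric]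
      by fastforce
    have mV: "mcut ?V B < a"
    proof -
      have "(mcut ?V B)\<^sup>2 < a\<^sup>2" using j L unfolding B_def by linarith
      then show ?thesis using a by (simp add: power_less_imp_less_base)
    qed
    define N where "N = real (card (ksubsets ?V k))"
    have n: "0 < real (card ?V)" and kp: "0 < real k" using k by auto
    have "(\<Sum>S\<in>ksubsets ?V k. q4 S B / real k ^ 4) \<le> N * (\<eta> / 6)"
    proof -
      have "(\<Sum>S\<in>ksubsets ?V k. q4 S B / real k ^ 4) = (\<Sum>S\<in>ksubsets ?V k. q4 S B) / real k ^ 4"
        by (rule sum_divide_distrib[symmetric])
      also have "\<dots> \<le> N * ((real k / real (card ?V)) ^ 4 * (q4 ?V B + 6 * real (card ?V) ^ 3) + 6 * real k ^ 3) / real k ^ 4"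
        unfolding N_def using kp by (intro divide_right_mono sum_q4_ksubsets V B1 k) auto
      also have "\<dots> = N * (q4 ?V B / real (card ?V) ^ 4 + 6 / real (card ?V) + 6 / real k)"
        using n kp by (simp add: power_divide field_simps power_numeral_reduce)
      also have "\<dots> \<le> N * (\<eta> / 6)"
      proof (rule mult_left_mono)
        have "q4 ?V B / real (card ?V) ^ 4 \<le> 4 * mcut ?V B"
          using q4_le_mcut[OF V, of B] B1 n by (simp add: pos_divide_le_eq)
        also have "\<dots> \<le> \<eta> / 12" using mV by (simp add: a_def)
        finally have 1: "q4 ?V B / real (card ?V) ^ 4 \<le> \<eta> / 12" .
        have "6 / real (card ?V) \<le> 6 / real k" using k kp by (intro divide_left_mono) auto
        moreover have "12 / real k \<le> \<eta> / 12" using kK(1) \<eta> kp by (simp add: field_simps)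
        ultimately show "q4 ?V B / real (card ?V) ^ 4 + 6 / real (card ?V) + 6 / real k \<le> \<eta> / 6" using 1 by linarith
      qed (simp add: N_def)
      finally show ?thesis .
    qed
    then have bad1: "real (card {S \<in> ksubsets ?V k. \<eta> < q4 S B / real k ^ 4}) \<le> N * (\<eta> / 6 / \<eta>)"
      unfolding N_def using \<eta> q4_nonneg by (intro markov_sum finite_ksubsets V divide_nonneg_nonneg) auto
    define dv where "dv S = (\<Sum>c<4^j. (thr ?V \<kappa> c - thr S \<kappa> c)\<^sup>2)" for S
    have "(\<Sum>S\<in>ksubsets ?V k. dv S) \<le> N * (M / real k)"
    proof -
      have "(\<Sum>S\<in>ksubsets ?V k. dv S) = (\<Sum>c<4^j. \<Sum>S\<in>ksubsets ?V k. (thr ?V \<kappa> c - thr S \<kappa> c)\<^sup>2)"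
        unfolding dv_def by (rule sum.swap)
      also have "\<dots> \<le> (\<Sum>c<(4::nat)^j. N / real k)"
      proof (rule sum_mono)
        fix c :: nat
        have "(thr ?V \<kappa> c - thr S \<kappa> c)\<^sup>2 = (real (card (S \<inter> {v\<in>?V. \<kappa> v < c})) / real k - real (card {v\<in>?V. \<kappa> v < c}) / real (card ?V))\<^sup>2"
          if S: "S \<in> ksubsets ?V k" for S
        proof -
          have "S \<inter> {v\<in>?V. \<kappa> v < c} = {v\<in>S. \<kappa> v < c}" using S by auto
          then show ?thesis using S by (simp add: thr_def power2_commute)
        qed
        then have "(\<Sum>S\<in>ksubsets ?V k. (thr ?V \<kappa> c - thr S \<kappa> c)\<^sup>2) = (\<Sum>S\<in>ksubsets ?V k. (real (card (S \<inter> {v\<in>?V. \<kappa> v < c})) / real k - real (card {v\<in>?V. \<kappa> v < c}) / real (card ?V))\<^sup>2)"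
          by (rule sum.cong[OF refl])
        also have "\<dots> \<le> N / real k" unfolding N_def using k by (intro sum_deviation_ksubsets V) auto
        finally show "(\<Sum>S\<in>ksubsets ?V k. (thr ?V \<kappa> c - thr S \<kappa> c)\<^sup>2) \<le> N / real k" .
      qed
      also have "\<dots> = real (4 ^ j) * (N / real k)" by simp
      also have "\<dots> \<le> M * (N / real k)"
      proof (rule mult_right_mono)
        show "real (4 ^ j) \<le> M" unfolding M_def using j(1) by (intro of_nat_mono power_increasing) auto
      qed (simp add: N_def)
      finally show ?thesis by (simp add: mult_ac)
    qed
    then have bad2: "real (card {S \<in> ksubsets ?V k. \<eta>' < dv S}) \<le> N * (M / real k / \<eta>')"
      unfolding N_def using \<eta>' by (intro markov_sum finite_ksubsets V) (auto simp: dv_def intro: sum_nonneg)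
    have good: "cut_dist G (induced G S) < \<epsilon>" if S: "S \<in> ksubsets ?V k" and g1: "q4 S B / real k ^ 4 \<le> \<eta>" and g2: "dv S \<le> \<eta>'" for S
    proof -
      have fS: "finite S" using S V finite_subset by blast
      have "(mcut S B) ^ 4 * real k ^ 4 \<le> q4 S B" using mcut_le_q4[OF fS, of B] S by simp
      also have "\<dots> \<le> \<eta> * real k ^ 4" using g1 kp by (simp add: pos_divide_le_eq)
      finally have "(mcut S B) ^ 4 \<le> (\<epsilon> / 4) ^ 4" using kp by (simp add: \<eta>_def)
      then have mS: "mcut S B \<le> \<epsilon> / 4" using power_le_imp_le_base[of "mcut S B" 3 "\<epsilon> / 4"] \<epsilon> by simp
      have "\<bar>thr ?V \<kappa> c - thr S \<kappa> c\<bar> \<le> \<epsilon> / (16 * M)" if "c < 4 ^ j" for c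
      proof -
        have "(thr ?V \<kappa> c - thr S \<kappa> c)\<^sup>2 \<le> dv S"
          unfolding dv_def using that by (intro member_le_sum) auto
        then have "\<bar>thr ?V \<kappa> c - thr S \<kappa> c\<bar>\<^sup>2 \<le> (\<epsilon> / (16 * M))\<^sup>2" using g2 by (simp add: \<eta>'_def)
        then show ?thesis by (rule power2_le_imp_le) (use \<epsilon> M in simp)
      qed
      then have "(\<Sum>c<4^j. \<bar>thr ?V \<kappa> c - thr S \<kappa> c\<bar>) \<le> (\<Sum>c<(4::nat)^j. \<epsilon> / (16 * M))" by (intro sum_mono) auto
      also have "\<dots> = real (4 ^ j) * (\<epsilon> / (16 * M))" by simp
      also have "\<dots> \<le> M * (\<epsilon> / (16 * M))"
      proof (rule mult_right_mono)
        show "real (4 ^ j) \<le> M" unfolding M_def using j(1) by (intro of_nat_mono power_increasing) auto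
      qed (use \<epsilon> M in simp)
      also have "\<dots> = \<epsilon> / 16" using M by simp
      finally have th: "(\<Sum>c<4^j. \<bar>thr ?V \<kappa> c - thr S \<kappa> c\<bar>) \<le> \<epsilon> / 16" .
      have "S \<noteq> {}" using S k by auto
      then have "cut_dist G (induced G S) \<le> mcut ?V B + mcut S B + 2 * (\<Sum>c<4^j. \<bar>thr ?V \<kappa> c - thr S \<kappa> c\<bar>)"
        unfolding B_def \<kappa>_def A_def using asm S by (intro cut_dist_induced_le) auto
      moreover have "mcut ?V B < \<epsilon> / 4" using mV by (simp add: a_def)
      ultimately show ?thesis using mS th \<epsilon> by linarith
    qed
    have "{S \<in> ksubsets ?V k. \<epsilon> \<le> cut_dist G (induced G S)} \<subseteq>
        {S \<in> ksubsets ?V k. \<eta> < q4 S B / real k ^ 4} \<union> {S \<in> ksubsets ?V k. \<eta>' < dv S}"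
    proof
      fix S assume S: "S \<in> {S \<in> ksubsets ?V k. \<epsilon> \<le> cut_dist G (induced G S)}"
      then have "\<not> (q4 S B / real k ^ 4 \<le> \<eta> \<and> dv S \<le> \<eta>')" using good[of S] by auto
      then show "S \<in> {S \<in> ksubsets ?V k. \<eta> < q4 S B / real k ^ 4} \<union> {S \<in> ksubsets ?V k. \<eta>' < dv S}"
        using S by auto
    qed
    then have "card {S \<in> ksubsets ?V k. \<epsilon> \<le> cut_dist G (induced G S)} \<le>
        card ({S \<in> ksubsets ?V k. \<eta> < q4 S B / real k ^ 4} \<union> {S \<in> ksubsets ?V k. \<eta>' < dv S})"
      by (rule card_mono[rotated]) (intro finite_UnI finite_subset[OF _ finite_ksubsets[OF V, of k]]; blast)
    also have "\<dots> \<le> card {S \<in> ksubsets ?V k. \<eta> < q4 S B / real k ^ 4} + card {S \<in> ksubsets ?V k. \<eta>' < dv S}"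
      by (rule card_Un_le)
    finally have "real (card {S \<in> ksubsets ?V k. \<epsilon> \<le> cut_dist G (induced G S)}) \<le>
        real (card {S \<in> ksubsets ?V k. \<eta> < q4 S B / real k ^ 4} + card {S \<in> ksubsets ?V k. \<eta>' < dv S})"
      by (rule of_nat_mono)
    also have "\<dots> \<le> N * (\<eta> / 6 / \<eta>) + N * (M / real k / \<eta>')" using bad1 bad2 by simp
    also have "\<dots> \<le> N * (1/6) + N * (1/6)"
    proof (intro add_mono mult_left_mono)
      show "\<eta> / 6 / \<eta> \<le> 1 / 6" using \<eta> by simp
      show "M / real k / \<eta>' \<le> 1 / 6" using kK(2) \<eta>' kp by (simp add: field_simps)
    qed (simp_all add: N_def)
    finally show "real (card {S \<in> ksubsets ?V k. \<epsilon> \<le> cut_dist G (induced G S)}) \<le> 1/3 * real (card (ksubsets ?V k))"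
      by (simp add: N_def)
  qed
qed

section \<open>Limits of graph sequences\<close>

lemma diagonal_bounded:
  fixes \<theta> :: "nat \<Rightarrow> 'i :: countable \<Rightarrow> real"
  assumes "\<And>m i. 0 \<le> \<theta> m i \<and> \<theta> m i \<le> 1"
  shows "\<exists>r l. strict_mono (r :: nat \<Rightarrow> nat) \<and> (\<forall>i. (\<lambda>m. \<theta> (r m) i) \<longlonglongrightarrow> l i)"
proof -
  define P where "P n s = convergent (\<lambda>m. \<theta> (s m) (from_nat n))" for n and s :: "nat \<Rightarrow> nat"
  interpret subseqs P
  proof
    fix n and s :: "nat \<Rightarrow> nat"
    have "Bseq (\<lambda>m. \<theta> (s m) (from_nat n))" by (rule BseqI'[of _ 1]) (use assms in auto)
    then have "bounded (range (\<lambda>m. \<theta> (s m) (from_nat n)))" by (simp add: Bseq_eq_bounded)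
    from bounded_imp_convergent_subsequence[OF this]
    obtain l r where "strict_mono (r :: nat \<Rightarrow> nat)" "((\<lambda>m. \<theta> (s m) (from_nat n)) \<circ> r) \<longlonglongrightarrow> l" by blast
    then show "\<exists>r'. strict_mono r' \<and> P n (s \<circ> r')" unfolding P_def by (auto simp: o_def convergent_def)
  qed
  have "P n (diagseq \<circ> ((+) (Suc n)))" for n
    by (rule diagseq_holds) (auto simp: P_def o_def dest: convergent_subseq_convergent)
  then have "convergent (\<lambda>m. \<theta> (diagseq (m + Suc n)) (from_nat n))" for n
    unfolding P_def o_def add.commute[of _ "Suc n"] .
  then have "convergent (\<lambda>m. \<theta> (diagseq m) (from_nat n))" for n
    using convergent_ignore_initial_segment[of "\<lambda>m. \<theta> (diagseq m) (from_nat n)" "Suc n"] by simp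
  then have "convergent (\<lambda>m. \<theta> (diagseq m) i)" for i by (metis from_nat_to_nat)
  then have "(\<lambda>m. \<theta> (diagseq m) i) \<longlonglongrightarrow> lim (\<lambda>m. \<theta> (diagseq m) i)" for i
    by (simp add: convergent_LIMSEQ_iff)
  then show ?thesis
    by (intro exI[of _ diagseq] exI[of _ "\<lambda>i. lim (\<lambda>m. \<theta> (diagseq m) i)"] conjI allI subseq_diagseq)
qed

lemma AE_unit_finite:
  fixes F :: "real set"
  assumes "finite F"
  shows "AE x in unit_measure. x \<notin> F"
proof (rule AE_I')
  have "F \<inter> {0..1} \<in> null_sets lborel" by (rule finite_imp_null_set_lborel) (use assms in simp)
  then have "F \<inter> {0..1} \<in> null_sets lebesgue" by (rule null_sets_completionI)
  then show "F \<inter> {0..1} \<in> null_sets unit_measure"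
    by (auto simp: null_sets_def sets_unit_iff emeasure_restrict_space)
qed auto

text \<open>Reads the class of a point off the thresholds \<open>\<alpha>\<close>, and so makes
  sense for limits of thresholds as well. Index 0 is left out because that threshold is 0, below
  every positive \<open>x\<close>.\<close>

definition cls :: "nat \<Rightarrow> (nat \<Rightarrow> real) \<Rightarrow> real \<Rightarrow> nat" where
  "cls M \<alpha> x = card {c\<in>{1..<M}. \<alpha> c < x}"

lemma measurable_cls [measurable]: "cls M \<alpha> \<in> unit_measure \<rightarrow>\<^sub>M count_space UNIV"
proof -
  have "cls M \<alpha> x = nat \<lfloor>\<Sum>c\<in>{1..<M}. if \<alpha> c < x then 1 else 0 :: real\<rfloor>" for x
    by (simp add: cls_def sum.If_cases Int_def)
  moreover have "(\<lambda>x. nat \<lfloor>\<Sum>c\<in>{1..<M}. if \<alpha> c < x then 1 else 0 :: real\<rfloor>) \<in> lborel \<rightarrow>\<^sub>M count_space UNIV"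
    by measurable
  ultimately have "cls M \<alpha> \<in> lborel \<rightarrow>\<^sub>M count_space UNIV" by presburger
  then show ?thesis by (intro measurable_restrict_space1 measurable_completion)
qed

lemma cls_class:
  assumes V: "finite V" "V \<noteq> {}" and e: "class_ordering V \<kappa> e" and x: "0 < x" "x \<le> 1" and M: "\<And>v. v \<in> V \<Longrightarrow> \<kappa> v < M"
  shows "\<kappa> (e (idx (card V) x)) = cls M (thr V \<kappa>) x"
proof -
  let ?v = "e (idx (card V) x)"
  have "0 < card V" using V by (simp add: card_gt_0_iff)
  then have "?v \<in> V" using e idx_less[OF _ x(2)] by (auto simp: class_ordering_def dest: bij_betwE)
  then have "\<kappa> ?v < M" by (rule M)
  then have "{c\<in>{1..<M}. c \<le> \<kappa> ?v} = {1..\<kappa> ?v}" by auto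
  then have "card {c\<in>{1..<M}. c \<le> \<kappa> ?v} = \<kappa> ?v" by simp
  then show ?thesis unfolding class_thresholds[OF V e x] cls_def by (rule sym)
qed

text \<open>Off the limit thresholds, each comparison of \<open>a m c\<close> with \<open>x\<close>
  is eventually the comparison of the limits.\<close>

lemma cls_eventually:
  assumes a: "\<And>c. (\<lambda>m. a m c) \<longlonglongrightarrow> \<alpha> c" and x: "\<And>c. c < M \<Longrightarrow> x \<noteq> \<alpha> c"
  shows "\<forall>\<^sub>F m in sequentially. cls M (a m) x = cls M \<alpha> x"
proof -
  have "\<forall>\<^sub>F m in sequentially. a m c < x \<longleftrightarrow> \<alpha> c < x" if "c \<in> {1..<M}" for c
  proof (cases "\<alpha> c < x")
    case True
    then show ?thesis using order_tendstoD(2)[OF a True] by (auto elim: eventually_mono)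
  next
    case False
    then have "x < \<alpha> c" using x[of c] that by auto
    from order_tendstoD(1)[OF a this] show ?thesis by eventually_elim (use False in auto)
  qed
  then have "\<forall>\<^sub>F m in sequentially. \<forall>c\<in>{1..<M}. a m c < x \<longleftrightarrow> \<alpha> c < x"
    by (intro eventually_ball_finite) auto
  then show ?thesis
  proof eventually_elim
    case (elim m)
    then have "{c\<in>{1..<M}. a m c < x} = {c\<in>{1..<M}. \<alpha> c < x}" by blast
    then show ?case unfolding cls_def by (simp only:)
  qed
qed

text \<open>Coarser classes are quotients of finer ones by a power of 4, and division is monotone,
  so an ordering by fine classes also sorts the coarse ones.\<close>

lemma ordering_coarsen:
  assumes "class_ordering V (parts V A m) e" "j \<le> m"
  shows "class_ordering V (parts V A j) e"
  using assms by (auto simp: class_ordering_def parts_div[OF assms(2)] intro: div_le_mono)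

lemma step_err_bound:
  assumes "finite V" "\<And>u w. 0 \<le> A u w \<and> A u w \<le> 1"
  shows "\<bar>step_err V A j u w\<bar> \<le> 1"
  using dens_bounds[OF assms(1), of A "parts V A j" "parts V A j u" "parts V A j w"] assms(2)[of u w] assms(2)
  unfolding step_err_def by (smt (verit))

text \<open>At each level the block averages are described by finitely many numbers, their count
  bounded independently of the graph, so a diagonal subsequence makes thresholds, densities, errors
  and energies of all levels converge. This supplies the hypotheses of
  \<open>cut_limit\<close>.\<close>

lemma graph_limit_kernel:
  fixes G :: "nat \<Rightarrow> ugraph"
  assumes simple: "\<And>m. simple_graph (G m)" and ne: "\<And>m. nodes (G m) \<noteq> {}"
  shows "\<exists>r e W. strict_mono (r :: nat \<Rightarrow> nat) \<and> (\<forall>m. bij_betw (e m) {..<card (nodes (G (r m)))} (nodes (G (r m)))) \<and>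
     unit_kernel W \<and> (\<forall>\<delta>>0. \<exists>N. \<forall>m\<ge>N. ucut_close (gker (G (r m)) (e m)) W \<delta>)"
proof -
  define V A \<kappa> where "V m = nodes (G m)" and "A m = adj (G m)" and "\<kappa> j m = parts (nodes (G m)) (adj (G m)) j" for m j
  have V: "finite (V m)" "V m \<noteq> {}" for m using simple[of m] ne[of m] by (auto simp: V_def simple_graph_def)
  have A01: "0 \<le> A m u w \<and> A m u w \<le> 1" for m u w by (simp add: A_def adj_def)
  \<comment> \<open>Graph \<open>m\<close> is sorted by its classes at level \<open>m\<close>, which
    serves all levels \<open>j \<le> m\<close> and thus every level eventually.\<close>
  have "\<exists>e. class_ordering (V m) (\<kappa> m m) e" for m by (rule ex_ordering_key[OF V(1)])
  then have "\<forall>m. \<exists>e. class_ordering (V m) (\<kappa> m m) e" by blast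
  from choice[OF this] obtain e0 where e0: "\<And>m. class_ordering (V m) (\<kappa> m m) (e0 m)" by blast
  define mc where "mc m j = mcut (V m) (step_err (V m) (A m) j)" for m j
  define en where "en m j = energy (V m) (\<kappa> j m) (A m)" for m j
  define ds where "ds m j = dens (V m) (\<kappa> j m) (A m)" for m j
  \<comment> \<open>Four families of numbers under one countable index; the tag \<open>t\<close>
    tells them apart.\<close>
  define \<theta> where "\<theta> m = (\<lambda>(t, j, a, b). if t = (0::nat) then thr (V m) (\<kappa> j m) a
      else if t = 1 then ds m j a b else if t = 2 then mc m j else en m j)" for m
  have mc01: "0 \<le> mc m j \<and> mc m j \<le> 1" for m j
    unfolding mc_def using mcut_nonneg[OF V(1)] mcut_le_1[OF V(1)] step_err_bound[where A = "A m", OF V(1) A01] by blast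
  have en01: "0 \<le> en m j \<and> en m j \<le> 1" for m j
    unfolding en_def using energy_bounds[where A = "A m", OF V(1)] A01 by blast
  have ds01: "0 \<le> ds m j a b \<and> ds m j a b \<le> 1" for m j a b
    unfolding ds_def using dens_bounds[where A = "A m", OF V(1)] A01 by blast
  have \<theta>01: "0 \<le> \<theta> m i \<and> \<theta> m i \<le> 1" for m i
    unfolding \<theta>_def using thr_bounds[OF V(1)] mc01 en01 ds01 by (auto split: prod.split)
  from diagonal_bounded[of \<theta>, OF \<theta>01] obtain r l where r: "strict_mono (r :: nat \<Rightarrow> nat)"
    and l: "\<And>i. (\<lambda>m. \<theta> (r m) i) \<longlonglongrightarrow> l i" by blast
  define \<alpha> where "\<alpha> j a = l (0, j, a, 0)" for j a
  define d where "d j a b = l (1, j, a, b)" for j a b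
  define g where "g j = l (2, j, 0, 0)" for j
  define E where "E j = l (3, j, 0, 0)" for j
  have \<alpha>: "(\<lambda>m. thr (V (r m)) (\<kappa> j (r m)) a) \<longlonglongrightarrow> \<alpha> j a" for j a
    using l[of "(0, j, a, 0)"] by (simp add: \<theta>_def \<alpha>_def)
  have d: "(\<lambda>m. ds (r m) j a b) \<longlonglongrightarrow> d j a b" for j a b
    using l[of "(1, j, a, b)"] by (simp add: \<theta>_def d_def)
  have g: "(\<lambda>m. mc (r m) j) \<longlonglongrightarrow> g j" for j
    using l[of "(2, j, 0, 0)"] by (simp add: \<theta>_def g_def)
  have E: "(\<lambda>m. en (r m) j) \<longlonglongrightarrow> E j" for j
    using l[of "(3, j, 0, 0)"] by (simp add: \<theta>_def E_def)
  have d01: "0 \<le> d j a b \<and> d j a b \<le> 1" for j a b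
    using LIMSEQ_le_const[OF d, of 0] LIMSEQ_le_const2[OF d, of _ _ _ 1] ds01 by blast
  \<comment> \<open>The bound of \<open>sum_mcut_le_1\<close> survives the limit, so the squares of
    \<open>g\<close> are summable.\<close>
  have g0: "g \<longlonglongrightarrow> 0"
  proof -
    have "(\<Sum>j<J. (g j)\<^sup>2) \<le> 1" for J
    proof (rule LIMSEQ_le_const2)
      show "(\<lambda>m. \<Sum>j<J. (mc (r m) j)\<^sup>2) \<longlonglongrightarrow> (\<Sum>j<J. (g j)\<^sup>2)" by (intro tendsto_sum tendsto_power g)
      have "(\<Sum>j<J. (mc m j)\<^sup>2) \<le> 1" for m
        unfolding mc_def using sum_mcut_le_1[where A = "A m", OF V(1)] A01 by blast
      then show "\<exists>N. \<forall>m\<ge>N. (\<Sum>j<J. (mc (r m) j)\<^sup>2) \<le> 1" by blast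
    qed
    then have "summable (\<lambda>j. (g j)\<^sup>2)" by (intro summableI_nonneg_bounded[of _ 1]) auto
    from summable_LIMSEQ_zero[OF this] show ?thesis by simp
  qed
  define v where "v m x = e0 (r m) (idx (card (V (r m))) x)" for m x
  have be: "bij_betw (e0 m) {..<card (V m)} (V m)" for m using e0[of m] by (simp add: class_ordering_def)
  have vm[measurable]: "v m \<in> unit_measure \<rightarrow>\<^sub>M count_space UNIV" for m unfolding v_def by measurable
  define U where "U m z = A (r m) (v m (fst z)) (v m (snd z))" for m z
  define P where "P j m z = ds (r m) j (\<kappa> j (r m) (v m (fst z))) (\<kappa> j (r m) (v m (snd z)))" for j m z
  define w where "w j z = d j (cls (4^j) (\<alpha> j) (fst z)) (cls (4^j) (\<alpha> j) (snd z))" for j z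
  have KU: "unit_kernel (U m)" for m unfolding U_def by (intro kernel_step vm A01)
  have KP: "unit_kernel (P j m)" for j m
  proof -
    have "(\<lambda>x. \<kappa> j (r m) (v m x)) \<in> unit_measure \<rightarrow>\<^sub>M count_space UNIV" by measurable
    then show ?thesis unfolding P_def by (rule kernel_step) (rule ds01)
  qed
  have Kw: "unit_kernel (w j)" for j unfolding w_def by (rule kernel_step[OF measurable_cls]) (rule d01)
  have lim: "AE z in unit_measure \<Otimes>\<^sub>M unit_measure. (\<lambda>m. P j m z) \<longlonglongrightarrow> w j z" for j
  proof -
    define Q where "Q x \<longleftrightarrow> 0 < x \<and> x \<le> 1 \<and> (\<forall>c<4^j. x \<noteq> \<alpha> j c)" for x
    have "AE x in unit_measure. Q x"
      using AE_unit_pos AE_space AE_unit_finite[of "\<alpha> j ` {..<4^j}", OF finite_imageI[OF finite_lessThan]]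
      by eventually_elim (auto simp: Q_def)
    have ev: "\<forall>\<^sub>F m in sequentially. \<kappa> j (r m) (v m x) = cls (4^j) (\<alpha> j) x" if "Q x" for x
    proof -
      have "\<forall>\<^sub>F m in sequentially. cls (4^j) (thr (V (r m)) (\<kappa> j (r m))) x = cls (4^j) (\<alpha> j) x"
        using that by (intro cls_eventually \<alpha>) (auto simp: Q_def)
      moreover have "\<forall>\<^sub>F m in sequentially. j \<le> m" by (rule eventually_ge_at_top)
      ultimately show ?thesis
      proof eventually_elim
        case (elim m)
        have "j \<le> r m" using elim(2) seq_suble[OF r, of m] by simp
        then have "class_ordering (V (r m)) (\<kappa> j (r m)) (e0 (r m))"
          using ordering_coarsen[of "V (r m)" "A (r m)" "r m" "e0 (r m)" j] e0[of "r m"]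
          by (simp add: V_def A_def \<kappa>_def)
        moreover have "\<kappa> j (r m) u < 4^j" for u unfolding \<kappa>_def by (rule parts_less)
        ultimately have "\<kappa> j (r m) (v m x) = cls (4^j) (thr (V (r m)) (\<kappa> j (r m))) x"
          unfolding v_def using that by (intro cls_class V) (simp_all add: Q_def)
        then show ?case using elim(1) by simp
      qed
    qed
    show ?thesis using AE_unit_pair[OF \<open>AE x in unit_measure. Q x\<close>]
    proof eventually_elim
      case (elim z)
      have "\<forall>\<^sub>F m in sequentially. \<kappa> j (r m) (v m (fst z)) = cls (4^j) (\<alpha> j) (fst z) \<and>
          \<kappa> j (r m) (v m (snd z)) = cls (4^j) (\<alpha> j) (snd z)"
        using elim by (intro eventually_conj ev) auto
      then have "\<forall>\<^sub>F m in sequentially. ds (r m) j (cls (4^j) (\<alpha> j) (fst z)) (cls (4^j) (\<alpha> j) (snd z)) = P j m z"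
        by eventually_elim (simp add: P_def)
      from Lim_transform_eventually[OF d this] show ?case by (simp add: w_def)
    qed
  qed
  have err: "step_err (V m) (A m) j = (\<lambda>u w. A m u w - ds m j (\<kappa> j m u) (\<kappa> j m w))" for m j
    by (intro ext) (simp add: step_err_def ds_def \<kappa>_def V_def A_def)
  have cut: "ucut_close (U m) (P j m) (mc (r m) j)" for j m
    unfolding U_def P_def v_def mc_def err by (rule ucut_close_mcut[OF V be])
  have energy: "(\<integral>z. (P j m z - P i m z)\<^sup>2 \<partial>(unit_measure \<Otimes>\<^sub>M unit_measure)) = en (r m) j - en (r m) i" if "i \<le> j" for i j m
  proof -
    let ?V = "V (r m)"
    have "(\<integral>z. (P j m z - P i m z)\<^sup>2 \<partial>(unit_measure \<Otimes>\<^sub>M unit_measure)) =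
       (\<Sum>u\<in>?V. \<Sum>w\<in>?V. (ds (r m) j (\<kappa> j (r m) u) (\<kappa> j (r m) w) - ds (r m) i (\<kappa> i (r m) u) (\<kappa> i (r m) w))\<^sup>2) / (real (card ?V))\<^sup>2"
      unfolding P_def v_def
      by (rule step_integral_space[OF V be, where B = "\<lambda>u w. (ds (r m) j (\<kappa> j (r m) u) (\<kappa> j (r m) w) - ds (r m) i (\<kappa> i (r m) u) (\<kappa> i (r m) w))\<^sup>2"])
    also have "\<dots> = (en (r m) j - en (r m) i) * (real (card ?V))\<^sup>2 / (real (card ?V))\<^sup>2"
      unfolding ds_def en_def
      by (subst energy_refine[OF V(1), where r = "\<lambda>c. c div 4 ^ (j - i)"]) (simp_all add: \<kappa>_def parts_div[OF that])
    also have "\<dots> = en (r m) j - en (r m) i" using V[of "r m"] by simp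
    finally show ?thesis .
  qed
  have "\<exists>W. W \<in> borel_measurable (unit_measure \<Otimes>\<^sub>M unit_measure) \<and> (\<forall>z\<in>space (unit_measure \<Otimes>\<^sub>M unit_measure). 0 \<le> W z \<and> W z \<le> 1) \<and>
           (\<forall>\<delta>>0. \<exists>N. \<forall>m\<ge>N. ucut_close (U m) W \<delta>)"
    by (rule unit.cut_limit[OF kernelD(1)[OF KU] kernelD(2)[OF KU] kernelD(1)[OF KP] kernelD(2)[OF KP]
          kernelD(1)[OF Kw] kernelD(2)[OF Kw] lim cut g g0 energy E en01])
  then obtain W where W: "unit_kernel W" "\<And>\<delta>. \<delta> > 0 \<Longrightarrow> \<exists>N. \<forall>m\<ge>N. ucut_close (U m) W \<delta>"
    unfolding unit_kernel_def space_unit2 by blast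
  have "gker (G (r m)) (e0 (r m)) = U m" for m
    by (rule ext) (simp add: gker_def U_def v_def A_def V_def)
  then show ?thesis using r W be unfolding V_def
    by (intro exI[of _ r] exI[of _ "\<lambda>m. e0 (r m)"] exI[of _ W]) auto
qed

text \<open>The kernel is hidden behind its pattern densities \<open>\<tau>\<close>. Weak
  convergence on the sets where the kernel is 0 and where it is 1 supplies the hypotheses of
  \<open>removal\<close>.\<close>

lemma graph_limit:
  fixes G :: "nat \<Rightarrow> ugraph"
  assumes simple: "\<And>m. simple_graph (G m)" and ne: "\<And>m. nodes (G m) \<noteq> {}"
  shows "\<exists>r \<tau>. strict_mono (r :: nat \<Rightarrow> nat) \<and> (\<forall>k D. (\<lambda>m. tden k D (G (r m))) \<longlonglongrightarrow> \<tau> k D) \<and>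
     (\<forall>\<epsilon>>0. \<exists>N. \<forall>m\<ge>N. \<exists>e D. bij_betw e {..<card (nodes (G (r m)))} (nodes (G (r m))) \<and> D \<subseteq> pairs (card (nodes (G (r m)))) \<and>
        0 < \<tau> (card (nodes (G (r m)))) D \<and>
        real (card {p\<in>pairs (card (nodes (G (r m)))). (p \<in> D) \<noteq> ({e (fst p), e (snd p)} \<in> edges (G (r m)))})
          \<le> \<epsilon> * (real (card (nodes (G (r m)))))\<^sup>2)"
proof -
  obtain r e W where r: "strict_mono (r :: nat \<Rightarrow> nat)"
    and e: "\<And>m. bij_betw (e m) {..<card (nodes (G (r m)))} (nodes (G (r m)))"
    and W: "unit_kernel W" and cut: "\<And>\<delta>. \<delta> > 0 \<Longrightarrow> \<exists>N. \<forall>m\<ge>N. ucut_close (gker (G (r m)) (e m)) W \<delta>"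
    using graph_limit_kernel[where G = G, OF assms] by blast
  let ?M = "unit_measure \<Otimes>\<^sub>M unit_measure"
  define \<tau> where "\<tau> k D = tdens unit_measure k D W" for k D
  define U where "U m = gker (G (r m)) (e m)" for m
  have n: "0 < card (nodes (G m))" for m using simple[of m] ne[of m] by (simp add: simple_graph_def card_gt_0_iff)
  have KU: "unit_kernel (U m)" for m unfolding U_def by (rule kernel_gker)
  have td: "tden k D (G (r m)) = tdens unit_measure k D (U m)" for k D m
    unfolding U_def by (rule tdens_gker[OF n e, symmetric])
  have t: "(\<lambda>m. tden k D (G (r m))) \<longlonglongrightarrow> \<tau> k D" for k D
  proof (rule LIMSEQ_I)
    fix s :: real assume s: "0 < s"
    \<comment> \<open>The added 1 avoids a division by 0 for \<open>k = 0\<close>.\<close>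
    define \<delta> where "\<delta> = s / (2 * (real (k\<^sup>2) + 1))"
    have \<delta>: "\<delta> > 0" using s unfolding \<delta>_def by (intro divide_pos_pos) (auto intro: add_nonneg_pos)
    have "real (k\<^sup>2) * \<delta> \<le> (real (k\<^sup>2) + 1) * \<delta>" using \<delta> by (intro mult_right_mono) auto
    also have "\<dots> = s / 2"
    proof -
      have "real (k\<^sup>2) + 1 \<noteq> 0" by (metis add_nonneg_pos less_irrefl of_nat_0_le_iff zero_less_one)
      then show ?thesis unfolding \<delta>_def by (simp add: field_simps)
    qed
    also have "\<dots> < s" using s by simp
    finally have small: "real (k\<^sup>2) * \<delta> < s" .
    obtain N where N: "\<And>m. m \<ge> N \<Longrightarrow> ucut_close (U m) W \<delta>" using cut[OF \<delta>] unfolding U_def by blast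
    show "\<exists>N. \<forall>m\<ge>N. norm (tden k D (G (r m)) - \<tau> k D) < s"
    proof (intro exI[of _ N] allI impI)
      fix m assume "N \<le> m"
      have "\<bar>tdens unit_measure k D (U m) - tdens unit_measure k D W\<bar> \<le> real (k\<^sup>2) * \<delta>"
        by (rule unit.tdens_cut_close[OF kernelD(1)[OF KU] kernelD(2)[OF KU] kernelD(1)[OF W] kernelD(2)[OF W] N[OF \<open>N \<le> m\<close>]])
      then show "norm (tden k D (G (r m)) - \<tau> k D) < s" using small unfolding td \<tau>_def by simp
    qed
  qed
  have Wm[measurable]: "W \<in> borel_measurable ?M" by (rule kernelD(1)[OF W])
  define Z0 Z1 where "Z0 = {z \<in> space ?M. W z = 0}" and "Z1 = {z \<in> space ?M. W z = 1}"
  have Zm: "Z0 \<in> sets ?M" "Z1 \<in> sets ?M" unfolding Z0_def Z1_def by measurable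
  have cut': "\<exists>N. \<forall>m\<ge>N. cut_close unit_measure (U m) W \<delta>" if "\<delta> > 0" for \<delta> using cut[OF that] by (simp add: U_def)
  have ws: "(\<lambda>m. \<integral>z. indicator Z z * (U m z - W z) \<partial>?M) \<longlonglongrightarrow> 0" if "Z \<in> sets ?M" for Z
    by (rule unit.cut_close_weak_star[OF kernelD(1)[OF KU] kernelD(2)[OF KU] Wm kernelD(2)[OF W] cut' that])
  have i0: "(\<integral>z. indicator Z0 z * (U m z - W z) \<partial>?M) = (\<integral>z. indicator Z0 z * U m z \<partial>?M)" for m
    by (intro Bochner_Integration.integral_cong refl) (auto simp: Z0_def indicator_def)
  have i1: "(\<integral>z. indicator Z1 z * (U m z - W z) \<partial>?M) = - (\<integral>z. indicator Z1 z * (1 - U m z) \<partial>?M)" for m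
    unfolding Bochner_Integration.integral_minus[symmetric]
    by (intro Bochner_Integration.integral_cong refl) (auto simp: Z1_def indicator_def)
  have "\<exists>N. \<forall>m\<ge>N. \<exists>e D. bij_betw e {..<card (nodes (G (r m)))} (nodes (G (r m))) \<and> D \<subseteq> pairs (card (nodes (G (r m)))) \<and>
        0 < \<tau> (card (nodes (G (r m)))) D \<and>
        real (card {p\<in>pairs (card (nodes (G (r m)))). (p \<in> D) \<noteq> ({e (fst p), e (snd p)} \<in> edges (G (r m)))})
          \<le> \<epsilon> * (real (card (nodes (G (r m)))))\<^sup>2" if \<epsilon>: "\<epsilon> > 0" for \<epsilon>
  proof -
    have "\<forall>\<^sub>F m in sequentially. (\<integral>z. indicator Z0 z * (U m z - W z) \<partial>?M) < \<epsilon> / 4"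
      using \<epsilon> by (intro order_tendstoD(2)[OF ws[OF Zm(1)]]) simp
    moreover have "\<forall>\<^sub>F m in sequentially. - (\<epsilon> / 4) < (\<integral>z. indicator Z1 z * (U m z - W z) \<partial>?M)"
      using \<epsilon> by (intro order_tendstoD(1)[OF ws[OF Zm(2)]]) simp
    ultimately have "\<forall>\<^sub>F m in sequentially. (\<integral>z. indicator Z0 z * (U m z - W z) \<partial>?M) < \<epsilon> / 4 \<and>
        - (\<epsilon> / 4) < (\<integral>z. indicator Z1 z * (U m z - W z) \<partial>?M)" by (rule eventually_conj)
    then obtain N where N: "\<And>m. m \<ge> N \<Longrightarrow> (\<integral>z. indicator Z0 z * U m z \<partial>?M) < \<epsilon> / 4"
      "\<And>m. m \<ge> N \<Longrightarrow> (\<integral>z. indicator Z1 z * (1 - U m z) \<partial>?M) < \<epsilon> / 4"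
      unfolding i0 i1 eventually_sequentially by auto
    show ?thesis
    proof (intro exI[of _ N] allI impI)
      fix m assume m: "N \<le> m"
      let ?n = "card (nodes (G (r m)))"
      let ?A = "\<lambda>i j. adj (G (r m)) (e m i) (e m j)"
      have Ueq: "U m z = ?A (idx ?n (fst z)) (idx ?n (snd z))" for z by (simp add: U_def gker_def)
      have "\<exists>D\<subseteq>pairs ?n. 0 < tdens unit_measure ?n D W \<and>
           real (card {p\<in>pairs ?n. (p \<in> D) \<noteq> (?A (fst p) (snd p) = 1)}) \<le> \<epsilon> * (real ?n)\<^sup>2"
      \<comment> \<open>A quarter of \<epsilon>, because \<open>removal\<close> requires twice its
        \<open>\<delta>\<close> to stay below \<epsilon>.\<close>
      proof (rule unit.removal[where v = "idx ?n" and \<delta> = "\<epsilon> / 4"])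
        show "(\<integral>z. indicator {z \<in> space ?M. W z = 0} z * ?A (idx ?n (fst z)) (idx ?n (snd z)) \<partial>?M) \<le> \<epsilon> / 4"
          using N(1)[OF m] unfolding Z0_def Ueq by simp
        show "(\<integral>z. indicator {z \<in> space ?M. W z = 1} z * (1 - ?A (idx ?n (fst z)) (idx ?n (snd z))) \<partial>?M) \<le> \<epsilon> / 4"
          using N(2)[OF m] unfolding Z1_def Ueq by simp
        show "?A i j = 0 \<or> ?A i j = 1" for i j by (simp add: adj_def)
      qed (use n prob_idx kernelD(2)[OF W] \<epsilon> in auto)
      then obtain D where D: "D \<subseteq> pairs ?n" "0 < tdens unit_measure ?n D W"
        "real (card {p\<in>pairs ?n. (p \<in> D) \<noteq> (?A (fst p) (snd p) = 1)}) \<le> \<epsilon> * (real ?n)\<^sup>2" by blast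
      have "(?A i j = 1) = ({e m i, e m j} \<in> edges (G (r m)))" for i j by (simp add: adj_def)
      then show "\<exists>e D. bij_betw e {..<?n} (nodes (G (r m))) \<and> D \<subseteq> pairs ?n \<and> 0 < \<tau> ?n D \<and>
        real (card {p\<in>pairs ?n. (p \<in> D) \<noteq> ({e (fst p), e (snd p)} \<in> edges (G (r m)))}) \<le> \<epsilon> * (real ?n)\<^sup>2"
        using D e[of m] unfolding \<tau>_def by (intro exI[of _ "e m"] exI[of _ D]) simp
    qed
  qed
  then show ?thesis using r t by blast
qed

section \<open>Edit distance\<close>

lemma mcut_le_sum_abs:
  assumes V: "finite V" "V \<noteq> {}"
  shows "mcut V B \<le> (\<Sum>u\<in>V. \<Sum>w\<in>V. \<bar>B u w\<bar>) / (real (card V))\<^sup>2"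
proof -
  have n: "0 < real (card V)" using V by (simp add: card_gt_0_iff)
  obtain X Y where XY: "X \<subseteq> V" "Y \<subseteq> V" "\<bar>\<Sum>u\<in>X. \<Sum>v\<in>Y. B u v\<bar> = mcut V B * (real (card V))\<^sup>2"
    using mcut_attained[OF V(1), of B] by blast
  have "\<bar>\<Sum>u\<in>X. \<Sum>v\<in>Y. B u v\<bar> \<le> (\<Sum>u\<in>X. \<Sum>v\<in>Y. \<bar>B u v\<bar>)"
    by (intro order_trans[OF sum_abs] sum_mono sum_abs)
  also have "\<dots> \<le> (\<Sum>u\<in>X. \<Sum>v\<in>V. \<bar>B u v\<bar>)"
    using V XY by (intro sum_mono sum_mono2) auto
  also have "\<dots> \<le> (\<Sum>u\<in>V. \<Sum>v\<in>V. \<bar>B u v\<bar>)"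
    using V XY by (intro sum_mono2 sum_nonneg) auto
  finally show ?thesis unfolding XY(3) using n by (simp add: pos_le_divide_eq)
qed

lemma finite_edges: "simple_graph G \<Longrightarrow> finite (edges G)"
  by (rule finite_subset[of _ "Pow (nodes G)"]) (auto simp: simple_graph_def)

lemma edgeE:
  assumes "simple_graph G" "x \<in> edges G"
  obtains a b where "a \<noteq> b" "x = {a, b}" "a \<in> nodes G" "b \<in> nodes G"
proof -
  have "card x = 2" "x \<subseteq> nodes G" using assms by (auto simp: simple_graph_def)
  then show ?thesis using that by (auto simp: card_2_iff)
qed

text \<open>The edit distance counts an edge once, the matrix counts it as two ordered pairs; hence
  the factor 2.\<close>

lemma cut_dist_edit:
  assumes G: "simple_graph G" and H: "simple_graph H" and nn: "nodes H = nodes G" "nodes G \<noteq> {}"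
  shows "cut_dist G H \<le> 2 * edit_dist G H"
proof -
  let ?V = "nodes G"
  have V: "finite ?V" using G by (simp add: simple_graph_def)
  have n: "0 < card ?V" using V nn by (simp add: card_gt_0_iff)
  obtain e where e: "bij_betw e {..<card ?V} ?V" using ex_ordering[OF V] by blast
  let ?D = "(edges G - edges H) \<union> (edges H - edges G)"
  have fD: "finite ?D" using finite_edges G H by auto
  have "(\<Sum>u\<in>?V. \<Sum>w\<in>?V. \<bar>adj G u w - adj H u w\<bar>) = (\<Sum>(u, w)\<in>?V \<times> ?V. \<bar>adj G u w - adj H u w\<bar>)"
    by (rule sum.cartesian_product)
  also have "\<dots> = (\<Sum>p\<in>?V \<times> ?V. if {fst p, snd p} \<in> ?D then 1 else 0)"
    by (intro sum.cong refl) (auto simp: adj_def)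
  also have "\<dots> = real (card {p\<in>?V \<times> ?V. {fst p, snd p} \<in> ?D})"
    using V by (simp add: sum.If_cases Int_def)
  also have "\<dots> \<le> real (2 * card ?D)"
  proof (rule of_nat_mono)
    have "card {p\<in>?V \<times> ?V. {fst p, snd p} \<in> ?D} \<le> card (\<Union>x\<in>?D. {p\<in>?V \<times> ?V. {fst p, snd p} = x})"
      by (rule card_mono) (use fD V in auto)
    also have "\<dots> \<le> (\<Sum>x\<in>?D. card {p\<in>?V \<times> ?V. {fst p, snd p} = x})" by (rule card_UN_le[OF fD])
    also have "\<dots> \<le> (\<Sum>x\<in>?D. 2)"
    proof (rule sum_mono)
      fix x assume "x \<in> ?D"
      then obtain a b where "x = {a, b}" using edgeE[OF G, of x] edgeE[OF H, of x] by blast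
      then have "{p\<in>?V \<times> ?V. {fst p, snd p} = x} \<subseteq> {(a, b), (b, a)}" by (auto simp: doubleton_eq_iff)
      then have "card {p\<in>?V \<times> ?V. {fst p, snd p} = x} \<le> card {(a, b), (b, a)}" by (intro card_mono) auto
      also have "\<dots> \<le> 2" by (cases "a = b") auto
      finally show "card {p\<in>?V \<times> ?V. {fst p, snd p} = x} \<le> 2" .
    qed
    finally show "card {p\<in>?V \<times> ?V. {fst p, snd p} \<in> ?D} \<le> 2 * card ?D" by simp
  qed
  finally have "(\<Sum>u\<in>?V. \<Sum>w\<in>?V. \<bar>adj G u w - adj H u w\<bar>) / (real (card ?V))\<^sup>2 \<le> 2 * edit_dist G H"
    using n by (simp add: edit_dist_def divide_right_mono)
  then have m: "mcut ?V (\<lambda>u w. adj G u w - adj H u w) \<le> 2 * edit_dist G H"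
    using mcut_le_sum_abs[OF V nn(2), of "\<lambda>u w. adj G u w - adj H u w"] by linarith
  have "ucut_close (gker G e) (gker H e) (mcut ?V (\<lambda>u w. adj G u w - adj H u w))"
    using ucut_close_mcut[OF V nn(2) e, of "adj G" "adj H"] unfolding gker_def[abs_def] nn(1) .
  then have "cut_dist G H \<le> mcut ?V (\<lambda>u w. adj G u w - adj H u w)"
    using n e nn by (intro cut_dist_le[of G H e e]) auto
  then show ?thesis using m by linarith
qed

text \<open>An enumeration of the nodes, transported along the isomorphism, gives the same step
  kernel.\<close>

lemma cut_dist_iso:
  assumes iso: "isomorphic_graphs F H" and F: "finite (nodes F)" "nodes F \<noteq> {}"
  shows "cut_dist F H \<le> 0"
proof -
  obtain f where f: "bij_betw f (nodes F) (nodes H)"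
    and fe: "\<And>u v. u \<in> nodes F \<Longrightarrow> v \<in> nodes F \<Longrightarrow> {u, v} \<in> edges F \<longleftrightarrow> {f u, f v} \<in> edges H"
    using iso by (auto simp: isomorphic_graphs_def)
  have c: "card (nodes H) = card (nodes F)" using bij_betw_same_card[OF f] by simp
  have n: "0 < card (nodes F)" using F by (simp add: card_gt_0_iff)
  obtain e where e: "bij_betw e {..<card (nodes F)} (nodes F)" using ex_ordering[OF F(1)] by blast
  have e': "bij_betw (f \<circ> e) {..<card (nodes H)} (nodes H)" unfolding c by (rule bij_betw_trans[OF e f])
  have "ucut_close (gker F e) (gker H (f \<circ> e)) 0"
  proof (rule ucut_close_AE_eq[OF kernel_gker kernel_gker AE_unit_pos])
    fix x y :: real assume "x \<in> {0..1}" "y \<in> {0..1}"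
    then have "e (idx (card (nodes F)) x) \<in> nodes F" "e (idx (card (nodes F)) y) \<in> nodes F"
      using idx_less[OF n, of x] idx_less[OF n, of y] bij_betwE[OF e] by auto
    then show "gker F e (x, y) = gker H (f \<circ> e) (x, y)" by (simp add: gker_def c adj_def fe)
  qed
  then show ?thesis using n c e e' by (intro cut_dist_le) auto
qed

section \<open>Relabelling and the distance to a property\<close>

definition relabel :: "(nat \<Rightarrow> nat) \<Rightarrow> ugraph \<Rightarrow> ugraph" where
  "relabel f H = UGraph (f ` nodes H) ((`) f ` edges H)"

lemma relabel_simple_iso:
  assumes H: "simple_graph H" and f: "inj_on f (nodes H)"
  shows "simple_graph (relabel f H)" "isomorphic_graphs H (relabel f H)"
proof -
  have sub: "x \<subseteq> nodes H" "card x = 2" if "x \<in> edges H" for x using H that by (auto simp: simple_graph_def)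
  show "simple_graph (relabel f H)"
    unfolding simple_graph_def relabel_def
  proof (simp, intro conjI ballI)
    show "finite (f ` nodes H)" using H by (simp add: simple_graph_def)
    fix x assume x: "x \<in> edges H"
    show "f ` x \<subseteq> f ` nodes H" using sub(1)[OF x] by (rule image_mono)
    show "card (f ` x) = 2" using sub[OF x] f by (simp add: card_image inj_on_subset)
  qed
  have "{u, v} \<in> edges H \<longleftrightarrow> {f u, f v} \<in> (`) f ` edges H" if uv: "u \<in> nodes H" "v \<in> nodes H" for u v
  proof
    assume "{u, v} \<in> edges H"
    then show "{f u, f v} \<in> (`) f ` edges H" by (rule rev_image_eqI) simp
  next
    assume "{f u, f v} \<in> (`) f ` edges H"
    then obtain x where x: "x \<in> edges H" "f ` {u, v} = f ` x" by auto
    have "{u, v} = x" using inj_on_image_eq_iff[OF f, of "{u, v}" x] uv sub(1)[OF x(1)] x(2) by simp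
    then show "{u, v} \<in> edges H" using x(1) by simp
  qed
  then show "isomorphic_graphs H (relabel f H)"
    unfolding isomorphic_graphs_def using f by (intro exI[of _ f]) (simp add: relabel_def bij_betw_def)
qed

lemma iso_edges:
  assumes F: "simple_graph F" and H: "simple_graph H" and f: "bij_betw f (nodes F) (nodes H)"
    and fe: "\<And>u v. u \<in> nodes F \<Longrightarrow> v \<in> nodes F \<Longrightarrow> {u, v} \<in> edges F \<longleftrightarrow> {f u, f v} \<in> edges H"
  shows "edges H = (`) f ` edges F"
proof (intro equalityI subsetI)
  fix x assume "x \<in> edges H"
  then obtain a b where ab: "x = {a, b}" "a \<in> nodes H" "b \<in> nodes H" by (rule edgeE[OF H])
  then obtain u v where uv: "u \<in> nodes F" "v \<in> nodes F" "a = f u" "b = f v"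
    using bij_betw_imp_surj_on[OF f] by blast
  then have "{u, v} \<in> edges F" using fe ab \<open>x \<in> edges H\<close> by simp
  then show "x \<in> (`) f ` edges F" by (rule rev_image_eqI) (simp add: ab uv)
next
  fix x assume "x \<in> (`) f ` edges F"
  then obtain y where y: "y \<in> edges F" "x = f ` y" by auto
  then obtain u v where "y = {u, v}" "u \<in> nodes F" "v \<in> nodes F" by (meson edgeE[OF F])
  then show "x \<in> edges H" using fe y by simp
qed

lemma finite_edit_dists:
  assumes P: "graph_property P" and F: "simple_graph F"
  shows "finite {edit_dist F H | H. H \<in> P \<and> nodes H = nodes F}"
proof -
  have "finite {H. H \<in> P \<and> nodes H = nodes F}"
  proof (rule finite_subset)
    show "{H. H \<in> P \<and> nodes H = nodes F} \<subseteq> UGraph (nodes F) ` Pow (Pow (nodes F))"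
    proof
      fix K assume K: "K \<in> {H. H \<in> P \<and> nodes H = nodes F}"
      then have "simple_graph K" using P by (simp add: graph_property_def)
      then have "edges K \<in> Pow (Pow (nodes F))" using K by (auto simp: simple_graph_def)
      then show "K \<in> UGraph (nodes F) ` Pow (Pow (nodes F))" using K by (intro image_eqI[of _ _ "edges K"]) (cases K, auto)
    qed
  qed (use F in \<open>simp add: simple_graph_def\<close>)
  then show ?thesis by simp
qed

text \<open>A member of \<open>P\<close> with the right number of nodes can be relabelled to live on
  the nodes of \<open>F\<close>, so the minimum is taken over a non-empty set and is
  attained.\<close>

lemma edit_dist_property_lessD:
  assumes P: "graph_property P" and F: "simple_graph F" and less: "edit_dist_property F P < ereal x"
  shows "\<exists>H\<in>P. nodes H = nodes F \<and> edit_dist F H < x"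
proof -
  have ex: "\<exists>H\<in>P. card (nodes H) = card (nodes F)"
    using less by (auto simp: edit_dist_property_def split: if_splits)
  then obtain H where H: "H \<in> P" "card (nodes H) = card (nodes F)" by blast
  have sH: "simple_graph H" using P H by (simp add: graph_property_def)
  have "finite (nodes F)" "finite (nodes H)" using F sH by (auto simp: simple_graph_def)
  then obtain f where f: "bij_betw f (nodes H) (nodes F)" using H(2) finite_same_card_bij by blast
  have rl: "simple_graph (relabel f H)" "isomorphic_graphs H (relabel f H)"
    using relabel_simple_iso[OF sH bij_betw_imp_inj_on[OF f]] by auto
  have "relabel f H \<in> P" using P H(1) rl unfolding graph_property_def by blast
  moreover have "nodes (relabel f H) = nodes F" using bij_betw_imp_surj_on[OF f] by (simp add: relabel_def)
  ultimately have ne: "{edit_dist F H | H. H \<in> P \<and> nodes H = nodes F} \<noteq> {}" by blast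
  note fin = finite_edit_dists[OF P F]
  have "Min {edit_dist F H | H. H \<in> P \<and> nodes H = nodes F} \<in> {edit_dist F H | H. H \<in> P \<and> nodes H = nodes F}"
    by (rule Min_in[OF fin ne])
  moreover have "Min {edit_dist F H | H. H \<in> P \<and> nodes H = nodes F} < x"
    using less ex by (simp add: edit_dist_property_def)
  ultimately show ?thesis by auto
qed

lemma edit_dist_property_lessI:
  assumes P: "graph_property P" and F: "simple_graph F" and H: "H \<in> P" "nodes H = nodes F" "edit_dist F H < x"
  shows "edit_dist_property F P < ereal x"
proof -
  note fin = finite_edit_dists[OF P F]
  have "Min {edit_dist F H | H. H \<in> P \<and> nodes H = nodes F} \<le> edit_dist F H"
    by (rule Min_le[OF fin]) (use H in blast)
  moreover have "\<exists>H\<in>P. card (nodes H) = card (nodes F)" using H(1,2) by (intro bexI[of _ H]) simp_all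
  ultimately show ?thesis using H(3) by (simp add: edit_dist_property_def)
qed

text \<open>The member of \<open>P\<close> near \<open>F\<close> is relabelled along the
  isomorphism, which acts injectively on sets of nodes and so keeps the size of symmetric
  differences.\<close>

lemma edit_dist_property_iso:
  assumes P: "graph_property P" and F: "simple_graph F" and F': "simple_graph F'" and iso: "isomorphic_graphs F F'"
    and less: "edit_dist_property F P < ereal x"
  shows "edit_dist_property F' P < ereal x"
proof -
  obtain f where f: "bij_betw f (nodes F) (nodes F')"
    and fe: "\<And>u v. u \<in> nodes F \<Longrightarrow> v \<in> nodes F \<Longrightarrow> {u, v} \<in> edges F \<longleftrightarrow> {f u, f v} \<in> edges F'"
    using iso by (auto simp: isomorphic_graphs_def)
  obtain H where H: "H \<in> P" "nodes H = nodes F" "edit_dist F H < x" using edit_dist_property_lessD[OF P F less] by blast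
  have sH: "simple_graph H" using P H by (simp add: graph_property_def)
  have inj: "inj_on f (nodes F)" by (rule bij_betw_imp_inj_on[OF f])
  have rl: "simple_graph (relabel f H)" "isomorphic_graphs H (relabel f H)"
    using relabel_simple_iso[OF sH] inj H(2) by auto
  have "relabel f H \<in> P" using P H(1) rl unfolding graph_property_def by blast
  moreover have nr: "nodes (relabel f H) = nodes F'" using bij_betw_imp_surj_on[OF f] H(2) by (simp add: relabel_def)
  moreover have "edit_dist F' (relabel f H) = edit_dist F H"
  proof -
    have e: "edges F' = (`) f ` edges F" by (rule iso_edges[OF F F' f fe])
    have sub: "edges F \<subseteq> Pow (nodes F)" "edges H \<subseteq> Pow (nodes F)" using F sH H(2) by (auto simp: simple_graph_def)
    have injP: "inj_on ((`) f) (Pow (nodes F))" using inj by (rule inj_on_image_Pow)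
    have "(edges F' - edges (relabel f H)) \<union> (edges (relabel f H) - edges F') =
       (`) f ` ((edges F - edges H) \<union> (edges H - edges F))"
    proof -
      have "(`) f ` (edges F - edges H) = (`) f ` edges F - (`) f ` edges H"
        by (rule inj_on_image_set_diff[OF injP _ sub(2)]) (use sub in blast)
      moreover have "(`) f ` (edges H - edges F) = (`) f ` edges H - (`) f ` edges F"
        by (rule inj_on_image_set_diff[OF injP _ sub(1)]) (use sub in blast)
      ultimately show ?thesis unfolding e relabel_def ugraph.sel image_Un by (simp only:)
    qed
    moreover have "card ((`) f ` ((edges F - edges H) \<union> (edges H - edges F))) = card ((edges F - edges H) \<union> (edges H - edges F))"
      using sub by (intro card_image inj_on_subset[OF injP]) auto
    ultimately show ?thesis using bij_betw_same_card[OF f] by (simp add: edit_dist_def)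
  qed
  ultimately show ?thesis using H(3) by (intro edit_dist_property_lessI[OF P F', of "relabel f H"]) auto
qed

lemma edit_dist_property_triangle:
  assumes P: "graph_property P" and G: "simple_graph G" and G': "simple_graph G'" "nodes G' = nodes G"
    and a: "edit_dist G G' \<le> a" and b: "edit_dist_property G' P < ereal b"
  shows "edit_dist_property G P < ereal (a + b)"
proof -
  obtain H where H: "H \<in> P" "nodes H = nodes G'" "edit_dist G' H < b" using edit_dist_property_lessD[OF P G'(1) b] by blast
  have sH: "simple_graph H" using P H by (simp add: graph_property_def)
  let ?D = "\<lambda>G H. (edges G - edges H) \<union> (edges H - edges G)"
  have fin: "finite (edges G)" "finite (edges G')" "finite (edges H)" using finite_edges G G' sH by auto
  have "card (?D G H) \<le> card (?D G G' \<union> ?D G' H)" by (rule card_mono) (use fin in auto)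
  also have "\<dots> \<le> card (?D G G') + card (?D G' H)" by (rule card_Un_le)
  finally have "real (card (?D G H)) \<le> real (card (?D G G')) + real (card (?D G' H))" by simp
  then have "edit_dist G H \<le> edit_dist G G' + edit_dist G' H"
    unfolding edit_dist_def G'(2) add_divide_distrib[symmetric] by (intro divide_right_mono) auto
  then have "edit_dist G H < a + b" using a H(3) by linarith
  then show ?thesis using H G' by (intro edit_dist_property_lessI[OF P G, of H]) auto
qed

lemma induced_iso_dgraph:
  assumes G: "simple_graph G" and S: "S \<subseteq> nodes G" "card S = k"
  shows "\<exists>D\<subseteq>pairs k. isomorphic_graphs (dgraph k D) (induced G S)"
proof -
  have "finite S" using S G finite_subset by (auto simp: simple_graph_def)
  then obtain g where g: "bij_betw g {..<k} S" using ex_ordering[of S] S by auto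
  define f where "f = restrict g {..<k}"
  define D where "D = {p\<in>pairs k. {f (fst p), f (snd p)} \<in> edges G}"
  have im: "f ` {..<k} = S" using bij_betw_imp_surj_on[OF g] by (simp add: f_def)
  have "inj_on f {..<k}" using bij_betw_imp_inj_on[OF g] by (simp add: f_def inj_on_def)
  moreover have "f \<in> {..<k} \<rightarrow>\<^sub>E nodes G"
    unfolding f_def restrict_PiE_iff using bij_betwE[OF g] S by blast
  then have "f \<in> hom_maps k D G" by (simp add: hom_maps_def D_def)
  ultimately have "isomorphic_graphs (dgraph k D) (induced G S)" using hom_map_iso[OF G] im by blast
  moreover have "D \<subseteq> pairs k" by (auto simp: D_def)
  ultimately show ?thesis by blast
qed

text \<open>At most a third of the samples of size \<open>K\<close> are far from the graph, so some
  sample is near. As only finitely many \<open>D\<close> occur, this is total boundedness of the cut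
  distance on large graphs.\<close>

lemma finite_approximation:
  fixes \<epsilon> :: real
  assumes "0 < \<epsilon>"
  shows "\<exists>K\<ge>1. \<forall>G. simple_graph G \<and> K \<le> card (nodes G) \<longrightarrow> (\<exists>D\<subseteq>pairs K. cut_dist G (dgraph K D) < \<epsilon>)"
proof -
  obtain K where K: "K \<ge> 1" "\<And>G k. simple_graph G \<Longrightarrow> K \<le> k \<Longrightarrow> k \<le> card (nodes G) \<Longrightarrow>
    real (card {S \<in> ksubsets (nodes G) k. \<epsilon> \<le> cut_dist G (induced G S)}) \<le> 1/3 * real (card (ksubsets (nodes G) k))"
    using sampling[OF assms] by blast
  have "\<exists>D\<subseteq>pairs K. cut_dist G (dgraph K D) < \<epsilon>" if G: "simple_graph G" and n: "K \<le> card (nodes G)" for G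
  proof -
    have V: "finite (nodes G)" using G by (simp add: simple_graph_def)
    have pos: "0 < card (ksubsets (nodes G) K)" using n_subsets[OF V, of K] n by simp
    have "\<exists>S\<in>ksubsets (nodes G) K. cut_dist G (induced G S) < \<epsilon>"
    proof (rule ccontr)
      assume "\<not> ?thesis"
      then have "{S \<in> ksubsets (nodes G) K. \<epsilon> \<le> cut_dist G (induced G S)} = ksubsets (nodes G) K" by force
      then show False using K(2)[OF G order.refl n] pos by simp
    qed
    then obtain S where S: "S \<subseteq> nodes G" "card S = K" "cut_dist G (induced G S) < \<epsilon>" by blast
    obtain D where D: "D \<subseteq> pairs K" "isomorphic_graphs (dgraph K D) (induced G S)"
      using induced_iso_dgraph[OF G S(1,2)] by blast
    have "cut_dist (dgraph K D) (induced G S) \<le> 0"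
      using K(1) by (intro cut_dist_iso[OF D(2)]) (auto simp: dgraph_def lessThan_empty_iff)
    then have "cut_dist G (dgraph K D) < \<epsilon>"
      using S(3) cut_dist_triangle[of G "dgraph K D" "induced G S"] cut_dist_sym[of "induced G S" "dgraph K D"] by linarith
    then show ?thesis using D by blast
  qed
  then show ?thesis using K(1) by blast
qed

section \<open>Testable properties\<close>

text \<open>Condition (b) of the theorem; \<open>induced_robust\<close> is condition (c).\<close>

definition cut_robust :: "ugraph set \<Rightarrow> bool" where
  "cut_robust P \<longleftrightarrow> (\<forall>\<epsilon>::real. \<epsilon> > 0 \<longrightarrow> (\<exists>\<epsilon>'::real. \<epsilon>' > 0 \<and> (\<exists>n'::nat. n' > 0 \<and>
     (\<forall>G\<in>P. \<forall>G'. simple_graph G' \<and> cut_dist G G' < \<epsilon>' \<and>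
        card (nodes G) \<ge> n' \<and> card (nodes G') \<ge> n' \<longrightarrow> edit_dist_property G' P < ereal \<epsilon>))))"

definition induced_robust :: "ugraph set \<Rightarrow> bool" where
  "induced_robust P \<longleftrightarrow> (\<forall>\<epsilon>::real. \<epsilon> > 0 \<longrightarrow> (\<exists>\<epsilon>\<^sub>0::real. \<epsilon>\<^sub>0 > 0 \<and> (\<exists>n\<^sub>0::nat. n\<^sub>0 > 0 \<and>
     (\<forall>G\<in>P. \<forall>G'. induced_subgraph_of G' G \<and> cut_dist G G' < \<epsilon>\<^sub>0 \<and>
        card (nodes G') \<ge> n\<^sub>0 \<longrightarrow> edit_dist_property G' P < ereal \<epsilon>))))"

text \<open>The fraction of accepted \<open>k\<close>-subsets is almost a sum of pattern densities,
  which vary little in cut distance. So \<open>G'\<close> cannot drop from at least 2/3 to at most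
  1/3, as it would if it were far from \<open>P\<close>.\<close>

lemma testable_imp_cut_robust:
  assumes P: "graph_property P" and T: "testable P"
  shows "cut_robust P"
  unfolding cut_robust_def
proof (intro allI impI)
  fix \<epsilon> :: real assume \<epsilon>: "\<epsilon> > 0"
  obtain P' where P': "graph_property P'"
    and T1: "\<And>G k. G \<in> P \<Longrightarrow> 1 \<le> k \<Longrightarrow> k \<le> card (nodes G) \<Longrightarrow> induced_fraction k G P' \<ge> 2 / 3"
    and T2: "\<And>\<epsilon>::real. \<epsilon> > 0 \<Longrightarrow> \<exists>k\<^sub>\<epsilon>\<ge>1. \<forall>G. simple_graph G \<and> edit_dist_property G P \<ge> ereal \<epsilon> \<longrightarrow>
           (\<forall>k. k\<^sub>\<epsilon> \<le> k \<and> k \<le> card (nodes G) \<longrightarrow> induced_fraction k G P' \<le> 1 / 3)"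
    using T unfolding testable_def by blast
  obtain k where k: "1 \<le> k" and T2k: "\<And>G. simple_graph G \<Longrightarrow> edit_dist_property G P \<ge> ereal \<epsilon> \<Longrightarrow> k \<le> card (nodes G) \<Longrightarrow> induced_fraction k G P' \<le> 1 / 3"
    using T2[OF \<epsilon>] by blast
  define Ds where "Ds = {D. D \<subseteq> pairs k \<and> dgraph k D \<in> P'}"
  have finD: "finite Ds" unfolding Ds_def by (rule finite_subset[of _ "Pow (pairs k)"]) auto
  define C where "C = real (card Ds) * real (k\<^sup>2)"
  have C: "C \<ge> 0" by (simp add: C_def)
  \<comment> \<open>The errors 1/24, 1/24 and 1/12, two from the bound on
    \<open>k\<^sup>2 / n\<close> and one from this choice, sum to 1/6, less than the gap
    1/3.\<close>
  define \<epsilon>' where "\<epsilon>' = 1 / (12 * (C + 1))"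
  define n' where "n' = max k (24 * k\<^sup>2)"
  show "\<exists>\<epsilon>'>0. \<exists>n'>0. \<forall>G\<in>P. \<forall>G'. simple_graph G' \<and> cut_dist G G' < \<epsilon>' \<and>
        n' \<le> card (nodes G) \<and> n' \<le> card (nodes G') \<longrightarrow> edit_dist_property G' P < ereal \<epsilon>"
  proof (intro exI[of _ \<epsilon>'] exI[of _ n'] conjI ballI allI impI)
    show "\<epsilon>' > 0" using C by (simp add: \<epsilon>'_def)
    show "n' > 0" using k by (simp add: n'_def)
    fix G G' assume G: "G \<in> P" and A: "simple_graph G' \<and> cut_dist G G' < \<epsilon>' \<and> n' \<le> card (nodes G) \<and> n' \<le> card (nodes G')"
    have sG: "simple_graph G" using P G by (simp add: graph_property_def)
    have n: "k \<le> card (nodes G)" "k \<le> card (nodes G')" "24 * k\<^sup>2 \<le> card (nodes G)" "24 * k\<^sup>2 \<le> card (nodes G')"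
      using A by (auto simp: n'_def)
    have n0: "0 < card (nodes G)" "0 < card (nodes G')" using n k by auto
    have small: "real (k\<^sup>2) / real (card (nodes F)) \<le> 1 / 24" if "24 * k\<^sup>2 \<le> card (nodes F)" "0 < card (nodes F)" for F
    proof -
      have "real (24 * k\<^sup>2) \<le> real (card (nodes F))" using that(1) by (rule of_nat_mono)
      then show ?thesis using that(2) by (simp add: pos_divide_le_eq)
    qed
    have f1: "\<bar>induced_fraction k G P' - (\<Sum>D\<in>Ds. tden k D G)\<bar> \<le> 1 / 24"
      unfolding Ds_def by (rule order_trans[OF induced_fraction_tden[OF sG n0(1) n(1) P'] small[OF n(3) n0(1)]])
    have f2: "\<bar>induced_fraction k G' P' - (\<Sum>D\<in>Ds. tden k D G')\<bar> \<le> 1 / 24"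
      unfolding Ds_def using A by (intro order_trans[OF induced_fraction_tden[OF _ n0(2) n(2) P'] small[OF n(4) n0(2)]]) auto
    have "\<bar>(\<Sum>D\<in>Ds. tden k D G) - (\<Sum>D\<in>Ds. tden k D G')\<bar> \<le> (\<Sum>D\<in>Ds. \<bar>tden k D G - tden k D G'\<bar>)"
      unfolding sum_subtractf[symmetric] by (rule sum_abs)
    also have "\<dots> \<le> (\<Sum>D\<in>Ds. real (k\<^sup>2) * \<epsilon>')" using A by (intro sum_mono tden_cut_dist n0) auto
    also have "\<dots> = C * \<epsilon>'" by (simp add: C_def)
    also have "\<dots> \<le> 1 / 12" using C by (simp add: \<epsilon>'_def field_simps)
    finally have f3: "\<bar>(\<Sum>D\<in>Ds. tden k D G) - (\<Sum>D\<in>Ds. tden k D G')\<bar> \<le> 1 / 12" .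
    have "induced_fraction k G P' \<ge> 2 / 3" by (rule T1[OF G k n(1)])
    then have "induced_fraction k G' P' > 1 / 3" using f1 f2 f3 by linarith
    then have "\<not> edit_dist_property G' P \<ge> ereal \<epsilon>" using T2k[of G'] A n(2) by force
    then show "edit_dist_property G' P < ereal \<epsilon>" by simp
  qed
qed

lemma cut_robust_imp_induced_robust:
  assumes P: "graph_property P" and B: "cut_robust P"
  shows "induced_robust P"
  unfolding induced_robust_def
proof (intro allI impI)
  fix \<epsilon> :: real assume "\<epsilon> > 0"
  then obtain \<epsilon>' n' where b: "\<epsilon>' > 0" "n' > 0" "\<And>G G'. G \<in> P \<Longrightarrow> simple_graph G' \<Longrightarrow> cut_dist G G' < \<epsilon>' \<Longrightarrow>
        card (nodes G) \<ge> n' \<Longrightarrow> card (nodes G') \<ge> n' \<Longrightarrow> edit_dist_property G' P < ereal \<epsilon>"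
    using B unfolding cut_robust_def by meson
  show "\<exists>\<epsilon>\<^sub>0>0. \<exists>n\<^sub>0>0. \<forall>G\<in>P. \<forall>G'. induced_subgraph_of G' G \<and> cut_dist G G' < \<epsilon>\<^sub>0 \<and>
        n\<^sub>0 \<le> card (nodes G') \<longrightarrow> edit_dist_property G' P < ereal \<epsilon>"
  proof (intro exI[of _ \<epsilon>'] exI[of _ n'] conjI ballI allI impI b(1,2))
    fix G G' assume G: "G \<in> P" and A: "induced_subgraph_of G' G \<and> cut_dist G G' < \<epsilon>' \<and> n' \<le> card (nodes G')"
    have sG: "simple_graph G" using P G by (simp add: graph_property_def)
    obtain S where S: "S \<subseteq> nodes G" "G' = induced G S" using A by (auto simp: induced_subgraph_of_def)
    have "card (nodes G') \<le> card (nodes G)"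
      unfolding S(2) induced_def using S(1) sG by (auto simp: simple_graph_def intro: card_mono)
    then show "edit_dist_property G' P < ereal \<epsilon>"
      using A S simple_induced[OF sG S(1)] by (intro b(3)[OF G]) auto
  qed
qed

text \<open>The corrected graph \<open>G'\<close> is fixed first and embedded into a much later host
  \<open>H (q j)\<close>. To apply (c) it must be close to that host, although the two come from
  different places in the sequence; therefore the hosts are first made pairwise close.\<close>

lemma induced_robust_imp_cut_robust:
  assumes P: "graph_property P" and C: "induced_robust P"
  shows "cut_robust P"
proof (rule ccontr)
  assume "\<not> cut_robust P"
  then obtain \<epsilon> :: real where \<epsilon>: "\<epsilon> > 0" and neg: "\<And>\<epsilon>' n'. \<epsilon>' > 0 \<Longrightarrow> n' > 0 \<Longrightarrow>
     \<exists>G\<in>P. \<exists>G'. simple_graph G' \<and> cut_dist G G' < \<epsilon>' \<and> card (nodes G) \<ge> n' \<and> card (nodes G') \<ge> n' \<and>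
       \<not> edit_dist_property G' P < ereal \<epsilon>"
    unfolding cut_robust_def by meson
  have "\<exists>X. fst X \<in> P \<and> simple_graph (snd X) \<and> cut_dist (fst X) (snd X) < 1 / real (Suc m) \<and>
      card (nodes (fst X)) \<ge> Suc m \<and> card (nodes (snd X)) \<ge> Suc m \<and> \<not> edit_dist_property (snd X) P < ereal \<epsilon>" for m
    using neg[of "1 / real (Suc m)" "Suc m"] by auto
  then have "\<forall>m. \<exists>X. fst X \<in> P \<and> simple_graph (snd X) \<and> cut_dist (fst X) (snd X) < 1 / real (Suc m) \<and>
      card (nodes (fst X)) \<ge> Suc m \<and> card (nodes (snd X)) \<ge> Suc m \<and> \<not> edit_dist_property (snd X) P < ereal \<epsilon>" by blast
  from choice[OF this] obtain X where X: "\<And>m. fst (X m) \<in> P \<and> simple_graph (snd (X m)) \<and> cut_dist (fst (X m)) (snd (X m)) < 1 / real (Suc m) \<and>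
      card (nodes (fst (X m))) \<ge> Suc m \<and> card (nodes (snd (X m))) \<ge> Suc m \<and> \<not> edit_dist_property (snd (X m)) P < ereal \<epsilon>" by blast
  define H G where "H m = fst (X m)" and "G m = snd (X m)" for m
  have HP: "H m \<in> P" and sG: "simple_graph (G m)" and HG: "cut_dist (H m) (G m) < 1 / real (Suc m)"
    and cH: "Suc m \<le> card (nodes (H m))" and cG: "Suc m \<le> card (nodes (G m))"
    and bad: "\<not> edit_dist_property (G m) P < ereal \<epsilon>" for m
    using X[of m] by (auto simp: H_def G_def)
  have sH: "simple_graph (H m)" for m using P HP[of m] by (simp add: graph_property_def)
  obtain \<epsilon>0 n0 where c: "\<epsilon>0 > 0" "n0 > 0" and cc: "\<And>G G'. G \<in> P \<Longrightarrow> induced_subgraph_of G' G \<Longrightarrow> cut_dist G G' < \<epsilon>0 \<Longrightarrow>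
        card (nodes G') \<ge> n0 \<Longrightarrow> edit_dist_property G' P < ereal (\<epsilon> / 2)"
    using C[unfolded induced_robust_def, rule_format, OF half_gt_zero[OF \<epsilon>]] by blast
  \<comment> \<open>There are finitely many approximating graphs, so infinitely many hosts are near
    the same one.\<close>
  obtain K where K: "K \<ge> 1" "\<And>G. simple_graph G \<Longrightarrow> K \<le> card (nodes G) \<Longrightarrow> \<exists>D\<subseteq>pairs K. cut_dist G (dgraph K D) < \<epsilon>0 / 8"
    using finite_approximation[of "\<epsilon>0 / 8"] c(1) by auto
  have "\<exists>D. D \<in> Pow (pairs K) \<and> cut_dist (H (K + m)) (dgraph K D) < \<epsilon>0 / 8" for m
    using K(2)[OF sH[of "K + m"]] cH[of "K + m"] by auto
  then have "\<forall>m. \<exists>D. D \<in> Pow (pairs K) \<and> cut_dist (H (K + m)) (dgraph K D) < \<epsilon>0 / 8" by blast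
  from choice[OF this] obtain Df where Df: "\<And>m. Df m \<in> Pow (pairs K)" "\<And>m. cut_dist (H (K + m)) (dgraph K (Df m)) < \<epsilon>0 / 8" by blast
  have "Df ` UNIV \<subseteq> Pow (pairs K)" using Df(1) by blast
  then have "finite (Df ` UNIV)" by (rule finite_subset) simp
  then obtain m0 where "infinite {m \<in> UNIV. Df m = Df m0}"
    using pigeonhole_infinite[of "UNIV :: nat set" Df] by auto
  then obtain s0 where s0: "strict_mono (s0 :: nat \<Rightarrow> nat)" "\<And>m. Df (s0 m) = Df m0"
    using infinite_enumerate[of "{m \<in> UNIV. Df m = Df m0}"] by auto
  \<comment> \<open>The shift by \<open>K\<close> gives every host at least \<open>K\<close>
    nodes.\<close>
  define s where "s m = K + s0 m" for m
  have s: "strict_mono s" using s0(1) by (simp add: s_def strict_mono_def)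
  have near: "cut_dist (H (s i)) (H (s j)) < \<epsilon>0 / 4" for i j
    using Df(2)[of "s0 i"] Df(2)[of "s0 j"] s0(2) cut_dist_triangle[of "H (s i)" "H (s j)" "dgraph K (Df m0)"]
      cut_dist_sym[of "H (s j)" "dgraph K (Df m0)"]
    by (simp add: s_def)
  have neG: "nodes (G (s m)) \<noteq> {}" for m using cG[of "s m"] by auto
  obtain r \<tau> where r: "strict_mono (r :: nat \<Rightarrow> nat)" and t: "\<And>k D. (\<lambda>m. tden k D (G (s (r m)))) \<longlonglongrightarrow> \<tau> k D"
    and rem: "\<And>\<epsilon>. \<epsilon> > 0 \<Longrightarrow> \<exists>N. \<forall>m\<ge>N. \<exists>e D. bij_betw e {..<card (nodes (G (s (r m))))} (nodes (G (s (r m)))) \<and>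
        D \<subseteq> pairs (card (nodes (G (s (r m))))) \<and> 0 < \<tau> (card (nodes (G (s (r m))))) D \<and>
        real (card {p\<in>pairs (card (nodes (G (s (r m))))). (p \<in> D) \<noteq> ({e (fst p), e (snd p)} \<in> edges (G (s (r m))))})
          \<le> \<epsilon> * (real (card (nodes (G (s (r m))))))\<^sup>2"
    using graph_limit[where G = "\<lambda>m. G (s m)", OF sG neG] by blast
  define q where "q m = s (r m)" for m
  have q: "m \<le> q m" for m
    using seq_suble[OF r, of m] seq_suble[OF s, of "r m"] by (simp add: q_def)
  have inv0: "(\<lambda>m. 1 / real (Suc m)) \<longlonglongrightarrow> 0" using LIMSEQ_inverse_real_of_nat by (simp add: inverse_eq_divide)
  have posH: "0 < card (nodes (H m))" and posG: "0 < card (nodes (G m))" for m using cH[of m] cG[of m] by auto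
  have qle: "1 / real (Suc (q m)) \<le> 1 / real (Suc m)" for m using q[of m] by (intro divide_left_mono) auto
  \<comment> \<open>The hosts inherit the limit densities, since the cut distance of
    \<open>H m\<close> and \<open>G m\<close> tends to 0.\<close>
  have tH: "(\<lambda>m. tden k D (H (q m))) \<longlonglongrightarrow> \<tau> k D" for k D
  proof -
    have "(\<lambda>m. tden k D (H (q m)) - tden k D (G (q m))) \<longlonglongrightarrow> 0"
    proof (rule Lim_null_comparison)
      show "\<forall>\<^sub>F m in sequentially. norm (tden k D (H (q m)) - tden k D (G (q m))) \<le> real (k\<^sup>2) * (1 / real (Suc m))"
      proof (rule always_eventually, rule allI)
        fix m
        have "\<bar>tden k D (H (q m)) - tden k D (G (q m))\<bar> \<le> real (k\<^sup>2) * (1 / real (Suc (q m)))"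
          by (rule tden_cut_dist[OF posH posG HG])
        also have "\<dots> \<le> real (k\<^sup>2) * (1 / real (Suc m))" using qle by (intro mult_left_mono) auto
        finally show "norm (tden k D (H (q m)) - tden k D (G (q m))) \<le> real (k\<^sup>2) * (1 / real (Suc m))" by simp
      qed
      show "(\<lambda>m. real (k\<^sup>2) * (1 / real (Suc m))) \<longlonglongrightarrow> 0" by (rule tendsto_mult_right_zero[OF inv0])
    qed
    from tendsto_add[OF this t[folded q_def, of k D]] show ?thesis by simp
  qed
  \<comment> \<open>One half of \<epsilon> is spent on the correction, the other half on (c). By
    \<open>cut_dist_edit\<close>, \<open>\<epsilon>0 / 16\<close> keeps the correction within
    \<open>\<epsilon>0 / 8\<close> in cut distance.\<close>
  define \<epsilon>1 where "\<epsilon>1 = min (\<epsilon> / 2) (\<epsilon>0 / 16)"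
  have \<epsilon>1: "\<epsilon>1 > 0" using \<epsilon> c by (simp add: \<epsilon>1_def)
  obtain N1 where N1: "\<And>m. m \<ge> N1 \<Longrightarrow> \<exists>e D. bij_betw e {..<card (nodes (G (q m)))} (nodes (G (q m))) \<and>
        D \<subseteq> pairs (card (nodes (G (q m)))) \<and> 0 < \<tau> (card (nodes (G (q m)))) D \<and>
        real (card {p\<in>pairs (card (nodes (G (q m)))). (p \<in> D) \<noteq> ({e (fst p), e (snd p)} \<in> edges (G (q m)))})
          \<le> \<epsilon>1 * (real (card (nodes (G (q m)))))\<^sup>2"
    using rem[OF \<epsilon>1] unfolding q_def by blast
  have "\<forall>\<^sub>F m in sequentially. 1 / real (Suc m) < \<epsilon>0 / 4" using c by (intro order_tendstoD(2)[OF inv0]) simp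
  then obtain N2 where N2: "\<And>m. m \<ge> N2 \<Longrightarrow> 1 / real (Suc m) < \<epsilon>0 / 4" by (auto simp: eventually_sequentially)
  define m where "m = max (max N1 N2) n0"
  define n where "n = card (nodes (G (q m)))"
  have "m \<ge> N1" by (simp add: m_def)
  from N1[OF this, folded n_def]
  obtain e D where e: "bij_betw e {..<n} (nodes (G (q m)))" and D: "D \<subseteq> pairs n" "0 < \<tau> n D"
    and ed: "real (card {p\<in>pairs n. (p \<in> D) \<noteq> ({e (fst p), e (snd p)} \<in> edges (G (q m)))}) \<le> \<epsilon>1 * (real n)\<^sup>2"
    by blast
  have n: "0 < n" "n0 \<le> n" using cG[of "q m"] q[of m] unfolding n_def by (auto simp: m_def)
  have "\<forall>\<^sub>F j in sequentially. \<tau> n D / 2 < tden n D (H (q j))" using D(2) by (intro order_tendstoD(1)[OF tH]) simp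
  moreover have "\<forall>\<^sub>F j in sequentially. real (n\<^sup>2) * (1 / real (Suc j)) < \<tau> n D / 2"
    using D(2) by (intro order_tendstoD(2)[OF tendsto_mult_right_zero[OF inv0]]) simp
  ultimately have "\<forall>\<^sub>F j in sequentially. \<tau> n D / 2 < tden n D (H (q j)) \<and> real (n\<^sup>2) * (1 / real (Suc j)) < \<tau> n D / 2"
    by (rule eventually_conj)
  \<comment> \<open>\<open>j\<close> depends on \<open>n\<close> and \<open>D\<close> and is so
    large that non-injective maps cannot account for the density of \<open>D\<close> in the
    host.\<close>
  from eventually_happens'[OF sequentially_bot this]
  obtain j where j: "\<tau> n D / 2 < tden n D (H (q j))" "real (n\<^sup>2) * (1 / real (Suc j)) < \<tau> n D / 2"
    by blast
  have "real (n\<^sup>2) / real (card (nodes (H (q j)))) \<le> real (n\<^sup>2) * (1 / real (Suc j))"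
  proof -
    have "real (Suc j) \<le> real (card (nodes (H (q j))))" using cH[of "q j"] q[of j] by simp
    then have "real (n\<^sup>2) / real (card (nodes (H (q j)))) \<le> real (n\<^sup>2) / real (Suc j)"
      using posH[of "q j"] by (intro divide_left_mono) (auto intro!: mult_pos_pos)
    then show ?thesis by simp
  qed
  then have "real (n\<^sup>2) / real (card (nodes (H (q j)))) < tden n D (H (q j))" using j by linarith
  from tden_pos_induced[OF sH posH this]
  obtain S where S: "S \<subseteq> nodes (H (q j))" and iso: "isomorphic_graphs (dgraph n D) (induced (H (q j)) S)" by blast
  define G' where "G' = relabel e (dgraph n D)"
  have nd: "nodes (dgraph n D) = {..<n}" by (simp add: dgraph_def)
  have G': "simple_graph G'" "isomorphic_graphs (dgraph n D) G'"
    unfolding G'_def using relabel_simple_iso[OF simple_dgraph, of e n D] bij_betw_imp_inj_on[OF e] nd by auto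
  have nG': "nodes G' = nodes (G (q m))" using bij_betw_imp_surj_on[OF e] by (simp add: G'_def relabel_def nd)
  have ed1: "edit_dist (G (q m)) G' \<le> \<epsilon>1"
  proof -
    let ?X = "{p\<in>pairs n. (p \<in> D) \<noteq> ({e (fst p), e (snd p)} \<in> edges (G (q m)))}"
    have eG': "edges G' = (\<lambda>p. {e (fst p), e (snd p)}) ` D"
      using D(1) by (simp add: G'_def relabel_def dgraph_def image_image Int_absorb2)
    have inj: "inj_on e {..<n}" by (rule bij_betw_imp_inj_on[OF e])
    have pn: "fst p < n \<and> snd p < n \<and> fst p < snd p" if "p \<in> pairs n" for p using that by (auto simp: pairs_def)
    have mem: "{e (fst p), e (snd p)} \<in> edges G' \<longleftrightarrow> p \<in> D" if p: "p \<in> pairs n" for p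
    proof
      assume "{e (fst p), e (snd p)} \<in> edges G'"
      then obtain p' where p': "p' \<in> D" "{e (fst p), e (snd p)} = {e (fst p'), e (snd p')}" unfolding eG' by blast
      have "e ` {fst p, snd p} = e ` {fst p', snd p'}" using p'(2) by simp
      moreover have "{fst p, snd p} \<subseteq> {..<n}" "{fst p', snd p'} \<subseteq> {..<n}" using pn[OF p] pn[of p'] p'(1) D(1) by auto
      ultimately have "{fst p, snd p} = {fst p', snd p'}" using inj_on_image_eq_iff[OF inj] by blast
      then have "p = p'" using pn[OF p] pn[of p'] p'(1) D(1) by (cases p; cases p') (auto simp: doubleton_eq_iff)
      then show "p \<in> D" using p'(1) by simp
    qed (use eG' in blast)
    have "(edges (G (q m)) - edges G') \<union> (edges G' - edges (G (q m))) \<subseteq> (\<lambda>p. {e (fst p), e (snd p)}) ` ?X"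
    proof
      fix x assume x: "x \<in> (edges (G (q m)) - edges G') \<union> (edges G' - edges (G (q m)))"
      have "\<exists>p\<in>pairs n. x = {e (fst p), e (snd p)}"
      proof -
        obtain a b where ab: "a \<noteq> b" "x = {a, b}" "a \<in> nodes (G (q m))" "b \<in> nodes (G (q m))"
          using x edgeE[OF sG, of x "q m"] edgeE[OF G'(1), of x] unfolding nG' by blast
        then obtain i l where il: "i < n" "l < n" "a = e i" "b = e l"
          using bij_betw_imp_surj_on[OF e] by (metis imageE lessThan_iff)
        then have "i \<noteq> l" using ab(1) by blast
        then have "i < l \<or> l < i" by (rule nat_neq_iff[THEN iffD1])
        then show ?thesis
        proof
          assume "i < l"
          then show ?thesis using il ab by (intro bexI[of _ "(i, l)"]) (auto simp: pairs_def)
        next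
          assume "l < i"
          then show ?thesis using il ab by (intro bexI[of _ "(l, i)"]) (auto simp: pairs_def)
        qed
      qed
      then obtain p where p: "p \<in> pairs n" "x = {e (fst p), e (snd p)}" by blast
      then have "(p \<in> D) \<noteq> (x \<in> edges (G (q m)))" using mem[OF p(1)] x by auto
      then show "x \<in> (\<lambda>p. {e (fst p), e (snd p)}) ` ?X" using p by blast
    qed
    then have "card ((edges (G (q m)) - edges G') \<union> (edges G' - edges (G (q m)))) \<le> card ((\<lambda>p. {e (fst p), e (snd p)}) ` ?X)"
      by (intro card_mono) auto
    also have "\<dots> \<le> card ?X" by (rule card_image_le) simp
    finally have "real (card ((edges (G (q m)) - edges G') \<union> (edges G' - edges (G (q m))))) \<le> \<epsilon>1 * (real n)\<^sup>2"
      using ed by linarith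
    then show ?thesis unfolding edit_dist_def n_def[symmetric] using n by (simp add: pos_divide_le_eq)
  qed
  have "cut_dist (H (q j)) (induced (H (q j)) S) < \<epsilon>0"
  proof -
    have fd: "finite (nodes (dgraph n D))" "nodes (dgraph n D) \<noteq> {}" using n by (auto simp: nd lessThan_empty_iff)
    have a: "cut_dist (H (q j)) (H (q m)) < \<epsilon>0 / 4" unfolding q_def by (rule near)
    have b: "cut_dist (H (q m)) (G (q m)) < \<epsilon>0 / 4"
    proof -
      have "m \<ge> N2" by (simp add: m_def)
      then show ?thesis using HG[of "q m"] qle[of m] N2[of m] by linarith
    qed
    have "cut_dist (G (q m)) G' \<le> 2 * edit_dist (G (q m)) G'"
      using neG by (intro cut_dist_edit sG G' nG') (simp add: q_def)
    then have d: "cut_dist (G (q m)) G' \<le> \<epsilon>0 / 8" using ed1 by (simp add: \<epsilon>1_def)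
    have f: "cut_dist G' (dgraph n D) \<le> 0" using cut_dist_iso[OF G'(2) fd] cut_dist_sym[of G' "dgraph n D"] by simp
    have g: "cut_dist (dgraph n D) (induced (H (q j)) S) \<le> 0" by (rule cut_dist_iso[OF iso fd])
    \<comment> \<open>The path runs through \<open>H (q j)\<close>, \<open>H (q m)\<close>,
      \<open>G (q m)\<close>, \<open>G'\<close> and two isomorphic copies; it costs less than 1/4 +
      1/4 + 1/8 of \<open>\<epsilon>0\<close>.\<close>
    show ?thesis
      using a b d f g c(1) cut_dist_triangle[of "H (q j)" "induced (H (q j)) S" "H (q m)"]
        cut_dist_triangle[of "H (q m)" "induced (H (q j)) S" "G (q m)"]
        cut_dist_triangle[of "G (q m)" "induced (H (q j)) S" G']
        cut_dist_triangle[of G' "induced (H (q j)) S" "dgraph n D"] by linarith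
  qed
  moreover have "card (nodes (induced (H (q j)) S)) = n"
    using iso bij_betw_same_card unfolding isomorphic_graphs_def nd by fastforce
  ultimately have "edit_dist_property (induced (H (q j)) S) P < ereal (\<epsilon> / 2)"
    using S n by (intro cc[OF HP]) (auto simp: induced_subgraph_of_def)
  from edit_dist_property_iso[OF P simple_induced[OF sH S] simple_dgraph isomorphic_sym[OF iso] this]
  have "edit_dist_property (dgraph n D) P < ereal (\<epsilon> / 2)" .
  from edit_dist_property_iso[OF P simple_dgraph G' this]
  have "edit_dist_property G' P < ereal (\<epsilon> / 2)" .
  moreover have "edit_dist (G (q m)) G' \<le> \<epsilon> / 2" using ed1 by (simp add: \<epsilon>1_def)
  ultimately have "edit_dist_property (G (q m)) P < ereal (\<epsilon> / 2 + \<epsilon> / 2)"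
    by (intro edit_dist_property_triangle[OF P sG G'(1) nG'])
  then show False using bad by simp
qed

lemma induced_robust_sample:
  assumes C: "induced_robust P" and x: "0 < (x :: real)"
  shows "\<exists>K. \<forall>G\<in>P. \<forall>k. simple_graph G \<and> K \<le> k \<and> k \<le> card (nodes G) \<longrightarrow>
    real (card {S \<in> ksubsets (nodes G) k. \<not> edit_dist_property (induced G S) P < ereal x}) \<le> 1/3 * real (card (ksubsets (nodes G) k))"
proof -
  obtain \<epsilon>0 n0 where c: "\<epsilon>0 > 0" "n0 > 0" and cc: "\<And>G G'. G \<in> P \<Longrightarrow> induced_subgraph_of G' G \<Longrightarrow> cut_dist G G' < \<epsilon>0 \<Longrightarrow>
        card (nodes G') \<ge> n0 \<Longrightarrow> edit_dist_property G' P < ereal x"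
    using C[unfolded induced_robust_def, rule_format, OF x] by blast
  obtain K where K: "\<And>G k. simple_graph G \<Longrightarrow> K \<le> k \<Longrightarrow> k \<le> card (nodes G) \<Longrightarrow>
    real (card {S \<in> ksubsets (nodes G) k. \<epsilon>0 \<le> cut_dist G (induced G S)}) \<le> 1/3 * real (card (ksubsets (nodes G) k))"
    using sampling[OF c(1)] by blast
  show ?thesis
  proof (intro exI[of _ "max K n0"] ballI allI impI)
    fix G k assume G: "G \<in> P" and A: "simple_graph G \<and> max K n0 \<le> k \<and> k \<le> card (nodes G)"
    have V: "finite (nodes G)" using A by (simp add: simple_graph_def)
    have "{S \<in> ksubsets (nodes G) k. \<not> edit_dist_property (induced G S) P < ereal x} \<subseteq> {S \<in> ksubsets (nodes G) k. \<epsilon>0 \<le> cut_dist G (induced G S)}"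
    proof
      fix S assume S: "S \<in> {S \<in> ksubsets (nodes G) k. \<not> edit_dist_property (induced G S) P < ereal x}"
      have "nodes (induced G S) = S" by (simp add: induced_def)
      then have "\<not> cut_dist G (induced G S) < \<epsilon>0"
        using S A cc[OF G, of "induced G S"] by (auto simp: induced_subgraph_of_def)
      then show "S \<in> {S \<in> ksubsets (nodes G) k. \<epsilon>0 \<le> cut_dist G (induced G S)}" using S by auto
    qed
    then have "card {S \<in> ksubsets (nodes G) k. \<not> edit_dist_property (induced G S) P < ereal x} \<le> card {S \<in> ksubsets (nodes G) k. \<epsilon>0 \<le> cut_dist G (induced G S)}"
      by (rule card_mono[rotated]) (rule finite_subset[OF _ finite_ksubsets[OF V, of k]], blast)
    then have "real (card {S \<in> ksubsets (nodes G) k. \<not> edit_dist_property (induced G S) P < ereal x}) \<le> real (card {S \<in> ksubsets (nodes G) k. \<epsilon>0 \<le> cut_dist G (induced G S)})"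
      by (rule of_nat_mono)
    also have "\<dots> \<le> 1/3 * real (card (ksubsets (nodes G) k))" using A by (intro K) auto
    finally show "real (card {S \<in> ksubsets (nodes G) k. \<not> edit_dist_property (induced G S) P < ereal x}) \<le> 1/3 * real (card (ksubsets (nodes G) k))" .
  qed
qed

text \<open>The tester does not know \<epsilon>. It accepts graphs within
  \<open>1 / real (Suc i)\<close> of \<open>P\<close>, where \<open>i\<close> grows with the number
  of nodes, but slowly enough for most samples of members of \<open>P\<close> to pass by (c). If
  more than a third of the samples of \<open>G\<close> passed, a passing one would be near
  \<open>G\<close> in cut distance; being near a member of \<open>P\<close> as well, it would bring
  \<open>G\<close> close to \<open>P\<close> by (b).\<close>

lemma robust_imp_testable:
  assumes P: "graph_property P" and C: "induced_robust P" and B: "cut_robust P"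
  shows "testable P"
proof -
  have "\<forall>i. \<exists>K. \<forall>G\<in>P. \<forall>k. simple_graph G \<and> K \<le> k \<and> k \<le> card (nodes G) \<longrightarrow>
    real (card {S \<in> ksubsets (nodes G) k. \<not> edit_dist_property (induced G S) P < ereal (1 / real (Suc i))}) \<le> 1/3 * real (card (ksubsets (nodes G) k))"
    by (intro allI induced_robust_sample[OF C]) simp
  from choice[OF this] obtain \<kappa> where \<kappa>: "\<And>i G k. G \<in> P \<Longrightarrow> simple_graph G \<Longrightarrow> \<kappa> i \<le> k \<Longrightarrow> k \<le> card (nodes G) \<Longrightarrow>
    real (card {S \<in> ksubsets (nodes G) k. \<not> edit_dist_property (induced G S) P < ereal (1 / real (Suc i))}) \<le> 1/3 * real (card (ksubsets (nodes G) k))"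
    by blast
  \<comment> \<open>The tolerances whose required sample size is reached at \<open>k\<close>; the
    condition \<open>i \<le> k\<close> makes this a finite set, so that it has a maximum.\<close>
  define A where "A k = {i. i \<le> k \<and> \<kappa> i \<le> k}" for k
  have finA: "finite (A k)" for k unfolding A_def by simp
  \<comment> \<open>As long as no tolerance is available, every simple graph is accepted.\<close>
  define P' where "P' = {F. simple_graph F \<and> (A (card (nodes F)) \<noteq> {} \<longrightarrow>
     edit_dist_property F P < ereal (1 / real (Suc (Max (A (card (nodes F)))))))}"
  have "graph_property P'"
    unfolding graph_property_def
  proof (intro conjI ballI allI impI)
    fix F H assume F: "F \<in> P'" and H: "simple_graph H \<and> isomorphic_graphs F H"
    have "card (nodes F) = card (nodes H)" using H bij_betw_same_card unfolding isomorphic_graphs_def by blast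
    then show "H \<in> P'" using F H edit_dist_property_iso[OF P, of F H] unfolding P'_def by auto
  qed (simp add: P'_def)
  moreover have "induced_fraction k G P' \<ge> 2 / 3" if G: "G \<in> P" and k: "1 \<le> k" "k \<le> card (nodes G)" for G k
  proof -
    have sG: "simple_graph G" using P G by (simp add: graph_property_def)
    have V: "finite (nodes G)" using sG by (simp add: simple_graph_def)
    have pos: "0 < card (ksubsets (nodes G) k)" using n_subsets[OF V, of k] k by simp
    define Bd where "Bd = {S \<in> ksubsets (nodes G) k. induced G S \<notin> P'}"
    have Bd3: "real (card Bd) \<le> 1/3 * real (card (ksubsets (nodes G) k))"
    proof (cases "A k = {}")
      case True
      have "Bd = {}" using True simple_induced[OF sG] by (auto simp: Bd_def P'_def induced_def)
      then show ?thesis by simp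
    next
      case False
      define i where "i = Max (A k)"
      have "i \<in> A k" unfolding i_def by (rule Max_in[OF finA False])
      then have "\<kappa> i \<le> k" by (simp add: A_def)
      have "Bd = {S \<in> ksubsets (nodes G) k. \<not> edit_dist_property (induced G S) P < ereal (1 / real (Suc i))}"
        using False simple_induced[OF sG] by (auto simp: Bd_def P'_def induced_def i_def)
      then show ?thesis using \<kappa>[OF G sG \<open>\<kappa> i \<le> k\<close> k(2)] by simp
    qed
    have "card {S. S \<subseteq> nodes G \<and> card S = k \<and> induced G S \<in> P'} + card Bd = card (ksubsets (nodes G) k)"
    proof -
      have "ksubsets (nodes G) k \<inter> {S. induced G S \<in> P'} = {S. S \<subseteq> nodes G \<and> card S = k \<and> induced G S \<in> P'}"
        "ksubsets (nodes G) k - {S. induced G S \<in> P'} = Bd"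
        unfolding Bd_def by blast+
      then show ?thesis using card_Int_Diff[OF finite_ksubsets[OF V], of k "{S. induced G S \<in> P'}"] by (simp only:)
    qed
    then have "real (card {S. S \<subseteq> nodes G \<and> card S = k \<and> induced G S \<in> P'}) \<ge> 2/3 * real (card (ksubsets (nodes G) k))"
      using Bd3 by linarith
    then show ?thesis unfolding induced_fraction_def using pos by (simp add: pos_le_divide_eq)
  qed
  moreover have "\<exists>k\<^sub>\<epsilon>\<ge>1. \<forall>G. simple_graph G \<and> edit_dist_property G P \<ge> ereal \<epsilon> \<longrightarrow>
           (\<forall>k. k\<^sub>\<epsilon> \<le> k \<and> k \<le> card (nodes G) \<longrightarrow> induced_fraction k G P' \<le> 1 / 3)" if \<epsilon>: "\<epsilon> > 0" for \<epsilon> :: real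
  proof -
    obtain \<epsilon>' n' where b: "\<epsilon>' > 0" "n' > 0" and bb: "\<And>G G'. G \<in> P \<Longrightarrow> simple_graph G' \<Longrightarrow> cut_dist G G' < \<epsilon>' \<Longrightarrow>
        card (nodes G) \<ge> n' \<Longrightarrow> card (nodes G') \<ge> n' \<Longrightarrow> edit_dist_property G' P < ereal \<epsilon>"
      using B[unfolded cut_robust_def, rule_format, OF \<epsilon>] by blast
    obtain K where K: "K \<ge> 1" "\<And>G k. simple_graph G \<Longrightarrow> K \<le> k \<Longrightarrow> k \<le> card (nodes G) \<Longrightarrow>
      real (card {S \<in> ksubsets (nodes G) k. \<epsilon>' / 2 \<le> cut_dist G (induced G S)}) \<le> 1/3 * real (card (ksubsets (nodes G) k))"
      using sampling[OF half_gt_zero[OF b(1)]] by blast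
    \<comment> \<open>Doubled by \<open>cut_dist_edit\<close>, this stays below
      \<open>\<epsilon>' / 2\<close>; the other half is for the distance between the sample and
      \<open>G\<close>.\<close>
    obtain i :: nat where i: "1 / real (Suc i) < \<epsilon>' / 4"
      using nat_approx_posE[of "\<epsilon>' / 4"] b(1) by (metis divide_pos_pos zero_less_numeral)
    \<comment> \<open>The bounds \<open>i\<close> and \<open>\<kappa> i\<close> put \<open>i\<close>
      into \<open>A k\<close>, so the tolerance in use at \<open>k\<close> is at most
      \<open>1 / real (Suc i)\<close>.\<close>
    define k0 where "k0 = max (max K n') (max i (\<kappa> i))"
    show ?thesis
    proof (intro exI[of _ k0] conjI allI impI)
      show "1 \<le> k0" using K(1) by (simp add: k0_def)
      fix G k assume G: "simple_graph G \<and> ereal \<epsilon> \<le> edit_dist_property G P" and k: "k0 \<le> k \<and> k \<le> card (nodes G)"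
      have V: "finite (nodes G)" using G by (simp add: simple_graph_def)
      have pos: "0 < card (ksubsets (nodes G) k)" using n_subsets[OF V, of k] k by simp
      have "{S \<in> ksubsets (nodes G) k. induced G S \<in> P'} \<subseteq> {S \<in> ksubsets (nodes G) k. \<epsilon>' / 2 \<le> cut_dist G (induced G S)}"
      proof
        fix S assume S: "S \<in> {S \<in> ksubsets (nodes G) k. induced G S \<in> P'}"
        have nI: "nodes (induced G S) = S" by (simp add: induced_def)
        have sI: "simple_graph (induced G S)" using S G by (intro simple_induced) auto
        have "i \<in> A k" using k by (simp add: A_def k0_def)
        then have "i \<le> Max (A k)" by (rule Max_ge[OF finA])
        then have le: "1 / real (Suc (Max (A k))) \<le> 1 / real (Suc i)" by (intro divide_left_mono) auto
        have "edit_dist_property (induced G S) P < ereal (1 / real (Suc (Max (A k))))"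
          using S \<open>i \<in> A k\<close> by (auto simp: P'_def nI)
        from edit_dist_property_lessD[OF P sI this] obtain H where H: "H \<in> P" "nodes H = S"
          "edit_dist (induced G S) H < 1 / real (Suc (Max (A k)))" unfolding nI by blast
        have sH: "simple_graph H" using P H by (simp add: graph_property_def)
        have kS: "0 < k" "n' \<le> k" using k b K(1) by (auto simp: k0_def)
        then have "S \<noteq> {}" using S by auto
        then have "cut_dist (induced G S) H \<le> 2 * edit_dist (induced G S) H"
          using nI H(2) by (intro cut_dist_edit sI sH) auto
        then have near: "cut_dist (induced G S) H < \<epsilon>' / 2" using H(3) le i by linarith
        have "\<not> cut_dist G (induced G S) < \<epsilon>' / 2"
        proof
          assume "cut_dist G (induced G S) < \<epsilon>' / 2"
          then have "cut_dist H G < \<epsilon>'" using near cut_dist_triangle[of G H "induced G S"] cut_dist_sym[of H G] by linarith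
          then have "edit_dist_property G P < ereal \<epsilon>"
            using G S k kS H(2) by (intro bb[OF H(1)]) auto
          then show False using G leD by blast
        qed
        then show "S \<in> {S \<in> ksubsets (nodes G) k. \<epsilon>' / 2 \<le> cut_dist G (induced G S)}" using S by auto
      qed
      then have "card {S \<in> ksubsets (nodes G) k. induced G S \<in> P'} \<le> card {S \<in> ksubsets (nodes G) k. \<epsilon>' / 2 \<le> cut_dist G (induced G S)}"
        by (rule card_mono[rotated]) (rule finite_subset[OF _ finite_ksubsets[OF V, of k]], blast)
      then have "real (card {S \<in> ksubsets (nodes G) k. induced G S \<in> P'}) \<le> real (card {S \<in> ksubsets (nodes G) k. \<epsilon>' / 2 \<le> cut_dist G (induced G S)})"
        by (rule of_nat_mono)
      also have "\<dots> \<le> 1/3 * real (card (ksubsets (nodes G) k))" using G k by (intro K(2)) (auto simp: k0_def)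
      finally show "induced_fraction k G P' \<le> 1 / 3"
        unfolding induced_fraction_def using pos by (simp add: pos_divide_le_eq conj_assoc)
    qed
  qed
  ultimately show ?thesis unfolding testable_def by blast
qed

theorem theorem3p20:
  fixes P :: "ugraph set"
  assumes "graph_property P"
  shows
    "(testable P \<longleftrightarrow>
        (\<forall>\<epsilon>::real. \<epsilon> > 0 \<longrightarrow> (\<exists>\<epsilon>'::real. \<epsilon>' > 0 \<and> (\<exists>n'::nat. n' > 0 \<and>
          (\<forall>G\<in>P. \<forall>G'. simple_graph G' \<and> cut_dist G G' < \<epsilon>' \<and>
              card (nodes G) \<ge> n' \<and> card (nodes G') \<ge> n' \<longrightarrow>
            edit_dist_property G' P < ereal \<epsilon>)))))
     \<and>
     (testable P \<longleftrightarrow>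
        (\<forall>\<epsilon>::real. \<epsilon> > 0 \<longrightarrow> (\<exists>\<epsilon>\<^sub>0::real. \<epsilon>\<^sub>0 > 0 \<and> (\<exists>n\<^sub>0::nat. n\<^sub>0 > 0 \<and>
          (\<forall>G\<in>P. \<forall>G'. induced_subgraph_of G' G \<and> cut_dist G G' < \<epsilon>\<^sub>0 \<and>
              card (nodes G') \<ge> n\<^sub>0 \<longrightarrow>
            edit_dist_property G' P < ereal \<epsilon>)))))"
proof -
  have ab: "testable P \<Longrightarrow> cut_robust P" by (rule testable_imp_cut_robust[OF assms])
  have bc: "cut_robust P \<Longrightarrow> induced_robust P" by (rule cut_robust_imp_induced_robust[OF assms])
  have cb: "induced_robust P \<Longrightarrow> cut_robust P" by (rule induced_robust_imp_cut_robust[OF assms])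
  have ca: "induced_robust P \<Longrightarrow> testable P" by (rule robust_imp_testable[OF assms _ cb])
  have "(testable P \<longleftrightarrow> cut_robust P) \<and> (testable P \<longleftrightarrow> induced_robust P)" using ab bc ca by blast
  then show ?thesis unfolding cut_robust_def induced_robust_def .
qed

end
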